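(* Let $\mathbb{G}$ be a graded Lie group of homogeneous dimension $Q$ with dilation weights $\nu_1,\dots,\nu_n$, let $\{X_1,\dots,X_n\}$ be a strong Malcev basis of its Lie algebra $\mathfrak g$ (with $X_j$ homogeneous of degree $\nu_j$), let $\nu_0$ be any common multiple of $\nu_1,\dots,\nu_n$, and let $$\mathcal R:=\sum_{j=1}^n(-1)^{\frac{\nu_0}{\nu_j}}a_jX_j^{2\frac{\nu_0}{\nu_j}},\qquad a_1,\dots,a_n>0,$$ which is a positive Rockland operator of homogeneous degree $\nu:=2\nu_0$. Let $\gamma\in(0,\frac Q2)$ and let $p$ satisfy $$1<p<1+\frac{2\nu}{Q+2\gamma}.$$ Let $|\cdot|$ be a homogeneous norm on $\mathbb G$ and $\langle x\rangle=(1+|x|^2)^{1/2}$. Assume that the non-negative initial data $(u_0,u_1)\in\dot H^{-\gamma}(\mathbb G)\times\dot H^{-\gamma}(\mathbb G)$ are such that, for some constant $C_1>0$, $$u_0(x)+u_1(x)\ge C_1\langle x\rangle^{-Q\left(\frac12+\frac\gamma Q\right)}\big(\log(e+|x|)\big)^{-1},\qquad x\in\mathbb G.$$ Then, for $\varepsilon>0$, there is no global-in-time weak solution to the Cauchy problem $$\begin{cases} u_{tt}+\mathcal{R}u+u_t=|u|^p, & x\in\mathbb{G},\ t>0,\\ u(0,x)=\varepsilon u_0(x), & x\in\mathbb{G},\\ u_t(0,x)=\varepsilon u_1(x), & x\in\mathbb{G}.\end{cases}$$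
   Context: A graded Lie group $\mathbb{G}$ is a connected, simply connected Lie group whose (finite-dimensional) Lie algebra $\mathfrak g$ has a decomposition $\mathfrak g=\bigoplus_{i\ge1}\mathfrak g_i$ with only finitely many nonzero $\mathfrak g_i$ and $[\mathfrak g_i,\mathfrak g_j]\subset\mathfrak g_{i+j}$. A basis $\{X_1,\dots,X_n\}$ of $\mathfrak g$ obtained as a union of bases of the $\mathfrak g_i$ is a strong Malcev basis; the dilation weight $\nu_j$ of $X_j\in\mathfrak g_i$ is $\nu_j=i$ (weights ordered increasingly; they may be jointly rescaled so that $\nu_1=1$). Dilations on $\mathfrak g$ are given by $D_r^{\mathfrak g}X_j=r^{\nu_j}X_j$ and on $\mathbb G$ by $D_r=\exp\circ D_r^{\mathfrak g}\circ\exp^{-1}$, $r>0$. Elements of $\mathfrak g$ are identified with left-invariant vector fields. $dx$ is the bi-invariant Haar measure and $Q=\nu_1+\dots+\nu_n$ is the homogeneous dimension. A homogeneous (quasi-)norm is a continuous function $|\cdot|:\mathbb G\to[0,\infty)$ with $|x|=0$ iff $x$ is the identity, $|x^{-1}|=|x|$, and $|D_rx|=r|x|$ for $r>0$. Any two homogeneous quasi-norms on $\mathbb G$ are equivalent. $\dot H^{-\gamma}(\mathbb G)$ is the space of distributions $f$ with $\|f\|_{\dot H^{-\gamma}}=\|\mathcal R^{-\gamma/\nu}f\|_{L^2(\mathbb G)}<\infty$, powers being defined by the spectral theorem for the self-adjoint extension of $\mathcal R$ on $L^2(\mathbb G)$. The data $u_0,u_1$ are locally integrable functions. Weak solution: for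 $T\in(0,\infty]$, a weak solution of the Cauchy problem on $[0,T)\times\mathbb G$ is a function $u\in L^p_{\mathrm{loc}}([0,T)\times\mathbb G)$ such that for every $\phi\in\mathcal C_0^\infty([0,T)\times\mathbb G)$ $$\int_0^T\!\!\int_{\mathbb G}u\,\big(\partial_t^2\phi+\mathcal R\phi-\partial_t\phi\big)\,dx\,dt-\varepsilon\int_{\mathbb G}\big(u_0(x)+u_1(x)\big)\phi(0,x)\,dx+\varepsilon\int_{\mathbb G}u_0(x)\,\partial_t\phi(0,x)\,dx=\int_0^T\!\!\int_{\mathbb G}|u|^p\phi\,dx\,dt.$$ It is global-in-time if $T=\infty$. *)

theory Defs
  imports "HOL-Analysis.Analysis" "HOL-Library.Function_Algebras"
begin

section \<open>Smooth maps and Lie groups\<close>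

text \<open>Continuous differentiability of order \<open>k\<close> and smoothness; only used for open sets \<open>S\<close>.\<close>

fun Ck_on :: "nat \<Rightarrow> 'a::real_normed_vector set \<Rightarrow> ('a \<Rightarrow> 'b::real_normed_vector) \<Rightarrow> bool" where
  "Ck_on 0 S f = continuous_on S f"
| "Ck_on (Suc k) S f =
    ((\<forall>x\<in>S. f differentiable (at x)) \<and> (\<forall>v. Ck_on k S (\<lambda>x. frechet_derivative f (at x) v)))"

definition smooth_on :: "'a::real_normed_vector set \<Rightarrow> ('a \<Rightarrow> 'b::real_normed_vector) \<Rightarrow> bool" where
  "smooth_on S f \<longleftrightarrow> (\<forall>k. Ck_on k S f)"

text \<open>An atlas is a set of pairs \<open>(U, c)\<close> of a coordinate domain \<open>U\<close> and a chart \<open>c\<close>, whose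
  values outside \<open>U\<close> are irrelevant.  The model space \<open>'m\<close> plays the role of Euclidean space of
  dimension \<open>DIM('m)\<close>.\<close>

type_synonym ('g, 'm) atlas = "('g set \<times> ('g \<Rightarrow> 'm)) set"

definition smooth_atlas :: "('g::topological_space, 'm::euclidean_space) atlas \<Rightarrow> bool" where
  "smooth_atlas \<A> \<longleftrightarrow>
     (\<Union>(U, c)\<in>\<A>. U) = UNIV \<and>
     (\<forall>(U, c)\<in>\<A>. open U \<and> open (c ` U) \<and> homeomorphism U (c ` U) c (inv_into U c)) \<and>
     (\<forall>(U, c)\<in>\<A>. \<forall>(V, d)\<in>\<A>. smooth_on (c ` (U \<inter> V)) (d \<circ> inv_into U c))"

text \<open>The group operation is written additively, since the library's class of topological groups
  is; \<open>group_add\<close> does not include commutativity.  Thus \<open>x + y\<close>, \<open>- x\<close> and \<open>0\<close> are the product,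
  the inverse and the identity element.\<close>

definition lie_group ::
    "('g::{topological_group_add,t2_space,second_countable_topology}, 'm::euclidean_space) atlas \<Rightarrow> bool" where
  "lie_group \<A> \<longleftrightarrow>
     smooth_atlas \<A> \<and>
     (\<forall>(U, c)\<in>\<A>. \<forall>(V, d)\<in>\<A>. \<forall>(W, e)\<in>\<A>.
        smooth_on {(y, z). y \<in> c ` U \<and> z \<in> d ` V \<and> inv_into U c y + inv_into V d z \<in> W}
          (\<lambda>(y, z). e (inv_into U c y + inv_into V d z))) \<and>
     (\<forall>(U, c)\<in>\<A>. \<forall>(V, d)\<in>\<A>.
        smooth_on {y. y \<in> c ` U \<and> - inv_into U c y \<in> V} (\<lambda>y. d (- inv_into U c y)))"

definition smooth_functions :: "('g::topological_space, 'm::euclidean_space) atlas \<Rightarrow> ('g \<Rightarrow> real) set" where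
  "smooth_functions \<A> = {f. \<forall>(U, c)\<in>\<A>. smooth_on (c ` U) (f \<circ> inv_into U c)}"

definition test_functions :: "('g::topological_space, 'm::euclidean_space) atlas \<Rightarrow> ('g \<Rightarrow> real) set" where
  "test_functions \<A> = {f \<in> smooth_functions \<A>. \<exists>K. compact K \<and> (\<forall>x. x \<notin> K \<longrightarrow> f x = 0)}"


section \<open>The Lie algebra of left-invariant vector fields\<close>

text \<open>Vector fields are derivations of the algebra of smooth functions.  They are
  extended by zero to all functions, so that equal vector fields are equal as functions.\<close>

type_synonym 'g vfield = "('g \<Rightarrow> real) \<Rightarrow> ('g \<Rightarrow> real)"

definition vf_scale :: "real \<Rightarrow> 'g vfield \<Rightarrow> 'g vfield" where
  "vf_scale c X = (\<lambda>f x. c * X f x)"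

global_interpretation vf: vector_space "vf_scale :: real \<Rightarrow> 'g vfield \<Rightarrow> 'g vfield"
  by standard (auto simp: vf_scale_def fun_eq_iff algebra_simps)

definition lie_algebra :: "('g::topological_group_add, 'm::euclidean_space) atlas \<Rightarrow> 'g vfield set" where
  "lie_algebra \<A> = {X.
     (\<forall>f\<in>smooth_functions \<A>. X f \<in> smooth_functions \<A>) \<and>
     (\<forall>f. f \<notin> smooth_functions \<A> \<longrightarrow> X f = (\<lambda>x. 0)) \<and>
     (\<forall>f\<in>smooth_functions \<A>. \<forall>g\<in>smooth_functions \<A>. \<forall>a b.
        X (\<lambda>x. a * f x + b * g x) = (\<lambda>x. a * X f x + b * X g x)) \<and>
     (\<forall>f\<in>smooth_functions \<A>. \<forall>g\<in>smooth_functions \<A>.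
        X (\<lambda>x. f x * g x) = (\<lambda>x. X f x * g x + f x * X g x)) \<and>
     (\<forall>f\<in>smooth_functions \<A>. \<forall>y. X (\<lambda>x. f (y + x)) = (\<lambda>x. X f (y + x)))}"

definition lie_bracket :: "'g vfield \<Rightarrow> 'g vfield \<Rightarrow> 'g vfield" where
  "lie_bracket X Y = (\<lambda>f x. X (Y f) x - Y (X f) x)"

text \<open>The exponential map: the value at time 1 of the one-parameter subgroup with velocity \<open>X\<close>.\<close>

definition lie_exp :: "('g::topological_group_add, 'm::euclidean_space) atlas \<Rightarrow> 'g vfield \<Rightarrow> 'g" where
  "lie_exp \<A> X = (THE x. \<exists>\<gamma> :: real \<Rightarrow> 'g.
     (\<forall>s t. \<gamma> (s + t) = \<gamma> s + \<gamma> t) \<and>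
     (\<forall>f\<in>smooth_functions \<A>. ((\<lambda>t. f (\<gamma> t)) has_real_derivative X f 0) (at 0)) \<and>
     x = \<gamma> 1)"


section \<open>Graded Lie groups\<close>

text \<open>\<open>V i\<close> is the component of degree \<open>i\<close>.  Only positive degrees occur, hence \<open>V 0 = {0}\<close>; the
  existence and uniqueness of the decomposition \<open>Y\<close> says that the sum of the \<open>V i\<close> is direct and
  equal to the Lie algebra.\<close>

definition gradation :: "('g::topological_group_add, 'm::euclidean_space) atlas \<Rightarrow> (nat \<Rightarrow> 'g vfield set) \<Rightarrow> bool" where
  "gradation \<A> V \<longleftrightarrow>
     (\<forall>i. vf.subspace (V i) \<and> V i \<subseteq> lie_algebra \<A>) \<and>
     V 0 = {0} \<and> finite {i. V i \<noteq> {0}} \<and>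
     (\<forall>X\<in>lie_algebra \<A>. \<exists>!Y. (\<forall>i. Y i \<in> V i) \<and> X = (\<Sum>i | V i \<noteq> {0}. Y i)) \<and>
     (\<forall>i j. \<forall>X\<in>V i. \<forall>Y\<in>V j. lie_bracket X Y \<in> V (i + j))"

definition graded_lie_group ::
    "('g::{topological_group_add,t2_space,second_countable_topology}, 'm::euclidean_space) atlas
      \<Rightarrow> (nat \<Rightarrow> 'g vfield set) \<Rightarrow> bool" where
  "graded_lie_group \<A> V \<longleftrightarrow>
     lie_group \<A> \<and> connected (UNIV :: 'g set) \<and> simply_connected (UNIV :: 'g set) \<and> gradation \<A> V"

definition strong_malcev_basis ::
    "(nat \<Rightarrow> 'g vfield set) \<Rightarrow> nat \<Rightarrow> (nat \<Rightarrow> 'g vfield) \<Rightarrow> (nat \<Rightarrow> nat) \<Rightarrow> bool" where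
  "strong_malcev_basis V n X \<nu> \<longleftrightarrow>
     inj_on X {1..n} \<and> mono_on {1..n} \<nu> \<and>
     (\<forall>i. let B = X ` {j\<in>{1..n}. \<nu> j = i} in vf.independent B \<and> vf.span B = V i)"

definition dil_alg :: "nat \<Rightarrow> (nat \<Rightarrow> 'g vfield) \<Rightarrow> (nat \<Rightarrow> nat) \<Rightarrow> real \<Rightarrow> 'g vfield \<Rightarrow> 'g vfield" where
  "dil_alg n X \<nu> r Y =
     (\<Sum>j = 1..n. vf_scale (r ^ \<nu> j * vf.representation (X ` {1..n}) Y (X j)) (X j))"

definition dil :: "('g::topological_group_add, 'm::euclidean_space) atlas \<Rightarrow>
    nat \<Rightarrow> (nat \<Rightarrow> 'g vfield) \<Rightarrow> (nat \<Rightarrow> nat) \<Rightarrow> real \<Rightarrow> 'g \<Rightarrow> 'g" where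
  "dil \<A> n X \<nu> r = lie_exp \<A> \<circ> dil_alg n X \<nu> r \<circ> inv_into (lie_algebra \<A>) (lie_exp \<A>)"

definition homogeneous_norm :: "('g::topological_group_add, 'm::euclidean_space) atlas \<Rightarrow>
    nat \<Rightarrow> (nat \<Rightarrow> 'g vfield) \<Rightarrow> (nat \<Rightarrow> nat) \<Rightarrow> ('g \<Rightarrow> real) \<Rightarrow> bool" where
  "homogeneous_norm \<A> n X \<nu> N \<longleftrightarrow>
     continuous_on UNIV N \<and> (\<forall>x. N x \<ge> 0) \<and> (\<forall>x. N x = 0 \<longleftrightarrow> x = 0) \<and> (\<forall>x. N (- x) = N x) \<and>
     (\<forall>r>0. \<forall>x. N (dil \<A> n X \<nu> r x) = r * N x)"

definition haar_measure :: "'g::{topological_group_add,second_countable_topology} measure \<Rightarrow> bool" where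
  "haar_measure \<mu> \<longleftrightarrow>
     sets \<mu> = sets borel \<and>
     (\<forall>K. compact K \<longrightarrow> emeasure \<mu> K < \<infinity>) \<and>
     (\<forall>U. open U \<and> U \<noteq> {} \<longrightarrow> emeasure \<mu> U > 0) \<and>
     (\<forall>y. distr \<mu> borel (\<lambda>x. y + x) = \<mu> \<and> distr \<mu> borel (\<lambda>x. x + y) = \<mu>)"

definition rockland_operator ::
    "nat \<Rightarrow> (nat \<Rightarrow> 'g vfield) \<Rightarrow> (nat \<Rightarrow> nat) \<Rightarrow> nat \<Rightarrow> (nat \<Rightarrow> real) \<Rightarrow> ('g \<Rightarrow> real) \<Rightarrow> ('g \<Rightarrow> real)" where
  "rockland_operator n X \<nu> \<nu>0 a f x =
     (\<Sum>j = 1..n. (-1) ^ (\<nu>0 div \<nu> j) * a j * (X j ^^ (2 * (\<nu>0 div \<nu> j))) f x)"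


section \<open>Self-adjoint operators on $L^2$ and their spectral calculus\<close>

text \<open>Elements of $L^2$ are represented by functions, with equality almost everywhere.  Unbounded
  operators are given by their graphs, which contain every representative.\<close>

definition l2 :: "'g measure \<Rightarrow> ('g \<Rightarrow> complex) set" where
  "l2 \<mu> = {f \<in> borel_measurable \<mu>. integrable \<mu> (\<lambda>x. (cmod (f x))\<^sup>2)}"

definition l2_inner :: "'g measure \<Rightarrow> ('g \<Rightarrow> complex) \<Rightarrow> ('g \<Rightarrow> complex) \<Rightarrow> complex" where
  "l2_inner \<mu> f g = (LINT x|\<mu>. f x * cnj (g x))"

definition l2_adjoint ::
    "'g measure \<Rightarrow> (('g \<Rightarrow> complex) \<times> ('g \<Rightarrow> complex)) set \<Rightarrow> (('g \<Rightarrow> complex) \<times> ('g \<Rightarrow> complex)) set" where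
  "l2_adjoint \<mu> A = {(f, g). f \<in> l2 \<mu> \<and> g \<in> l2 \<mu> \<and> (\<forall>(h, k)\<in>A. l2_inner \<mu> k f = l2_inner \<mu> h g)}"

text \<open>Used only for extensions of operators defined on the test functions, so that the domain is
  dense; linearity follows from \<open>A\<close> being an adjoint.\<close>

definition l2_self_adjoint :: "'g measure \<Rightarrow> (('g \<Rightarrow> complex) \<times> ('g \<Rightarrow> complex)) set \<Rightarrow> bool" where
  "l2_self_adjoint \<mu> A \<longleftrightarrow> l2_adjoint \<mu> A = A"

text \<open>Projection-valued measures on the Borel sets of the real line.  Linearity of \<open>E B\<close> and its
  compatibility with equality almost everywhere follow from symmetry.\<close>

definition projection_valued_measure ::
    "'g measure \<Rightarrow> (real set \<Rightarrow> ('g \<Rightarrow> complex) \<Rightarrow> ('g \<Rightarrow> complex)) \<Rightarrow> bool" where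
  "projection_valued_measure \<mu> E \<longleftrightarrow>
     (\<forall>B\<in>sets borel. \<forall>f\<in>l2 \<mu>. E B f \<in> l2 \<mu>) \<and>
     (\<forall>B\<in>sets borel. \<forall>f\<in>l2 \<mu>. \<forall>g\<in>l2 \<mu>. l2_inner \<mu> (E B f) g = l2_inner \<mu> f (E B g)) \<and>
     (\<forall>f\<in>l2 \<mu>. AE x in \<mu>. E UNIV f x = f x) \<and>
     (\<forall>B\<in>sets borel. \<forall>C\<in>sets borel. \<forall>f\<in>l2 \<mu>. AE x in \<mu>. E B (E C f) x = E (B \<inter> C) f x) \<and>
     (\<forall>B :: nat \<Rightarrow> real set. range B \<subseteq> sets borel \<longrightarrow> disjoint_family B \<longrightarrow>
        (\<forall>f\<in>l2 \<mu>. (\<lambda>i. l2_inner \<mu> (E (B i) f) f) sums l2_inner \<mu> (E (\<Union>i. B i) f) f))"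

definition scalar_spectral_measure ::
    "'g measure \<Rightarrow> (real set \<Rightarrow> ('g \<Rightarrow> complex) \<Rightarrow> ('g \<Rightarrow> complex)) \<Rightarrow> ('g \<Rightarrow> complex) \<Rightarrow> real measure" where
  "scalar_spectral_measure \<mu> E f =
     measure_of UNIV (sets borel) (\<lambda>B. ennreal (Re (l2_inner \<mu> (E B f) f)))"

text \<open>The graph of the operator $\int F(\lambda)\,dE(\lambda)$: its domain consists of those \<open>f\<close> for
  which $|F|^2$ is integrable with respect to $\langle E f, f\rangle$, and its value \<open>h\<close> is
  characterised by $\langle h, k\rangle = \int F(\lambda)\,d\langle E(\lambda) f, k\rangle$ for all
  \<open>k\<close> in the (dense) domain, where the complex measure $\langle E f, k\rangle$ is written by
  polarization as
  $\frac14 \sum_{m<4} i^m \langle E (f + i^m k), f + i^m k\rangle$.\<close>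

definition spectral_integral ::
    "'g measure \<Rightarrow> (real set \<Rightarrow> ('g \<Rightarrow> complex) \<Rightarrow> ('g \<Rightarrow> complex)) \<Rightarrow> (real \<Rightarrow> real) \<Rightarrow>
     (('g \<Rightarrow> complex) \<times> ('g \<Rightarrow> complex)) set" where
  "spectral_integral \<mu> E F =
     (let D = {f \<in> l2 \<mu>. integrable (scalar_spectral_measure \<mu> E f) (\<lambda>l. (F l)\<^sup>2)}
      in {(f, h). f \<in> D \<and> h \<in> l2 \<mu> \<and>
            (\<forall>k\<in>D. l2_inner \<mu> h k =
               (1/4) * (\<Sum>m<4. \<i> ^ m *
                 complex_of_real (LINT l|scalar_spectral_measure \<mu> E (\<lambda>x. f x + \<i> ^ m * k x). F l)))})"

text \<open>\<open>E\<close> is the spectral resolution of the self-adjoint extension \<open>A\<close> of the operator \<open>R\<close>, given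
  on test functions.\<close>

definition spectral_resolution ::
    "('g::topological_space, 'm::euclidean_space) atlas \<Rightarrow> 'g measure \<Rightarrow> (('g \<Rightarrow> real) \<Rightarrow> ('g \<Rightarrow> real)) \<Rightarrow>
     (('g \<Rightarrow> complex) \<times> ('g \<Rightarrow> complex)) set \<Rightarrow>
     (real set \<Rightarrow> ('g \<Rightarrow> complex) \<Rightarrow> ('g \<Rightarrow> complex)) \<Rightarrow> bool" where
  "spectral_resolution \<A> \<mu> R A E \<longleftrightarrow>
     l2_self_adjoint \<mu> A \<and>
     (\<forall>\<phi>\<in>test_functions \<A>. (\<lambda>x. complex_of_real (\<phi> x), \<lambda>x. complex_of_real (R \<phi> x)) \<in> A) \<and>
     projection_valued_measure \<mu> E \<and> A = spectral_integral \<mu> E (\<lambda>l. l)"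

text \<open>$R^{-s} T = g$ in $L^2$ for a distribution \<open>T\<close> and \<open>s > 0\<close>, i.e. $T = R^s g$ in the sense of
  distributions: $T(\phi) = \langle g, R^s \phi\rangle$ for all (real) test functions, where $R^s$ is
  given by the spectral theorem.  Since \<open>R\<close> is positive, negative \<open>l\<close> play no role in
  \<open>l powr s\<close>.\<close>

definition inverse_power_image ::
    "('g::topological_space, 'm::euclidean_space) atlas \<Rightarrow> 'g measure \<Rightarrow>
     (real set \<Rightarrow> ('g \<Rightarrow> complex) \<Rightarrow> ('g \<Rightarrow> complex)) \<Rightarrow> real \<Rightarrow>
     (('g \<Rightarrow> real) \<Rightarrow> complex) \<Rightarrow> ('g \<Rightarrow> complex) \<Rightarrow> bool" where
  "inverse_power_image \<A> \<mu> E s T g \<longleftrightarrow>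
     g \<in> l2 \<mu> \<and>
     (\<forall>\<phi>\<in>test_functions \<A>. \<exists>h. (\<lambda>x. complex_of_real (\<phi> x), h) \<in> spectral_integral \<mu> E (\<lambda>l. l powr s) \<and>
        T \<phi> = l2_inner \<mu> g h)"

text \<open>Membership of the distribution \<open>T\<close> in $\dot H^{-\gamma}$, where \<open>d\<close> is the homogeneous degree
  of \<open>R\<close>.\<close>

definition homogeneous_sobolev_neg ::
    "('g::topological_space, 'm::euclidean_space) atlas \<Rightarrow> 'g measure \<Rightarrow> (('g \<Rightarrow> real) \<Rightarrow> ('g \<Rightarrow> real)) \<Rightarrow>
     real \<Rightarrow> real \<Rightarrow> (('g \<Rightarrow> real) \<Rightarrow> complex) \<Rightarrow> bool" where
  "homogeneous_sobolev_neg \<A> \<mu> R d \<gamma> T \<longleftrightarrow>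
     (\<exists>A E g. spectral_resolution \<A> \<mu> R A E \<and> inverse_power_image \<A> \<mu> E (\<gamma> / d) T g)"

definition locally_integrable :: "'g::topological_space measure \<Rightarrow> ('g \<Rightarrow> real) \<Rightarrow> bool" where
  "locally_integrable \<mu> f \<longleftrightarrow>
     f \<in> borel_measurable \<mu> \<and> (\<forall>K. compact K \<longrightarrow> set_integrable \<mu> K f)"

definition distribution_of :: "'g measure \<Rightarrow> ('g \<Rightarrow> real) \<Rightarrow> ('g \<Rightarrow> real) \<Rightarrow> complex" where
  "distribution_of \<mu> f \<phi> = complex_of_real (LINT x|\<mu>. f x * \<phi> x)"


section \<open>Weak solutions\<close>

text \<open>Test functions on $[0,T) \times G$ need not vanish at \<open>t = 0\<close>.  They are represented by smooth
  functions on $\mathbb{R} \times G$ with compact support in $(-\infty,T) \times G$; their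
  values at negative times do not enter below.\<close>

definition spacetime_test_functions ::
    "('g::topological_space, 'm::euclidean_space) atlas \<Rightarrow> ereal \<Rightarrow> (real \<Rightarrow> 'g \<Rightarrow> real) set" where
  "spacetime_test_functions \<A> T = {\<phi>.
     (\<forall>(U, c)\<in>\<A>. smooth_on (UNIV \<times> c ` U) (\<lambda>(t, y). \<phi> t (inv_into U c y))) \<and>
     (\<exists>K. compact K \<and> K \<subseteq> {t. ereal t < T} \<times> UNIV \<and> (\<forall>t x. (t, x) \<notin> K \<longrightarrow> \<phi> t x = 0))}"

text \<open>Weak solutions on $[0,T) \times G$ of $u_{tt} + R u + u_t = |u|^p$ with data
  \<open>\<epsilon> u0\<close>, \<open>\<epsilon> u1\<close>.  Solutions may be complex-valued; as the equation is linear in the test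
  function, real test functions suffice.\<close>

definition weak_solution ::
    "('g::topological_space, 'm::euclidean_space) atlas \<Rightarrow> 'g measure \<Rightarrow> (('g \<Rightarrow> real) \<Rightarrow> ('g \<Rightarrow> real)) \<Rightarrow>
     real \<Rightarrow> real \<Rightarrow> ('g \<Rightarrow> real) \<Rightarrow> ('g \<Rightarrow> real) \<Rightarrow> ereal \<Rightarrow> (real \<Rightarrow> 'g \<Rightarrow> complex) \<Rightarrow> bool" where
  "weak_solution \<A> \<mu> R p \<epsilon> u0 u1 T u \<longleftrightarrow>
     0 < T \<and>
     (let M = lborel \<Otimes>\<^sub>M \<mu>; S = {t. 0 \<le> t \<and> ereal t < T} \<times> UNIV in
      set_borel_measurable M S (\<lambda>(t, x). u t x) \<and>
      (\<forall>K. compact K \<and> K \<subseteq> S \<longrightarrow> set_integrable M K (\<lambda>(t, x). cmod (u t x) powr p)) \<and>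
      (\<forall>\<phi>\<in>spacetime_test_functions \<A> T.
         set_lebesgue_integral M S (\<lambda>(t, x). u t x * complex_of_real
             ((deriv ^^ 2) (\<lambda>s. \<phi> s x) t + R (\<phi> t) x - deriv (\<lambda>s. \<phi> s x) t))
         - complex_of_real (\<epsilon> * (LINT x|\<mu>. (u0 x + u1 x) * \<phi> 0 x))
         + complex_of_real (\<epsilon> * (LINT x|\<mu>. u0 x * deriv (\<lambda>s. \<phi> s x) 0))
         = complex_of_real (set_lebesgue_integral M S (\<lambda>(t, x). cmod (u t x) powr p * \<phi> t x))))"

end

theory Submission
  imports Defs "HOL-Real_Asymp.Real_Asymp"
begin

text \<open>If $S$ is the automorphism of the group inducing the dilation by $q^{-1}$ on the Lie algebra, then
  $(\mathcal R f) \circ S$ and $\mathcal R (f \circ S)$ differ by the factor $q^\nu$.  Testing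
  the equation with $\theta(t / q^\nu)\, \Psi(S x)$, where $\theta$ and $\Psi$ are high powers of cutoff
  functions, and absorbing the left-hand side into $\int |u|^p \phi$ by Young's inequality gives
  $\varepsilon \int (u_0 + u_1)\, \Psi(S x)\, dx \le C q^{-\nu/(p-1)} \mu(S^{-1} K)$.  The data
  bound makes the left-hand side at least a constant times
  $q^{-(Q/2+\gamma)} (\log q)^{-1} \mu(S^{-1} B)$ for a neighbourhood $B$ of the identity; since
  finitely many translates of $B$ cover $K$, the measures cancel up to a constant, and $q \to \infty$ gives a
  contradiction as $\nu/(p-1) > Q/2+\gamma$.

  The automorphisms are obtained from Lie algebra automorphisms by Lie's second theorem.  In a chart at
  the identity the exponential map is the inverse of the linearization of the squaring map; a Lie
  algebra homomorphism is shown to induce a local group homomorphism in exponential coordinates, which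
  extends to the whole group by developing it along paths.\<close>

section \<open>Calculus of smooth maps\<close>

text \<open>Two obstacles shape the proof. The scaling of the operator has to hold on the whole
  group, while \<open>dil\<close> is a formula through \<open>inv_into\<close> of the exponential
  map and carries no homomorphism property by definition. So automorphisms \<open>dl q\<close> are
  built from the grading and compared with \<open>dil\<close> on the range of the exponential map;
  the spatial cutoff is supported there, so that homogeneity of the norm can be used on its support.
  The second obstacle is regularity: the linearization of the squaring map is obtained as a C^1
  limit. Identities for its derivative are therefore derived from halving equations, whose solutions
  are pinned down by their behaviour at the identity, and smoothness of the induced homomorphisms is
  recovered afterwards from a differential equation. High powers of cutoffs occur because absorption
  needs the operator applied to \<phi> to be bounded by a multiple of \<phi>^(1/p): a derivative
  lowers the power by at most one, and for a large exponent M the loss \<nu> is covered by M/p \<le>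
  M - \<nu>.\<close>

lemma Ck_on_subset: "Ck_on k S f \<Longrightarrow> T \<subseteq> S \<Longrightarrow> Ck_on k T f"
proof (induction k arbitrary: f)
  case 0 then show ?case by (auto intro: continuous_on_subset)
next
  case (Suc k)
  then show ?case by (auto simp: subset_iff)
qed

lemma Ck_on_SucD: "Ck_on (Suc k) S f \<Longrightarrow> Ck_on k S f"
proof (induction k arbitrary: f)
  case 0
  then show ?case
    by (auto intro!: continuous_at_imp_continuous_on differentiable_imp_continuous_within)
next
  case (Suc k)
  then show ?case by (metis Ck_on.simps(2))
qed

lemma Ck_on_imp_continuous_on: "Ck_on k S f \<Longrightarrow> continuous_on S f"
  by (induction k) (auto dest: Ck_on_SucD simp del: Ck_on.simps(2))

text \<open>The congruence at order \<open>k\<close> is an assumption because congruence is itself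
  proved by induction through this lemma: in that induction only the hypothesis for \<open>k\<close>
  is at hand.\<close>

lemma Ck_on_Suc_iff:
  fixes f :: "'a::real_normed_vector \<Rightarrow> 'b::real_normed_vector"
  assumes "\<And>x. x \<in> S \<Longrightarrow> (f has_derivative f' x) (at x)" "open S"
    and cong: "\<And>g h. (\<And>x. x \<in> S \<Longrightarrow> g x = h x) \<Longrightarrow> Ck_on k S g = Ck_on k S (h :: 'a \<Rightarrow> 'b)"
  shows "Ck_on (Suc k) S f \<longleftrightarrow> (\<forall>v. Ck_on k S (\<lambda>x. f' x v))"
proof -
  have "frechet_derivative f (at x) = f' x" if "x \<in> S" for x
    using assms(1)[OF that] frechet_derivative_at by metis
  then have "Ck_on k S (\<lambda>x. frechet_derivative f (at x) v) = Ck_on k S (\<lambda>x. f' x v)" for v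
    by (intro cong) simp
  moreover have "f differentiable at x" if "x \<in> S" for x
    using assms(1)[OF that] by (auto simp: differentiable_def)
  ultimately show ?thesis by simp
qed

lemma Ck_on_cong:
  assumes "open S" "\<And>x. x \<in> S \<Longrightarrow> f x = g x"
  shows "Ck_on k S f = Ck_on k S g"
  using assms(2)
proof (induction k arbitrary: f g)
  case 0 then show ?case by (simp cong: continuous_on_cong)
next
  case (Suc k)
  have *: "Ck_on (Suc k) S g" if fg: "\<And>x. x \<in> S \<Longrightarrow> f x = g x" and f: "Ck_on (Suc k) S f" for f g :: "'a \<Rightarrow> 'b"
  proof -
    have d: "(f has_derivative frechet_derivative f (at x)) (at x)" if "x \<in> S" for x
      using f that by (simp add: frechet_derivative_works)
    have "(g has_derivative frechet_derivative f (at x)) (at x)" if "x \<in> S" for x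
      by (rule has_derivative_transform_within_open[OF d[OF that] \<open>open S\<close> that fg])
    from Ck_on_Suc_iff[OF this \<open>open S\<close> Suc.IH] show ?thesis using f by simp
  qed
  show ?case using *[of f g] *[of g f] Suc.prems by metis
qed

lemma Ck_on_SucI:
  assumes "open S" "\<And>x. x \<in> S \<Longrightarrow> (f has_derivative f' x) (at x)" "\<And>v. Ck_on k S (\<lambda>x. f' x v)"
  shows "Ck_on (Suc k) S f"
  using Ck_on_Suc_iff[OF assms(2,1) Ck_on_cong[OF assms(1)]] assms(3) by blast

lemma Ck_on_SucE:
  assumes "Ck_on (Suc k) S f"
  obtains f' where "\<And>x. x \<in> S \<Longrightarrow> (f has_derivative f' x) (at x)" "\<And>v. Ck_on k S (\<lambda>x. f' x v)"
proof
  show "(f has_derivative frechet_derivative f (at x)) (at x)" if "x \<in> S" for x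
    using assms that by (simp add: frechet_derivative_works)
  show "Ck_on k S (\<lambda>x. frechet_derivative f (at x) v)" for v
    using assms by simp
qed

lemma Ck_on_local:
  assumes "\<And>x. x \<in> S \<Longrightarrow> \<exists>T. open T \<and> x \<in> T \<and> Ck_on k T f"
  shows "Ck_on k S f"
  using assms
proof (induction k arbitrary: f)
  case 0
  show ?case
    unfolding Ck_on.simps
  proof (rule continuous_at_imp_continuous_on, rule ballI)
    fix x assume "x \<in> S"
    then obtain T where "open T" "x \<in> T" "continuous_on T f" using 0 by (auto simp: Ck_on.simps)
    then show "isCont f x" using continuous_on_eq_continuous_at by blast
  qed
next
  case (Suc k)
  have "f differentiable at x" if "x \<in> S" for x
    using Suc.prems[OF that] by auto
  moreover have "Ck_on k S (\<lambda>x. frechet_derivative f (at x) v)" for v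
  proof (rule Suc.IH)
    fix x assume "x \<in> S"
    from Suc.prems[OF this] show "\<exists>T. open T \<and> x \<in> T \<and> Ck_on k T (\<lambda>x. frechet_derivative f (at x) v)"
      by auto
  qed
  ultimately show ?case by simp
qed

section \<open>Closure properties of C^k maps\<close>

lemma Ck_on_const [intro]: "Ck_on k S (\<lambda>x. c)"
  by (induction k arbitrary: c) auto

lemma Ck_on_linear_compose:
  assumes L: "bounded_linear L" and "open S" and "Ck_on k S f"
  shows "Ck_on k S (\<lambda>x. L (f x))"
  using assms(3)
proof (induction k arbitrary: f)
  case 0 then show ?case by (auto intro: bounded_linear.continuous_on[OF L])
next
  case (Suc k)
  from Suc.prems obtain f' where f': "\<And>x. x \<in> S \<Longrightarrow> (f has_derivative f' x) (at x)" "\<And>v. Ck_on k S (\<lambda>x. f' x v)"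
    by (rule Ck_on_SucE) blast
  show ?case
    by (rule Ck_on_SucI[OF \<open>open S\<close> bounded_linear.has_derivative[OF L f'(1)] Suc.IH[OF f'(2)]])
qed

lemma Ck_on_bounded_linear:
  assumes L: "bounded_linear L" and "open S"
  shows "Ck_on k S L"
proof (cases k)
  case 0 then show ?thesis by (auto intro: linear_continuous_on L)
next
  case (Suc j)
  show ?thesis unfolding Suc
    by (rule Ck_on_SucI[OF \<open>open S\<close> bounded_linear_imp_has_derivative[OF L] Ck_on_const])
qed

lemma Ck_on_add:
  assumes "open S" "Ck_on k S f" "Ck_on k S g"
  shows "Ck_on k S (\<lambda>x. f x + g x)"
  using assms(2,3)
proof (induction k arbitrary: f g)
  case 0 then show ?case by (auto intro: continuous_on_add)
next
  case (Suc k)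
  from Suc.prems(1) obtain f' where f': "\<And>x. x \<in> S \<Longrightarrow> (f has_derivative f' x) (at x)" "\<And>v. Ck_on k S (\<lambda>x. f' x v)"
    by (rule Ck_on_SucE) blast
  from Suc.prems(2) obtain g' where g': "\<And>x. x \<in> S \<Longrightarrow> (g has_derivative g' x) (at x)" "\<And>v. Ck_on k S (\<lambda>x. g' x v)"
    by (rule Ck_on_SucE) blast
  show ?case
    by (rule Ck_on_SucI[OF \<open>open S\<close> has_derivative_add[OF f'(1) g'(1)] Suc.IH[OF f'(2) g'(2)]])
qed

lemma Ck_on_sum:
  assumes "open S" "\<And>i. i \<in> I \<Longrightarrow> Ck_on k S (f i)"
  shows "Ck_on k S (\<lambda>x. \<Sum>i\<in>I. f i x)"
  using assms(2)
  by (induction I rule: infinite_finite_induct) (auto intro!: Ck_on_add \<open>open S\<close>)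

lemma Ck_on_bilinear:
  assumes B: "bounded_bilinear B" and "open S" and "Ck_on k S f" "Ck_on k S g"
  shows "Ck_on k S (\<lambda>x. B (f x) (g x))"
  using assms(3,4)
proof (induction k arbitrary: f g)
  case 0 then show ?case by (auto intro: bounded_bilinear.continuous_on[OF B])
next
  case (Suc k)
  from Suc.prems(1) obtain f' where f': "\<And>x. x \<in> S \<Longrightarrow> (f has_derivative f' x) (at x)" "\<And>v. Ck_on k S (\<lambda>x. f' x v)"
    by (rule Ck_on_SucE) blast
  from Suc.prems(2) obtain g' where g': "\<And>x. x \<in> S \<Longrightarrow> (g has_derivative g' x) (at x)" "\<And>v. Ck_on k S (\<lambda>x. g' x v)"
    by (rule Ck_on_SucE) blast
  show ?case
    by (rule Ck_on_SucI[OF \<open>open S\<close> bounded_bilinear.FDERIV[OF B f'(1) g'(1)]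
        Ck_on_add[OF \<open>open S\<close> Suc.IH[OF Ck_on_SucD[OF Suc.prems(1)] g'(2)]
          Suc.IH[OF f'(2) Ck_on_SucD[OF Suc.prems(2)]]]])
qed

text \<open>In the chain rule the direction \<open>f' x v\<close> in which \<open>g\<close> is
  differentiated varies with \<open>x\<close>, while the induction hypothesis treats fixed
  directions. Expanding it in the basis writes the derivative as a finite sum of products of C^k
  maps; this is where finite dimension of the intermediate space enters.\<close>

lemma Ck_on_compose:
  fixes g :: "'b::euclidean_space \<Rightarrow> 'c::real_normed_vector"
  assumes "open S" "open T" "Ck_on k T g" "Ck_on k S f" "f ` S \<subseteq> T"
  shows "Ck_on k S (\<lambda>x. g (f x))"
  using assms(3-5)
proof (induction k arbitrary: f g)
  case 0 then show ?case by (auto intro: continuous_on_compose2)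
next
  case (Suc k)
  from Suc.prems(2) obtain f' where f': "\<And>x. x \<in> S \<Longrightarrow> (f has_derivative f' x) (at x)" "\<And>v. Ck_on k S (\<lambda>x. f' x v)"
    by (rule Ck_on_SucE) blast
  from Suc.prems(1) obtain g' where g': "\<And>x. x \<in> T \<Longrightarrow> (g has_derivative g' x) (at x)" "\<And>v. Ck_on k T (\<lambda>x. g' x v)"
    by (rule Ck_on_SucE) blast
  define h where "h = (\<lambda>x v. \<Sum>b\<in>Basis. (f' x v \<bullet> b) *\<^sub>R g' (f x) b)"
  have h: "h x v = g' (f x) (f' x v)" if "x \<in> S" for x v
  proof -
    have "linear (g' (f x))" using g'(1) that Suc.prems(3) has_derivative_linear by blast
    then show ?thesis unfolding h_def
      by (subst (3) euclidean_representation[symmetric]) (simp add: linear_sum linear_scale)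
  qed
  show ?case
  proof (rule Ck_on_SucI[OF \<open>open S\<close>, where f' = h])
    show "((\<lambda>x. g (f x)) has_derivative h x) (at x)" if "x \<in> S" for x
    proof -
      have "h x = (\<lambda>v. g' (f x) (f' x v))" using h that by auto
      then show ?thesis
        using has_derivative_compose[OF f'(1)[OF that] g'(1)] that Suc.prems(3) by auto
    qed
    show "Ck_on k S (\<lambda>x. h x v)" for v
      unfolding h_def
    proof (intro Ck_on_sum \<open>open S\<close> Ck_on_bilinear[OF bounded_bilinear_scaleR])
      show "Ck_on k S (\<lambda>x. g' (f x) b)" for b
        using Suc.IH[OF g'(2) Ck_on_SucD[OF Suc.prems(2)] Suc.prems(3)] .
      show "Ck_on k S (\<lambda>x. f' x v \<bullet> b)" for b
        by (rule Ck_on_linear_compose[OF bounded_linear_inner_left \<open>open S\<close> f'(2)])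
    qed
  qed
qed

section \<open>Rules for smooth maps\<close>

lemma smooth_on_subset: "smooth_on S f \<Longrightarrow> T \<subseteq> S \<Longrightarrow> smooth_on T f"
  by (auto simp: smooth_on_def intro: Ck_on_subset)

lemma smooth_on_imp_continuous_on: "smooth_on S f \<Longrightarrow> continuous_on S f"
  using Ck_on_imp_continuous_on smooth_on_def by blast

lemma smooth_on_cong: "open S \<Longrightarrow> (\<And>x. x \<in> S \<Longrightarrow> f x = g x) \<Longrightarrow> smooth_on S f = smooth_on S g"
  unfolding smooth_on_def using Ck_on_cong by blast

lemma smooth_on_local:
  assumes "\<And>x. x \<in> S \<Longrightarrow> \<exists>T. open T \<and> x \<in> T \<and> smooth_on T f"
  shows "smooth_on S f"
  using assms unfolding smooth_on_def by (metis Ck_on_local)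

lemma smooth_on_const [intro]: "smooth_on S (\<lambda>x. c)"
  by (auto simp: smooth_on_def)

lemma smooth_on_bounded_linear: "bounded_linear L \<Longrightarrow> open S \<Longrightarrow> smooth_on S L"
  by (auto simp: smooth_on_def intro: Ck_on_bounded_linear)

lemma smooth_on_linear_compose:
  "bounded_linear L \<Longrightarrow> open S \<Longrightarrow> smooth_on S f \<Longrightarrow> smooth_on S (\<lambda>x. L (f x))"
  by (auto simp: smooth_on_def intro: Ck_on_linear_compose)

lemma smooth_on_add: "open S \<Longrightarrow> smooth_on S f \<Longrightarrow> smooth_on S g \<Longrightarrow> smooth_on S (\<lambda>x. f x + g x)"
  by (auto simp: smooth_on_def intro: Ck_on_add)

lemma smooth_on_sum:
  "open S \<Longrightarrow> (\<And>i. i \<in> I \<Longrightarrow> smooth_on S (f i)) \<Longrightarrow> smooth_on S (\<lambda>x. \<Sum>i\<in>I. f i x)"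
  by (auto simp: smooth_on_def intro: Ck_on_sum)

lemma smooth_on_bilinear:
  "bounded_bilinear B \<Longrightarrow> open S \<Longrightarrow> smooth_on S f \<Longrightarrow> smooth_on S g \<Longrightarrow> smooth_on S (\<lambda>x. B (f x) (g x))"
  by (auto simp: smooth_on_def intro: Ck_on_bilinear)

lemmas smooth_on_mult = smooth_on_bilinear[OF bounded_bilinear_mult]
  and smooth_on_inner = smooth_on_bilinear[OF bounded_bilinear_inner]

lemma smooth_on_compose:
  fixes g :: "'b::euclidean_space \<Rightarrow> 'c::real_normed_vector"
  shows "open S \<Longrightarrow> open T \<Longrightarrow> smooth_on T g \<Longrightarrow> smooth_on S f \<Longrightarrow> f ` S \<subseteq> T \<Longrightarrow> smooth_on S (\<lambda>x. g (f x))"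
  unfolding smooth_on_def using Ck_on_compose[of S T] by blast

lemma smooth_on_diff:
  assumes "open S" "smooth_on S f" "smooth_on S g"
  shows "smooth_on S (\<lambda>x. f x - g x)"
  using smooth_on_add[OF assms(1,2) smooth_on_linear_compose[OF bounded_linear_minus[OF bounded_linear_ident] assms(1,3)]]
  by simp

lemma smooth_on_Pair:
  assumes "open S" "smooth_on S f" "smooth_on S g"
  shows "smooth_on S (\<lambda>x. (f x, g x))"
proof -
  have 1: "bounded_linear (\<lambda>y::'b. (y, 0::'c))" and 2: "bounded_linear (\<lambda>y::'c. (0::'b, y))"
    by (auto intro!: bounded_linear_Pair bounded_linear_ident bounded_linear_zero)
  show ?thesis
    using smooth_on_add[OF assms(1) smooth_on_linear_compose[OF 1 assms(1,2)]
        smooth_on_linear_compose[OF 2 assms(1,3)]] by simp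
qed

lemma smooth_on_ident: "open S \<Longrightarrow> smooth_on S (\<lambda>x. x)"
  by (rule smooth_on_bounded_linear[OF bounded_linear_ident])

lemma smooth_on_power:
  fixes f :: "'a::real_normed_vector \<Rightarrow> real"
  shows "open S \<Longrightarrow> smooth_on S f \<Longrightarrow> smooth_on S (\<lambda>x. f x ^ n)"
  by (induction n) (auto intro: smooth_on_mult)

section \<open>The derivative as an operator-valued map\<close>

definition blinfun_deriv :: "('a::real_normed_vector \<Rightarrow> 'b::real_normed_vector) \<Rightarrow> 'a \<Rightarrow> 'a \<Rightarrow>\<^sub>L 'b" where
  "blinfun_deriv f x = Blinfun (frechet_derivative f (at x))"

lemma has_derivative_imp_blinfun_deriv:
  assumes "(f has_derivative f') (at x)"
  shows "blinfun_apply (blinfun_deriv f x) = f'"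
proof -
  have "frechet_derivative f (at x) = f'" using assms frechet_derivative_at by metis
  then show ?thesis
    using has_derivative_bounded_linear[OF assms] by (simp add: blinfun_deriv_def bounded_linear_Blinfun_apply)
qed

lemma smooth_on_differentiable: "smooth_on S f \<Longrightarrow> x \<in> S \<Longrightarrow> f differentiable at x"
  unfolding smooth_on_def by (metis Ck_on.simps(2))

lemma smooth_on_has_derivative:
  assumes "smooth_on S f" "x \<in> S"
  shows "(f has_derivative blinfun_apply (blinfun_deriv f x)) (at x)"
  using smooth_on_differentiable[OF assms] has_derivative_imp_blinfun_deriv
  by (metis frechet_derivative_works)

lemma smooth_on_directional:
  assumes "smooth_on S f"
  shows "smooth_on S (\<lambda>x. frechet_derivative f (at x) v)"
  using assms unfolding smooth_on_def by (metis Ck_on.simps(2))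

text \<open>In finite dimension an operator is the sum of the rank-one operators
  \<open>T b (F x b)\<close>, where \<open>T b w\<close> sends v to (v . b) w, so regularity may be
  tested on vectors.\<close>

lemma Ck_on_blinfunI:
  fixes F :: "'a::real_normed_vector \<Rightarrow> 'b::euclidean_space \<Rightarrow>\<^sub>L 'c::real_normed_vector"
  assumes "open S" "\<And>b. Ck_on k S (\<lambda>x. F x b)"
  shows "Ck_on k S F"
proof -
  define T :: "'b \<Rightarrow> 'c \<Rightarrow> 'b \<Rightarrow>\<^sub>L 'c" where "T = (\<lambda>b w. blinfun_scaleR_left w o\<^sub>L blinfun_inner_left b)"
  have T: "bounded_linear (T b)" for b
    unfolding T_def
    by (intro bounded_linear_compose[OF bounded_bilinear.bounded_linear_left[OF bounded_bilinear_blinfun_compose]]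
        bounded_linear_blinfun_scaleR_left)
  have "F x = (\<Sum>b\<in>Basis. T b (F x b))" for x
  proof (rule blinfun_eqI)
    fix v
    have "F x v = F x (\<Sum>b\<in>Basis. (v \<bullet> b) *\<^sub>R b)" by (simp add: euclidean_representation)
    also have "\<dots> = (\<Sum>b\<in>Basis. T b (F x b)) v"
      by (simp add: T_def blinfun.sum_left blinfun.sum_right blinfun.scaleR_right inner_commute)
    finally show "F x v = (\<Sum>b\<in>Basis. T b (F x b)) v" .
  qed
  then have "F = (\<lambda>x. \<Sum>b\<in>Basis. T b (F x b))" by auto
  moreover have "Ck_on k S (\<lambda>x. \<Sum>b\<in>Basis. T b (F x b))"
    by (intro Ck_on_sum Ck_on_linear_compose[OF T] assms)
  ultimately show ?thesis by simp
qed

lemma smooth_on_blinfunI: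
  fixes F :: "'a::real_normed_vector \<Rightarrow> 'b::euclidean_space \<Rightarrow>\<^sub>L 'c::real_normed_vector"
  shows "open S \<Longrightarrow> (\<And>b. smooth_on S (\<lambda>x. F x b)) \<Longrightarrow> smooth_on S F"
  unfolding smooth_on_def by (blast intro: Ck_on_blinfunI)

lemma smooth_on_blinfun_deriv:
  fixes f :: "'a::euclidean_space \<Rightarrow> 'b::real_normed_vector"
  assumes "open S" "smooth_on S f"
  shows "smooth_on S (blinfun_deriv f)"
proof (rule smooth_on_blinfunI[OF assms(1)])
  fix b
  have "blinfun_deriv f x b = frechet_derivative f (at x) b" if "x \<in> S" for x
    using smooth_on_differentiable[OF assms(2) that]
    by (simp add: has_derivative_imp_blinfun_deriv frechet_derivative_works)
  then show "smooth_on S (\<lambda>x. blinfun_deriv f x b)"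
    using smooth_on_cong[OF assms(1)] smooth_on_directional[OF assms(2)] by (metis (no_types, lifting))
qed

lemmas smooth_on_blinfun_compose = smooth_on_bilinear[OF bounded_bilinear_blinfun_compose]
  and smooth_on_blinfun_apply = smooth_on_bilinear[OF bounded_bilinear_blinfun_apply]

section \<open>Hadamard's lemma and cutoff functions\<close>

lemma Ck_on_blinfun_deriv:
  fixes f :: "'a::euclidean_space \<Rightarrow> 'b::real_normed_vector"
  assumes "open S" "Ck_on (Suc k) S f"
  shows "Ck_on k S (blinfun_deriv f)"
proof (rule Ck_on_blinfunI[OF assms(1)])
  fix b
  have "blinfun_deriv f x b = frechet_derivative f (at x) b" if "x \<in> S" for x
    using that assms(2) has_derivative_imp_blinfun_deriv[OF iffD1[OF frechet_derivative_works], of f x] by simp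
  moreover have "Ck_on k S (\<lambda>x. frechet_derivative f (at x) b)" using assms(2) by simp
  ultimately show "Ck_on k S (\<lambda>x. blinfun_deriv f x b)"
    using Ck_on_cong[OF assms(1)] by (metis (no_types, lifting))
qed

text \<open>The weight \<open>t ^ j\<close> is carried along because differentiating
  \<open>h (t *\<^sub>R y)\<close> in y produces another factor t, so the induction on
  \<open>k\<close> needs every \<open>j\<close>.\<close>

lemma Ck_on_integral_ray:
  fixes h :: "'a::euclidean_space \<Rightarrow> 'b::banach"
  assumes "Ck_on k (ball 0 r) h"
  shows "Ck_on k (ball 0 r) (\<lambda>y. integral (cbox 0 1) (\<lambda>t. t ^ j *\<^sub>R h (t *\<^sub>R y)))"
  using assms
proof (induction k arbitrary: h j)
  case 0
  have sub: "norm (t *\<^sub>R y) < r" if "norm y < r" "t \<in> cbox 0 (1::real)" for y :: 'a and t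
    using that mult_left_le_one_le[of "norm y" t] by auto
  show ?case
    unfolding Ck_on.simps
  proof (rule integral_continuous_on_param)
    have "continuous_on (ball 0 r \<times> cbox 0 1) (\<lambda>z::'a \<times> real. h (snd z *\<^sub>R fst z))"
      by (rule continuous_on_compose2[OF 0[unfolded Ck_on.simps]])
        (use sub in \<open>auto intro!: continuous_intros simp del: norm_scaleR mem_box cbox_interval\<close>)
    then show "continuous_on (ball 0 r \<times> cbox 0 1) (\<lambda>(x::'a, t). t ^ j *\<^sub>R h (t *\<^sub>R x))"
      by (auto intro!: continuous_intros simp: case_prod_beta)
  qed
next
  case (Suc k)
  have sub: "norm (t *\<^sub>R y) < r" if "norm y < r" "t \<in> cbox 0 (1::real)" for y :: 'a and t
    using that mult_left_le_one_le[of "norm y" t] by auto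
  define g where "g = (\<lambda>(y::'a) t. t ^ Suc j *\<^sub>R blinfun_deriv h (t *\<^sub>R y))"
  have der: "(h has_derivative blinfun_deriv h x) (at x)" if "x \<in> ball 0 r" for x
    using Suc.prems that by (metis Ck_on.simps(2) has_derivative_imp_blinfun_deriv frechet_derivative_works)
  have Ck: "Ck_on k (ball 0 r) (\<lambda>x. blinfun_deriv h x v)" for v
    by (rule Ck_on_bilinear[OF bounded_bilinear_blinfun_apply _ Ck_on_blinfun_deriv[OF _ Suc.prems]]) auto
  have cont: "continuous_on (ball 0 r) (blinfun_deriv h)"
    using Ck_on_imp_continuous_on Ck_on_blinfun_deriv[OF _ Suc.prems] by auto
  have cont2: "continuous_on (ball 0 r \<times> cbox 0 1) (\<lambda>(x::'a, t). g x t)"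
  proof -
    have "continuous_on (ball 0 r \<times> cbox 0 1) (\<lambda>z::'a \<times> real. blinfun_deriv h (snd z *\<^sub>R fst z))"
      by (rule continuous_on_compose2[OF cont])
        (use sub in \<open>auto intro!: continuous_intros simp del: norm_scaleR mem_box cbox_interval\<close>)
    then show ?thesis
      by (auto intro!: continuous_intros simp: case_prod_beta g_def simp del: power_Suc)
  qed
  have conth: "continuous_on (cbox 0 1) (\<lambda>t. t ^ j *\<^sub>R h (t *\<^sub>R y))" if "y \<in> ball 0 r" for y
    by (intro continuous_intros continuous_on_compose2[OF Ck_on_imp_continuous_on[OF Suc.prems]])
      (use sub that in \<open>auto simp del: norm_scaleR mem_box cbox_interval\<close>)
  have contg: "continuous_on (cbox 0 1) (\<lambda>t. g y t)" if "y \<in> ball 0 r" for y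
    by (rule continuous_on_compose2[OF cont2, of _ "\<lambda>t. (y, t)", simplified])
      (use that in \<open>auto intro!: continuous_intros\<close>)
  show ?case
  proof (rule Ck_on_SucI)
    fix y :: 'a assume y: "y \<in> ball 0 r"
    have "((\<lambda>y. integral (cbox 0 1) (\<lambda>t. t ^ j *\<^sub>R h (t *\<^sub>R y))) has_derivative
      integral (cbox 0 1) (g y)) (at y within ball 0 r)"
    proof (rule leibniz_rule[OF _ _ cont2 y])
      fix x :: 'a and t :: real
      assume x: "x \<in> ball 0 r" and t: "t \<in> cbox 0 1"
      have "((\<lambda>x. h (t *\<^sub>R x)) has_derivative (\<lambda>v. blinfun_deriv h (t *\<^sub>R x) (t *\<^sub>R v))) (at x within ball 0 r)"
        by (rule has_derivative_compose[OF _ der])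
          (use sub x t in \<open>auto intro!: derivative_eq_intros simp del: norm_scaleR mem_box cbox_interval\<close>)
      then show "((\<lambda>x. t ^ j *\<^sub>R h (t *\<^sub>R x)) has_derivative g x t) (at x within ball 0 r)"
        by (auto intro!: derivative_eq_intros simp: g_def blinfun.scaleR_right blinfun.scaleR_left mult.commute)
    next
      show "(\<lambda>t. t ^ j *\<^sub>R h (t *\<^sub>R x)) integrable_on cbox 0 1" if "x \<in> ball 0 r" for x
        by (rule integrable_continuous[OF conth[OF that]])
    qed simp
    moreover have "at y within ball 0 r = at y" using y by (auto intro: at_within_open)
    ultimately show "((\<lambda>y. integral (cbox 0 1) (\<lambda>t. t ^ j *\<^sub>R h (t *\<^sub>R y))) has_derivative
      integral (cbox 0 1) (g y)) (at y)" by simp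
  next
    fix v
    have "blinfun_apply (integral (cbox 0 1) (g y)) v
        = integral (cbox 0 1) (\<lambda>t. t ^ Suc j *\<^sub>R blinfun_deriv h (t *\<^sub>R y) v)" if "y \<in> ball 0 r" for y
      using blinfun_apply_integral[OF integrable_continuous[OF contg[OF that]], of v]
      by (simp add: g_def blinfun.scaleR_left)
    then show "Ck_on k (ball 0 r) (\<lambda>y. blinfun_apply (integral (cbox 0 1) (g y)) v)"
      using Suc.IH[OF Ck, of "Suc j" v] Ck_on_cong[OF open_ball] by (metis (no_types, lifting))
  qed auto
qed

text \<open>The factors are the averages of the partial derivatives along the ray from 0 to y, by
  the fundamental theorem of calculus. The decomposition serves to show that every derivation at the
  identity is a tangent vector.\<close>

lemma Hadamard:
  fixes f :: "'a::euclidean_space \<Rightarrow> real"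
  assumes "smooth_on (ball 0 r) f"
  obtains g where "\<And>b. smooth_on (ball 0 r) (g b)"
    "\<And>y. y \<in> ball 0 r \<Longrightarrow> f y = f 0 + (\<Sum>b\<in>Basis. (y \<bullet> b) * g b y)"
    "\<And>b. r > 0 \<Longrightarrow> g b 0 = frechet_derivative f (at 0) b"
proof
  define g where "g = (\<lambda>b y. integral (cbox 0 1) (\<lambda>t. t ^ 0 *\<^sub>R frechet_derivative f (at (t *\<^sub>R y)) b))"
  show "smooth_on (ball 0 r) (g b)" for b
    unfolding g_def smooth_on_def
    using smooth_on_directional[OF assms, of b] Ck_on_integral_ray unfolding smooth_on_def by blast
  show "g b 0 = frechet_derivative f (at 0) b" for b
    by (simp add: g_def)
  fix y :: 'a assume y: "y \<in> ball 0 r"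
  have sub: "t *\<^sub>R y \<in> ball 0 r" if "t \<in> {0..1}" for t :: real
    using that y mult_left_le_one_le[of "norm y" t] by auto
  have d: "((\<lambda>t. f (t *\<^sub>R y)) has_vector_derivative frechet_derivative f (at (t *\<^sub>R y)) y) (at t within {0..1})"
    if "t \<in> {0..1}" for t
  proof -
    have f: "(f has_derivative frechet_derivative f (at (t *\<^sub>R y))) (at (t *\<^sub>R y))"
      using smooth_on_differentiable[OF assms sub[OF that]] frechet_derivative_works by blast
    have "((\<lambda>t. f (t *\<^sub>R y)) has_derivative (\<lambda>s. frechet_derivative f (at (t *\<^sub>R y)) (s *\<^sub>R y))) (at t within {0..1})"
      by (rule has_derivative_compose[where f = "\<lambda>t. t *\<^sub>R y" and g = f, OF _ f]) (auto intro!: derivative_eq_intros)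
    moreover have "frechet_derivative f (at (t *\<^sub>R y)) (s *\<^sub>R y) = s *\<^sub>R frechet_derivative f (at (t *\<^sub>R y)) y" for s
      using linear_scale[OF has_derivative_linear[OF f]] .
    ultimately show ?thesis by (simp add: has_vector_derivative_def)
  qed
  have int: "(\<lambda>t. frechet_derivative f (at (t *\<^sub>R y)) b) integrable_on {0..1}" for b
  proof -
    have "continuous_on {0..1} (\<lambda>t. frechet_derivative f (at (t *\<^sub>R y)) b)"
      by (rule continuous_on_compose2[OF smooth_on_imp_continuous_on[OF smooth_on_directional[OF assms]]])
        (use sub in \<open>auto intro!: continuous_intros\<close>)
    then show ?thesis by (rule integrable_continuous_real)
  qed
  have rep: "frechet_derivative f (at (t *\<^sub>R y)) y
      = (\<Sum>b\<in>Basis. (y \<bullet> b) * frechet_derivative f (at (t *\<^sub>R y)) b)" if "t \<in> {0..1}" for t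
  proof -
    have l: "linear (frechet_derivative f (at (t *\<^sub>R y)))"
      using smooth_on_differentiable[OF assms sub[OF that]] linear_frechet_derivative by blast
    have "frechet_derivative f (at (t *\<^sub>R y)) (\<Sum>b\<in>Basis. (y \<bullet> b) *\<^sub>R b)
      = (\<Sum>b\<in>Basis. (y \<bullet> b) * frechet_derivative f (at (t *\<^sub>R y)) b)"
      by (simp add: linear_sum[OF l] linear_scale[OF l])
    then show ?thesis by (simp only: euclidean_representation)
  qed
  have "((\<lambda>t. frechet_derivative f (at (t *\<^sub>R y)) y) has_integral f (1 *\<^sub>R y) - f (0 *\<^sub>R y)) {0..1}"
    by (rule fundamental_theorem_of_calculus[OF _ d]) auto
  then have "f y - f 0 = integral {0..1} (\<lambda>t. frechet_derivative f (at (t *\<^sub>R y)) y)"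
    by (simp add: integral_unique)
  also have "\<dots> = integral {0..1} (\<lambda>t. \<Sum>b\<in>Basis. (y \<bullet> b) * frechet_derivative f (at (t *\<^sub>R y)) b)"
    by (rule integral_cong) (rule rep)
  also have "\<dots> = (\<Sum>b\<in>Basis. (y \<bullet> b) * g b y)"
    by (subst integral_sum) (auto intro!: integrable_on_mult_right int simp: g_def)
  finally show "f y = f 0 + (\<Sum>b\<in>Basis. (y \<bullet> b) * g b y)" by simp
qed

text \<open>The powers of 1/t are included because the functions t^(-n) exp(-1/t), extended by 0,
  are closed under differentiation up to linear combinations; one induction then gives smoothness of
  all of them.\<close>

definition flat :: "nat \<Rightarrow> real \<Rightarrow> real" where
  "flat n t = (if t > 0 then inverse t ^ n * exp (- inverse t) else 0)"

lemma flat_tendsto_0: "(flat n \<longlongrightarrow> 0) (at 0)"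
proof (rule filterlim_split_at)
  have "eventually (\<lambda>t. 0 = flat n t) (at_left 0)"
    unfolding eventually_at_filter by (auto simp: flat_def intro!: always_eventually)
  then show "(flat n \<longlongrightarrow> 0) (at_left 0)"
    by (rule Lim_transform_eventually[OF tendsto_const])
  have "((\<lambda>t. inverse t ^ n / exp (inverse t)) \<longlongrightarrow> (0::real)) (at_right 0)"
    by (rule filterlim_compose[OF tendsto_power_div_exp_0 filterlim_inverse_at_top_right])
  moreover have "eventually (\<lambda>t. inverse t ^ n / exp (inverse t) = flat n t) (at_right 0)"
    unfolding eventually_at_filter by (auto simp: flat_def exp_minus divide_inverse intro!: always_eventually)
  ultimately show "(flat n \<longlongrightarrow> 0) (at_right 0)"
    by (rule Lim_transform_eventually)
qed

text \<open>At 0 the difference quotient of \<open>flat n\<close> is \<open>flat (Suc n)\<close>,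
  which tends to 0; away from 0 the product rule applies.\<close>

lemma flat_has_derivative:
  "(flat n has_real_derivative (flat (n + 2) t - n * flat (n + 1) t)) (at t)"
proof (cases t "0::real" rule: linorder_cases)
  case less
  have "((\<lambda>t. 0) has_real_derivative 0) (at t)" by simp
  then show ?thesis
    by (rule has_field_derivative_transform_within_open[of _ _ _ "{..<0}", THEN DERIV_cong])
      (use less in \<open>auto simp: flat_def\<close>)
next
  case equal
  have "(flat n (0 + h) - flat n 0) / h = flat (Suc n) h" for h
    by (simp add: flat_def field_simps)
  then show ?thesis
    using equal flat_tendsto_0[of "Suc n"] unfolding DERIV_def by (simp add: flat_def[of _ 0])
next
  case greater
  have "((\<lambda>t. inverse t ^ n * exp (- inverse t)) has_real_derivative
      (flat (n + 2) t - n * flat (n + 1) t)) (at t)"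
  proof -
    have i: "(inverse has_real_derivative - (inverse t ^ 2)) (at t)"
      using DERIV_inverse[of t UNIV] greater by (simp add: numeral_2_eq_2)
    have "((\<lambda>t. exp (- inverse t)) has_real_derivative exp (- inverse t) * inverse t ^ 2) (at t)"
      using DERIV_fun_exp[OF DERIV_minus[OF i]] by simp
    from DERIV_mult[OF DERIV_power[OF i, of n] this] show ?thesis
    proof (rule DERIV_cong)
      have "real n * (- (s\<^sup>2) * s ^ (n - Suc 0)) * E + E * s\<^sup>2 * s ^ n = s ^ (n + 2) * E - n * (s ^ (n + 1) * E)" for s E :: real
        by (cases n) (simp_all add: power2_eq_square algebra_simps)
      from this[of "inverse t" "exp (- inverse t)"]
      show "real n * (- (inverse t)\<^sup>2 * inverse t ^ (n - Suc 0)) * exp (- inverse t)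
          + exp (- inverse t) * (inverse t)\<^sup>2 * inverse t ^ n = flat (n + 2) t - n * flat (n + 1) t"
        using greater by (simp only: flat_def if_True)
    qed
  qed
  then show ?thesis
    by (rule has_field_derivative_transform_within_open[of _ _ _ "{0<..}"])
      (use greater in \<open>auto simp: flat_def\<close>)
qed

lemma smooth_on_flat: "smooth_on UNIV (flat n)"
proof -
  have "Ck_on k UNIV (flat n)" for k
  proof (induction k arbitrary: n)
    case 0
    show ?case using flat_has_derivative[of n]
      by (auto intro!: continuous_at_imp_continuous_on DERIV_isCont)
  next
    case (Suc k)
    show ?case
    proof (rule Ck_on_SucI)
      show "(flat n has_derivative (\<lambda>v. (flat (n + 2) t - n * flat (n + 1) t) * v)) (at t)" for t
        using flat_has_derivative[of n t] by (simp add: has_field_derivative_def)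
      have "Ck_on k UNIV (\<lambda>t. v * (flat (n + 2) t + (- real n) * flat (n + 1) t))" for v
        by (intro Ck_on_linear_compose[OF bounded_linear_mult_right] Ck_on_add Suc) auto
      then show "Ck_on k UNIV (\<lambda>t. (flat (n + 2) t - n * flat (n + 1) t) * v)" for v
        by (simp add: mult.commute)
    qed auto
  qed
  then show ?thesis by (simp add: smooth_on_def)
qed

text \<open>The norm enters through its square, which is smooth at 0 as well.\<close>

definition bump :: "real \<Rightarrow> 'a::euclidean_space \<Rightarrow> real" where
  "bump r y = flat 0 (r\<^sup>2 - y \<bullet> y)"

lemma smooth_on_bump: "smooth_on UNIV (bump r)"
  unfolding bump_def
  by (rule smooth_on_compose[OF _ _ smooth_on_flat])
    (rule open_UNIV subset_UNIV smooth_on_diff smooth_on_inner smooth_on_ident smooth_on_const)+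

lemma bump_pos_iff: "r > 0 \<Longrightarrow> bump r y > 0 \<longleftrightarrow> norm y < r"
  using power2_less_imp_less[of "norm y" r] power_strict_mono[of "norm y" r 2]
  unfolding bump_def flat_def dot_square_norm by auto

lemma bump_nonneg: "bump r y \<ge> 0"
  by (simp add: bump_def flat_def)

lemma bump_le_1: "bump r y \<le> 1"
  by (simp add: bump_def flat_def)

lemma bump_eq_0: "r > 0 \<Longrightarrow> norm y \<ge> r \<Longrightarrow> bump r y = 0"
  using bump_pos_iff[of r y] bump_nonneg[of r y] by linarith

section \<open>Strict derivatives and uniqueness lemmas\<close>

text \<open>Mean value inequality for f minus its linearization at \<open>x0\<close>: the derivative
  of this difference is small near \<open>x0\<close> by continuity.\<close>

lemma smooth_on_strict_derivative:
  fixes f :: "'a::euclidean_space \<Rightarrow> 'b::real_normed_vector"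
  assumes "open S" "smooth_on S f" "x0 \<in> S" "e > 0"
  obtains d where "d > 0" "ball x0 d \<subseteq> S"
    "\<And>x y. x \<in> ball x0 d \<Longrightarrow> y \<in> ball x0 d \<Longrightarrow>
      norm (f x - f y - blinfun_deriv f x0 (x - y)) \<le> e * norm (x - y)"
proof -
  have "isCont (blinfun_deriv f) x0"
    using smooth_on_imp_continuous_on[OF smooth_on_blinfun_deriv[OF assms(1,2)]] assms(1,3)
    by (simp add: continuous_on_eq_continuous_at)
  then obtain d1 where d1: "d1 > 0" "\<And>x. dist x x0 < d1 \<Longrightarrow> dist (blinfun_deriv f x) (blinfun_deriv f x0) < e"
    using \<open>e > 0\<close> unfolding continuous_at_eps_delta by blast
  obtain d2 where d2: "d2 > 0" "ball x0 d2 \<subseteq> S" using assms(1,3) open_contains_ball by blast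
  show thesis
  proof
    show "min d1 d2 > 0" "ball x0 (min d1 d2) \<subseteq> S" using d1 d2 by auto
    fix x y assume xy: "x \<in> ball x0 (min d1 d2)" "y \<in> ball x0 (min d1 d2)"
    have "norm ((f x - blinfun_deriv f x0 x) - (f y - blinfun_deriv f x0 y)) \<le> e * norm (x - y)"
    proof (rule differentiable_bound[OF convex_ball _ _ xy(1,2)])
      fix z assume z: "z \<in> ball x0 (min d1 d2)"
      then have "z \<in> S" using d2 by auto
      have "((\<lambda>x. f x - blinfun_deriv f x0 x) has_derivative (\<lambda>v. blinfun_deriv f z v - blinfun_deriv f x0 v)) (at z)"
        by (intro has_derivative_diff smooth_on_has_derivative[OF assms(2) \<open>z \<in> S\<close>]
            bounded_linear_imp_has_derivative blinfun.bounded_linear_right)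
      then show "((\<lambda>x. f x - blinfun_deriv f x0 x) has_derivative (blinfun_deriv f z - blinfun_deriv f x0))
          (at z within ball x0 (min d1 d2))"
        by (auto intro!: has_derivative_at_withinI simp: blinfun.diff_left[abs_def])
      show "onorm (blinfun_apply (blinfun_deriv f z - blinfun_deriv f x0)) \<le> e"
        using d1(2)[of z] z by (simp add: norm_blinfun.rep_eq[symmetric] dist_norm norm_minus_commute)
    qed
    then show "norm (f x - f y - blinfun_deriv f x0 (x - y)) \<le> e * norm (x - y)"
      by (simp add: blinfun.diff_right algebra_simps)
  qed
qed

text \<open>The second difference is the increment over [0, t] of the first difference in direction
  t v. The derivative of the latter is an increment of \<open>G\<close>, the derivative of f along
  u, and strict differentiability of \<open>G\<close> at \<open>x0\<close> controls it
  uniformly.\<close>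

lemma second_difference:
  fixes f :: "'a::euclidean_space \<Rightarrow> 'b::real_normed_vector"
  assumes "open S" "smooth_on S f" "x0 \<in> S" "e > 0"
  obtains d where "d > 0"
    "\<And>t. 0 < t \<Longrightarrow> t < d \<Longrightarrow> norm (f (x0 + t *\<^sub>R u + t *\<^sub>R v) - f (x0 + t *\<^sub>R u) - f (x0 + t *\<^sub>R v) + f x0
       - (t * t) *\<^sub>R blinfun_deriv (\<lambda>x. blinfun_deriv f x u) x0 v) \<le> t * t * (e * norm v)"
proof -
  define G where "G = (\<lambda>x. blinfun_deriv f x u)"
  have smG: "smooth_on S G" unfolding G_def
    by (intro smooth_on_blinfun_apply smooth_on_blinfun_deriv smooth_on_const assms)
  obtain d where d: "d > 0" "ball x0 d \<subseteq> S"
    "\<And>x y. x \<in> ball x0 d \<Longrightarrow> y \<in> ball x0 d \<Longrightarrow>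
      norm (G x - G y - blinfun_deriv G x0 (x - y)) \<le> e * norm (x - y)"
    using smooth_on_strict_derivative[OF assms(1) smG assms(3,4)] by metis
  \<comment> \<open>For t below this bound all points x0 + s u and x0 + s u + t v with s \<le> t lie
    in the ball.\<close>
  define d' where "d' = d / (norm u + norm v + 1)"
  have "d' > 0" using d(1) by (simp add: d'_def add_nonneg_pos)
  moreover have "norm (f (x0 + t *\<^sub>R u + t *\<^sub>R v) - f (x0 + t *\<^sub>R u) - f (x0 + t *\<^sub>R v) + f x0
       - (t * t) *\<^sub>R blinfun_deriv G x0 v) \<le> t * t * (e * norm v)" if t: "0 < t" "t < d'" for t
  proof -
    have pos: "norm u + norm v + 1 > 0" by (simp add: add_nonneg_pos)
    have td: "t * norm u + t * norm v < d"
    proof -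
      have "t * (norm u + norm v) \<le> t * (norm u + norm v + 1)" using t by (intro mult_left_mono) auto
      also have "\<dots> < d" using t pos by (simp add: d'_def field_simps)
      finally show ?thesis by (simp add: algebra_simps)
    qed
    have in1: "x0 + s *\<^sub>R u \<in> ball x0 d" and in2: "x0 + s *\<^sub>R u + t *\<^sub>R v \<in> ball x0 d" if "s \<in> {0..t}" for s
    proof -
      have "s * norm u \<le> t * norm u" using that by (intro mult_right_mono) auto
      moreover have "0 \<le> t * norm v" using t by simp
      moreover have "norm (s *\<^sub>R u + t *\<^sub>R v) \<le> s * norm u + t * norm v"
        using norm_triangle_ineq[of "s *\<^sub>R u" "t *\<^sub>R v"] that t by simp
      moreover have "dist x0 (x0 + s *\<^sub>R u) = s * norm u"
        using that by (simp add: dist_norm)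
      moreover have "dist x0 (x0 + s *\<^sub>R u + t *\<^sub>R v) = norm (s *\<^sub>R u + t *\<^sub>R v)"
        by (metis add.assoc add_diff_cancel_left' dist_commute dist_norm)
      ultimately show "x0 + s *\<^sub>R u \<in> ball x0 d" "x0 + s *\<^sub>R u + t *\<^sub>R v \<in> ball x0 d"
        using td by (auto simp: mem_ball)
    qed
    define p where "p = (\<lambda>s. f (x0 + s *\<^sub>R u + t *\<^sub>R v) - f (x0 + s *\<^sub>R u) - s *\<^sub>R (t *\<^sub>R blinfun_deriv G x0 v))"
    define p' where "p' = (\<lambda>s. G (x0 + s *\<^sub>R u + t *\<^sub>R v) - G (x0 + s *\<^sub>R u) - t *\<^sub>R blinfun_deriv G x0 v)"
    have "norm (p t - p 0) \<le> (t * (e * norm v)) * norm (t - 0)"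
    proof (rule differentiable_bound[where S = "{0..t}" and f' = "\<lambda>s h. h *\<^sub>R p' s"])
      fix s assume s: "s \<in> {0..t}"
      have A: "((\<lambda>s. f (w + s *\<^sub>R u)) has_derivative (\<lambda>h. blinfun_deriv f (w + s *\<^sub>R u) (h *\<^sub>R u))) (at s within {0..t})"
        if "w + s *\<^sub>R u \<in> ball x0 d" for w
        by (rule has_derivative_compose[of "\<lambda>s. w + s *\<^sub>R u" "\<lambda>h. h *\<^sub>R u" s "{0..t}" f, OF _ smooth_on_has_derivative[OF assms(2)]])
          (use that d(2) in \<open>auto intro!: derivative_eq_intros\<close>)
      have w: "x0 + t *\<^sub>R v + s *\<^sub>R u = x0 + s *\<^sub>R u + t *\<^sub>R v" for s by simp
      have "((\<lambda>s. f (x0 + s *\<^sub>R u + t *\<^sub>R v)) has_derivative (\<lambda>h. blinfun_deriv f (x0 + s *\<^sub>R u + t *\<^sub>R v) (h *\<^sub>R u))) (at s within {0..t})"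
        using A[of "x0 + t *\<^sub>R v", unfolded w] in2[OF s] by simp
      from has_derivative_diff[OF has_derivative_diff[OF this A[OF in1[OF s]]] has_derivative_scaleR_left[OF has_derivative_ident, of "t *\<^sub>R blinfun_deriv G x0 v"]]
      show "(p has_derivative (\<lambda>h. h *\<^sub>R p' s)) (at s within {0..t})"
        by (simp add: p_def p'_def G_def blinfun.scaleR_right scaleR_diff_right)
      have "norm (p' s) \<le> e * norm (t *\<^sub>R v)"
        using d(3)[OF in2[OF s] in1[OF s]] by (simp add: p'_def blinfun.scaleR_right)
      then show "onorm (\<lambda>h. h *\<^sub>R p' s) \<le> t * (e * norm v)"
        using t by (subst onorm_scaleR_left) (auto simp: onorm_id mult_ac bounded_linear_ident)
    qed (use t in auto)
    then show ?thesis using t by (simp add: p_def algebra_simps)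
  qed
  ultimately show thesis using that unfolding G_def by blast
qed

text \<open>The second difference is symmetric in u and v, and divided by t^2 it approximates both
  mixed derivatives.\<close>

lemma second_derivative_symmetric:
  fixes f :: "'a::euclidean_space \<Rightarrow> 'b::real_normed_vector"
  assumes "open S" "smooth_on S f" "x0 \<in> S"
  shows "blinfun_deriv (\<lambda>x. blinfun_deriv f x u) x0 v = blinfun_deriv (\<lambda>x. blinfun_deriv f x v) x0 u"
    (is "?a = ?b")
proof -
  have "norm (?a - ?b) \<le> e" if "e > 0" for e
  proof -
    define e' where "e' = e / (norm u + norm v + 1)"
    have pos: "norm u + norm v + 1 > 0" by (simp add: add_nonneg_pos)
    have "e' > 0" using that pos by (simp add: e'_def)
    obtain d1 where d1: "d1 > 0"
      "\<And>t. 0 < t \<Longrightarrow> t < d1 \<Longrightarrow> norm (f (x0 + t *\<^sub>R u + t *\<^sub>R v) - f (x0 + t *\<^sub>R u) - f (x0 + t *\<^sub>R v) + f x0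
       - (t * t) *\<^sub>R ?a) \<le> t * t * (e' * norm v)"
      using second_difference[OF assms \<open>e' > 0\<close>] by metis
    obtain d2 where d2: "d2 > 0"
      "\<And>t. 0 < t \<Longrightarrow> t < d2 \<Longrightarrow> norm (f (x0 + t *\<^sub>R v + t *\<^sub>R u) - f (x0 + t *\<^sub>R v) - f (x0 + t *\<^sub>R u) + f x0
       - (t * t) *\<^sub>R ?b) \<le> t * t * (e' * norm u)"
      using second_difference[OF assms \<open>e' > 0\<close>] by metis
    define t where "t = min d1 d2 / 2"
    have t: "0 < t" "t < d1" "t < d2" using d1(1) d2(1) by (auto simp: t_def)
    define Z where "Z = f (x0 + t *\<^sub>R u + t *\<^sub>R v) - f (x0 + t *\<^sub>R u) - f (x0 + t *\<^sub>R v) + f x0"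
    have a: "norm (Z - (t * t) *\<^sub>R ?a) \<le> t * t * (e' * norm v)" using d1(2)[OF t(1,2)] by (simp add: Z_def)
    have "f (x0 + t *\<^sub>R v + t *\<^sub>R u) - f (x0 + t *\<^sub>R v) - f (x0 + t *\<^sub>R u) + f x0 = Z"
      by (simp add: Z_def add_ac)
    then have b: "norm (Z - (t * t) *\<^sub>R ?b) \<le> t * t * (e' * norm u)" using d2(2)[OF t(1,3)] by simp
    have "(t * t) *\<^sub>R (?a - ?b) = (Z - (t * t) *\<^sub>R ?b) - (Z - (t * t) *\<^sub>R ?a)" by (simp add: algebra_simps)
    then have "norm ((t * t) *\<^sub>R (?a - ?b)) \<le> t * t * (e' * norm u) + t * t * (e' * norm v)"
      using norm_triangle_ineq4[of "Z - (t * t) *\<^sub>R ?b" "Z - (t * t) *\<^sub>R ?a"] a b by simp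
    also have "t * t * (e' * norm u) + t * t * (e' * norm v) = t * t * (e' * (norm u + norm v))"
      by (simp add: algebra_simps)
    finally have "(t * t) * norm (?a - ?b) \<le> (t * t) * (e' * (norm u + norm v))" using t(1) by simp
    then have "norm (?a - ?b) \<le> e' * (norm u + norm v)"
      by (rule mult_left_le_imp_le) (use t in simp)
    also have "\<dots> \<le> e" using that pos by (simp add: e'_def field_simps)
    finally show ?thesis .
  qed
  then have "norm (?a - ?b) \<le> 0" by (rule field_le_epsilon[of _ 0, simplified])
  then show ?thesis by simp
qed

text \<open>Iterating \<open>step\<close> k times costs q^k times the product of 1 + c|v|/2^j over j
  < k, and this product stays below exp(2c|v|). What remains tends to 0 by \<open>lim\<close>: for q
  = 1 this is continuity at 0 with value 0, for q = 2 a vanishing first derivative at 0.\<close>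

lemma halving_vanish:
  fixes f :: "'a::real_normed_vector \<Rightarrow> 'b::real_normed_vector"
  assumes "c \<ge> 0" "q \<ge> 0"
    and step: "\<And>v. norm v < r \<Longrightarrow> norm (f v) \<le> q * (1 + c * norm v) * norm (f (v /\<^sub>R 2))"
    and lim: "(\<lambda>k. q ^ k * norm (f (v /\<^sub>R 2 ^ k))) \<longlonglongrightarrow> 0"
    and "norm v < r"
  shows "f v = 0"
proof -
  have *: "norm (f v) \<le> exp (c * (\<Sum>j<k. norm v / 2 ^ j)) * (q ^ k * norm (f (v /\<^sub>R 2 ^ k)))" for k
  proof (induction k)
    case (Suc k)
    have nv: "norm (v /\<^sub>R 2 ^ k) = norm v / 2 ^ k" by (simp add: divide_inverse mult.commute)
    have "norm v / 2 ^ k \<le> norm v / 1" by (rule divide_left_mono) auto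
    then have "norm (v /\<^sub>R 2 ^ k) < r" using \<open>norm v < r\<close> nv by simp
    moreover have h: "(v /\<^sub>R 2 ^ k) /\<^sub>R 2 = v /\<^sub>R 2 ^ Suc k" by simp
    ultimately have "norm (f (v /\<^sub>R 2 ^ k)) \<le> q * (1 + c * (norm v / 2 ^ k)) * norm (f (v /\<^sub>R 2 ^ Suc k))"
      using step[of "v /\<^sub>R 2 ^ k"] unfolding nv h by blast
    also have "\<dots> \<le> q * exp (c * (norm v / 2 ^ k)) * norm (f (v /\<^sub>R 2 ^ Suc k))"
      using assms(2) exp_ge_add_one_self by (intro mult_right_mono mult_left_mono) auto
    finally have "exp (c * (\<Sum>j<k. norm v / 2 ^ j)) * (q ^ k * norm (f (v /\<^sub>R 2 ^ k)))
      \<le> exp (c * (\<Sum>j<k. norm v / 2 ^ j)) * (q ^ k * (q * exp (c * (norm v / 2 ^ k)) * norm (f (v /\<^sub>R 2 ^ Suc k))))"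
      using assms(2) by (intro mult_left_mono) auto
    also have "\<dots> = exp (c * (\<Sum>j<Suc k. norm v / 2 ^ j)) * (q ^ Suc k * norm (f (v /\<^sub>R 2 ^ Suc k)))"
      by (simp add: exp_add distrib_left mult_ac)
    finally show ?case using Suc by linarith
  qed simp
  have sum: "(\<Sum>j<k. norm v / 2 ^ j) \<le> 2 * norm v" for k
  proof -
    have "(\<Sum>j<k. norm v / 2 ^ j) = norm v * (\<Sum>j<k. (1/2) ^ j)"
      by (simp add: sum_distrib_left power_divide)
    also have "(\<Sum>j<k. (1/2::real) ^ j) = 2 - 2 * (1/2) ^ k"
      by (subst geometric_sum) (auto simp: field_simps)
    also have "norm v * (2 - 2 * (1/2) ^ k) \<le> norm v * 2" by (intro mult_left_mono) auto
    finally show ?thesis by simp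
  qed
  have "norm (f v) \<le> exp (c * (2 * norm v)) * (q ^ k * norm (f (v /\<^sub>R 2 ^ k)))" for k
    using assms(1,2) sum[of k]
    by (intro order_trans[OF *[of k]] mult_right_mono) (auto intro: mult_left_mono)
  moreover have "(\<lambda>k. exp (c * (2 * norm v)) * (q ^ k * norm (f (v /\<^sub>R 2 ^ k)))) \<longlonglongrightarrow> 0"
    using tendsto_mult_left[OF lim, of "exp (c * (2 * norm v))"] by simp
  ultimately have "norm (f v) \<le> 0"
    using LIMSEQ_le_const by blast
  then show ?thesis by simp
qed

text \<open>The function exp(-2Ct)|w|^2 has nonpositive derivative and starts at 0. The squared norm
  is used because the norm need not be differentiable at zeros of w.\<close>

lemma Gronwall_zero:
  fixes w :: "real \<Rightarrow> 'a::euclidean_space"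
  assumes "\<And>t. t \<in> {0..1} \<Longrightarrow> (w has_vector_derivative w' t) (at t within {0..1})"
    and "\<And>t. t \<in> {0..1} \<Longrightarrow> norm (w' t) \<le> C * norm (w t)"
    and "w 0 = 0" "t \<in> {0..1}"
  shows "w t = 0"
proof -
  define u where "u = (\<lambda>t. exp (- (2 * C * t)) * (w t \<bullet> w t))"
  have C: "w s \<bullet> w' s \<le> C * (w s \<bullet> w s)" if "s \<in> {0..1}" for s
  proof -
    have "w s \<bullet> w' s \<le> norm (w s) * norm (w' s)" by (rule norm_cauchy_schwarz)
    also have "\<dots> \<le> norm (w s) * (C * norm (w s))" using assms(2)[OF that] by (intro mult_left_mono) auto
    finally show ?thesis by (simp add: dot_square_norm power2_eq_square mult_ac)
  qed
  have der: "(u has_real_derivative exp (- (2 * C * s)) * (2 * (w s \<bullet> w' s) - 2 * C * (w s \<bullet> w s))) (at s within {0..1})"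
    if s: "s \<in> {0..1}" for s
  proof -
    have "(w has_derivative (\<lambda>h. h *\<^sub>R w' s)) (at s within {0..1})"
      using assms(1)[OF s] by (simp add: has_vector_derivative_def)
    from has_derivative_inner[OF this this]
    have i: "((\<lambda>s. w s \<bullet> w s) has_real_derivative 2 * (w s \<bullet> w' s)) (at s within {0..1})"
      by (rule has_derivative_imp_has_field_derivative) (simp add: inner_commute algebra_simps)
    have e: "((\<lambda>s. exp (- (2 * C * s))) has_real_derivative exp (- (2 * C * s)) * - (2 * C)) (at s within {0..1})"
      by (auto intro!: derivative_eq_intros)
    show ?thesis
      unfolding u_def by (rule DERIV_cong[OF DERIV_mult[OF e i]]) (simp add: algebra_simps)
  qed
  have "u t \<le> u 0"
  proof (rule DERIV_nonpos_imp_decreasing_open[where f = u and a = 0 and b = t])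
    show "0 \<le> t" using assms by auto
    show "continuous_on {0..t} u"
      by (rule continuous_on_subset[OF DERIV_continuous_on[OF der]]) (use assms in auto)
    fix s assume s: "0 < s" "s < t"
    then have s1: "s \<in> {0..1}" "at s within {0..1} = at s" using assms(4) by (auto simp: at_within_Icc_at)
    have "exp (- (2 * C * s)) * (2 * (w s \<bullet> w' s) - 2 * C * (w s \<bullet> w s)) \<le> 0"
      using C[OF s1(1)] by (intro mult_nonneg_nonpos) auto
    then show "\<exists>y. DERIV u s :> y \<and> y \<le> 0" using der[OF s1(1)] s1(2) by auto
  qed
  then have "exp (- (2 * C * t)) * (w t \<bullet> w t) \<le> 0" using assms(3) by (simp add: u_def)
  then have "w t \<bullet> w t \<le> 0" by (simp add: mult_le_0_iff)
  then show ?thesis by (metis inner_ge_zero inner_eq_zero_iff order_antisym)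
qed

section \<open>Linearization of a doubling map\<close>

text \<open>\<open>L\<close> is the limit of 2^k h^k with h the local inverse of s; h contracts, so
  its iterates exist on a fixed ball. The derivatives are products of the operators 2 h'(h^j x),
  which differ from the identity by geometrically decreasing amounts, so they converge uniformly and
  \<open>L\<close> is C^1.\<close>

lemma Koenigs_linearization:
  fixes s :: "'a::euclidean_space \<Rightarrow> 'a"
  assumes "\<rho> > 0" and sm: "smooth_on (ball 0 \<rho>) s" and "s 0 = 0"
    and s2: "\<And>v. blinfun_deriv s 0 v = 2 *\<^sub>R v"
  obtains r L L' where "0 < r" "r \<le> \<rho>"
    "\<And>x. x \<in> ball 0 r \<Longrightarrow> (L has_derivative blinfun_apply (L' x)) (at x)"
    "continuous_on (ball 0 r) L'" "L 0 = 0" "L' 0 = id_blinfun"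
    "\<And>x. x \<in> ball 0 r \<Longrightarrow> s x \<in> ball 0 r \<Longrightarrow> L (s x) = 2 *\<^sub>R L x"
proof -
  define S where "S = blinfun_deriv s"
  have smS: "smooth_on (ball 0 \<rho>) S" unfolding S_def by (rule smooth_on_blinfun_deriv[OF open_ball sm])
  have contS: "continuous_on (ball 0 \<rho>) S" by (rule smooth_on_imp_continuous_on[OF smS])
  have S0: "S 0 = 2 *\<^sub>R id_blinfun" by (rule blinfun_eqI) (simp add: S_def s2 blinfun.scaleR_left)
  have derS: "(s has_derivative blinfun_apply (S x)) (at x)" if "x \<in> ball 0 \<rho>" for x
    unfolding S_def by (rule smooth_on_has_derivative[OF sm that])
  have inv0: "(1/2) *\<^sub>R id_blinfun o\<^sub>L S 0 = id_blinfun"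
    by (rule blinfun_eqI) (simp add: S0 blinfun.scaleR_left)
  have z0: "0 \<in> ball 0 \<rho>" using \<open>\<rho> > 0\<close> by simp
  obtain U' V h h' where U': "open U'" "U' \<subseteq> ball 0 \<rho>" "0 \<in> U'" and V: "open V" "s 0 \<in> V"
    and hom: "homeomorphism U' V s h"
    and h': "\<And>y. y \<in> V \<Longrightarrow> (h has_derivative h' y) (at y)"
      "\<And>y. y \<in> V \<Longrightarrow> h' y = inv (blinfun_apply (S (h y)))"
      "\<And>y. y \<in> V \<Longrightarrow> bij (blinfun_apply (S (h y)))"
    using inverse_function_theorem[OF open_ball derS contS z0 inv0] by metis
  define H where "H = (\<lambda>y. Blinfun (h' y))"
  have H: "blinfun_apply (H y) = h' y" if "y \<in> V" for y
    using has_derivative_bounded_linear[OF h'(1)[OF that]] by (simp add: H_def bounded_linear_Blinfun_apply)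
  have SH: "S (h y) o\<^sub>L H y = id_blinfun" and HS: "H y o\<^sub>L S (h y) = id_blinfun" if "y \<in> V" for y
    using h'(2,3)[OF that] H[OF that]
    by (auto intro!: blinfun_eqI simp: bij_is_inj bij_is_surj surj_f_inv_f)
  have hs: "h (s x) = x" if "x \<in> U'" for x using hom that by (simp add: homeomorphism_def)
  have h0: "h 0 = 0" using hs[OF U'(3)] \<open>s 0 = 0\<close> by simp
  have V0: "0 \<in> V" using V \<open>s 0 = 0\<close> by simp
  obtain d where d: "d > 0" "ball (0::'a) d \<subseteq> ball 0 \<rho>"
    "\<And>x y. x \<in> ball 0 d \<Longrightarrow> y \<in> ball 0 d \<Longrightarrow>
      norm (S x - S y - blinfun_deriv S 0 (x - y)) \<le> 1 * norm (x - y)"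
    using smooth_on_strict_derivative[OF open_ball smS z0 zero_less_one] by metis
  define C where "C = norm (blinfun_deriv S 0) + 1"
  have C1: "C \<ge> 1" by (simp add: C_def)
  have lip: "norm (S x - S 0) \<le> C * norm x" if "norm x < d" for x
  proof -
    have "norm (S x - S 0) \<le> norm (S x - S 0 - blinfun_deriv S 0 x) + norm (blinfun_deriv S 0 x)"
      using norm_triangle_ineq[of "S x - S 0 - blinfun_deriv S 0 x" "blinfun_deriv S 0 x"] by simp
    then show ?thesis
      using d(3)[of x 0] that d(1) norm_blinfun[of "blinfun_deriv S 0" x] by (simp add: C_def algebra_simps)
  qed
  \<comment> \<open>With C \<delta> \<le> 1/2 the deviation \<open>T\<close> of the derivative of s
    from twice the identity has norm at most 1/2.\<close>
  define \<delta> where "\<delta> = min d (1 / (2 * C))"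
  have \<delta>: "\<delta> > 0" "\<delta> \<le> d" "C * \<delta> \<le> 1/2" using d(1) C1 by (auto simp: \<delta>_def min_def field_simps)
  have "isCont h 0" using has_derivative_continuous[OF h'(1)[OF V0]] .
  then obtain r1 where r1: "r1 > 0" "\<And>y. norm y < r1 \<Longrightarrow> norm (h y) < \<delta>"
    using \<delta>(1) h0 unfolding continuous_at_eps_delta by (auto simp: dist_norm)
  obtain r2 where r2: "r2 > 0" "ball 0 r2 \<subseteq> U' \<inter> V"
    using open_contains_ball[of "U' \<inter> V"] U' V V0 by blast
  define r where "r = min r1 r2"
  have r: "0 < r" "ball 0 r \<subseteq> U'" "ball 0 r \<subseteq> V" using r1 r2 by (auto simp: r_def)
  have "r \<le> \<rho>"
    using r U'(2) subset_trans[OF r(2) U'(2)] by (simp add: ball_subset_ball_iff)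
  define T where "T = (\<lambda>y. 2 *\<^sub>R id_blinfun - S (h y))"
  have T: "norm (T y) \<le> C * norm (h y)" "norm (T y) \<le> 1/2" if "y \<in> ball 0 r" for y
  proof -
    have "norm (h y) < \<delta>" using r1(2)[of y] that by (simp add: r_def)
    then show 1: "norm (T y) \<le> C * norm (h y)"
      using lip[of "h y"] \<delta> by (simp add: T_def S0[symmetric] norm_minus_commute)
    have "C * norm (h y) \<le> C * \<delta>" using C1 \<open>norm (h y) < \<delta>\<close> by (intro mult_left_mono) auto
    then show "norm (T y) \<le> 1/2" using 1 \<delta>(3) by linarith
  qed
  \<comment> \<open>Since S(h y) = 2 id - T, the relation S H = id reads 2 H = id + T H; it bounds H
    and shows that 2 H is close to the identity.\<close>
  have TH: "2 *\<^sub>R H y = id_blinfun + (T y o\<^sub>L H y)" if "y \<in> ball 0 r" for y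
  proof -
    have "y \<in> V" using that r by auto
    have "T y o\<^sub>L H y = 2 *\<^sub>R H y - (S (h y) o\<^sub>L H y)"
      by (rule blinfun_eqI) (simp add: T_def blinfun.diff_left blinfun.scaleR_left)
    then show ?thesis using SH[OF \<open>y \<in> V\<close>] by simp
  qed
  \<comment> \<open>From 2|H| \<le> 1 + |H|/2. This makes h a contraction with factor 2/3.\<close>
  have nH: "norm (H y) \<le> 2/3" if "y \<in> ball 0 r" for y
  proof -
    have "2 * norm (H y) = norm (2 *\<^sub>R H y)" by simp
    also have "\<dots> \<le> norm (id_blinfun :: 'a \<Rightarrow>\<^sub>L 'a) + norm (T y o\<^sub>L H y)" unfolding TH[OF that] by (rule norm_triangle_ineq)
    also have "\<dots> \<le> 1 + norm (T y) * norm (H y)" by (intro add_mono norm_blinfun_id_le norm_blinfun_compose)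
    also have "\<dots> \<le> 1 + 1/2 * norm (H y)" using T(2)[OF that] by (intro add_left_mono mult_right_mono) auto
    finally show ?thesis by simp
  qed
  have nh: "norm (h y) \<le> 2/3 * norm y" if "y \<in> ball 0 r" for y
  proof -
    have "norm (h y - h 0) \<le> 2/3 * norm (y - 0)"
    proof (rule differentiable_bound[OF convex_ball _ _ that])
      fix z :: 'a assume z: "z \<in> ball 0 r"
      then have "z \<in> V" using r by auto
      show "(h has_derivative blinfun_apply (H z)) (at z within ball 0 r)"
        using h'(1)[OF \<open>z \<in> V\<close>] H[OF \<open>z \<in> V\<close>] by (simp add: has_derivative_at_withinI)
      show "onorm (blinfun_apply (H z)) \<le> 2/3" using nH[OF z] by (simp add: norm_blinfun.rep_eq)
    qed (use r in simp)
    then show ?thesis using h0 by simp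
  qed
  have nHI: "norm (2 *\<^sub>R H y - id_blinfun) \<le> C * norm y" if "y \<in> ball 0 r" for y
  proof -
    have "norm (2 *\<^sub>R H y - id_blinfun) = norm (T y o\<^sub>L H y)" unfolding TH[OF that] by simp
    also have "\<dots> \<le> norm (T y) * norm (H y)" by (rule norm_blinfun_compose)
    also have "\<dots> \<le> (C * (2/3 * norm y)) * (2/3)"
      using T(1)[OF that] nh[OF that] nH[OF that] C1
      by (intro mult_mono order_trans[OF T(1)[OF that]]) auto
    also have "\<dots> \<le> C * norm y" using C1 by (simp add: mult_left_mono mult_right_mono)
    finally show ?thesis .
  qed
  \<comment> \<open>Continuity of the inverse operator comes from the resolvent identity H z - H y =
    H z (S(h y) - S(h z)) H y with H bounded.\<close>
  have contH: "continuous_on (ball 0 r) H"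
  proof (rule continuous_at_imp_continuous_on, rule ballI)
    fix y :: 'a assume y: "y \<in> ball 0 r"
    then have yV: "y \<in> V" using r by auto
    have hy: "h y \<in> ball 0 \<rho>" using hom yV U'(2) by (auto simp: homeomorphism_def)
    have "isCont S (h y)" using contS hy by (simp add: continuous_on_eq_continuous_at)
    then have "isCont (\<lambda>z. S (h z)) y"
      using continuous_at_compose[of y h S] has_derivative_continuous[OF h'(1)[OF yV]] by (simp add: o_def)
    then have "((\<lambda>z. norm (S (h y) - S (h z))) \<longlongrightarrow> 0) (at y)"
      by (simp add: isCont_def tendsto_norm_zero_iff LIM_zero_iff norm_minus_commute[of "S (h y)"])
    then have l: "((\<lambda>z. 2/3 * norm (S (h y) - S (h z)) * norm (H y)) \<longlongrightarrow> 0) (at y)"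
      by (intro tendsto_mult_left_zero tendsto_mult_right_zero)
    have "eventually (\<lambda>z. z \<in> ball 0 r) (at y)"
      using y by (intro eventually_at_in_open') auto
    then have "eventually (\<lambda>z. norm (H z - H y) \<le> 2/3 * norm (S (h y) - S (h z)) * norm (H y)) (at y)"
    proof eventually_elim
      case (elim z)
      then have zV: "z \<in> V" using r by auto
      have "H z - H y = (H z o\<^sub>L (S (h y) - S (h z))) o\<^sub>L H y"
      proof (rule blinfun_eqI)
        fix v
        have "S (h y) (H y v) = v" using SH[OF yV] by (metis blinfun_apply_blinfun_compose blinfun_apply_id_blinfun)
        moreover have "H z (S (h z) w) = w" for w using HS[OF zV] by (metis blinfun_apply_blinfun_compose blinfun_apply_id_blinfun)
        ultimately show "(H z - H y) v = ((H z o\<^sub>L (S (h y) - S (h z))) o\<^sub>L H y) v"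
          by (simp add: blinfun.diff_left blinfun.diff_right)
      qed
      then have "norm (H z - H y) \<le> norm (H z o\<^sub>L (S (h y) - S (h z))) * norm (H y)"
        by (simp add: norm_blinfun_compose)
      also have "\<dots> \<le> (norm (H z) * norm (S (h y) - S (h z))) * norm (H y)"
        by (intro mult_right_mono norm_blinfun_compose) auto
      also have "\<dots> \<le> 2/3 * norm (S (h y) - S (h z)) * norm (H y)"
        using nH[OF elim] by (intro mult_right_mono) auto
      finally show ?case .
    qed
    from Lim_null_comparison[OF this l]
    show "isCont H y" by (simp add: isCont_def LIM_zero_iff)
  qed
  have hk: "norm ((h ^^ k) x) \<le> (2/3) ^ k * norm x" "(h ^^ k) x \<in> ball 0 r" if "x \<in> ball 0 r" for k x
  proof -
    have "norm ((h ^^ k) x) \<le> (2/3) ^ k * norm x \<and> (h ^^ k) x \<in> ball 0 r"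
    proof (induction k)
      case (Suc k)
      then have "norm (h ((h ^^ k) x)) \<le> 2/3 * norm ((h ^^ k) x)" using nh by blast
      moreover have "2/3 * norm ((h ^^ k) x) \<le> 2/3 * ((2/3) ^ k * norm x)" using Suc by (intro mult_left_mono) auto
      moreover have "2/3 * norm ((h ^^ k) x) \<le> norm ((h ^^ k) x)" by simp
      moreover have "norm ((h ^^ k) x) < r" using Suc by simp
      ultimately have "norm (h ((h ^^ k) x)) \<le> (2/3) ^ Suc k * norm x" "norm (h ((h ^^ k) x)) < r"
        by (simp_all only: power_Suc mult.assoc)
      then show ?case by simp
    qed (use that in auto)
    then show "norm ((h ^^ k) x) \<le> (2/3) ^ k * norm x" "(h ^^ k) x \<in> ball 0 r" by auto
  qed
  \<comment> \<open>\<open>A k x\<close> is the chain-rule product for the derivative of 2^k h^k at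
    x.\<close>
  define A where "A = rec_nat (\<lambda>x. id_blinfun) (\<lambda>k Ak x. (2 *\<^sub>R H ((h ^^ k) x)) o\<^sub>L Ak x)"
  have A_simps: "A 0 x = id_blinfun" "A (Suc k) x = (2 *\<^sub>R H ((h ^^ k) x)) o\<^sub>L A k x" for k x
    by (simp_all add: A_def)
  define Lk where "Lk = (\<lambda>k x. 2 ^ k *\<^sub>R (h ^^ k) x)"
  have derLk: "(Lk k has_derivative blinfun_apply (A k x)) (at x)" if "x \<in> ball 0 r" for k x
  proof (induction k)
    case (Suc k)
    have hkV: "(h ^^ k) x \<in> V" using hk(2)[OF that] r by auto
    have 1: "((h ^^ k) has_derivative (\<lambda>v. (1 / 2 ^ k) *\<^sub>R A k x v)) (at x)"
      using has_derivative_scaleR_right[OF Suc, of "1 / 2 ^ k"] by (simp add: Lk_def)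
    have "((\<lambda>x. h ((h ^^ k) x)) has_derivative (\<lambda>v. H ((h ^^ k) x) ((1 / 2 ^ k) *\<^sub>R A k x v))) (at x)"
      using has_derivative_compose[OF 1 h'(1)[OF hkV]] H[OF hkV] by simp
    from has_derivative_scaleR_right[OF this, of "2 ^ Suc k"]
    show ?case by (simp add: Lk_def A_simps blinfun.scaleR_left blinfun.scaleR_right o_def)
  qed (simp add: Lk_def A_simps)
  define M where "M = exp (C * r * 3)"
  have nA: "norm (A k x) \<le> M" if x: "x \<in> ball 0 r" for k x
  proof -
    \<comment> \<open>3 - 3 (2/3)^k is the sum of (2/3)^j over j < k.\<close>
    have "norm (A k x) \<le> exp (C * r * (3 - 3 * (2/3) ^ k))"
    proof (induction k)
      case 0 then show ?case using norm_blinfun_id_le by (simp add: A_simps)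
    next
      case (Suc k)
      have "norm (2 *\<^sub>R H ((h ^^ k) x)) \<le> norm (id_blinfun :: 'a \<Rightarrow>\<^sub>L 'a) + norm (2 *\<^sub>R H ((h ^^ k) x) - id_blinfun)"
        using norm_triangle_ineq[of "id_blinfun" "2 *\<^sub>R H ((h ^^ k) x) - id_blinfun"] by simp
      also have "\<dots> \<le> 1 + C * norm ((h ^^ k) x)" by (intro add_mono norm_blinfun_id_le nHI hk x)
      also have "\<dots> \<le> 1 + C * ((2/3) ^ k * r)"
        using hk(1)[OF x, of k] x C1 by (intro add_left_mono mult_left_mono order_trans[OF hk(1)[OF x]]) auto
      also have "\<dots> \<le> exp (C * ((2/3) ^ k * r))" by (rule exp_ge_add_one_self)
      finally have "norm (A (Suc k) x) \<le> exp (C * ((2/3) ^ k * r)) * exp (C * r * (3 - 3 * (2/3) ^ k))"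
        unfolding A_simps using Suc by (intro order_trans[OF norm_blinfun_compose] mult_mono) auto
      also have "\<dots> = exp (C * r * (3 - 3 * (2/3) ^ Suc k))"
        by (simp add: exp_add[symmetric] algebra_simps)
      finally show ?case .
    qed
    also have "\<dots> \<le> M" using C1 r by (simp add: M_def algebra_simps)
    finally show ?thesis .
  qed
  have dA: "norm (A (Suc k) x - A k x) \<le> C * r * M * (2/3) ^ k" if x: "x \<in> ball 0 r" for k x
  proof -
    have "A (Suc k) x - A k x = (2 *\<^sub>R H ((h ^^ k) x) - id_blinfun) o\<^sub>L A k x"
      by (rule blinfun_eqI) (simp add: A_simps blinfun.diff_left blinfun.scaleR_left)
    then have "norm (A (Suc k) x - A k x) \<le> norm (2 *\<^sub>R H ((h ^^ k) x) - id_blinfun) * norm (A k x)"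
      by (simp add: norm_blinfun_compose)
    also have "\<dots> \<le> (C * ((2/3) ^ k * r)) * M"
    proof (rule mult_mono)
      have "C * norm ((h ^^ k) x) \<le> C * ((2/3) ^ k * r)"
        using x C1 by (intro mult_left_mono order_trans[OF hk(1)[OF x]]) auto
      then show "norm (2 *\<^sub>R H ((h ^^ k) x) - id_blinfun) \<le> C * ((2/3) ^ k * r)"
        using nHI[OF hk(2)[OF x]] order_trans by blast
    qed (use nA[OF x] C1 r in auto)
    finally show ?thesis by (simp add: mult_ac)
  qed
  \<comment> \<open>The limit of \<open>A\<close> as a telescoping series, so that the Weierstrass
    test applies.\<close>
  define L' where "L' = (\<lambda>x. id_blinfun + (\<Sum>i. A (Suc i) x - A i x))"
  have unif: "uniform_limit (ball 0 r) A L' sequentially"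
  proof -
    have "uniform_limit (ball 0 r) (\<lambda>n x. \<Sum>i<n. A (Suc i) x - A i x) (\<lambda>x. \<Sum>i. A (Suc i) x - A i x) sequentially"
      by (rule Weierstrass_m_test[where M = "\<lambda>k. C * r * M * (2/3) ^ k"])
        (use dA in \<open>auto intro!: summable_mult summable_geometric\<close>)
    moreover have "(\<Sum>i<n. A (Suc i) x - A i x) = A n x - id_blinfun" for n x
      by (simp add: sum_lessThan_telescope[of "\<lambda>i. A i x"] A_simps(1))
    ultimately have "uniform_limit (ball 0 r) (\<lambda>n x. A n x - id_blinfun) (\<lambda>x. \<Sum>i. A (Suc i) x - A i x) sequentially"
      by simp
    from uniform_limit_add[OF uniform_limit_const this, of "\<lambda>_. id_blinfun"]
    show ?thesis by (simp add: L'_def)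
  qed
  have contA: "continuous_on (ball 0 r) (A k)" for k
  proof (induction k)
    case 0 then show ?case by (simp add: A_def)
  next
    case (Suc k)
    have "continuous_on (ball 0 r) (h ^^ k)"
    proof (rule continuous_at_imp_continuous_on, rule ballI)
      fix x :: 'a assume "x \<in> ball 0 r"
      from has_derivative_continuous[OF derLk[OF this, of k]]
      have "isCont (\<lambda>x. (1 / 2 ^ k) *\<^sub>R Lk k x) x" by (intro continuous_intros)
      then show "isCont (h ^^ k) x" by (simp add: Lk_def)
    qed
    then have "continuous_on (ball 0 r) (\<lambda>x. H ((h ^^ k) x))"
      using hk(2) by (intro continuous_on_compose2[OF contH]) auto
    then show ?case unfolding A_simps(2)[abs_def]
      by (intro bounded_bilinear.continuous_on[OF bounded_bilinear_blinfun_compose] continuous_intros Suc)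
  qed
  have contL': "continuous_on (ball 0 r) L'"
    by (rule uniform_limit_theorem[OF always_eventually unif]) (use contA in auto)
  have A0: "A k 0 = id_blinfun" for k
  proof (induction k)
    case (Suc k)
    have "(h ^^ k) 0 = 0" using hk(1)[of 0 k] r by simp
    moreover have "2 *\<^sub>R H 0 = id_blinfun" using nHI[of 0] r by simp
    ultimately show ?case using Suc by (auto simp: A_simps intro!: blinfun_eqI)
  qed (simp add: A_simps)
  have L'0: "L' 0 = id_blinfun" by (simp add: L'_def A0)
  have "\<exists>g. \<forall>x\<in>ball 0 r. (\<lambda>n. Lk n x) \<longlonglongrightarrow> g x \<and> (g has_derivative blinfun_apply (L' x)) (at x within ball 0 r)"
  proof (rule has_derivative_sequence[OF convex_ball])
    show "(Lk n has_derivative blinfun_apply (A n x)) (at x within ball 0 r)" if "x \<in> ball 0 r" for n x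
      using derLk[OF that] by (rule has_derivative_at_withinI)
    show "\<forall>\<^sub>F n in sequentially. \<forall>x\<in>ball 0 r. \<forall>v. norm (A n x v - L' x v) \<le> e * norm v" if "e > 0" for e
      using uniform_limitD[OF unif that]
    proof eventually_elim
      case (elim n)
      show ?case
      proof (intro ballI allI)
        fix x v :: 'a assume "x \<in> ball 0 r"
        then have "norm (A n x - L' x) \<le> e" using elim by (auto simp: dist_norm less_imp_le)
        then show "norm (A n x v - L' x v) \<le> e * norm v"
          using norm_blinfun[of "A n x - L' x" v] mult_right_mono[of "norm (A n x - L' x)" e "norm v"]
          by (simp add: blinfun.diff_left)
      qed
    qed
    show "0 \<in> ball 0 r" using r by simp
    have "Lk n 0 = 0" for n using hk(1)[of 0 n] r by (simp add: Lk_def)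
    then show "(\<lambda>n. Lk n 0) \<longlonglongrightarrow> 0" by simp
  qed
  then obtain L where L: "\<And>x. x \<in> ball 0 r \<Longrightarrow> (\<lambda>n. Lk n x) \<longlonglongrightarrow> L x"
    "\<And>x. x \<in> ball 0 r \<Longrightarrow> (L has_derivative blinfun_apply (L' x)) (at x within ball 0 r)" by blast
  show thesis
  proof (rule that[OF r(1) \<open>r \<le> \<rho>\<close> _ contL' _ L'0])
    show "(L has_derivative blinfun_apply (L' x)) (at x)" if "x \<in> ball 0 r" for x
      using L(2)[OF that] that by (simp add: at_within_open[OF _ open_ball])
    have "Lk n 0 = 0" for n using hk(1)[of 0 n] r by (simp add: Lk_def)
    then show "L 0 = 0" using L(1)[of 0] r by (simp add: LIMSEQ_const_iff)
    show "L (s x) = 2 *\<^sub>R L x" if x: "x \<in> ball 0 r" "s x \<in> ball 0 r" for x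
    proof -
      \<comment> \<open>One iterate of h cancels against s: the approximants shift by one index and
        a factor 2 comes out.\<close>
      have "h (s x) = x" using hs x(1) r by auto
      then have "Lk (Suc n) (s x) = 2 *\<^sub>R Lk n x" for n
        by (simp add: Lk_def funpow_Suc_right del: funpow.simps)
      then have "(\<lambda>n. 2 *\<^sub>R Lk n x) \<longlonglongrightarrow> L (s x)"
        using LIMSEQ_Suc[OF L(1)[OF x(2)]] by simp
      moreover have "(\<lambda>n. 2 *\<^sub>R Lk n x) \<longlonglongrightarrow> 2 *\<^sub>R L x"
        by (intro tendsto_intros L x)
      ultimately show ?thesis using LIMSEQ_unique by blast
    qed
  qed
qed

section \<open>Local Lie groups\<close>

text \<open>For differentiating identities that hold only near a point, such as associativity in a
  local group.\<close>

lemma has_derivative_eq_eventually: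
  fixes f :: "'a::real_normed_vector \<Rightarrow> 'b::real_normed_vector"
  assumes "(f has_derivative f') (at x)" "(g has_derivative g') (at x)"
    "eventually (\<lambda>z. f z = g z) (nhds x)"
  shows "f' = g'"
proof -
  obtain S where S: "open S" "x \<in> S" "\<And>z. z \<in> S \<Longrightarrow> f z = g z"
    using assms(3) unfolding eventually_nhds by blast
  from has_derivative_transform_within_open[OF assms(1) S] assms(2) show ?thesis
    by (rule has_derivative_unique)
qed

lemma blinfun_compose_eqD: "F o\<^sub>L G = H \<Longrightarrow> F (G v) = H v"
  by (metis blinfun_apply_blinfun_compose)

lemma blinfun_inverse_commute:
  fixes A B :: "'a::euclidean_space \<Rightarrow>\<^sub>L 'a"
  assumes "A o\<^sub>L B = id_blinfun"
  shows "B o\<^sub>L A = id_blinfun"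
proof -
  have AB: "A (B v) = v" for v using assms by (metis blinfun_apply_blinfun_compose blinfun_apply_id_blinfun)
  have "linear (blinfun_apply B)" by (simp add: blinfun.bounded_linear_right bounded_linear.linear)
  moreover have "inj (blinfun_apply B)" using AB by (metis injI)
  ultimately have "surj (blinfun_apply B)" by (rule linear_inj_imp_surj)
  show ?thesis
  proof (rule blinfun_eqI)
    fix v
    obtain w where "v = B w" using \<open>surj (blinfun_apply B)\<close> by blast
    then show "(B o\<^sub>L A) v = id_blinfun v" by (simp add: AB)
  qed
qed

text \<open>The sequence is |v| times the difference quotient at v/2^k; it supplies the limit
  required by \<open>halving_vanish\<close> for q = 2.\<close>

lemma has_derivative_dyadic_tendsto_0:
  fixes f :: "'a::real_normed_vector \<Rightarrow> 'b::real_normed_vector"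
  assumes "(f has_derivative (\<lambda>_. 0)) (at 0)" "f 0 = 0"
  shows "(\<lambda>k. 2 ^ k * norm (f (v /\<^sub>R 2 ^ k))) \<longlonglongrightarrow> 0"
proof (cases "v = 0")
  case False
  have "((\<lambda>h. norm (f h) / norm h) \<longlongrightarrow> 0) (at 0)"
    using assms by (simp add: has_derivative_at)
  moreover have "filterlim (\<lambda>k. v /\<^sub>R 2 ^ k) (at 0) sequentially"
  proof -
    have "(\<lambda>k. (1/2) ^ k *\<^sub>R v) \<longlonglongrightarrow> 0 *\<^sub>R v"
      by (intro tendsto_intros LIMSEQ_power_zero) auto
    moreover have "(1/2) ^ k *\<^sub>R v = v /\<^sub>R 2 ^ k" for k
      by (simp add: power_one_over inverse_eq_divide)
    ultimately have "(\<lambda>k. v /\<^sub>R 2 ^ k) \<longlonglongrightarrow> 0" by simp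
    then show ?thesis using False by (simp add: filterlim_at)
  qed
  ultimately have "(\<lambda>k. norm (f (v /\<^sub>R 2 ^ k)) / norm (v /\<^sub>R 2 ^ k)) \<longlonglongrightarrow> 0"
    by (rule filterlim_compose)
  from tendsto_mult_left[OF this, of "norm v"]
  have "(\<lambda>k. norm v * (norm (f (v /\<^sub>R 2 ^ k)) / norm (v /\<^sub>R 2 ^ k))) \<longlonglongrightarrow> 0"
    by simp
  moreover have "norm v * (norm (f (v /\<^sub>R 2 ^ k)) / norm (v /\<^sub>R 2 ^ k)) = 2 ^ k * norm (f (v /\<^sub>R 2 ^ k))" for k
  proof -
    have "norm (v /\<^sub>R 2 ^ k) = norm v / 2 ^ k" by (simp add: divide_inverse mult.commute)
    then show ?thesis using False by simp
  qed
  ultimately show ?thesis by simp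
qed (use assms in simp)

text \<open>Two radii: on the ball of radius \<open>\<sigma>\<close> the operations are smooth, and
  from the smaller ball of radius \<open>\<rho>\<close> products and inverses stay in it.
  Associativity is required where both inner products stay in the larger ball, which a chart at the
  identity provides.\<close>

locale local_group =
  fixes m :: "'a::euclidean_space \<Rightarrow> 'a \<Rightarrow> 'a" and i :: "'a \<Rightarrow> 'a" and \<rho> \<sigma> :: real
  assumes rho_pos: "0 < \<rho>" and rho_le: "\<rho> \<le> \<sigma>"
    and smooth_m: "smooth_on (ball 0 \<sigma> \<times> ball 0 \<sigma>) (\<lambda>p. m (fst p) (snd p))"
    and smooth_i: "smooth_on (ball 0 \<sigma>) i"
    and m_0_left: "x \<in> ball 0 \<sigma> \<Longrightarrow> m 0 x = x"
    and m_0_right: "x \<in> ball 0 \<sigma> \<Longrightarrow> m x 0 = x"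
    and m_i_left: "x \<in> ball 0 \<rho> \<Longrightarrow> m (i x) x = 0"
    and m_closed: "x \<in> ball 0 \<rho> \<Longrightarrow> y \<in> ball 0 \<rho> \<Longrightarrow> m x y \<in> ball 0 \<sigma>"
    and i_closed: "x \<in> ball 0 \<rho> \<Longrightarrow> i x \<in> ball 0 \<sigma>"
    and m_assoc: "x \<in> ball 0 \<sigma> \<Longrightarrow> y \<in> ball 0 \<sigma> \<Longrightarrow> z \<in> ball 0 \<sigma> \<Longrightarrow> m x y \<in> ball 0 \<sigma> \<Longrightarrow>
      m y z \<in> ball 0 \<sigma> \<Longrightarrow> m (m x y) z = m x (m y z)"
begin

lemma sigma_pos: "0 < \<sigma>" using rho_pos rho_le by linarith

lemma zero_in: "0 \<in> ball (0::'a) \<sigma>" "0 \<in> ball (0::'a) \<rho>" using sigma_pos rho_pos by auto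

lemma rho_sigma: "x \<in> ball 0 \<rho> \<Longrightarrow> x \<in> ball 0 \<sigma>" using rho_le by auto

lemma i_0: "i 0 = 0"
  using m_i_left[of 0] m_0_right[of "i 0"] i_closed[of 0] zero_in by simp

section \<open>Translations and the adjoint action in a local group\<close>

definition dm :: "'a \<Rightarrow> 'a \<Rightarrow> ('a \<times> 'a) \<Rightarrow>\<^sub>L 'a" where
  "dm x y = blinfun_deriv (\<lambda>p. m (fst p) (snd p)) (x, y)"

definition inl :: "'a \<Rightarrow>\<^sub>L ('a \<times> 'a)" where "inl = Blinfun (\<lambda>h. (h, 0))"
definition inr :: "'a \<Rightarrow>\<^sub>L ('a \<times> 'a)" where "inr = Blinfun (\<lambda>h. (0, h))"

lemma inl_apply [simp]: "inl h = (h, 0)" and inr_apply [simp]: "inr h = (0, h)"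
  unfolding inl_def inr_def
  by (simp_all add: bounded_linear_Blinfun_apply bounded_linear_Pair bounded_linear_ident bounded_linear_zero)

definition D1 :: "'a \<Rightarrow> 'a \<Rightarrow> 'a \<Rightarrow>\<^sub>L 'a" where "D1 x y = dm x y o\<^sub>L inl"
definition D2 :: "'a \<Rightarrow> 'a \<Rightarrow> 'a \<Rightarrow>\<^sub>L 'a" where "D2 x y = dm x y o\<^sub>L inr"
text \<open>\<open>J y\<close> and \<open>K y\<close> are the derivatives at the identity of left
  and right translation by y, so \<open>J\<close> is the left-invariant frame; \<open>Ji y\<close>
  is the derivative at y of left translation by the inverse of y, which inverts
  \<open>J y\<close>.\<close>

definition J :: "'a \<Rightarrow> 'a \<Rightarrow>\<^sub>L 'a" where "J y = D2 y 0"
definition K :: "'a \<Rightarrow> 'a \<Rightarrow>\<^sub>L 'a" where "K y = D1 0 y"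
definition Ji :: "'a \<Rightarrow> 'a \<Rightarrow>\<^sub>L 'a" where "Ji y = D2 (i y) y"
text \<open>In terms of the group, \<open>A y\<close> is the adjoint action of the inverse of \<open>y\<close>.\<close>
definition A :: "'a \<Rightarrow> 'a \<Rightarrow>\<^sub>L 'a" where "A y = Ji y o\<^sub>L K y"
text \<open>The commutator at 0 of the left-invariant fields with values v and w: the second-order
  parts cancel and the derivative of the frame remains.\<close>

definition br :: "'a \<Rightarrow> 'a \<Rightarrow> 'a" where "br v w = blinfun_deriv J 0 v w - blinfun_deriv J 0 w v"

lemma open_sq: "open (ball (0::'a) \<sigma> \<times> ball (0::'a) \<sigma>)" by (simp add: open_Times)

lemma m_has_derivative:
  assumes "(f has_derivative f') (at z within T)" "(g has_derivative g') (at z within T)"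
    "f z \<in> ball 0 \<sigma>" "g z \<in> ball 0 \<sigma>"
  shows "((\<lambda>z. m (f z) (g z)) has_derivative (\<lambda>h. D1 (f z) (g z) (f' h) + D2 (f z) (g z) (g' h))) (at z within T)"
proof -
  have "((\<lambda>p. m (fst p) (snd p)) has_derivative blinfun_apply (dm (f z) (g z))) (at (f z, g z))"
    unfolding dm_def by (rule smooth_on_has_derivative[OF smooth_m]) (use assms in auto)
  from has_derivative_compose[OF has_derivative_Pair[OF assms(1,2)] this]
  have "((\<lambda>z. m (f z) (g z)) has_derivative (\<lambda>h. dm (f z) (g z) (f' h, g' h))) (at z within T)" by simp
  moreover have "dm (f z) (g z) (f' h, g' h) = D1 (f z) (g z) (f' h) + D2 (f z) (g z) (g' h)" for h
    by (simp add: D1_def D2_def blinfun.add_right[symmetric])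
  ultimately show ?thesis by simp
qed

lemma m_left_has_derivative:
  assumes "x \<in> ball 0 \<sigma>" "y \<in> ball 0 \<sigma>"
  shows "((\<lambda>z. m z y) has_derivative blinfun_apply (D1 x y)) (at x)"
  using m_has_derivative[OF has_derivative_ident has_derivative_const, of x y UNIV] assms
  by (simp add: blinfun.zero_right)

lemma m_right_has_derivative:
  assumes "x \<in> ball 0 \<sigma>" "y \<in> ball 0 \<sigma>"
  shows "((\<lambda>z. m x z) has_derivative blinfun_apply (D2 x y)) (at y)"
  using m_has_derivative[OF has_derivative_const has_derivative_ident, of x y UNIV] assms
  by (simp add: blinfun.zero_right)

lemma eventually_ball: "isCont f x \<Longrightarrow> f x \<in> ball 0 s \<Longrightarrow> eventually (\<lambda>z. f z \<in> ball 0 s) (nhds x)"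
  unfolding isCont_def tendsto_at_iff_tendsto_nhds by (rule topological_tendstoD[OF _ open_ball])

lemma eventually_m_left: "x \<in> ball 0 \<sigma> \<Longrightarrow> y \<in> ball 0 \<sigma> \<Longrightarrow> m x y \<in> ball 0 s \<Longrightarrow> eventually (\<lambda>z. m z y \<in> ball 0 s) (nhds x)"
  by (rule eventually_ball[OF has_derivative_continuous[OF m_left_has_derivative]])

lemma eventually_m_right: "x \<in> ball 0 \<sigma> \<Longrightarrow> y \<in> ball 0 \<sigma> \<Longrightarrow> m x y \<in> ball 0 s \<Longrightarrow> eventually (\<lambda>z. m x z \<in> ball 0 s) (nhds y)"
  by (rule eventually_ball[OF has_derivative_continuous[OF m_right_has_derivative]])

lemma eventually_in: "x \<in> ball 0 s \<Longrightarrow> eventually (\<lambda>z. z \<in> ball (0::'a) s) (nhds x)"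
  by (rule eventually_nhds_in_open) auto

lemma D_00: "D1 0 0 = id_blinfun" "D2 0 0 = id_blinfun"
proof -
  have "eventually (\<lambda>z. m z 0 = z) (nhds 0)" "eventually (\<lambda>z. m 0 z = z) (nhds 0)"
    using eventually_in[OF zero_in(1)] by (auto elim!: eventually_mono simp: m_0_left m_0_right)
  from has_derivative_eq_eventually[OF m_left_has_derivative has_derivative_ident this(1)]
    has_derivative_eq_eventually[OF m_right_has_derivative has_derivative_ident this(2)] zero_in
  show "D1 0 0 = id_blinfun" "D2 0 0 = id_blinfun" by (auto intro!: blinfun_eqI simp: fun_eq_iff)
qed

lemma J_0: "J 0 = id_blinfun" and K_0: "K 0 = id_blinfun"
  by (simp_all add: J_def K_def D_00)

text \<open>The associative law differentiated at 0 in its last argument; \<open>D1_K\<close> and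
  \<open>D1_J\<close> come in the same way from the first and the middle one.\<close>

lemma D2_J:
  assumes "x \<in> ball 0 \<sigma>" "y \<in> ball 0 \<sigma>" "m x y \<in> ball 0 \<sigma>"
  shows "D2 x y o\<^sub>L J y = J (m x y)"
proof -
  have y0: "m y 0 = y" by (rule m_0_right[OF assms(2)])
  have "eventually (\<lambda>z. m (m x y) z = m x (m y z)) (nhds 0)"
    using eventually_in[OF zero_in(1)] eventually_m_right[OF assms(2) zero_in(1), unfolded y0, OF assms(2)]
    by eventually_elim (use assms in \<open>auto intro: m_assoc\<close>)
  from has_derivative_eq_eventually[OF m_right_has_derivative[OF assms(3) zero_in(1)]
      m_has_derivative[OF has_derivative_const m_right_has_derivative[OF assms(2) zero_in(1)]] this]
  show ?thesis using assms y0 by (auto intro!: blinfun_eqI simp: J_def fun_eq_iff blinfun.zero_right)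
qed

lemma D1_K:
  assumes "x \<in> ball 0 \<sigma>" "y \<in> ball 0 \<sigma>" "m x y \<in> ball 0 \<sigma>"
  shows "D1 x y o\<^sub>L K x = K (m x y)"
proof -
  have x0: "m 0 x = x" by (rule m_0_left[OF assms(1)])
  have "eventually (\<lambda>z. m z (m x y) = m (m z x) y) (nhds 0)"
    using eventually_in[OF zero_in(1)] eventually_m_left[OF zero_in(1) assms(1), unfolded x0, OF assms(1)]
    by eventually_elim (use assms in \<open>auto intro: m_assoc[symmetric]\<close>)
  from has_derivative_eq_eventually[OF m_left_has_derivative[OF zero_in(1) assms(3)]
      m_has_derivative[OF m_left_has_derivative[OF zero_in(1) assms(1)] has_derivative_const] this]
  show ?thesis using assms x0 by (auto intro!: blinfun_eqI simp: K_def fun_eq_iff blinfun.zero_right)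
qed

lemma D1_J:
  assumes "x \<in> ball 0 \<sigma>" "y \<in> ball 0 \<sigma>"
  shows "D1 x y o\<^sub>L J x = D2 x y o\<^sub>L K y"
proof -
  have 0: "m x 0 = x" "m 0 y = y" using assms by (auto simp: m_0_left m_0_right)
  have "eventually (\<lambda>z. m (m x z) y = m x (m z y)) (nhds 0)"
    using eventually_in[OF zero_in(1)] eventually_m_left[OF zero_in(1) assms(2), unfolded 0, OF assms(2)]
      eventually_m_right[OF assms(1) zero_in(1), unfolded 0, OF assms(1)]
    by eventually_elim (use assms in \<open>auto intro: m_assoc\<close>)
  from has_derivative_eq_eventually[OF m_has_derivative[OF m_right_has_derivative[OF assms(1) zero_in(1)] has_derivative_const]
      m_has_derivative[OF has_derivative_const m_left_has_derivative[OF zero_in(1) assms(2)]] this]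
  show ?thesis using assms 0 by (auto intro!: blinfun_eqI simp: J_def K_def fun_eq_iff blinfun.zero_right)
qed

lemma Ji_J: "y \<in> ball 0 \<rho> \<Longrightarrow> Ji y o\<^sub>L J y = id_blinfun"
  using D2_J[of "i y" y] m_i_left[of y] i_closed[of y] rho_sigma[of y] zero_in J_0 by (simp add: Ji_def)

lemma J_Ji: "y \<in> ball 0 \<rho> \<Longrightarrow> J y o\<^sub>L Ji y = id_blinfun"
  by (rule blinfun_inverse_commute[OF Ji_J])

lemma J_A: "y \<in> ball 0 \<rho> \<Longrightarrow> J y (A y v) = K y v"
  using blinfun_compose_eqD[OF J_Ji[of y]] by (simp add: A_def)

lemma A_0: "A 0 = id_blinfun"
  by (rule blinfun_eqI) (simp add: A_def Ji_def i_0 D_00 K_0)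

text \<open>The order is reversed because \<open>A y\<close> is the adjoint action of an inverse.
  The chain moves the right-translation frame past x and then past y, each time writing K = J
  A.\<close>

lemma A_mult:
  assumes "x \<in> ball 0 \<rho>" "y \<in> ball 0 \<rho>" "m x y \<in> ball 0 \<rho>"
  shows "A (m x y) = A y o\<^sub>L A x"
proof (rule blinfun_eqI)
  fix v
  have s: "x \<in> ball 0 \<sigma>" "y \<in> ball 0 \<sigma>" "m x y \<in> ball 0 \<sigma>" using assms rho_le by auto
  have "K (m x y) v = D1 x y (J x (A x v))"
    using blinfun_compose_eqD[OF D1_K[OF s]] by (simp add: J_A[OF assms(1)])
  also have "\<dots> = D2 x y (J y (A y (A x v)))"
    using arg_cong[OF D1_J[OF s(1,2)], of "\<lambda>F. blinfun_apply F (A x v)"] by (simp add: J_A[OF assms(2)])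
  also have "\<dots> = J (m x y) (A y (A x v))"
    by (rule blinfun_compose_eqD[OF D2_J[OF s]])
  finally show "A (m x y) v = (A y o\<^sub>L A x) v"
    using blinfun_compose_eqD[OF Ji_J[OF assms(3)]] by (simp add: A_def)
qed

lemma smooth_dm: "smooth_on (ball 0 \<sigma> \<times> ball 0 \<sigma>) (\<lambda>p. dm (fst p) (snd p))"
  using smooth_on_blinfun_deriv[OF open_sq smooth_m] by (simp add: dm_def)

lemma smooth_J: "smooth_on (ball 0 \<sigma>) J"
proof -
  have "smooth_on (ball 0 \<sigma>) (\<lambda>y::'a. (y, 0::'a))"
    by (intro smooth_on_Pair smooth_on_ident smooth_on_const open_ball)
  from smooth_on_compose[OF open_ball open_sq smooth_dm this]
  have "smooth_on (ball 0 \<sigma>) (\<lambda>y. dm y 0)"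
    using sigma_pos by (simp add: image_subset_iff)
  then show ?thesis unfolding J_def D2_def by (intro smooth_on_blinfun_compose smooth_on_const open_ball)
qed

lemma smooth_K: "smooth_on (ball 0 \<sigma>) K"
proof -
  have "smooth_on (ball 0 \<sigma>) (\<lambda>y::'a. (0::'a, y))"
    by (intro smooth_on_Pair smooth_on_ident smooth_on_const open_ball)
  from smooth_on_compose[OF open_ball open_sq smooth_dm this]
  have "smooth_on (ball 0 \<sigma>) (\<lambda>y. dm 0 y)"
    using sigma_pos by (simp add: image_subset_iff)
  then show ?thesis unfolding K_def D1_def by (intro smooth_on_blinfun_compose smooth_on_const open_ball)
qed

lemma smooth_Ji: "smooth_on (ball 0 \<rho>) Ji"
proof -
  have "smooth_on (ball 0 \<rho>) (\<lambda>y. (i y, y))"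
    using smooth_on_subset[OF smooth_i subset_ball[OF rho_le]]
    by (intro smooth_on_Pair smooth_on_ident open_ball)
  from smooth_on_compose[OF open_ball open_sq smooth_dm this]
  have "smooth_on (ball 0 \<rho>) (\<lambda>y. dm (i y) y)"
    using i_closed rho_le by (auto simp add: image_subset_iff)
  then show ?thesis unfolding Ji_def D2_def by (intro smooth_on_blinfun_compose smooth_on_const open_ball)
qed

lemma smooth_A: "smooth_on (ball 0 \<rho>) A"
  unfolding A_def
  by (intro smooth_on_blinfun_compose smooth_Ji open_ball smooth_on_subset[OF smooth_K subset_ball[OF rho_le]])

text \<open>Both sides are the mixed second derivative of the multiplication at the identity, taken
  in the two orders.\<close>

lemma K_deriv_0: "blinfun_deriv K 0 w v = blinfun_deriv J 0 v w"
proof -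
  let ?f = "\<lambda>p. m (fst p) (snd p)"
  have J': "(J has_derivative blinfun_deriv J 0) (at 0)" by (rule smooth_on_has_derivative[OF smooth_J zero_in(1)])
  have K': "(K has_derivative blinfun_deriv K 0) (at 0)" by (rule smooth_on_has_derivative[OF smooth_K zero_in(1)])
  have d: "((\<lambda>p. blinfun_deriv ?f p u) has_derivative blinfun_deriv (\<lambda>p. blinfun_deriv ?f p u) (0, 0)) (at (0, 0))" for u
    by (rule smooth_on_has_derivative[OF smooth_on_blinfun_apply[OF open_sq smooth_on_blinfun_deriv[OF open_sq smooth_m] smooth_on_const]])
      (use sigma_pos in auto)
  have "((\<lambda>y. K y v) has_derivative (\<lambda>h. blinfun_deriv K 0 h v)) (at 0)"
    using bounded_linear.has_derivative[OF blinfun.bounded_linear_left K'] .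
  moreover have "((\<lambda>y. K y v) has_derivative (\<lambda>h. blinfun_deriv (\<lambda>p. blinfun_deriv ?f p (v, 0)) (0, 0) (0, h))) (at 0)"
    using has_derivative_compose[OF has_derivative_Pair[OF has_derivative_const has_derivative_ident] d[of "(v, 0)"]]
    by (simp add: K_def D1_def dm_def)
  ultimately have 1: "blinfun_deriv K 0 w v = blinfun_deriv (\<lambda>p. blinfun_deriv ?f p (v, 0)) (0, 0) (0, w)"
    by (rule fun_cong[OF has_derivative_unique])
  have "((\<lambda>y. J y w) has_derivative (\<lambda>h. blinfun_deriv J 0 h w)) (at 0)"
    using bounded_linear.has_derivative[OF blinfun.bounded_linear_left J'] .
  moreover have "((\<lambda>y. J y w) has_derivative (\<lambda>h. blinfun_deriv (\<lambda>p. blinfun_deriv ?f p (0, w)) (0, 0) (h, 0))) (at 0)"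
    using has_derivative_compose[OF has_derivative_Pair[OF has_derivative_ident has_derivative_const] d[of "(0, w)"]]
    by (simp add: J_def D2_def dm_def)
  ultimately have 2: "blinfun_deriv J 0 v w = blinfun_deriv (\<lambda>p. blinfun_deriv ?f p (0, w)) (0, 0) (v, 0)"
    by (rule fun_cong[OF has_derivative_unique])
  show ?thesis unfolding 1 2 by (rule second_derivative_symmetric[OF open_sq smooth_m]) (use sigma_pos in auto)
qed

text \<open>The derivative of Ad at the identity is ad, and the sign comes from the inverse.
  Differentiating \<open>Ji y o\<^sub>L J y = id_blinfun\<close> gives the derivative of
  \<open>Ji\<close> as minus that of \<open>J\<close>, and \<open>K_deriv_0\<close> exchanges the
  arguments in the derivative of \<open>K\<close>.\<close>

lemma A_deriv_0: "blinfun_deriv A 0 w v = - br w v"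
proof -
  have J': "(J has_derivative blinfun_deriv J 0) (at 0)" by (rule smooth_on_has_derivative[OF smooth_J zero_in(1)])
  have K': "(K has_derivative blinfun_deriv K 0) (at 0)" by (rule smooth_on_has_derivative[OF smooth_K zero_in(1)])
  have Ji': "(Ji has_derivative blinfun_deriv Ji 0) (at 0)" by (rule smooth_on_has_derivative[OF smooth_Ji zero_in(2)])
  have Ji0: "Ji 0 = id_blinfun" by (simp add: Ji_def i_0 D_00)
  have ev: "eventually (\<lambda>y. Ji y o\<^sub>L J y = id_blinfun) (nhds 0)"
    by (rule eventually_mono[OF eventually_in[OF zero_in(2)]]) (rule Ji_J)
  have d1: "((\<lambda>y. Ji y o\<^sub>L J y) has_derivative (\<lambda>h. (Ji 0 o\<^sub>L blinfun_deriv J 0 h) + (blinfun_deriv Ji 0 h o\<^sub>L J 0))) (at 0)"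
    by (rule bounded_bilinear.FDERIV[OF bounded_bilinear_blinfun_compose Ji' J'])
  have d2: "((\<lambda>y::'a. id_blinfun :: 'a \<Rightarrow>\<^sub>L 'a) has_derivative (\<lambda>h. 0)) (at 0)" by (rule has_derivative_const)
  have "(\<lambda>h. (Ji 0 o\<^sub>L blinfun_deriv J 0 h) + (blinfun_deriv Ji 0 h o\<^sub>L J 0)) = (\<lambda>h. 0)"
    by (rule has_derivative_eq_eventually[OF d1 d2 ev])
  then have 1: "(Ji 0 o\<^sub>L blinfun_deriv J 0 w) + (blinfun_deriv Ji 0 w o\<^sub>L J 0) = 0" by (rule fun_cong)
  have "(A has_derivative (\<lambda>h. (Ji 0 o\<^sub>L blinfun_deriv K 0 h) + (blinfun_deriv Ji 0 h o\<^sub>L K 0))) (at 0)"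
    unfolding A_def[abs_def] by (rule bounded_bilinear.FDERIV[OF bounded_bilinear_blinfun_compose Ji' K'])
  from arg_cong[OF fun_cong[OF has_derivative_imp_blinfun_deriv[OF this], of w], of "\<lambda>F. blinfun_apply F v"]
  have "blinfun_deriv A 0 w v = ((Ji 0 o\<^sub>L blinfun_deriv K 0 w) + (blinfun_deriv Ji 0 w o\<^sub>L K 0)) v" .
  also have "\<dots> = blinfun_deriv K 0 w v + blinfun_deriv Ji 0 w v"
    by (simp add: Ji0 K_0 blinfun.add_left)
  finally have "blinfun_deriv A 0 w v = blinfun_deriv K 0 w v + blinfun_deriv Ji 0 w v" .
  moreover have "blinfun_deriv J 0 w v + blinfun_deriv Ji 0 w v = 0"
    using arg_cong[OF 1, of "\<lambda>F. blinfun_apply F v"] by (simp add: Ji0 J_0 blinfun.add_left)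
  ultimately show ?thesis by (simp add: br_def K_deriv_0 eq_neg_iff_add_eq_0 algebra_simps)
qed

lemma square_smooth: "smooth_on (ball 0 \<sigma>) (\<lambda>x. m x x)"
  using smooth_on_compose[OF open_ball open_sq smooth_m smooth_on_Pair[OF open_ball smooth_on_ident smooth_on_ident], of 0 \<sigma>]
  by (auto simp: image_subset_iff)

lemma square_deriv_0: "blinfun_deriv (\<lambda>x. m x x) 0 v = 2 *\<^sub>R v"
proof -
  have "((\<lambda>x. m x x) has_derivative (\<lambda>h. D1 0 0 h + D2 0 0 h)) (at 0)"
    using m_has_derivative[OF has_derivative_ident has_derivative_ident zero_in(1) zero_in(1)] .
  from has_derivative_imp_blinfun_deriv[OF this] show ?thesis by (simp add: D_00 scaleR_2)
qed

end

section \<open>Exponential coordinates\<close>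

text \<open>\<open>L\<close> is the logarithm, obtained by linearizing the squaring map, and \<open>E\<close> is its local inverse, the
  exponential map.\<close>

locale exp_chart = local_group +
  fixes r s R :: real and L E :: "'a \<Rightarrow> 'a" and L' :: "'a \<Rightarrow> 'a \<Rightarrow>\<^sub>L 'a"
  assumes r_pos: "0 < r" and r_le: "r \<le> \<rho>" and s_pos: "0 < s" and s_le: "s \<le> r" and R_pos: "0 < R"
    and L_0: "L 0 = 0" and L'_0: "L' 0 = id_blinfun"
    and L_deriv: "x \<in> ball 0 r \<Longrightarrow> (L has_derivative L' x) (at x)"
    and cont_L': "continuous_on (ball 0 r) L'"
    and L_square: "x \<in> ball 0 r \<Longrightarrow> m x x \<in> ball 0 r \<Longrightarrow> L (m x x) = 2 *\<^sub>R L x"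
    and E_in: "v \<in> ball 0 R \<Longrightarrow> E v \<in> ball 0 r"
    and L_E: "v \<in> ball 0 R \<Longrightarrow> L (E v) = v"
    and L_in: "x \<in> ball 0 s \<Longrightarrow> L x \<in> ball 0 R"
    and E_L: "x \<in> ball 0 s \<Longrightarrow> E (L x) = x"
    and E_deriv: "v \<in> ball 0 R \<Longrightarrow> (E has_derivative inv (blinfun_apply (L' (E v)))) (at v)"
    and bij_L': "v \<in> ball 0 R \<Longrightarrow> bij (blinfun_apply (L' (E v)))"
    and E_double: "v \<in> ball 0 R \<Longrightarrow> m (E (v /\<^sub>R 2)) (E (v /\<^sub>R 2)) = E v"

text \<open>\<open>Koenigs_linearization\<close> applies to the squaring map, whose derivative at
  the identity is twice the identity; \<open>E\<close> comes from the inverse function theorem for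
  \<open>L\<close>.\<close>

lemma (in local_group) exp_chart_exists: "\<exists>r s R L E L'. exp_chart m i \<rho> \<sigma> r s R L E L'"
proof -
  obtain r L L' where K: "0 < r" "r \<le> \<sigma>"
    "\<And>x. x \<in> ball 0 r \<Longrightarrow> (L has_derivative blinfun_apply (L' x)) (at x)"
    "continuous_on (ball 0 r) L'" "L 0 = 0" "L' 0 = id_blinfun"
    "\<And>x. x \<in> ball 0 r \<Longrightarrow> m x x \<in> ball 0 r \<Longrightarrow> L (m x x) = 2 *\<^sub>R L x"
    by (rule Koenigs_linearization[OF sigma_pos square_smooth _ square_deriv_0])
      (use m_0_left[OF zero_in(1)] in auto)
  define q where "q = min r \<rho>"
  have q: "0 < q" "q \<le> \<rho>" "q \<le> r" "q \<le> \<sigma>" using K rho_pos rho_le by (auto simp: q_def)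
  have z: "0 \<in> ball (0::'a) q" using q by simp
  have Lq: "\<And>x. x \<in> ball 0 q \<Longrightarrow> (L has_derivative blinfun_apply (L' x)) (at x)" using K(3) q by auto
  have cq: "continuous_on (ball 0 q) L'" by (rule continuous_on_subset[OF K(4)]) (use q in auto)
  have iv: "id_blinfun o\<^sub>L L' 0 = id_blinfun" using K(6) by (auto intro!: blinfun_eqI)
  obtain U V E E' where U: "open U" "U \<subseteq> ball 0 q" "0 \<in> U" and V: "open V" "L 0 \<in> V"
    and hom: "homeomorphism U V L E"
    and E: "\<And>v. v \<in> V \<Longrightarrow> (E has_derivative E' v) (at v)"
      "\<And>v. v \<in> V \<Longrightarrow> E' v = inv (blinfun_apply (L' (E v)))"
      "\<And>v. v \<in> V \<Longrightarrow> bij (blinfun_apply (L' (E v)))"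
    by (rule inverse_function_theorem[OF open_ball Lq cq z iv]) blast+
  have V0: "0 \<in> V" using V K by simp
  have EL: "E (L x) = x" if "x \<in> U" for x using hom that by (simp add: homeomorphism_def)
  have LE: "L (E v) = v" "E v \<in> U" if "v \<in> V" for v using hom that by (auto simp: homeomorphism_def)
  have E0: "E 0 = 0" using EL[OF U(3)] K by simp
  have contE: "isCont E v" if "v \<in> V" for v using has_derivative_continuous[OF E(1)[OF that]] .
  have "isCont (\<lambda>x. m x x) 0"
    using smooth_on_imp_continuous_on[OF square_smooth] zero_in by (simp add: continuous_on_eq_continuous_at)
  then have ev: "eventually (\<lambda>x. m x x \<in> U) (nhds 0)"
    using tendsto_at_iff_tendsto_nhds[of "\<lambda>x. m x x" 0] topological_tendstoD[of "\<lambda>x. m x x" "m 0 0" "nhds 0" U]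
      U m_0_left[OF zero_in(1)] by (simp add: isCont_def)
  have "filterlim E (nhds 0) (nhds 0)"
    using contE[OF V0] E0 tendsto_at_iff_tendsto_nhds[of E 0] by (simp add: isCont_def)
  then have "eventually (\<lambda>v. m (E v) (E v) \<in> U) (nhds 0)"
    using ev filterlim_iff by blast
  \<comment> \<open>The square of \<open>E v\<close> has to stay in \<open>U\<close>, where
    \<open>E\<close> inverts \<open>L\<close>: then L(x x) = 2 L x yields the doubling rule for
    \<open>E\<close>.\<close>
  then obtain W where W: "open W" "0 \<in> W" "\<And>v. v \<in> W \<Longrightarrow> m (E v) (E v) \<in> U"
    unfolding eventually_nhds by blast
  obtain R where R: "R > 0" "ball 0 R \<subseteq> V \<inter> W"
    using open_contains_ball[of "V \<inter> W"] V W V0 by blast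
  have contL: "isCont L 0" using has_derivative_continuous[OF Lq[OF z]] .
  have "eventually (\<lambda>x. L x \<in> ball 0 R) (nhds 0)"
    by (rule eventually_ball[OF contL]) (use K(5) R in simp)
  then obtain W2 where W2: "open W2" "0 \<in> W2" "\<And>x. x \<in> W2 \<Longrightarrow> L x \<in> ball 0 R"
    unfolding eventually_nhds by blast
  obtain s where s: "s > 0" "ball 0 s \<subseteq> U \<inter> W2"
    using open_contains_ball[of "U \<inter> W2"] U W2 by blast
  have "exp_chart m i \<rho> \<sigma> q (min s q) R L E L'"
  proof unfold_locales
    show "0 < q" "q \<le> \<rho>" "0 < min s q" "min s q \<le> q" "0 < R" "L 0 = 0" "L' 0 = id_blinfun"
      "continuous_on (ball 0 q) L'"
      using q s R K cq by auto
    show "(L has_derivative blinfun_apply (L' x)) (at x)" if "x \<in> ball 0 q" for x using Lq that by blast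
    show "L (m x x) = 2 *\<^sub>R L x" if "x \<in> ball 0 q" "m x x \<in> ball 0 q" for x
      using K(7)[of x] that q by auto
    fix v :: 'a assume v: "v \<in> ball 0 R"
    then have vV: "v \<in> V" using R by auto
    show "E v \<in> ball 0 q" using LE(2)[OF vV] U by auto
    show "L (E v) = v" using LE[OF vV] by simp
    show "(E has_derivative inv (blinfun_apply (L' (E v)))) (at v)" using E(1,2)[OF vV] by simp
    show "bij (blinfun_apply (L' (E v)))" using E(3)[OF vV] .
    have "norm (v /\<^sub>R 2) < R" using v R(1) by simp
    then have v2: "v /\<^sub>R 2 \<in> V" "v /\<^sub>R 2 \<in> W" using R by auto
    let ?x = "E (v /\<^sub>R 2)"
    have "m ?x ?x \<in> U" using W v2 by blast
    then have "E (L (m ?x ?x)) = m ?x ?x" by (rule EL)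
    moreover have "L (m ?x ?x) = 2 *\<^sub>R L ?x"
      using K(7)[of ?x] \<open>m ?x ?x \<in> U\<close> LE(2)[OF v2(1)] U q by (meson order_trans subsetD subset_ball)
    ultimately show "m ?x ?x = E v" using LE(1)[OF v2(1)] by simp
  next
    fix x :: 'a assume "x \<in> ball 0 (min s q)"
    then have "x \<in> U" "x \<in> W2" using s by auto
    then show "L x \<in> ball 0 R" "E (L x) = x" using W2 EL by auto
  qed
  then show ?thesis by blast
qed

context exp_chart
begin

lemma E_0: "E 0 = 0"
  using E_L[of 0] s_pos L_0 by simp

lemma E_rho: "v \<in> ball 0 R \<Longrightarrow> E v \<in> ball 0 \<rho>" and E_sigma: "v \<in> ball 0 R \<Longrightarrow> E v \<in> ball 0 \<sigma>"
  using E_in[of v] r_le rho_le by auto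

lemma half_in: "(v::'a) \<in> ball 0 R \<Longrightarrow> v /\<^sub>R 2 \<in> ball 0 R"
  using R_pos by simp

lemma E_deriv_0: "(E has_derivative (\<lambda>v. v)) (at 0)"
proof -
  have "inv (blinfun_apply (L' (E 0))) = (\<lambda>v. v)"
    by (simp add: E_0 L'_0 id_blinfun.rep_eq inv_id[unfolded id_def])
  then show ?thesis using E_deriv[of 0] R_pos by simp
qed

lemma L_deriv_0: "(L has_derivative (\<lambda>v. v)) (at 0)"
  using L_deriv[of 0] r_pos by (simp add: L'_0 id_blinfun.rep_eq)

text \<open>\<open>B v\<close> is the inverse of the left-trivialized derivative of the exponential
  map at v, and \<open>M v\<close> is the adjoint action of exp(-v).\<close>

definition B :: "'a \<Rightarrow> 'a \<Rightarrow>\<^sub>L 'a" where "B v = L' (E v) o\<^sub>L J (E v)"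
definition M :: "'a \<Rightarrow> 'a \<Rightarrow>\<^sub>L 'a" where "M v = A (E v)"

lemma B_0: "B 0 = id_blinfun" and M_0: "M 0 = id_blinfun"
  by (auto simp: B_def M_def E_0 L'_0 J_0 A_0 intro!: blinfun_eqI)

lemma M_double: "v \<in> ball 0 R \<Longrightarrow> M v = M (v /\<^sub>R 2) o\<^sub>L M (v /\<^sub>R 2)"
  unfolding M_def using A_mult[OF E_rho E_rho] E_double[of v] half_in[of v] E_rho[of v] by metis

text \<open>Differentiate L(z z) = 2 L z at x = E(v/2) in the direction J x k. The left factor
  contributes D1 x x (J x k) = D2 x x (J x (A x k)), which produces the term with
  \<open>M\<close>.\<close>

lemma B_double:
  assumes v: "v \<in> ball 0 R"
  shows "B v (k + M (v /\<^sub>R 2) k) = 2 *\<^sub>R B (v /\<^sub>R 2) k"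
proof -
  define x where "x = E (v /\<^sub>R 2)"
  have h: "v /\<^sub>R 2 \<in> ball 0 R" using half_in[OF v] .
  have x: "x \<in> ball 0 r" "x \<in> ball 0 \<sigma>" "x \<in> ball 0 \<rho>"
    using E_in[OF h] E_sigma[OF h] E_rho[OF h] by (auto simp: x_def)
  have xx: "m x x = E v" using E_double[OF v] by (simp add: x_def)
  have xr: "m x x \<in> ball 0 r" using E_in[OF v] by (simp add: xx)
  have xs: "m x x \<in> ball 0 \<sigma>" using E_sigma[OF v] by (simp add: xx)
  have d: "((\<lambda>z. m z z) has_derivative (\<lambda>h. D1 x x h + D2 x x h)) (at x)"
    using m_has_derivative[OF has_derivative_ident has_derivative_ident x(2) x(2)] .
  have "eventually (\<lambda>z. m z z \<in> ball 0 r) (nhds x)"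
    by (rule eventually_ball[OF has_derivative_continuous[OF d] xr])
  then have ev: "eventually (\<lambda>z. L (m z z) = 2 *\<^sub>R L z) (nhds x)"
    using eventually_in[OF x(1)] by eventually_elim (rule L_square)
  have 1: "((\<lambda>z. L (m z z)) has_derivative (\<lambda>h. L' (m x x) (D1 x x h + D2 x x h))) (at x)"
    by (rule has_derivative_compose[OF d L_deriv[OF xr]])
  have 2: "((\<lambda>z. 2 *\<^sub>R L z) has_derivative (\<lambda>h. 2 *\<^sub>R L' x h)) (at x)"
    by (rule has_derivative_scaleR_right[OF L_deriv[OF x(1)]])
  have "L' (m x x) (D1 x x (J x k) + D2 x x (J x k)) = 2 *\<^sub>R L' x (J x k)"
    using fun_cong[OF has_derivative_eq_eventually[OF 1 2 ev]] .
  moreover have "D2 x x (J x w) = J (m x x) w" for w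
    by (rule blinfun_compose_eqD[OF D2_J[OF x(2) x(2) xs]])
  moreover have "D1 x x (J x k) = D2 x x (J x (A x k))"
    using arg_cong[OF D1_J[OF x(2) x(2)], of "\<lambda>F. blinfun_apply F k"] by (simp add: J_A[OF x(3)])
  ultimately show ?thesis
    unfolding B_def M_def x_def[symmetric] by (simp add: xx blinfun.add_right add.commute)
qed

lemma M_deriv_0: "(M has_derivative blinfun_deriv A 0) (at 0)"
proof -
  have "(A has_derivative blinfun_deriv A 0) (at (E 0))"
    unfolding E_0 by (rule smooth_on_has_derivative[OF smooth_A zero_in(2)])
  from has_derivative_compose[OF E_deriv_0 this] show ?thesis by (simp add: M_def[abs_def])
qed

lemma isCont_E: "v \<in> ball 0 R \<Longrightarrow> isCont E v"
  by (rule has_derivative_continuous[OF E_deriv])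

text \<open>\<open>L'\<close> is known to be continuous, so this is the regularity that
  \<open>B\<close> inherits; it is what the halving argument with q = 1 takes as input.\<close>

lemma isCont_B_0: "isCont B 0"
proof -
  have 0: "0 \<in> ball (0::'a) R" using R_pos by simp
  have "isCont L' (E 0)" "isCont J (E 0)"
    using cont_L' smooth_on_imp_continuous_on[OF smooth_J] r_pos zero_in
    by (simp_all add: E_0 continuous_on_eq_continuous_at)
  then have "isCont (\<lambda>v. L' (E v)) 0" "isCont (\<lambda>v. J (E v)) 0"
    using isCont_o2[OF isCont_E[OF 0]] by blast+
  then show ?thesis
    unfolding B_def[abs_def] by (rule bounded_bilinear.continuous[OF bounded_bilinear_blinfun_compose])
qed

text \<open>Gives the factors 1 + c|v| that \<open>halving_vanish\<close> tolerates.\<close>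

lemma M_Lipschitz_0: "\<exists>c d. c \<ge> 0 \<and> d > 0 \<and> (\<forall>v. norm v < d \<longrightarrow> norm (M v - id_blinfun) \<le> c * norm v)"
proof -
  have "((\<lambda>h. norm (M (0 + h) - M 0 - blinfun_deriv A 0 h) / norm h) \<longlongrightarrow> 0) (at 0)"
    using M_deriv_0 by (simp add: has_derivative_at)
  then have "eventually (\<lambda>h. norm (M (0 + h) - M 0 - blinfun_deriv A 0 h) / norm h < 1) (at 0)"
    by (rule order_tendstoD) simp
  then obtain d where d: "d > 0" "\<And>h. h \<noteq> 0 \<Longrightarrow> norm h < d \<Longrightarrow> norm (M (0 + h) - M 0 - blinfun_deriv A 0 h) / norm h < 1"
    unfolding eventually_at by (auto simp: dist_norm)
  have "norm (M v - id_blinfun) \<le> (norm (blinfun_deriv A 0) + 1) * norm v" if "norm v < d" for v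
  proof (cases "v = 0")
    case False
    have "norm (M v - id_blinfun - blinfun_deriv A 0 v) \<le> norm v"
      using d(2)[OF False that] False by (simp add: M_0 divide_simps)
    moreover have "norm (M v - id_blinfun) \<le> norm (M v - id_blinfun - blinfun_deriv A 0 v) + norm (blinfun_deriv A 0 v)"
      using norm_triangle_ineq[of "M v - id_blinfun - blinfun_deriv A 0 v" "blinfun_deriv A 0 v"] by simp
    moreover have "norm (blinfun_deriv A 0 v) \<le> norm (blinfun_deriv A 0) * norm v" by (rule norm_blinfun)
    ultimately show ?thesis by (simp add: algebra_simps)
  qed (simp add: M_0)
  then show ?thesis using d(1)
    by (intro exI[of _ "norm (blinfun_deriv A 0) + 1"] exI[of _ d]) auto
qed

end

section \<open>Lie algebra homomorphisms induce local homomorphisms\<close>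

locale chart_hom =
  G: exp_chart mG iG \<rho>G \<sigma>G rG sG RG LG EG LG' + H: exp_chart mH iH \<rho>H \<sigma>H rH sH RH LH EH LH'
  for mG :: "'a::euclidean_space \<Rightarrow> 'a \<Rightarrow> 'a" and iG \<rho>G \<sigma>G rG sG RG LG EG LG'
    and mH :: "'b::euclidean_space \<Rightarrow> 'b \<Rightarrow> 'b" and iH \<rho>H \<sigma>H rH sH RH LH EH LH' +
  fixes \<delta> :: "'a \<Rightarrow>\<^sub>L 'b"
  assumes delta_br: "\<delta> (G.br v w) = H.br (\<delta> v) (\<delta> w)"
begin

lemma delta_0_deriv: "(blinfun_apply \<delta> has_derivative \<delta>) (at x)"
  by (rule bounded_linear_imp_has_derivative[OF blinfun.bounded_linear_right])

lemma small_radius: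
  "\<exists>q>0. \<exists>c\<ge>0. q \<le> RG \<and> c * q \<le> 1 \<and> (\<forall>v. norm v < q \<longrightarrow> \<delta> v \<in> ball 0 RH \<and>
     norm (G.M v - id_blinfun) \<le> c * norm v \<and> norm (H.M (\<delta> v) - id_blinfun) \<le> c * norm v)"
proof -
  obtain c1 d1 where 1: "c1 \<ge> 0" "d1 > 0" "\<And>v. norm v < d1 \<Longrightarrow> norm (G.M v - id_blinfun) \<le> c1 * norm v"
    using G.M_Lipschitz_0 by blast
  obtain c2 d2 where 2: "c2 \<ge> 0" "d2 > 0" "\<And>v. norm v < d2 \<Longrightarrow> norm (H.M v - id_blinfun) \<le> c2 * norm v"
    using H.M_Lipschitz_0 by blast
  define n where "n = norm \<delta> + 1"
  have n: "n \<ge> 1" by (simp add: n_def)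
  have dn: "norm (\<delta> v) \<le> n * norm v" for v
    using norm_blinfun[of \<delta> v] norm_ge_zero[of v] unfolding n_def distrib_right by linarith
  define c where "c = c1 + c2 * n"
  have c: "c \<ge> 0" "c1 \<le> c" "c2 * n \<le> c" using 1 2 n by (auto simp: c_def)
  \<comment> \<open>Dividing by n, which bounds the norm of \<delta>, keeps
    \<open>\<delta> v\<close> within the radii of the target; the last entry gives c q \<le>
    1.\<close>
  define q where "q = Min {RG, d1, d2 / n, RH / n, 1 / (c + 1)}"
  have q: "q > 0" "q \<le> RG" "q \<le> d1" "q \<le> d2 / n" "q \<le> RH / n" "q \<le> 1 / (c + 1)"
    unfolding q_def using G.R_pos H.R_pos 1 2 n c by (auto simp: add_nonneg_pos)
  have "c * q \<le> (c + 1) * (1 / (c + 1))" using q c by (intro mult_mono) auto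
  then have cq: "c * q \<le> 1" using c by simp
  have "\<delta> v \<in> ball 0 RH \<and> norm (G.M v - id_blinfun) \<le> c * norm v \<and> norm (H.M (\<delta> v) - id_blinfun) \<le> c * norm v"
    if "norm v < q" for v
  proof -
    have "n * norm v < n * q" using that n by simp
    then have "norm (\<delta> v) < n * q" using dn[of v] by linarith
    moreover have "n * q \<le> d2" "n * q \<le> RH" using q n by (auto simp: field_simps)
    ultimately have d: "norm (\<delta> v) < d2" "norm (\<delta> v) < RH" by auto
    have "norm (G.M v - id_blinfun) \<le> c * norm v"
      using 1(3)[of v] that q mult_right_mono[OF c(2), of "norm v"] by force
    moreover have "norm (H.M (\<delta> v) - id_blinfun) \<le> c2 * (n * norm v)"
      using 2(3)[OF d(1)] mult_left_mono[OF dn[of v] 2(1)] by linarith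
    then have "norm (H.M (\<delta> v) - id_blinfun) \<le> c * norm v"
      using mult_right_mono[OF c(3), of "norm v"] by (simp add: mult.assoc)
    ultimately show ?thesis using d by simp
  qed
  then show ?thesis using q c cq by blast
qed

text \<open>The adjoint actions satisfy M v = M(v/2)^2, and their first-order terms at 0 are minus
  the brackets, which \<open>\<delta>\<close> intertwines. So the defect satisfies a halving
  inequality with q = 2 and has vanishing derivative at 0.\<close>

lemma M_equivariant:
  assumes q: "q > 0" "q \<le> RG" "c \<ge> 0"
    "\<And>v. norm v < q \<Longrightarrow> \<delta> v \<in> ball 0 RH \<and>
     norm (G.M v - id_blinfun) \<le> c * norm v \<and> norm (H.M (\<delta> v) - id_blinfun) \<le> c * norm v"
    and v: "norm v < q"
  shows "H.M (\<delta> v) (\<delta> k) = \<delta> (G.M v k)"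
proof -
  define f where "f = (\<lambda>v. (H.M (\<delta> v) o\<^sub>L \<delta>) - (\<delta> o\<^sub>L G.M v))"
  have f0: "f 0 = 0" by (rule blinfun_eqI) (simp add: f_def blinfun.zero_right G.M_0 H.M_0 blinfun.diff_left)
  have "f v = 0"
  proof (rule halving_vanish[where c = c and q = 2 and r = q and f = f, OF _ _ _ _ v])
    fix v :: 'a assume v: "norm v < q"
    then have v2: "norm (v /\<^sub>R 2) < q" using q(1) by simp
    have vG: "v \<in> ball 0 RG" using v q(2) by simp
    have vH: "\<delta> v \<in> ball 0 RH" using q(4)[OF v] by simp
    have dh: "\<delta> (v /\<^sub>R 2) = \<delta> v /\<^sub>R 2" by (rule blinfun.scaleR_right)
    \<comment> \<open>With a and b for the adjoint actions at v/2: a a \<delta> - \<delta> b b = a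
      (a \<delta> - \<delta> b) + (a \<delta> - \<delta> b) b.\<close>
    have "f v = (H.M (\<delta> (v /\<^sub>R 2)) o\<^sub>L f (v /\<^sub>R 2)) + (f (v /\<^sub>R 2) o\<^sub>L G.M (v /\<^sub>R 2))"
      unfolding f_def G.M_double[OF vG] H.M_double[OF vH] dh
      by (rule blinfun_eqI) (simp add: blinfun.diff_left blinfun.add_left blinfun.diff_right)
    then have "norm (f v) \<le> norm (H.M (\<delta> (v /\<^sub>R 2)) o\<^sub>L f (v /\<^sub>R 2)) + norm (f (v /\<^sub>R 2) o\<^sub>L G.M (v /\<^sub>R 2))"
      by (metis norm_triangle_ineq)
    also have "\<dots> \<le> norm (H.M (\<delta> (v /\<^sub>R 2))) * norm (f (v /\<^sub>R 2)) + norm (f (v /\<^sub>R 2)) * norm (G.M (v /\<^sub>R 2))"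
      by (intro add_mono norm_blinfun_compose)
    also have "\<dots> \<le> (1 + c * norm (v /\<^sub>R 2)) * norm (f (v /\<^sub>R 2)) + norm (f (v /\<^sub>R 2)) * (1 + c * norm (v /\<^sub>R 2))"
    proof -
      have id1: "norm F \<le> 1 + norm (F - id_blinfun)" for F :: "'c::real_normed_vector \<Rightarrow>\<^sub>L 'c"
        using norm_triangle_ineq[of "F - id_blinfun" id_blinfun] norm_blinfun_id_le by (smt (verit) diff_add_cancel)
      have "norm (H.M (\<delta> (v /\<^sub>R 2))) \<le> 1 + c * norm (v /\<^sub>R 2)" "norm (G.M (v /\<^sub>R 2)) \<le> 1 + c * norm (v /\<^sub>R 2)"
        using id1[of "H.M (\<delta> (v /\<^sub>R 2))"] id1[of "G.M (v /\<^sub>R 2)"] q(4)[OF v2] by linarith+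
      then show ?thesis by (intro add_mono mult_right_mono mult_left_mono) auto
    qed
    also have "\<dots> = (2 + c * norm v) * norm (f (v /\<^sub>R 2))" by (simp add: algebra_simps)
    also have "\<dots> \<le> 2 * (1 + c * norm v) * norm (f (v /\<^sub>R 2))" using q(3) by (intro mult_right_mono) auto
    finally show "norm (f v) \<le> 2 * (1 + c * norm v) * norm (f (v /\<^sub>R 2))" .
  next
    have dH: "((\<lambda>v. H.M (\<delta> v)) has_derivative (\<lambda>h. blinfun_deriv H.A 0 (\<delta> h))) (at 0)"
      by (rule has_derivative_compose[OF delta_0_deriv]) (simp add: blinfun.zero_right H.M_deriv_0)
    have "(f has_derivative (\<lambda>h. (blinfun_deriv H.A 0 (\<delta> h) o\<^sub>L \<delta>) - (\<delta> o\<^sub>L blinfun_deriv G.A 0 h))) (at 0)"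
      unfolding f_def
      by (intro has_derivative_diff
          bounded_linear.has_derivative[OF bounded_bilinear.bounded_linear_left[OF bounded_bilinear_blinfun_compose] dH]
          bounded_linear.has_derivative[OF bounded_bilinear.bounded_linear_right[OF bounded_bilinear_blinfun_compose] G.M_deriv_0])
    moreover have "(blinfun_deriv H.A 0 (\<delta> h) o\<^sub>L \<delta>) - (\<delta> o\<^sub>L blinfun_deriv G.A 0 h) = 0" for h
      by (rule blinfun_eqI)
        (simp add: blinfun.diff_left G.A_deriv_0 H.A_deriv_0 blinfun.minus_right delta_br)
    ultimately have "(f has_derivative (\<lambda>_. 0)) (at 0)" by simp
    then show "(\<lambda>k. 2 ^ k * norm (f (v /\<^sub>R 2 ^ k))) \<longlonglongrightarrow> 0"
      by (rule has_derivative_dyadic_tendsto_0[where f = f, OF _ f0])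
  qed (use q in auto)
  then have "(H.M (\<delta> v) o\<^sub>L \<delta>) k = (\<delta> o\<^sub>L G.M v) k" by (simp add: f_def)
  then show ?thesis by simp
qed

text \<open>Subtracting the two doubling equations, with \<open>M\<close> already intertwined, gives
  f v (1 + M(v/2)) = 2 f(v/2) for the defect f. As \<open>M\<close> is near the identity this is a
  halving inequality with q = 1, and continuity of f at 0 decides.\<close>

lemma B_equivariant:
  assumes q: "q > 0" "q \<le> RG" "c \<ge> 0" "c * q \<le> 1"
    "\<And>v. norm v < q \<Longrightarrow> \<delta> v \<in> ball 0 RH \<and>
     norm (G.M v - id_blinfun) \<le> c * norm v \<and> norm (H.M (\<delta> v) - id_blinfun) \<le> c * norm v"
    and v: "norm v < q"
  shows "H.B (\<delta> v) (\<delta> k) = \<delta> (G.B v k)"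
proof -
  define f where "f = (\<lambda>v. (H.B (\<delta> v) o\<^sub>L \<delta>) - (\<delta> o\<^sub>L G.B v))"
  have f0: "f 0 = 0" by (rule blinfun_eqI) (simp add: f_def blinfun.zero_right G.B_0 H.B_0 blinfun.diff_left)
  have "f v = 0"
  proof (rule halving_vanish[where c = c and q = 1 and r = q and f = f, OF _ _ _ _ v])
    fix v :: 'a assume v: "norm v < q"
    then have v2: "norm (v /\<^sub>R 2) < q" using q(1) by simp
    have vG: "v \<in> ball 0 RG" using v q(2) by simp
    have vH: "\<delta> v \<in> ball 0 RH" using q(5)[OF v] by simp
    have dh: "\<delta> v /\<^sub>R 2 = \<delta> (v /\<^sub>R 2)" by (rule blinfun.scaleR_right[symmetric])
    let ?N = "G.M (v /\<^sub>R 2) - id_blinfun"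
    have eq: "2 *\<^sub>R f (v /\<^sub>R 2) = 2 *\<^sub>R f v + (f v o\<^sub>L ?N)"
    proof (rule blinfun_eqI)
      fix k
      have "2 *\<^sub>R H.B (\<delta> (v /\<^sub>R 2)) (\<delta> k) = H.B (\<delta> v) (\<delta> k + \<delta> (G.M (v /\<^sub>R 2) k))"
        using H.B_double[OF vH, of "\<delta> k"] M_equivariant[OF q(1-3,5) v2, of k] by (simp only: dh)
      moreover have "2 *\<^sub>R \<delta> (G.B (v /\<^sub>R 2) k) = \<delta> (G.B v (k + G.M (v /\<^sub>R 2) k))"
        unfolding G.B_double[OF vG] by (simp add: blinfun.scaleR_right)
      ultimately show "(2 *\<^sub>R f (v /\<^sub>R 2)) k = (2 *\<^sub>R f v + (f v o\<^sub>L ?N)) k"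
        by (simp add: f_def blinfun.diff_left blinfun.add_left blinfun.scaleR_left blinfun.add_right
            blinfun.diff_right scaleR_diff_right scaleR_2)
    qed
    have "c * norm v \<le> c * q" using v q(3) by (intro mult_left_mono) auto
    then have cv: "c * norm v \<le> 1" using q(4) by linarith
    have "norm ?N \<le> c * norm (v /\<^sub>R 2)" using q(5)[OF v2] by blast
    then have N: "norm ?N \<le> c * norm v / 2" by simp
    have "norm (2 *\<^sub>R f v) \<le> norm (2 *\<^sub>R f (v /\<^sub>R 2)) + norm (f v o\<^sub>L ?N)"
      using norm_triangle_ineq4[of "2 *\<^sub>R f (v /\<^sub>R 2)" "f v o\<^sub>L ?N"] unfolding eq by simp
    also have "norm (f v o\<^sub>L ?N) \<le> norm (f v) * (c * norm v / 2)"
      using N by (intro order_trans[OF norm_blinfun_compose] mult_left_mono) auto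
    finally have *: "norm (f v) * (1 - c * norm v / 4) \<le> norm (f (v /\<^sub>R 2))" by (simp add: algebra_simps)
    have "norm (f v) \<le> norm (f v) * ((1 - c * norm v / 4) * (1 + c * norm v))"
    proof -
      \<comment> \<open>With x = c|v|: (1 - x/4)(1 + x) = 1 + x(3 - x)/4, which is at least 1 for 0
        \<le> x \<le> 1.\<close>
      have "0 \<le> c * norm v * (3 - c * norm v)" using q(3) cv by (intro mult_nonneg_nonneg) auto
      then have "1 \<le> (1 - c * norm v / 4) * (1 + c * norm v)" by (simp add: algebra_simps)
      then show ?thesis using mult_left_mono[of 1 _ "norm (f v)"] by simp
    qed
    also have "\<dots> = (norm (f v) * (1 - c * norm v / 4)) * (1 + c * norm v)" by (simp only: mult.assoc)
    also have "\<dots> \<le> norm (f (v /\<^sub>R 2)) * (1 + c * norm v)"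
      using * q(3) by (intro mult_right_mono) auto
    finally show "norm (f v) \<le> 1 * (1 + c * norm v) * norm (f (v /\<^sub>R 2))" by (simp add: mult.commute)
  next
    have "isCont (\<lambda>v. H.B (\<delta> v)) 0"
      using isCont_o2[OF has_derivative_continuous[OF delta_0_deriv], of 0 H.B] H.isCont_B_0
      by (simp add: blinfun.zero_right)
    then have "isCont f 0"
      unfolding f_def
      by (intro continuous_diff bounded_bilinear.continuous[OF bounded_bilinear_blinfun_compose] G.isCont_B_0 continuous_const)
    moreover have "(\<lambda>k. (1/2) ^ k *\<^sub>R v) \<longlonglongrightarrow> 0 *\<^sub>R v"
      by (intro tendsto_intros LIMSEQ_power_zero) auto
    then have "(\<lambda>k. v /\<^sub>R 2 ^ k) \<longlonglongrightarrow> 0" by (simp add: power_one_over inverse_eq_divide)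
    ultimately have "(\<lambda>k. f (v /\<^sub>R 2 ^ k)) \<longlonglongrightarrow> f 0" by (rule isCont_tendsto_compose)
    then show "(\<lambda>k. 1 ^ k * norm (f (v /\<^sub>R 2 ^ k))) \<longlonglongrightarrow> 0" using f0 by (simp add: tendsto_norm_zero_iff)
  qed (use q in auto)
  then have "(H.B (\<delta> v) o\<^sub>L \<delta>) k = (\<delta> o\<^sub>L G.B v) k" by (simp add: f_def)
  then show ?thesis by simp
qed

text \<open>Differentiating \<open>E (2 v) = E v E v\<close> gives halving equations for the left-trivialized derivative of
  \<open>E\<close> and for the adjoint action, which determine both from the Lie bracket.  Hence \<open>\<delta>\<close>
  intertwines them, the derivative of \<open>D\<close> is the one of a homomorphism, and Gronwall's inequality
  shows that \<open>D\<close> is one.\<close>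

definition D :: "'a \<Rightarrow> 'b" where "D x = EH (\<delta> (LG x))"

text \<open>The chain rule expresses the derivative through the two logarithms, and
  \<open>B_equivariant\<close> replaces them by the frames. The result says that the left
  logarithmic derivative of \<open>D\<close> is \<open>\<delta>\<close> applied to that of the
  identity map, as for a homomorphism with differential \<open>\<delta>\<close>.\<close>

lemma D_has_derivative:
  "\<exists>t>0. t \<le> sG \<and> (\<forall>x\<in>ball 0 t. LG x \<in> ball 0 RG \<and> \<delta> (LG x) \<in> ball 0 RH \<and>
      (D has_derivative (\<lambda>h. H.J (D x) (\<delta> (G.Ji x h)))) (at x))"
proof -
  obtain q c where q: "q > 0" "q \<le> RG" "c \<ge> 0" "c * q \<le> 1"
    "\<And>v. norm v < q \<Longrightarrow> \<delta> v \<in> ball 0 RH \<and>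
     norm (G.M v - id_blinfun) \<le> c * norm v \<and> norm (H.M (\<delta> v) - id_blinfun) \<le> c * norm v"
    using small_radius by metis
  have "eventually (\<lambda>x. LG x \<in> ball 0 q) (nhds 0)"
    by (rule G.eventually_ball[OF has_derivative_continuous[OF G.L_deriv_0]]) (use q G.L_0 in simp)
  then obtain W where W: "open W" "0 \<in> W" "\<And>x. x \<in> W \<Longrightarrow> norm (LG x) < q"
    unfolding eventually_nhds by auto
  obtain t where t: "t > 0" "ball 0 t \<subseteq> W" using W open_contains_ball by blast
  have "LG x \<in> ball 0 RG \<and> \<delta> (LG x) \<in> ball 0 RH \<and>
      (D has_derivative (\<lambda>h. H.J (D x) (\<delta> (G.Ji x h)))) (at x)" if x: "x \<in> ball 0 (min t sG)" for x
  proof -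
    let ?v = "LG x"
    have v: "norm ?v < q" using x t W by auto
    have vG: "?v \<in> ball 0 RG" using v q(2) by simp
    have vH: "\<delta> ?v \<in> ball 0 RH" using q(5)[OF v] by simp
    have xs: "x \<in> ball 0 sG" "x \<in> ball 0 rG" "x \<in> ball 0 \<rho>G" using x G.s_le G.r_le by auto
    have EL: "EG ?v = x" by (rule G.E_L[OF xs(1)])
    let ?L = "blinfun_apply (LH' (D x))"
    have bij: "bij ?L" using H.bij_L'[OF vH] by (simp add: D_def)
    have "(D has_derivative (\<lambda>h. inv ?L (\<delta> (LG' x h)))) (at x)"
      using has_derivative_compose[OF has_derivative_compose[OF G.L_deriv[OF xs(2)] delta_0_deriv] H.E_deriv[OF vH]]
      by (simp add: D_def[abs_def])
    moreover have "inv ?L (\<delta> (LG' x h)) = H.J (D x) (\<delta> (G.Ji x h))" for h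
    proof -
      have "G.J x (G.Ji x h) = h" using blinfun_compose_eqD[OF G.J_Ji[OF xs(3)]] by simp
      then have "\<delta> (LG' x h) = \<delta> (G.B ?v (G.Ji x h))" by (simp add: G.B_def EL)
      also have "\<dots> = H.B (\<delta> ?v) (\<delta> (G.Ji x h))" by (rule B_equivariant[OF q v, symmetric])
      also have "\<dots> = ?L (H.J (D x) (\<delta> (G.Ji x h)))" by (simp add: H.B_def D_def)
      finally show ?thesis by (simp only: inv_f_f[OF bij_is_inj[OF bij]])
    qed
    ultimately show ?thesis using vG vH by simp
  qed
  then show ?thesis using t G.s_pos by (intro exI[of _ "min t sG"]) auto
qed

theorem local_homomorphism:
  "\<exists>t>0. t \<le> \<rho>G \<and> smooth_on (ball 0 t) D \<and> (\<forall>x\<in>ball 0 t. D x \<in> ball 0 \<rho>H) \<and> D 0 = 0 \<and>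
     (D has_derivative \<delta>) (at 0) \<and>
     (\<forall>x\<in>ball 0 t. \<forall>y\<in>ball 0 t. mG x y \<in> ball 0 t \<longrightarrow> D (mG x y) = mH (D x) (D y))"
proof -
  obtain t where t: "t > 0" "t \<le> sG" "\<And>x. x \<in> ball 0 t \<Longrightarrow> \<delta> (LG x) \<in> ball 0 RH"
    "\<And>x. x \<in> ball 0 t \<Longrightarrow> (D has_derivative (\<lambda>h. H.J (D x) (\<delta> (G.Ji x h)))) (at x)"
    using D_has_derivative by metis
  have t\<rho>: "t \<le> \<rho>G" "t \<le> \<sigma>G" using t G.s_le G.r_le G.rho_le by auto
  have D0: "D 0 = 0" by (simp add: D_def G.L_0 blinfun.zero_right H.E_0)
  have D\<rho>: "D x \<in> ball 0 \<rho>H" if "x \<in> ball 0 t" for x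
    unfolding D_def by (rule H.E_rho[OF t(3)[OF that]])
  have D\<sigma>: "D x \<in> ball 0 \<sigma>H" if "x \<in> ball 0 t" for x
    using H.rho_sigma[OF D\<rho>[OF that]] .
  \<comment> \<open>Bootstrapping: the formula for the derivative contains \<open>D\<close> itself
    and smooth frames only, so C^k implies C^(k+1).\<close>
  have Ck: "Ck_on k (ball 0 t) D" for k
  proof (induction k)
    case 0
    show ?case using t(4) by (auto intro!: continuous_at_imp_continuous_on has_derivative_continuous)
  next
    case (Suc k)
    show ?case
    proof (rule Ck_on_SucI[OF open_ball t(4)])
      fix v
      have 1: "Ck_on k (ball 0 t) (\<lambda>x. H.J (D x))"
        by (rule Ck_on_compose[OF open_ball open_ball _ Suc]) (use H.smooth_J D\<sigma> in \<open>auto simp: smooth_on_def\<close>)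
      have "smooth_on (ball 0 t) (\<lambda>x. \<delta> (G.Ji x v))"
        by (intro smooth_on_linear_compose[OF blinfun.bounded_linear_right] smooth_on_blinfun_apply
            smooth_on_subset[OF G.smooth_Ji subset_ball[OF t\<rho>(1)]] smooth_on_const open_ball)
      then have 2: "Ck_on k (ball 0 t) (\<lambda>x. \<delta> (G.Ji x v))" by (simp add: smooth_on_def)
      show "Ck_on k (ball 0 t) (\<lambda>x. H.J (D x) (\<delta> (G.Ji x v)))"
        by (rule Ck_on_bilinear[OF bounded_bilinear_blinfun_apply open_ball 1 2])
    qed
  qed
  then have smD: "smooth_on (ball 0 t) D" by (simp add: smooth_on_def)
  have contD: "isCont D x" if "x \<in> ball 0 t" for x using has_derivative_continuous[OF t(4)[OF that]] .
  have "(\<lambda>h. H.J (D 0) (\<delta> (G.Ji 0 h))) = \<delta>"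
    by (auto simp: D0 H.J_0 G.Ji_def G.i_0 G.D_00)
  then have D'0: "(D has_derivative \<delta>) (at 0)" using t(4)[of 0] t(1) by simp

  \<comment> \<open>A Lipschitz bound for the frame of the target near 0, as uniqueness for the
    equation g' = J(g) k requires.\<close>
  obtain q where q: "q > 0" "ball 0 q \<subseteq> ball (0::'b) \<sigma>H"
    "\<And>x y. x \<in> ball 0 q \<Longrightarrow> y \<in> ball 0 q \<Longrightarrow>
      norm (H.J x - H.J y - blinfun_deriv H.J 0 (x - y)) \<le> 1 * norm (x - y)"
    using smooth_on_strict_derivative[OF open_ball H.smooth_J H.zero_in(1) zero_less_one] by metis
  define C where "C = norm (blinfun_deriv H.J 0) + 1"
  have lip: "norm (H.J x - H.J y) \<le> C * norm (x - y)" if "x \<in> ball 0 q" "y \<in> ball 0 q" for x y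
  proof -
    have "norm (H.J x - H.J y) \<le> norm (H.J x - H.J y - blinfun_deriv H.J 0 (x - y)) + norm (blinfun_deriv H.J 0 (x - y))"
      using norm_triangle_ineq[of "H.J x - H.J y - blinfun_deriv H.J 0 (x - y)" "blinfun_deriv H.J 0 (x - y)"] by simp
    then show ?thesis
      using q(3)[OF that] norm_blinfun[of "blinfun_deriv H.J 0" "x - y"] by (simp add: C_def algebra_simps)
  qed
  define F where "F = (\<lambda>y. \<delta> o\<^sub>L G.Ji y)"
  have contF: "isCont F 0"
  proof -
    have "isCont G.Ji 0" using smooth_on_imp_continuous_on[OF G.smooth_Ji] G.zero_in by (simp add: continuous_on_eq_continuous_at)
    then show ?thesis unfolding F_def
      by (intro bounded_bilinear.continuous[OF bounded_bilinear_blinfun_compose] continuous_const)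
  qed
  have evF: "eventually (\<lambda>y. norm (F y) < norm (F 0) + 1) (nhds 0)"
  proof -
    have "isCont (\<lambda>y. norm (F y)) 0" using contF by (intro continuous_norm)
    then have "((\<lambda>y. norm (F y)) \<longlongrightarrow> norm (F 0)) (nhds 0)"
      using tendsto_at_iff_tendsto_nhds[of "\<lambda>y. norm (F y)" 0] by (simp add: isCont_def)
    then show ?thesis by (rule order_tendstoD) simp
  qed
  have evD: "eventually (\<lambda>y. D y \<in> ball 0 q) (nhds 0)"
    by (rule G.eventually_ball[OF contD]) (use t(1) D0 q(1) in auto)
  obtain W where W: "open W" "0 \<in> W" "\<And>y. y \<in> W \<Longrightarrow> norm (F y) < norm (F 0) + 1 \<and> D y \<in> ball 0 q"
    using eventually_conj[OF evF evD] unfolding eventually_nhds by metis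
  obtain t1 where t1: "t1 > 0" "ball 0 t1 \<subseteq> W \<inter> ball 0 t"
    by (rule openE[of "W \<inter> ball 0 t" 0]) (use W t(1) in auto)
  have contm: "isCont (\<lambda>p. mG (fst p) (snd p)) (0, 0)"
    using smooth_on_imp_continuous_on[OF G.smooth_m] G.open_sq G.zero_in by (simp add: continuous_on_eq_continuous_at)
  have ev1: "eventually (\<lambda>p. mG (fst p) (snd p) \<in> ball 0 t1) (nhds (0, 0))"
  proof -
    have "((\<lambda>p. mG (fst p) (snd p)) \<longlongrightarrow> mG 0 0) (nhds (0, 0))"
      using contm tendsto_at_iff_tendsto_nhds[of "\<lambda>p. mG (fst p) (snd p)" "(0, 0)"] by (simp add: isCont_def)
    then show ?thesis
      by (rule topological_tendstoD) (use t1(1) G.m_0_left[OF G.zero_in(1)] in auto)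
  qed
  \<comment> \<open>Radius \<open>q\<close> is for the Lipschitz bound, \<open>\<sigma>H\<close> for
    the use of \<open>H.D2_J\<close>.\<close>
  have ev2: "eventually (\<lambda>p. mH (D (fst p)) (D (snd p)) \<in> ball 0 (min q \<sigma>H)) (nhds (0, 0))"
  proof -
    have c1: "isCont (\<lambda>p. (D (fst p), D (snd p))) (0, 0)"
      using contD[of 0] t(1)
      by (intro continuous_Pair isCont_o2[OF isCont_fst, of _ _ D] isCont_o2[OF isCont_snd, of _ _ D] continuous_ident) auto
    have "isCont (\<lambda>p. mH (fst p) (snd p)) (D 0, D 0)"
      using smooth_on_imp_continuous_on[OF H.smooth_m] H.open_sq H.zero_in by (simp add: D0 continuous_on_eq_continuous_at)
    with c1 have "isCont (\<lambda>p. mH (D (fst p)) (D (snd p))) (0, 0)"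
      using isCont_o2[of "(0, 0)" "\<lambda>p. (D (fst p), D (snd p))" "\<lambda>p. mH (fst p) (snd p)"] by simp
    then have "((\<lambda>p. mH (D (fst p)) (D (snd p))) \<longlongrightarrow> mH (D 0) (D 0)) (nhds (0, 0))"
      using tendsto_at_iff_tendsto_nhds[of "\<lambda>p. mH (D (fst p)) (D (snd p))" "(0, 0)"] by (simp add: isCont_def)
    then show ?thesis
      by (rule topological_tendstoD) (use q(1) H.sigma_pos D0 H.m_0_left[OF H.zero_in(1)] in auto)
  qed
  obtain U where U: "open U" "(0, 0) \<in> U" "\<And>x y. (x, y) \<in> U \<Longrightarrow> mG x y \<in> ball 0 t1 \<and> mH (D x) (D y) \<in> ball 0 (min q \<sigma>H)"
    using eventually_conj[OF ev1 ev2] unfolding eventually_nhds by (metis fst_conv snd_conv)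
  obtain U1 U2 where U12: "open U1" "open U2" "0 \<in> U1" "0 \<in> U2" "U1 \<times> U2 \<subseteq> U"
    using open_prod_elim[OF U(1,2)] by (metis mem_Sigma_iff)
  obtain u where u: "u > 0" "ball 0 u \<subseteq> U1 \<inter> U2 \<inter> ball 0 t1"
    by (rule openE[of "U1 \<inter> U2 \<inter> ball 0 t1" 0]) (use U12 t1(1) in auto)
  have bu: "ball 0 u \<subseteq> ball (0::'a) t1" "ball 0 u \<subseteq> ball (0::'a) t" using u(2) t1(2) by blast+
  have hom: "D (mG x y) = mH (D x) (D y)" if x: "x \<in> ball 0 u" and y: "y \<in> ball 0 u" for x y
  proof -
    have ty: "s *\<^sub>R y \<in> ball 0 u" if "s \<in> {0..1}" for s :: real
      using that y mult_left_le_one_le[of "norm y" s] by auto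
    have inU: "(x, s *\<^sub>R y) \<in> U" if "s \<in> {0..1}" for s
      using u(2) x ty[OF that] U12(5) by blast
    have xt: "x \<in> ball 0 t" and xt1: "x \<in> ball 0 t1" using x bu by blast+
    have tyt: "s *\<^sub>R y \<in> ball 0 t" and tyt1: "s *\<^sub>R y \<in> ball 0 t1" if "s \<in> {0..1}" for s
      using ty[OF that] bu by blast+
    have in\<sigma>: "z \<in> ball 0 \<sigma>G" "z \<in> ball 0 \<rho>G" if "z \<in> ball 0 t" for z using that t\<rho> by auto
    \<comment> \<open>Both curves start at \<open>D x\<close> and solve the same equation g' = J(g)
      k along the ray s y.\<close>
    define g1 where "g1 = (\<lambda>s. D (mG x (s *\<^sub>R y)))"
    define g2 where "g2 = (\<lambda>s. mH (D x) (D (s *\<^sub>R y)))"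
    define k where "k = (\<lambda>s. F (s *\<^sub>R y) y)"
    have sder: "((\<lambda>s. s *\<^sub>R y) has_derivative (\<lambda>h. h *\<^sub>R y)) (at s within T)" for s T
      by (auto intro!: derivative_eq_intros)
    have z1: "mG x (s *\<^sub>R y) \<in> ball 0 t1" "mG x (s *\<^sub>R y) \<in> ball 0 t" if "s \<in> {0..1}" for s
      using U(3)[OF inU[OF that]] t1(2) by auto
    have d1: "(g1 has_vector_derivative H.J (g1 s) (k s)) (at s within {0..1})" if s: "s \<in> {0..1}" for s
    proof -
      let ?z = "mG x (s *\<^sub>R y)"
      have a: "((\<lambda>s. mG x (s *\<^sub>R y)) has_derivative (\<lambda>h. G.D2 x (s *\<^sub>R y) (h *\<^sub>R y))) (at s within {0..1})"
        by (rule has_derivative_compose[OF sder G.m_right_has_derivative[OF in\<sigma>(1)[OF xt] in\<sigma>(1)[OF tyt[OF s]]]])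
      have "(g1 has_derivative (\<lambda>h. H.J (D ?z) (\<delta> (G.Ji ?z (G.D2 x (s *\<^sub>R y) (h *\<^sub>R y)))))) (at s within {0..1})"
        unfolding g1_def by (rule has_derivative_compose[OF a t(4)[OF z1(2)[OF s]]])
      \<comment> \<open>The left logarithmic derivative does not see the constant left factor
        x.\<close>
      moreover have "G.Ji ?z (G.D2 x (s *\<^sub>R y) w) = G.Ji (s *\<^sub>R y) w" for w
      proof -
        have "G.D2 x (s *\<^sub>R y) (G.J (s *\<^sub>R y) (G.Ji (s *\<^sub>R y) w)) = G.J ?z (G.Ji (s *\<^sub>R y) w)"
          by (rule blinfun_compose_eqD[OF G.D2_J[OF in\<sigma>(1)[OF xt] in\<sigma>(1)[OF tyt[OF s]] in\<sigma>(1)[OF z1(2)[OF s]]]])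
        then have "G.D2 x (s *\<^sub>R y) w = G.J ?z (G.Ji (s *\<^sub>R y) w)"
          using blinfun_compose_eqD[OF G.J_Ji[OF in\<sigma>(2)[OF tyt[OF s]]], of w] by simp
        then show ?thesis
          using blinfun_compose_eqD[OF G.Ji_J[OF in\<sigma>(2)[OF z1(2)[OF s]]]] by simp
      qed
      ultimately show ?thesis
        by (simp add: has_vector_derivative_def g1_def k_def F_def blinfun.scaleR_right)
    qed
    have d2: "(g2 has_vector_derivative H.J (g2 s) (k s)) (at s within {0..1})" if s: "s \<in> {0..1}" for s
    proof -
      let ?w = "D (s *\<^sub>R y)"
      have a: "((\<lambda>s. D (s *\<^sub>R y)) has_derivative (\<lambda>h. H.J ?w (\<delta> (G.Ji (s *\<^sub>R y) (h *\<^sub>R y))))) (at s within {0..1})"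
        by (rule has_derivative_compose[OF sder t(4)[OF tyt[OF s]]])
      have "(g2 has_derivative (\<lambda>h. H.D2 (D x) ?w (H.J ?w (\<delta> (G.Ji (s *\<^sub>R y) (h *\<^sub>R y)))))) (at s within {0..1})"
        unfolding g2_def
        by (rule has_derivative_compose[OF a H.m_right_has_derivative[OF D\<sigma>[OF xt] D\<sigma>[OF tyt[OF s]]]])
      moreover have "H.D2 (D x) ?w (H.J ?w w) = H.J (g2 s) w" for w
        unfolding g2_def
        by (rule blinfun_compose_eqD[OF H.D2_J[OF D\<sigma>[OF xt] D\<sigma>[OF tyt[OF s]]]])
          (use U(3)[OF inU[OF s]] in auto)
      ultimately show ?thesis
        by (simp add: has_vector_derivative_def k_def F_def blinfun.scaleR_right)
    qed
    have "g1 1 - g2 1 = 0"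
    proof (rule Gronwall_zero[where w = "\<lambda>s. g1 s - g2 s" and w' = "\<lambda>s. H.J (g1 s) (k s) - H.J (g2 s) (k s)"
          and C = "C * ((norm (F 0) + 1) * norm y)"])
      show "((\<lambda>s. g1 s - g2 s) has_vector_derivative H.J (g1 s) (k s) - H.J (g2 s) (k s)) (at s within {0..1})"
        if "s \<in> {0..1}" for s by (intro has_vector_derivative_diff d1 d2 that)
      fix s :: real assume s: "s \<in> {0..1}"
      have "g1 s \<in> ball 0 q" unfolding g1_def using z1(1)[OF s] t1(2) W(3) by blast
      moreover have "g2 s \<in> ball 0 q" unfolding g2_def using U(3)[OF inU[OF s]] by auto
      ultimately have l: "norm (H.J (g1 s) - H.J (g2 s)) \<le> C * norm (g1 s - g2 s)" by (rule lip)
      have "norm (k s) \<le> norm (F (s *\<^sub>R y)) * norm y" unfolding k_def by (rule norm_blinfun)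
      also have "\<dots> \<le> (norm (F 0) + 1) * norm y"
        using W(3)[of "s *\<^sub>R y"] tyt1[OF s] t1(2) by (intro mult_right_mono) (auto simp: subset_iff less_imp_le)
      finally have kb: "norm (k s) \<le> (norm (F 0) + 1) * norm y" .
      have "norm (H.J (g1 s) (k s) - H.J (g2 s) (k s)) = norm ((H.J (g1 s) - H.J (g2 s)) (k s))"
        by (simp add: blinfun.diff_left)
      also have "\<dots> \<le> norm (H.J (g1 s) - H.J (g2 s)) * norm (k s)" by (rule norm_blinfun)
      also have "\<dots> \<le> (C * norm (g1 s - g2 s)) * ((norm (F 0) + 1) * norm y)"
        using l kb order_trans[OF norm_ge_zero l] by (intro mult_mono) auto
      finally show "norm (H.J (g1 s) (k s) - H.J (g2 s) (k s)) \<le> C * ((norm (F 0) + 1) * norm y) * norm (g1 s - g2 s)"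
        by (simp add: mult_ac)
    next
      show "g1 0 - g2 0 = 0"
        using G.m_0_right[OF in\<sigma>(1)[OF xt]] H.m_0_right[OF D\<sigma>[OF xt]] by (simp add: g1_def g2_def D0)
    qed simp
    then show ?thesis by (simp add: g1_def g2_def)
  qed
  have ut: "u \<le> t"
  proof -
    have "ball (0::'a) u \<subseteq> ball 0 t" using u t1 by blast
    then show ?thesis using u(1) by (simp add: ball_subset_ball_iff)
  qed
  show ?thesis
    using u(1) ut t\<rho> smooth_on_subset[OF smD subset_ball[OF ut]] D\<rho> D0 D'0 hom
    by (intro exI[of _ u]) auto
qed

end

section \<open>Extension of local homomorphisms of simply connected groups\<close>

text \<open>\<open>H\<close> and its complement are both open, because points near y differ from y
  by a right factor in \<open>W\<close>, in either direction. This turns statements valid near 0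
  into global ones.\<close>

lemma connected_group_generated:
  fixes W H :: "'g::topological_group_add set"
  assumes "connected (UNIV :: 'g set)" "open W" "0 \<in> W" "0 \<in> H"
    and step: "\<And>y w. y \<in> H \<Longrightarrow> w \<in> W \<Longrightarrow> y + w \<in> H"
  shows "H = UNIV"
proof -
  have oH: "open H"
  proof (subst open_subopen, rule ballI)
    fix y assume "y \<in> H"
    let ?T = "(\<lambda>x. - y + x) -` W"
    have "open ?T" by (intro open_vimage assms continuous_intros)
    moreover have "y \<in> ?T" using assms(3) by simp
    moreover have "?T \<subseteq> H"
    proof
      fix x assume "x \<in> ?T"
      then show "x \<in> H" using step[OF \<open>y \<in> H\<close>, of "- y + x"] by simp
    qed
    ultimately show "\<exists>T. open T \<and> y \<in> T \<and> T \<subseteq> H" by blast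
  qed
  have oC: "open (- H)"
  proof (subst open_subopen, rule ballI)
    fix y assume "y \<in> - H"
    let ?T = "(\<lambda>x. - x + y) -` W"
    have "open ?T" by (intro open_vimage assms continuous_intros)
    moreover have "y \<in> ?T" using assms(3) by simp
    moreover have "?T \<subseteq> - H"
    proof
      fix x assume x: "x \<in> ?T"
      have "x \<notin> H"
      proof
        assume "x \<in> H"
        then show False using step[of x "- x + y"] x \<open>y \<in> - H\<close> by simp
      qed
      then show "x \<in> - H" by simp
    qed
    ultimately show "\<exists>T. open T \<and> y \<in> T \<and> T \<subseteq> - H" by blast
  qed
  show ?thesis
    using connectedD[OF assms(1) oH oC] assms(4) by auto
qed

locale local_group_hom =
  fixes U :: "'g::topological_group_add set" and f :: "'g \<Rightarrow> 'h::group_add"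
  assumes open_U: "open U" and zero_U: "0 \<in> U"
    and f_add: "\<And>x y. x \<in> U \<Longrightarrow> y \<in> U \<Longrightarrow> x + y \<in> U \<Longrightarrow> f (x + y) = f x + f y"
begin

lemma f_0: "f 0 = 0"
proof -
  have "f (0 + 0) = f 0 + f 0" by (rule f_add) (simp_all add: zero_U)
  then have "f 0 + 0 = f 0 + f 0" by (simp only: add_0_right)
  then show ?thesis by (simp only: add_left_cancel)
qed

text \<open>\<open>\<phi>\<close> is the development of \<open>h\<close> along \<open>f\<close>: its increments over short steps are the
  \<open>f\<close>-images of the increments of \<open>h\<close>.\<close>

definition dev :: "('z::metric_space \<Rightarrow> 'g) \<Rightarrow> 'z set \<Rightarrow> ('z \<Rightarrow> 'h) \<Rightarrow> bool" where
  "dev h S \<phi> \<longleftrightarrow> (\<exists>e>0. \<forall>z\<in>S. \<forall>w\<in>S. dist z w < e \<longrightarrow> - h z + h w \<in> U \<and> \<phi> w = \<phi> z + f (- h z + h w))"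

text \<open>The pairs whose increment leaves \<open>U\<close> form a closed set disjoint from the
  compact diagonal, hence at positive distance from it.\<close>

lemma increments_small:
  fixes h :: "'z::heine_borel \<Rightarrow> 'g"
  assumes "compact S" "continuous_on S h"
  shows "\<exists>e>0. \<forall>z\<in>S. \<forall>w\<in>S. dist z w < e \<longrightarrow> - h z + h w \<in> U"
proof -
  let ?g = "\<lambda>p. - h (fst p) + h (snd p)"
  have c1: "continuous_on (S \<times> S) (\<lambda>p. h (fst p))" "continuous_on (S \<times> S) (\<lambda>p. h (snd p))"
    by (auto intro!: continuous_on_compose2[OF assms(2)] continuous_intros)
  have c: "closed (S \<times> S \<inter> ?g -` (- U))"
    by (rule continuous_closed_preimage)
      (use c1 open_U assms(1) in \<open>simp_all add: continuous_on_add continuous_on_minus closed_Times compact_imp_closed closed_Compl\<close>)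
  have k: "compact ((\<lambda>z. (z, z)) ` S)"
    by (intro compact_continuous_image assms continuous_intros)
  have dj: "(\<lambda>z. (z, z)) ` S \<inter> (S \<times> S \<inter> ?g -` (- U)) = {}" using zero_U by auto
  obtain e where e: "e > 0" "\<And>x y. x \<in> (\<lambda>z. (z, z)) ` S \<Longrightarrow> y \<in> S \<times> S \<inter> ?g -` (- U) \<Longrightarrow> e \<le> dist x y"
    using separate_compact_closed[OF k c dj] by blast
  have "- h z + h w \<in> U" if "z \<in> S" "w \<in> S" "dist z w < e" for z w
  proof (rule ccontr)
    assume "- h z + h w \<notin> U"
    then have "e \<le> dist (z, z) (z, w)" using that by (intro e(2)) auto
    then show False using that(3) by (simp add: dist_Pair_Pair)
  qed
  then show ?thesis using e(1) by blast
qed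

text \<open>The value at z sums the f-images of the increments of h along the ray from 0 to z, cut
  into n steps. For nearby z and w the two rays are the sides of a ladder whose cells are so small
  that additivity of f applies to both triangles of each cell; hence the sums differ by the last
  rung.\<close>

lemma dev_exists:
  fixes h :: "'z::euclidean_space \<Rightarrow> 'g"
  assumes "compact S" "convex S" "0 \<in> S" "continuous_on S h"
  shows "\<exists>\<phi>. dev h S \<phi> \<and> \<phi> 0 = 0"
proof -
  obtain e where e: "e > 0" "\<And>z w. z \<in> S \<Longrightarrow> w \<in> S \<Longrightarrow> dist z w < e \<Longrightarrow> - h z + h w \<in> U"
    using increments_small[OF assms(1,4)] by blast
  obtain b where b: "b > 0" "\<And>z. z \<in> S \<Longrightarrow> norm z \<le> b"
    using compact_imp_bounded[OF assms(1)] bounded_pos by metis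
  \<comment> \<open>Every step is then shorter than e/2, so the diagonal of a cell, at most a rung
    below e/2 plus a step, stays below e.\<close>
  obtain n :: nat where n: "2 * b / e < real n" using reals_Archimedean2 by blast
  have "0 < 2 * b / e" using b(1) e(1) by simp
  then have "n > 0" using n by (cases n) auto
  have bn: "b / n < e / 2" using n e(1) \<open>n > 0\<close> by (simp add: field_simps)
  define pt where "pt = (\<lambda>(z::'z) k. (real k / n) *\<^sub>R z)"
  have ptS: "pt z k \<in> S" if "z \<in> S" "k \<le> n" for z k
  proof -
    have "(1 - real k / n) *\<^sub>R 0 + (real k / n) *\<^sub>R z \<in> S"
      using that \<open>n > 0\<close> assms(3) by (intro convexD_alt[OF assms(2)]) (auto simp: divide_simps)
    then show ?thesis by (simp add: pt_def)
  qed
  have step: "dist (pt z k) (pt z (Suc k)) < e / 2" if "z \<in> S" for z k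
  proof -
    have "pt z (Suc k) - pt z k = (1 / n) *\<^sub>R z"
      by (simp add: pt_def scaleR_diff_left[symmetric] diff_divide_distrib[symmetric])
    then have "dist (pt z k) (pt z (Suc k)) = norm z / n"
      by (simp add: dist_norm norm_minus_commute[of "pt z k"])
    also have "\<dots> \<le> b / n" using b(2)[OF that] by (intro divide_right_mono) auto
    finally show ?thesis using bn by linarith
  qed
  have cross: "dist (pt z k) (pt w k) \<le> dist z w" if "k \<le> n" for z w k
  proof -
    have "dist (pt z k) (pt w k) = real k / n * dist z w"
      by (simp add: pt_def dist_norm scaleR_diff_right[symmetric])
    also have "\<dots> \<le> 1 * dist z w" using that \<open>n > 0\<close> by (intro mult_right_mono) (auto simp: divide_simps)
    finally show ?thesis by simp
  qed
  define p where "p = (\<lambda>z. rec_nat 0 (\<lambda>k y. y + f (- h (pt z k) + h (pt z (Suc k)))))"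
  have p: "p z 0 = 0" "p z (Suc k) = p z k + f (- h (pt z k) + h (pt z (Suc k)))" for z k
    by (simp_all add: p_def)
  have cancel: "(- a + b) + (- b + c) = - a + c" for a b c :: 'g
    by (simp only: add.assoc) (simp add: add.assoc[symmetric])
  have ladder: "p w k = p z k + f (- h (pt z k) + h (pt w k))"
    if zw: "z \<in> S" "w \<in> S" "dist z w < e / 2" and "k \<le> n" for z w k
    using \<open>k \<le> n\<close>
  proof (induction k)
    case 0 then show ?case by (simp add: p pt_def f_0)
  next
    case (Suc k)
    let ?a = "h (pt z k)" and ?b = "h (pt w k)" and ?c = "h (pt w (Suc k))" and ?d = "h (pt z (Suc k))"
    have k: "k \<le> n" using Suc by simp
    have S: "pt z k \<in> S" "pt w k \<in> S" "pt w (Suc k) \<in> S" "pt z (Suc k) \<in> S" using zw Suc ptS by auto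
    have ab: "- ?a + ?b \<in> U" using e(2)[OF S(1,2)] cross[OF k, of z w] zw(3) e(1) by simp
    have bc: "- ?b + ?c \<in> U" using e(2)[OF S(2,3)] step[OF zw(2), of k] e(1) by simp
    have ad: "- ?a + ?d \<in> U" using e(2)[OF S(1,4)] step[OF zw(1), of k] e(1) by simp
    have dc: "- ?d + ?c \<in> U" using e(2)[OF S(4,3)] cross[OF Suc.prems, of z w] zw(3) e(1) by simp
    have ac: "- ?a + ?c \<in> U"
      using e(2)[OF S(1,3)] dist_triangle[of "pt z k" "pt w (Suc k)" "pt w k"]
        cross[OF k, of z w] zw(3) step[OF zw(2), of k] by linarith
    have 1: "f (- ?a + ?c) = f (- ?a + ?b) + f (- ?b + ?c)"
      using f_add[OF ab bc] ac by (simp only: cancel)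
    have 2: "f (- ?a + ?c) = f (- ?a + ?d) + f (- ?d + ?c)"
      using f_add[OF ad dc] ac by (simp only: cancel)
    show ?case unfolding p Suc.IH[OF k] using 1 2 by (simp add: add.assoc)
  qed
  have "dev h S (\<lambda>z. p z n)"
    unfolding dev_def
  proof (intro exI[of _ "e / 2"] conjI ballI impI)
    fix z w assume zw: "z \<in> S" "w \<in> S" "dist z w < e / 2"
    show "- h z + h w \<in> U" using e zw by simp
    show "p w n = p z n + f (- h z + h w)"
      using ladder[OF zw, of n] \<open>n > 0\<close> by (simp add: pt_def)
  qed (use e in simp)
  moreover have "p 0 k = 0" for k
    by (induction k) (simp_all add: p pt_def f_0)
  ultimately show ?thesis by blast
qed

text \<open>Both developments are multiplied on the right by the same increments, so \<phi> z -
  \<psi> z is locally constant.\<close>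

lemma dev_unique:
  assumes "dev h S \<phi>" "dev h S \<psi>" "connected S" "a \<in> S" "b \<in> S" "\<phi> a = \<psi> a"
  shows "\<phi> b = \<psi> b"
proof -
  obtain e1 where e1: "e1 > 0" "\<And>z w. z \<in> S \<Longrightarrow> w \<in> S \<Longrightarrow> dist z w < e1 \<Longrightarrow> \<phi> w = \<phi> z + f (- h z + h w)"
    using assms(1) unfolding dev_def by blast
  obtain e2 where e2: "e2 > 0" "\<And>z w. z \<in> S \<Longrightarrow> w \<in> S \<Longrightarrow> dist z w < e2 \<Longrightarrow> \<psi> w = \<psi> z + f (- h z + h w)"
    using assms(2) unfolding dev_def by blast
  have "(\<lambda>z. \<phi> z - \<psi> z) a = (\<lambda>z. \<phi> z - \<psi> z) b"
  proof (rule connected_local_const[OF assms(3-5)], rule ballI)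
    fix z assume z: "z \<in> S"
    show "eventually (\<lambda>w. \<phi> z - \<psi> z = \<phi> w - \<psi> w) (at z within S)"
      unfolding eventually_at
    proof (intro exI[of _ "min e1 e2"] conjI ballI impI)
      fix w assume w: "w \<in> S" "w \<noteq> z \<and> dist w z < min e1 e2"
      then have "\<phi> w = \<phi> z + f (- h z + h w)" "\<psi> w = \<psi> z + f (- h z + h w)"
        using e1(2)[OF z w(1)] e2(2)[OF z w(1)] by (auto simp: dist_commute)
      then show "\<phi> z - \<psi> z = \<phi> w - \<psi> w" by (simp add: diff_add_eq_diff_diff_swap)
    qed (use e1 e2 in simp)
  qed
  then show ?thesis using assms(6) by simp
qed

text \<open>A map that does not increase distances keeps the scale e in \<open>dev\<close>;
  restrictions to sides of a square, halves of paths and reversal are all of this kind.\<close>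

lemma dev_reparam:
  assumes "dev h S \<phi>" "\<And>t. t \<in> T \<Longrightarrow> r t \<in> S" "\<And>s t. s \<in> T \<Longrightarrow> t \<in> T \<Longrightarrow> dist (r s) (r t) \<le> dist s t"
    "\<And>t. t \<in> T \<Longrightarrow> g t = h (r t)"
  shows "dev g T (\<lambda>t. \<phi> (r t))"
proof -
  obtain e where e: "e > 0" "\<And>z w. z \<in> S \<Longrightarrow> w \<in> S \<Longrightarrow> dist z w < e \<Longrightarrow> - h z + h w \<in> U \<and> \<phi> w = \<phi> z + f (- h z + h w)"
    using assms(1) unfolding dev_def by blast
  show ?thesis
    unfolding dev_def
  proof (intro exI[of _ e] conjI ballI impI e(1))
    fix z w assume zw: "z \<in> T" "w \<in> T" "dist z w < e"
    then have "dist (r z) (r w) < e" using assms(3)[of z w] by simp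
    then show "- g z + g w \<in> U" "\<phi> (r w) = \<phi> (r z) + f (- g z + g w)"
      using e(2)[of "r z" "r w"] assms(2,4) zw by auto
  qed
qed

lemma dev_translate: "dev h S \<phi> \<Longrightarrow> dev (\<lambda>z. x + h z) S (\<lambda>z. c + \<phi> z)"
  unfolding dev_def by (simp only: minus_add add.assoc minus_add_cancel add_left_cancel)

lemma dev_const: "dev (\<lambda>_. c) S (\<lambda>_. d)"
  unfolding dev_def by (auto simp: zero_U f_0 intro!: exI[of _ 1])

text \<open>A null-homotopy is developed over the whole square. Two opposite sides carry the same
  curve because the homotopy runs through loops, and on the side of the constant loop the
  development is constant; comparing the corners gives the claim.\<close>

lemma dev_loop:
  assumes sc: "simply_connected (UNIV :: 'g set)"
    and p: "path p" "pathfinish p = pathstart p" and d: "dev p {0..1} \<psi>"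
  shows "\<psi> 1 = \<psi> 0"
proof -
  have "homotopic_loops UNIV p (\<lambda>_. p 0)"
    using sc p unfolding simply_connected_def by (auto simp: path_def pathfinish_def pathstart_def)
  then obtain h where h: "continuous_on ({0..1::real} \<times> {0..1}) h"
    "\<And>x. x \<in> {0..1} \<Longrightarrow> h (0, x) = p x" "\<And>x. x \<in> {0..1} \<Longrightarrow> h (1, x) = p 0"
    "\<And>t. t \<in> {0..1} \<Longrightarrow> h (t, 1) = h (t, 0)"
    unfolding homotopic_loops by (auto simp: pathfinish_def pathstart_def)
  let ?S = "{0..1::real} \<times> {0..1::real}"
  obtain \<phi> where \<phi>: "dev h ?S \<phi>" "\<phi> 0 = 0"
    using dev_exists[OF _ _ _ h(1)] by (auto simp: compact_Times convex_Times zero_prod_def)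
  have c01: "connected {0..1::real}" by simp
  have side: "dev (\<lambda>t. h (t, c)) {0..1} (\<lambda>t. \<phi> (t, c))" if "c \<in> {0..1}" for c
    by (rule dev_reparam[OF \<phi>(1)]) (use that in \<open>auto simp: dist_Pair_Pair\<close>)
  have "dev p {0..1} (\<lambda>x. \<phi> (0, x))"
    by (rule dev_reparam[OF \<phi>(1)]) (use h(2) in \<open>auto simp: dist_Pair_Pair\<close>)
  from dev_unique[OF d dev_translate[OF this, of 0 "\<psi> 0 - \<phi> (0, 0)", simplified] c01, of 0 1]
  have 1: "\<psi> 1 = \<psi> 0 - \<phi> (0, 0) + \<phi> (0, 1)" by simp
  have "dev (\<lambda>_. p 0) {0..1} (\<lambda>x. \<phi> (1, x))"
    by (rule dev_reparam[OF \<phi>(1)]) (use h(3) in \<open>auto simp: dist_Pair_Pair\<close>)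
  from dev_unique[OF this dev_const[of "p 0" _ "\<phi> (1, 0)"] c01, of 0 1]
  have 2: "\<phi> (1, 1) = \<phi> (1, 0)" by simp
  have "dev (\<lambda>t. h (t, 0)) {0..1} (\<lambda>t. \<phi> (t, 1))"
    by (rule dev_reparam[OF \<phi>(1)]) (use h(4) in \<open>auto simp: dist_Pair_Pair\<close>)
  from dev_unique[OF this side[of 0] c01, of 1 0] 2 have "\<phi> (0, 1) = \<phi> (0, 0)" by simp
  with 1 show ?thesis by simp
qed

lemma dev_path_exists: "path p \<Longrightarrow> \<exists>\<phi>. dev p {0..1} \<phi> \<and> \<phi> 0 = 0"
  unfolding path_def by (rule dev_exists) auto

lemma dev_join:
  assumes "dev (p +++ q) {0..1} \<psi>" "pathfinish p = pathstart q"
  shows "dev p {0..1} (\<lambda>t. \<psi> (t / 2))" "dev q {0..1} (\<lambda>t. \<psi> ((t + 1) / 2))"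
proof -
  show "dev p {0..1} (\<lambda>t. \<psi> (t / 2))"
    by (rule dev_reparam[OF assms(1)]) (auto simp: dist_real_def joinpaths_def)
  show "dev q {0..1} (\<lambda>t. \<psi> ((t + 1) / 2))"
  proof (rule dev_reparam[OF assms(1)])
    fix t :: real assume t: "t \<in> {0..1}"
    show "q t = (p +++ q) ((t + 1) / 2)"
      using t assms(2) by (cases "t = 0") (auto simp: joinpaths_def pathfinish_def pathstart_def add_divide_distrib)
    fix s :: real
    have "(s + 1) / 2 - (t + 1) / 2 = (s - t) / 2" by (simp add: field_simps)
    then show "dist ((s + 1) / 2) ((t + 1) / 2) \<le> dist s t" by (simp only: dist_real_def) simp
  qed auto
qed

text \<open>Develop the loop \<open>p\<close> followed by the reverse of \<open>q\<close>. At the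
  midpoint the value is that of \<phi> at the end of \<open>p\<close>; the end value is 0 by
  \<open>dev_loop\<close>, so the second half read backwards is the development along
  \<open>q\<close>.\<close>

lemma dev_endpoint_unique:
  assumes sc: "simply_connected (UNIV :: 'g set)"
    and p: "path p" "pathstart p = 0" "dev p {0..1} \<phi>" "\<phi> 0 = 0"
    and q: "path q" "pathstart q = 0" "dev q {0..1} \<psi>" "\<psi> 0 = 0"
    and "pathfinish p = pathfinish q"
  shows "\<phi> 1 = \<psi> 1"
proof -
  let ?l = "p +++ reversepath q"
  have "path ?l" using p q assms by simp
  then obtain \<theta> where \<theta>: "dev ?l {0..1} \<theta>" "\<theta> 0 = 0" using dev_path_exists by blast
  have "\<theta> 1 = \<theta> 0" by (rule dev_loop[OF sc \<open>path ?l\<close> _ \<theta>(1)]) (use p q in simp)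
  have c01: "connected {0..1::real}" by simp
  have j: "pathfinish p = pathstart (reversepath q)" using assms by simp
  have "\<theta> (1 / 2) = \<phi> 1"
    by (rule dev_unique[where a = 0, OF dev_join(1)[OF \<theta>(1) j] p(3) c01]) (use \<theta>(2) p(4) in simp_all)
  moreover have "dev q {0..1} (\<lambda>t. \<theta> ((1 - t + 1) / 2))"
  proof (rule dev_reparam[where r = "\<lambda>t. 1 - t", OF dev_join(2)[OF \<theta>(1) j]])
    show "dist (1 - s) (1 - t) \<le> dist s t" for s t :: real unfolding dist_real_def by linarith
  qed (auto simp: reversepath_def)
  then have "\<theta> ((1 - 1 + 1) / 2) = \<psi> 1"
    by (rule dev_unique[where a = 0, OF _ q(3) c01]) (use \<open>\<theta> 1 = \<theta> 0\<close> \<theta>(2) q(4) in simp_all)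
  ultimately show ?thesis by simp
qed

text \<open>The extension at x is the end value of the development along any path from 0 to x.
  Appending a short path multiplies it by an f-value, and the set of y with F(x + y) = F x + F y for
  all x is stable under such small right factors, hence everything.\<close>

theorem extend_homomorphism:
  assumes conn: "connected (UNIV :: 'g set)" and sc: "simply_connected (UNIV :: 'g set)"
    and lpc: "\<And>V::'g set. open V \<Longrightarrow> 0 \<in> V \<Longrightarrow> \<exists>W. open W \<and> 0 \<in> W \<and>
      (\<forall>u\<in>W. \<exists>q. path q \<and> path_image q \<subseteq> V \<and> pathstart q = 0 \<and> pathfinish q = u)"
  shows "\<exists>F W. open W \<and> 0 \<in> W \<and> (\<forall>u\<in>W. F u = f u) \<and> (\<forall>x y. F (x + y) = F x + F y)"
proof -
  have trans: "path (\<lambda>t. x + q t)" if "path q" for x :: 'g and q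
    using that unfolding path_def by (intro continuous_intros)
  have c01: "connected {0..1::real}" by simp
  have pc: "\<exists>p. path p \<and> pathstart p = 0 \<and> pathfinish p = x" for x :: 'g
  proof -
    obtain W :: "'g set" where W: "open W" "0 \<in> W"
      "\<And>u. u \<in> W \<Longrightarrow> \<exists>q. path q \<and> pathstart q = 0 \<and> pathfinish q = u"
      using lpc[of UNIV] by auto
    have "{x. \<exists>p. path p \<and> pathstart p = 0 \<and> pathfinish p = (x::'g)} = UNIV"
    proof (rule connected_group_generated[OF conn W(1,2)], goal_cases)
      case 1 then show ?case using W by auto
    next
      case (2 y w)
      then obtain p where p: "path p" "pathstart p = 0" "pathfinish p = y" by auto
      obtain q where q: "path q" "pathstart q = 0" "pathfinish q = w" using W(3) 2 by blast
      have "path (p +++ (\<lambda>t. y + q t))" using p q trans[OF q(1)] by (simp add: pathfinish_def pathstart_def)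
      then show ?case using p q
        by (intro CollectI exI[of _ "p +++ (\<lambda>t. y + q t)"]) (simp add: pathfinish_def pathstart_def joinpaths_def)
    qed
    then show ?thesis by blast
  qed
  define F where "F = (\<lambda>x. THE y. \<exists>p \<phi>. path p \<and> pathstart p = 0 \<and> pathfinish p = x \<and> dev p {0..1} \<phi> \<and> \<phi> 0 = 0 \<and> y = \<phi> 1)"
  have F: "F (pathfinish p) = \<phi> 1" if "path p" "pathstart p = 0" "dev p {0..1} \<phi>" "\<phi> 0 = 0" for p \<phi>
    unfolding F_def by (rule the_equality) (use that dev_endpoint_unique[OF sc] in blast)+
  have "open ((\<lambda>p. - fst p + snd p) -` U)"
    by (intro open_vimage open_U continuous_intros)
  moreover have "(0, 0) \<in> (\<lambda>p. - fst p + snd p) -` U" using zero_U by simp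
  ultimately obtain A B where AB: "open A" "open B" "(0, 0) \<in> A \<times> B" "A \<times> B \<subseteq> (\<lambda>p. - fst p + snd p) -` U"
    by (rule open_prod_elim)
  \<comment> \<open>Differences of points of \<open>V\<close> lie in \<open>U\<close>, so along a
    path inside \<open>V\<close> the development is f itself.\<close>
  define V where "V = A \<inter> B \<inter> U"
  have V: "open V" "0 \<in> V" using AB open_U zero_U by (auto simp: V_def)
  have VU: "a \<in> U" "- a + b \<in> U" if "a \<in> V" "b \<in> V" for a b
    using that AB(4) by (auto simp: V_def)
  obtain W where W: "open W" "0 \<in> W"
    "\<And>u. u \<in> W \<Longrightarrow> \<exists>q. path q \<and> path_image q \<subseteq> V \<and> pathstart q = 0 \<and> pathfinish q = u"
    using lpc[OF V] by blast
  have step: "F (x + u) = F x + f u" if "u \<in> W" for x u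
  proof -
    obtain p where p: "path p" "pathstart p = 0" "pathfinish p = x" using pc by blast
    obtain q where q: "path q" "path_image q \<subseteq> V" "pathstart q = 0" "pathfinish q = u" using W(3)[OF \<open>u \<in> W\<close>] by blast
    let ?q = "\<lambda>t. x + q t"
    have q': "path ?q" "pathstart ?q = x" "pathfinish ?q = x + u"
      using trans[OF q(1)] q(3,4) by (auto simp: pathstart_def pathfinish_def)
    have l: "path (p +++ ?q)" "pathstart (p +++ ?q) = 0" "pathfinish (p +++ ?q) = x + u" using p q' by auto
    obtain \<psi> where \<psi>: "dev (p +++ ?q) {0..1} \<psi>" "\<psi> 0 = 0" using dev_path_exists[OF l(1)] by blast
    have j: "pathfinish p = pathstart ?q" using p q' by simp
    have Fx: "F x = \<psi> (1 / 2)"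
      using F[OF p(1,2) dev_join(1)[OF \<psi>(1) j]] \<psi>(2) p(3) by simp
    have Fxu: "F (x + u) = \<psi> 1" using F[OF l(1,2) \<psi>] l(3) by simp
    have qV: "q t \<in> V" if "t \<in> {0..1}" for t using q(2) that unfolding path_image_def by blast
    have "dev q {0..1} (\<lambda>t. f (q t))"
      unfolding dev_def
    proof (intro exI[of _ 1] conjI ballI impI)
      fix s t :: real assume st: "s \<in> {0..1}" "t \<in> {0..1}"
      show d: "- q s + q t \<in> U" using VU(2) qV st by blast
      have "q s + (- q s + q t) = q t" by (simp add: add.assoc[symmetric])
      then show "f (q t) = f (q s) + f (- q s + q t)"
        using f_add[OF VU(1)[OF qV[OF st(1)] qV[OF st(1)]] d] VU(1)[OF qV[OF st(2)] qV[OF st(2)]] by simp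
    qed simp
    from dev_translate[OF this, of x "\<psi> (1 / 2)"]
    have "dev ?q {0..1} (\<lambda>t. \<psi> (1 / 2) + f (q t))" .
    with dev_join(2)[OF \<psi>(1) j] have "\<psi> ((1 + 1) / 2) = \<psi> (1 / 2) + f (q 1)"
      by (rule dev_unique[where a = 0, OF _ _ c01]) (use q(3) in \<open>simp_all add: pathstart_def f_0\<close>)
    then have "\<psi> 1 = \<psi> (1 / 2) + f u"
      using q(4) by (simp add: pathfinish_def)
    then show ?thesis unfolding Fx Fxu .
  qed
  have F0: "F 0 = 0"
  proof -
    have "path (\<lambda>_::real. 0::'g)" by (simp add: path_def)
    moreover have "pathstart (\<lambda>_::real. 0::'g) = 0" by (simp add: pathstart_def)
    ultimately have "F (pathfinish (\<lambda>_::real. 0)) = 0" by (rule F[OF _ _ dev_const refl])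
    then show ?thesis by (simp only: pathfinish_def)
  qed
  have FW: "F u = f u" if "u \<in> W" for u using step[OF that, of 0] unfolding F0 by simp
  have "{y. \<forall>x. F (x + y) = F x + F y} = UNIV"
  proof (rule connected_group_generated[OF conn W(1,2)], goal_cases)
    case 1 then show ?case by (simp add: F0)
  next
    case (2 y w)
    have "F (x + (y + w)) = F x + F (y + w)" for x
      using step[OF 2(2), of "x + y"] step[OF 2(2), of y] 2(1) by (simp only: add.assoc[symmetric] mem_Collect_eq)
    then show ?case by blast
  qed
  then have "\<forall>x y. F (x + y) = F x + F y" by blast
  then show ?thesis using W(1,2) FW by (intro exI[of _ F] exI[of _ W]) simp
qed

end

section \<open>Smooth maps into Lie groups\<close>

lemma smooth_on_eq: "open S \<Longrightarrow> smooth_on S f \<Longrightarrow> (\<And>x. x \<in> S \<Longrightarrow> f x = g x) \<Longrightarrow> smooth_on S g"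
  using smooth_on_cong by blast

locale lie =
  fixes \<A> :: "('g::{topological_group_add,t2_space,second_countable_topology}, 'm::euclidean_space) atlas"
  assumes lie: "lie_group \<A>"
begin

lemma chartD:
  assumes "(W, d) \<in> \<A>"
  shows "open W" "open (d ` W)" "homeomorphism W (d ` W) d (inv_into W d)"
  using lie assms unfolding lie_group_def smooth_atlas_def by blast+

lemma chart_inv: "(W, d) \<in> \<A> \<Longrightarrow> x \<in> W \<Longrightarrow> inv_into W d (d x) = x"
  using chartD(3) by (simp add: homeomorphism_def)

lemma chart_inv_in: "(W, d) \<in> \<A> \<Longrightarrow> y \<in> d ` W \<Longrightarrow> inv_into W d y \<in> W"
  by (rule inv_into_into)

lemma chart_inv2: "(W, d) \<in> \<A> \<Longrightarrow> y \<in> d ` W \<Longrightarrow> d (inv_into W d y) = y"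
  by (rule f_inv_into_f)

lemma smooth_mult:
  assumes W: "(W, d) \<in> \<A>" and V: "(V, k) \<in> \<A>" and E: "(E, e) \<in> \<A>"
  shows "smooth_on {(y, z). y \<in> d ` W \<and> z \<in> k ` V \<and> inv_into W d y + inv_into V k z \<in> E}
    (\<lambda>(y, z). e (inv_into W d y + inv_into V k z))"
proof -
  note 1 = bspec[OF conjunct1[OF conjunct2[OF lie[unfolded lie_group_def]]] W, unfolded prod.case]
  note 2 = bspec[OF 1 V, unfolded prod.case]
  show ?thesis by (rule bspec[OF 2 E, unfolded prod.case])
qed

lemma smooth_inverse:
  assumes W: "(W, d) \<in> \<A>" and E: "(E, e) \<in> \<A>"
  shows "smooth_on {y. y \<in> d ` W \<and> - inv_into W d y \<in> E} (\<lambda>y. e (- inv_into W d y))"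
proof -
  note 1 = bspec[OF conjunct2[OF conjunct2[OF lie[unfolded lie_group_def]]] W, unfolded prod.case]
  show ?thesis by (rule bspec[OF 1 E, unfolded prod.case])
qed

lemma chart_at: "\<exists>W d. (W, d) \<in> \<A> \<and> x \<in> W"
proof -
  have "x \<in> (\<Union>(U, c)\<in>\<A>. U)" using lie unfolding lie_group_def smooth_atlas_def by simp
  then show ?thesis by auto
qed

text \<open>The parameter space is Euclidean and only the target is a manifold, so coordinate
  expressions are handled by the calculus of \<open>smooth_on\<close> and no atlas on the source is
  involved.\<close>

definition smooth_into :: "'e::euclidean_space set \<Rightarrow> ('e \<Rightarrow> 'g) \<Rightarrow> bool" where
  "smooth_into S F \<longleftrightarrow> open S \<and> continuous_on S F \<and> (\<forall>(W, d)\<in>\<A>. smooth_on (S \<inter> F -` W) (\<lambda>s. d (F s)))"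

lemma smooth_intoD:
  assumes "smooth_into S F"
  shows "open S" "continuous_on S F" "(W, d) \<in> \<A> \<Longrightarrow> smooth_on (S \<inter> F -` W) (\<lambda>s. d (F s))"
  using assms unfolding smooth_into_def by auto

lemma smooth_into_preimage: "smooth_into S F \<Longrightarrow> open W \<Longrightarrow> open (S \<inter> F -` W)"
  using smooth_intoD(1,2) continuous_open_preimage by blast

lemma smooth_into_const: "open S \<Longrightarrow> smooth_into S (\<lambda>_. x)"
  unfolding smooth_into_def by auto

lemma smooth_into_chart:
  assumes "(W, d) \<in> \<A>"
  shows "smooth_into (d ` W) (inv_into W d)"
  unfolding smooth_into_def
proof (intro conjI ballI)
  show "open (d ` W)" "continuous_on (d ` W) (inv_into W d)"
    using chartD[OF assms] by (auto simp: homeomorphism_def)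
  fix p assume "p \<in> \<A>"
  moreover obtain V e where p: "p = (V, e)" by (cases p)
  ultimately have "smooth_on (d ` (W \<inter> V)) (e \<circ> inv_into W d)"
    using lie assms unfolding lie_group_def smooth_atlas_def by blast
  moreover have "d ` W \<inter> inv_into W d -` V = d ` (W \<inter> V)"
    using chart_inv[OF assms] by force
  ultimately show "case p of (V, e) \<Rightarrow> smooth_on (d ` W \<inter> inv_into W d -` V) (\<lambda>s. e (inv_into W d s))"
    by (simp add: p o_def)
qed

lemma smooth_into_compose:
  assumes "smooth_into T F" "open S" "smooth_on S g" "g ` S \<subseteq> T"
  shows "smooth_into S (\<lambda>s. F (g s))"
  unfolding smooth_into_def
proof (intro conjI ballI)
  show "open S" by fact
  show "continuous_on S (\<lambda>s. F (g s))"
    using continuous_on_compose2[OF smooth_intoD(2)[OF assms(1)] smooth_on_imp_continuous_on[OF assms(3)] assms(4)] .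
  fix p assume p: "p \<in> \<A>"
  obtain W d where Wd: "p = (W, d)" by (cases p)
  have W: "(W, d) \<in> \<A>" using p Wd by simp
  have o: "open (T \<inter> F -` W)" by (rule smooth_into_preimage[OF assms(1) chartD(1)[OF W]])
  have "open (S \<inter> g -` (T \<inter> F -` W))"
    by (rule continuous_open_preimage[OF smooth_on_imp_continuous_on[OF assms(3)] assms(2) o])
  moreover have "S \<inter> g -` (T \<inter> F -` W) = S \<inter> (\<lambda>s. F (g s)) -` W" using assms(4) by auto
  ultimately have "open (S \<inter> (\<lambda>s. F (g s)) -` W)" by simp
  from smooth_on_compose[OF this o smooth_intoD(3)[OF assms(1) W] smooth_on_subset[OF assms(3)]]
  show "case p of (W, d) \<Rightarrow> smooth_on (S \<inter> (\<lambda>s. F (g s)) -` W) (\<lambda>s. d (F (g s)))"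
    using assms(4) unfolding Wd by auto
qed

lemma smooth_into_add:
  assumes "smooth_into S F" "smooth_into S G"
  shows "smooth_into S (\<lambda>s. F s + G s)"
  unfolding smooth_into_def
proof (intro conjI ballI)
  show "open S" using smooth_intoD(1)[OF assms(1)] .
  show cont: "continuous_on S (\<lambda>s. F s + G s)"
    using smooth_intoD(2)[OF assms(1)] smooth_intoD(2)[OF assms(2)] by (intro continuous_intros)
  fix p assume p: "p \<in> \<A>"
  obtain E e where Ee: "p = (E, e)" by (cases p)
  have E: "(E, e) \<in> \<A>" using p Ee by simp
  have "smooth_on (S \<inter> (\<lambda>s. F s + G s) -` E) (\<lambda>s. e (F s + G s))"
  proof (rule smooth_on_local)
    fix s assume s: "s \<in> S \<inter> (\<lambda>s. F s + G s) -` E"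
    obtain W d where W: "(W, d) \<in> \<A>" "F s \<in> W" using chart_at by blast
    obtain V k where V: "(V, k) \<in> \<A>" "G s \<in> V" using chart_at by blast
    define T where "T = (S \<inter> F -` W) \<inter> (S \<inter> G -` V) \<inter> (S \<inter> (\<lambda>s. F s + G s) -` E)"
    have oT: "open T"
      unfolding T_def
      by (intro open_Int smooth_into_preimage[OF assms(1)] smooth_into_preimage[OF assms(2)] chartD(1)[OF W(1)]
          chartD(1)[OF V(1)] continuous_open_preimage[OF cont] chartD(1)[OF E] smooth_intoD(1)[OF assms(1)])
    define P where "P = {(y, z). y \<in> d ` W \<and> z \<in> k ` V \<and> inv_into W d y + inv_into V k z \<in> E}"
    have smP: "smooth_on P (\<lambda>(y, z). e (inv_into W d y + inv_into V k z))"
      unfolding P_def by (rule smooth_mult[OF W(1) V(1) E])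
    have "continuous_on (d ` W \<times> k ` V) (\<lambda>q. inv_into W d (fst q))"
      by (rule continuous_on_compose2[OF smooth_intoD(2)[OF smooth_into_chart[OF W(1)]] continuous_on_fst[OF continuous_on_id]]) auto
    moreover have "continuous_on (d ` W \<times> k ` V) (\<lambda>q. inv_into V k (snd q))"
      by (rule continuous_on_compose2[OF smooth_intoD(2)[OF smooth_into_chart[OF V(1)]] continuous_on_snd[OF continuous_on_id]]) auto
    ultimately have "continuous_on (d ` W \<times> k ` V) (\<lambda>q. inv_into W d (fst q) + inv_into V k (snd q))"
      by (rule continuous_on_add)
    from continuous_open_preimage[OF this open_Times[OF chartD(2)[OF W(1)] chartD(2)[OF V(1)]] chartD(1)[OF E]]
    have "open ((d ` W \<times> k ` V) \<inter> (\<lambda>q. inv_into W d (fst q) + inv_into V k (snd q)) -` E)" .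
    moreover have "(d ` W \<times> k ` V) \<inter> (\<lambda>q. inv_into W d (fst q) + inv_into V k (snd q)) -` E = P"
      by (auto simp: P_def)
    ultimately have oP: "open P" by simp
    have "smooth_on T (\<lambda>s. (d (F s), k (G s)))"
      by (rule smooth_on_Pair[OF oT smooth_on_subset[OF smooth_intoD(3)[OF assms(1) W(1)]]
            smooth_on_subset[OF smooth_intoD(3)[OF assms(2) V(1)]]]) (auto simp: T_def)
    moreover have "(\<lambda>s. (d (F s), k (G s))) ` T \<subseteq> P"
      using chart_inv[OF W(1)] chart_inv[OF V(1)] by (auto simp: P_def T_def)
    ultimately have "smooth_on T (\<lambda>s. (\<lambda>(y, z). e (inv_into W d y + inv_into V k z)) (d (F s), k (G s)))"
      by (rule smooth_on_compose[OF oT oP smP])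
    moreover have "(\<lambda>(y, z). e (inv_into W d y + inv_into V k z)) (d (F s), k (G s)) = e (F s + G s)" if "s \<in> T" for s
      using that chart_inv[OF W(1)] chart_inv[OF V(1)] by (simp add: T_def)
    ultimately have "smooth_on T (\<lambda>s. e (F s + G s))"
      by (rule smooth_on_eq[OF oT])
    then show "\<exists>T. open T \<and> s \<in> T \<and> smooth_on T (\<lambda>s. e (F s + G s))"
      using oT s W V by (intro exI[of _ T]) (auto simp: T_def)
  qed
  then show "case p of (E, e) \<Rightarrow> smooth_on (S \<inter> (\<lambda>s. F s + G s) -` E) (\<lambda>s. e (F s + G s))" unfolding Ee by simp
qed

lemma smooth_into_uminus:
  assumes "smooth_into S F"
  shows "smooth_into S (\<lambda>s. - F s)"
  unfolding smooth_into_def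
proof (intro conjI ballI)
  show "open S" using smooth_intoD(1)[OF assms(1)] .
  show cont: "continuous_on S (\<lambda>s. - F s)"
    using smooth_intoD(2)[OF assms(1)] by (intro continuous_intros)
  fix p assume p: "p \<in> \<A>"
  obtain E e where Ee: "p = (E, e)" by (cases p)
  have E: "(E, e) \<in> \<A>" using p Ee by simp
  have "smooth_on (S \<inter> (\<lambda>s. - F s) -` E) (\<lambda>s. e (- F s))"
  proof (rule smooth_on_local)
    fix s assume s: "s \<in> S \<inter> (\<lambda>s. - F s) -` E"
    obtain W d where W: "(W, d) \<in> \<A>" "F s \<in> W" using chart_at by blast
    define T where "T = (S \<inter> F -` W) \<inter> (S \<inter> (\<lambda>s. - F s) -` E)"
    have oT: "open T"
      unfolding T_def
      by (intro open_Int smooth_into_preimage[OF assms(1)] chartD(1)[OF W(1)]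
          continuous_open_preimage[OF cont] chartD(1)[OF E] smooth_intoD(1)[OF assms(1)])
    define P where "P = {y. y \<in> d ` W \<and> - inv_into W d y \<in> E}"
    have smP: "smooth_on P (\<lambda>y. e (- inv_into W d y))"
      unfolding P_def by (rule smooth_inverse[OF W(1) E])
    have "continuous_on (d ` W) (\<lambda>q. - inv_into W d q)"
      by (intro continuous_on_minus smooth_intoD(2)[OF smooth_into_chart[OF W(1)]])
    from continuous_open_preimage[OF this chartD(2)[OF W(1)] chartD(1)[OF E]]
    have "open (d ` W \<inter> (\<lambda>q. - inv_into W d q) -` E)" .
    moreover have "d ` W \<inter> (\<lambda>q. - inv_into W d q) -` E = P" by (auto simp: P_def)
    ultimately have oP: "open P" by simp
    have "smooth_on T (\<lambda>s. d (F s))"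
      by (rule smooth_on_subset[OF smooth_intoD(3)[OF assms(1) W(1)]]) (auto simp: T_def)
    moreover have "(\<lambda>s. d (F s)) ` T \<subseteq> P"
      using chart_inv[OF W(1)] by (auto simp: P_def T_def)
    ultimately have "smooth_on T (\<lambda>s. e (- inv_into W d (d (F s))))"
      by (rule smooth_on_compose[OF oT oP smP])
    moreover have "e (- inv_into W d (d (F s))) = e (- F s)" if "s \<in> T" for s
      using that chart_inv[OF W(1)] by (simp add: T_def)
    ultimately have "smooth_on T (\<lambda>s. e (- F s))"
      by (rule smooth_on_eq[OF oT])
    then show "\<exists>T. open T \<and> s \<in> T \<and> smooth_on T (\<lambda>s. e (- F s))"
      using oT s W by (intro exI[of _ T]) (auto simp: T_def)
  qed
  then show "case p of (E, e) \<Rightarrow> smooth_on (S \<inter> (\<lambda>s. - F s) -` E) (\<lambda>s. e (- F s))" unfolding Ee by simp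
qed

lemma smooth_function_into:
  assumes "f \<in> smooth_functions \<A>" "smooth_into S F"
  shows "smooth_on S (\<lambda>s. f (F s))"
proof (rule smooth_on_local)
  fix s assume s: "s \<in> S"
  obtain W d where W: "(W, d) \<in> \<A>" "F s \<in> W" using chart_at by blast
  have o: "open (S \<inter> F -` W)" by (rule smooth_into_preimage[OF assms(2) chartD(1)[OF W(1)]])
  have f: "smooth_on (d ` W) (f \<circ> inv_into W d)"
    using assms(1) W(1) unfolding smooth_functions_def by blast
  have "smooth_on (S \<inter> F -` W) (\<lambda>s. (f \<circ> inv_into W d) (d (F s)))"
    by (rule smooth_on_compose[OF o chartD(2)[OF W(1)] f smooth_intoD(3)[OF assms(2) W(1)]]) auto
  moreover have "(f \<circ> inv_into W d) (d (F s)) = f (F s)" if "s \<in> S \<inter> F -` W" for s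
    using chart_inv[OF W(1)] that by simp
  ultimately have "smooth_on (S \<inter> F -` W) (\<lambda>s. f (F s))"
    by (rule smooth_on_eq[OF o])
  then show "\<exists>T. open T \<and> s \<in> T \<and> smooth_on T (\<lambda>s. f (F s))" using o s W by blast
qed

lemma smooth_functionI:
  assumes "\<And>W d. (W, d) \<in> \<A> \<Longrightarrow> smooth_on (d ` W) (\<lambda>y. f (inv_into W d y))"
  shows "f \<in> smooth_functions \<A>"
  using assms by (auto simp: smooth_functions_def o_def)

lemma smooth_functionD: "f \<in> smooth_functions \<A> \<Longrightarrow> (W, d) \<in> \<A> \<Longrightarrow> smooth_on (d ` W) (\<lambda>y. f (inv_into W d y))"
  by (auto simp: smooth_functions_def o_def)

lemma smooth_function_const: "(\<lambda>_. a) \<in> smooth_functions \<A>"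
  by (rule smooth_functionI) auto

lemma smooth_function_add:
  "f \<in> smooth_functions \<A> \<Longrightarrow> g \<in> smooth_functions \<A> \<Longrightarrow> (\<lambda>x. f x + g x) \<in> smooth_functions \<A>"
  by (rule smooth_functionI) (rule smooth_on_add[OF chartD(2) smooth_functionD smooth_functionD]; assumption)

lemma smooth_function_mult:
  "f \<in> smooth_functions \<A> \<Longrightarrow> g \<in> smooth_functions \<A> \<Longrightarrow> (\<lambda>x. f x * g x) \<in> smooth_functions \<A>"
  by (rule smooth_functionI) (rule smooth_on_mult[OF chartD(2) smooth_functionD smooth_functionD]; assumption)

lemma smooth_function_sum:
  "(\<And>i. i \<in> I \<Longrightarrow> f i \<in> smooth_functions \<A>) \<Longrightarrow> (\<lambda>x. \<Sum>i\<in>I. f i x) \<in> smooth_functions \<A>"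
  by (rule smooth_functionI) (rule smooth_on_sum[OF chartD(2) smooth_functionD]; blast)

lemma smooth_function_power: "f \<in> smooth_functions \<A> \<Longrightarrow> (\<lambda>x. f x ^ k) \<in> smooth_functions \<A>"
  by (induction k) (simp_all add: smooth_function_const smooth_function_mult)

lemma smooth_function_translate:
  assumes "f \<in> smooth_functions \<A>"
  shows "(\<lambda>x. f (y + x)) \<in> smooth_functions \<A>"
proof (rule smooth_functionI)
  fix W d assume W: "(W, d) \<in> \<A>"
  show "smooth_on (d ` W) (\<lambda>z. f (y + inv_into W d z))"
    by (rule smooth_function_into[OF assms smooth_into_add[OF smooth_into_const[OF chartD(2)[OF W]] smooth_into_chart[OF W]]])
qed

lemma smooth_function_continuous:
  assumes "f \<in> smooth_functions \<A>"
  shows "continuous_on UNIV f"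
proof (rule continuous_at_imp_continuous_on, rule ballI)
  fix x
  obtain W d where W: "(W, d) \<in> \<A>" "x \<in> W" using chart_at by blast
  have "continuous_on W (\<lambda>x. f (inv_into W d (d x)))"
    by (rule continuous_on_compose2[OF smooth_on_imp_continuous_on[OF smooth_functionD[OF assms W(1)]]])
      (use chartD(3)[OF W(1)] in \<open>auto simp: homeomorphism_def\<close>)
  then have "continuous_on W f"
    using chart_inv[OF W(1)] by (simp cong: continuous_on_cong)
  then show "isCont f x" using chartD(1)[OF W(1)] W(2) continuous_on_eq_continuous_at by blast
qed

end

section \<open>Left-invariant vector fields\<close>

locale lie_chart = lie \<A>
  for \<A> :: "('g::{topological_group_add,t2_space,second_countable_topology}, 'm::euclidean_space) atlas" +
  fixes U :: "'g set" and c :: "'g \<Rightarrow> 'm"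
  assumes U_chart: "(U, c) \<in> \<A>" and zero_U: "0 \<in> U"
begin

section \<open>The chart centred at the identity\<close>

definition \<kappa> :: "'g \<Rightarrow> 'm" where "\<kappa> x = c x - c 0"
definition \<xi> :: "'m \<Rightarrow> 'g" where "\<xi> y = inv_into U c (y + c 0)"
definition \<Omega> :: "'m set" where "\<Omega> = \<kappa> ` U"

lemma dom_eq: "\<Omega> = (\<lambda>y. y + c 0) -` (c ` U)"
proof (rule set_eqI)
  fix y
  have "y \<in> \<Omega> \<longleftrightarrow> (\<exists>x\<in>U. y = c x - c 0)" by (auto simp: \<Omega>_def \<kappa>_def)
  also have "\<dots> \<longleftrightarrow> (\<exists>x\<in>U. y + c 0 = c x)" by (simp only: eq_diff_eq)
  finally show "y \<in> \<Omega> \<longleftrightarrow> y \<in> (\<lambda>y. y + c 0) -` (c ` U)" by auto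
qed

lemma open_dom: "open \<Omega>"
  unfolding dom_eq by (intro open_vimage chartD(2)[OF U_chart] continuous_intros)

lemma chi_kappa: "x \<in> U \<Longrightarrow> \<xi> (\<kappa> x) = x"
  by (simp add: \<xi>_def \<kappa>_def chart_inv[OF U_chart])

lemma chi_in: "y \<in> \<Omega> \<Longrightarrow> \<xi> y \<in> U"
  by (simp add: dom_eq \<xi>_def chart_inv_in[OF U_chart])

lemma kappa_chi: "y \<in> \<Omega> \<Longrightarrow> \<kappa> (\<xi> y) = y"
  by (simp add: dom_eq \<xi>_def \<kappa>_def chart_inv2[OF U_chart])

lemma kappa_in: "x \<in> U \<Longrightarrow> \<kappa> x \<in> \<Omega>"
  by (simp add: \<Omega>_def)

lemma kappa_0: "\<kappa> 0 = 0" by (simp add: \<kappa>_def)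

lemma zero_dom: "0 \<in> \<Omega>" using kappa_in[OF zero_U] kappa_0 by simp

lemma chi_0: "\<xi> 0 = 0" using chi_kappa[OF zero_U] kappa_0 by simp

lemma smooth_chi: "smooth_into \<Omega> \<xi>"
proof -
  have "smooth_on \<Omega> (\<lambda>y. y + c 0)"
    by (rule smooth_on_add[OF open_dom smooth_on_ident[OF open_dom] smooth_on_const])
  then show ?thesis
    unfolding \<xi>_def
    by (rule smooth_into_compose[OF smooth_into_chart[OF U_chart] open_dom]) (auto simp: dom_eq)
qed

lemma continuous_chi: "continuous_on \<Omega> \<xi>"
  by (rule smooth_intoD(2)[OF smooth_chi])

lemma smooth_kappa:
  assumes "smooth_into S F" "F ` S \<subseteq> U"
  shows "smooth_on S (\<lambda>s. \<kappa> (F s))"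
proof -
  have "S \<inter> F -` U = S" using assms(2) by auto
  then show ?thesis
    using smooth_intoD(3)[OF assms(1) U_chart] unfolding \<kappa>_def
    by (intro smooth_on_diff smooth_intoD(1)[OF assms(1)] smooth_on_const) simp
qed

lemma continuous_kappa: "continuous_on U \<kappa>"
  unfolding \<kappa>_def using chartD(3)[OF U_chart] by (intro continuous_intros) (simp add: homeomorphism_def)

lemma open_chi_image: "open S \<Longrightarrow> S \<subseteq> \<Omega> \<Longrightarrow> open (\<xi> ` S)"
proof -
  assume S: "open S" "S \<subseteq> \<Omega>"
  have "open (U \<inter> \<kappa> -` S)" by (rule continuous_open_preimage[OF continuous_kappa chartD(1)[OF U_chart] S(1)])
  moreover have "U \<inter> \<kappa> -` S = \<xi> ` S"
  proof
    show "U \<inter> \<kappa> -` S \<subseteq> \<xi> ` S"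
    proof
      fix x assume "x \<in> U \<inter> \<kappa> -` S"
      then have "x = \<xi> (\<kappa> x)" "\<kappa> x \<in> S" by (auto simp: chi_kappa)
      then show "x \<in> \<xi> ` S" by blast
    qed
    show "\<xi> ` S \<subseteq> U \<inter> \<kappa> -` S" using S(2) chi_in kappa_chi by auto
  qed
  ultimately show "open (\<xi> ` S)" by simp
qed

lemma dom_ball: "\<exists>r>0. cball 0 r \<subseteq> \<Omega>"
  using open_dom zero_dom unfolding open_contains_cball by (rule bspec)

definition rad :: real where "rad = (SOME r. r > 0 \<and> cball (0::'m) r \<subseteq> \<Omega>)"

lemma rad: "rad > 0" "cball 0 rad \<subseteq> \<Omega>"
  using someI_ex[OF dom_ball] unfolding rad_def by auto

lemma ball_rad: "ball 0 rad \<subseteq> \<Omega>" using rad(2) ball_subset_cball by blast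

text \<open>Derivations act on functions on the whole group, so coordinate expressions have to be
  globalized. The bump has no plateau; its value at the identity is divided out later.\<close>

definition loc :: "real \<Rightarrow> ('m \<Rightarrow> real) \<Rightarrow> 'g \<Rightarrow> real" where
  "loc r g x = (if x \<in> U \<and> norm (\<kappa> x) < r then bump r (\<kappa> x) * g (\<kappa> x) else 0)"

lemma loc_chi: "y \<in> \<Omega> \<Longrightarrow> r > 0 \<Longrightarrow> loc r g (\<xi> y) = bump r y * g y"
  by (simp add: loc_def chi_in kappa_chi bump_eq_0)

lemma loc_outside: "0 < r \<Longrightarrow> r < rad \<Longrightarrow> x \<notin> \<xi> ` cball 0 r \<Longrightarrow> loc r g x = 0"
  unfolding loc_def using chi_kappa[of x] by (metis image_eqI less_imp_le mem_cball_0)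

lemma compact_chi_cball: "r \<le> rad \<Longrightarrow> compact (\<xi> ` cball 0 r)"
  using rad(2) subset_cball[of r rad 0]
  by (intro compact_continuous_image continuous_on_subset[OF continuous_chi] compact_cball) blast+

text \<open>The image of the open ball of radius \<open>rad\<close> and the complement of the
  compact image of the smaller closed ball form an open cover, and on the second set the function is
  0.\<close>

lemma smooth_loc:
  assumes g: "smooth_on (ball 0 rad) g" and r: "0 < r" "r < rad"
  shows "loc r g \<in> smooth_functions \<A>"
proof (rule smooth_functionI)
  fix W d assume W: "(W, d) \<in> \<A>"
  let ?F = "inv_into W d"
  have F: "smooth_into (d ` W) ?F" by (rule smooth_into_chart[OF W])
  define T1 where "T1 = d ` W \<inter> ?F -` (\<xi> ` ball 0 rad)"
  define T2 where "T2 = d ` W \<inter> ?F -` (- \<xi> ` cball 0 r)"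
  have "open (\<xi> ` ball 0 rad)" by (rule open_chi_image[OF open_ball ball_rad])
  then have o1: "open T1" unfolding T1_def by (rule smooth_into_preimage[OF F])
  have "open (- \<xi> ` cball 0 r)"
    using compact_imp_closed[OF compact_chi_cball[of r]] r by (simp add: open_Compl)
  then have o2: "open T2" unfolding T2_def by (rule smooth_into_preimage[OF F])
  have F1: "smooth_into T1 ?F"
    by (rule smooth_into_compose[OF F o1 smooth_on_ident[OF o1]]) (auto simp: T1_def)
  have k1: "smooth_on T1 (\<lambda>y. \<kappa> (?F y))"
    by (rule smooth_kappa[OF F1]) (use ball_rad chi_in in \<open>auto simp: T1_def\<close>)
  have k2: "\<kappa> (?F y) \<in> ball 0 rad" "?F y \<in> U" if y: "y \<in> T1" for y
  proof -
    obtain z where "?F y = \<xi> z" "z \<in> ball 0 rad" using y by (auto simp: T1_def)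
    then show "\<kappa> (?F y) \<in> ball 0 rad" "?F y \<in> U"
      using ball_rad kappa_chi[of z] chi_in[of z] by auto
  qed
  have b: "smooth_on (ball 0 rad) (\<lambda>z. bump r z * g z)"
    by (rule smooth_on_mult[OF open_ball smooth_on_subset[OF smooth_on_bump] g]) simp
  have "smooth_on T1 (\<lambda>y. bump r (\<kappa> (?F y)) * g (\<kappa> (?F y)))"
    by (rule smooth_on_compose[OF o1 open_ball b k1]) (use k2 in auto)
  then have 1: "smooth_on T1 (\<lambda>y. loc r g (?F y))"
    by (rule smooth_on_eq[OF o1]) (use k2(2) r(1) in \<open>auto simp: loc_def bump_eq_0\<close>)
  have "smooth_on T2 (\<lambda>y. 0::real)" by (rule smooth_on_const)
  then have 2: "smooth_on T2 (\<lambda>y. loc r g (?F y))"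
    by (rule smooth_on_eq[OF o2]) (use loc_outside[OF r] in \<open>auto simp: T2_def\<close>)
  show "smooth_on (d ` W) (\<lambda>y. loc r g (?F y))"
  proof (rule smooth_on_local)
    fix y assume y: "y \<in> d ` W"
    have "y \<in> T1 \<or> y \<in> T2" using y r by (auto simp: T1_def T2_def)
    then show "\<exists>T. open T \<and> y \<in> T \<and> smooth_on T (\<lambda>y. loc r g (?F y))"
      using 1 2 o1 o2 by blast
  qed
qed

text \<open>The left-invariant field with value v at the identity. It is 0 on functions that are not
  smooth, in agreement with the convention in \<open>lie_algebra\<close>.\<close>

definition lv :: "'m \<Rightarrow> 'g vfield" where
  "lv v f x = (if f \<in> smooth_functions \<A> then frechet_derivative (\<lambda>z. f (x + \<xi> z)) (at 0) v else 0)"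

lemma smooth_shift: "f \<in> smooth_functions \<A> \<Longrightarrow> smooth_on \<Omega> (\<lambda>z. f (x + \<xi> z))"
  by (rule smooth_function_into[OF _ smooth_into_add[OF smooth_into_const[OF open_dom] smooth_chi]])

lemma lv_has_derivative:
  assumes "f \<in> smooth_functions \<A>"
  shows "((\<lambda>z. f (x + \<xi> z)) has_derivative (\<lambda>v. lv v f x)) (at 0)"
  using smooth_on_differentiable[OF smooth_shift[OF assms] zero_dom, of x] assms
  by (simp add: lv_def frechet_derivative_works)

lemma lv_unique:
  assumes "f \<in> smooth_functions \<A>" "((\<lambda>z. f (x + \<xi> z)) has_derivative D) (at 0)"
  shows "lv v f x = D v"
  using has_derivative_unique[OF lv_has_derivative[OF assms(1)] assms(2)] by (rule fun_cong)

text \<open>The function f(x + \<xi> z) is jointly smooth in the coordinates of x and in z, and the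
  field is a partial derivative of it at z = 0.\<close>

lemma lv_smooth:
  assumes f: "f \<in> smooth_functions \<A>"
  shows "lv v f \<in> smooth_functions \<A>"
proof (rule smooth_functionI)
  fix W d assume W: "(W, d) \<in> \<A>"
  let ?F = "inv_into W d"
  let ?S = "d ` W \<times> \<Omega>"
  define P where "P = (\<lambda>q. f (?F (fst q) + \<xi> (snd q)))"
  have oS: "open ?S" by (intro open_Times chartD(2)[OF W] open_dom)
  have "smooth_on ?S fst" "smooth_on ?S snd"
    by (rule smooth_on_bounded_linear[OF bounded_linear_fst oS], rule smooth_on_bounded_linear[OF bounded_linear_snd oS])
  then have "smooth_into ?S (\<lambda>q. ?F (fst q))" "smooth_into ?S (\<lambda>q. \<xi> (snd q))"
    by (auto intro!: smooth_into_compose[OF smooth_into_chart[OF W] oS] smooth_into_compose[OF smooth_chi oS])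
  then have P: "smooth_on ?S P"
    unfolding P_def by (intro smooth_function_into[OF f] smooth_into_add)
  have e: "smooth_on (d ` W) (\<lambda>y. (y, 0::'m))"
    by (intro smooth_on_Pair smooth_on_ident smooth_on_const chartD(2)[OF W])
  have "smooth_on (d ` W) (\<lambda>y. frechet_derivative P (at (y, 0)) (0, v))"
    by (rule smooth_on_compose[OF chartD(2)[OF W] oS smooth_on_directional[OF P] e]) (use zero_dom in auto)
  then show "smooth_on (d ` W) (\<lambda>y. lv v f (?F y))"
  proof (rule smooth_on_eq[OF chartD(2)[OF W]])
    fix y assume y: "y \<in> d ` W"
    have d: "(P has_derivative frechet_derivative P (at (y, 0))) (at (y, 0))"
      using smooth_on_differentiable[OF P] y zero_dom by (simp add: frechet_derivative_works)
    have p: "((\<lambda>z::'m. (y, z)) has_derivative (\<lambda>h. (0, h))) (at 0)"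
      by (intro has_derivative_Pair has_derivative_const has_derivative_ident)
    have "((\<lambda>z. f (?F y + \<xi> z)) has_derivative (\<lambda>h. frechet_derivative P (at (y, 0)) (0, h))) (at 0)"
      using has_derivative_compose[OF p d] by (simp add: P_def)
    from lv_unique[OF f this] show "frechet_derivative P (at (y, 0)) (0, v) = lv v f (?F y)" by simp
  qed
qed

lemma lv_translate:
  assumes "f \<in> smooth_functions \<A>"
  shows "lv v (\<lambda>x. f (y + x)) = (\<lambda>x. lv v f (y + x))"
  using assms smooth_function_translate[OF assms, of y] by (auto simp: lv_def add.assoc)

lemma lv_not_smooth: "f \<notin> smooth_functions \<A> \<Longrightarrow> lv v f = (\<lambda>x. 0)"
  by (auto simp: lv_def)

lemma lv_in_lie_algebra: "lv v \<in> lie_algebra \<A>"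
  unfolding lie_algebra_def
proof (intro CollectI conjI ballI allI impI)
  show "lv v f \<in> smooth_functions \<A>" if "f \<in> smooth_functions \<A>" for f by (rule lv_smooth[OF that])
  show "lv v f = (\<lambda>x. 0)" if "f \<notin> smooth_functions \<A>" for f by (rule lv_not_smooth[OF that])
  fix f assume f: "f \<in> smooth_functions \<A>"
  show "lv v (\<lambda>x. f (y + x)) = (\<lambda>x. lv v f (y + x))" for y by (rule lv_translate[OF f])
  fix g assume g: "g \<in> smooth_functions \<A>"
  note df = lv_has_derivative[OF f] and dg = lv_has_derivative[OF g]
  show "lv v (\<lambda>x. a * f x + b * g x) = (\<lambda>x. a * lv v f x + b * lv v g x)" for a b
  proof
    fix x
    have s: "(\<lambda>x. a * f x + b * g x) \<in> smooth_functions \<A>"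
      using f g by (intro smooth_function_add smooth_function_mult smooth_function_const)
    show "lv v (\<lambda>x. a * f x + b * g x) x = a * lv v f x + b * lv v g x"
      by (rule lv_unique[OF s]) (intro has_derivative_add has_derivative_mult_right df dg)
  qed
  show "lv v (\<lambda>x. f x * g x) = (\<lambda>x. lv v f x * g x + f x * lv v g x)"
  proof
    fix x
    have "lv v (\<lambda>x. f x * g x) x = f (x + \<xi> 0) * lv v g x + lv v f x * g (x + \<xi> 0)"
      by (rule lv_unique[OF smooth_function_mult[OF f g] has_derivative_mult[OF df dg]])
    then show "lv v (\<lambda>x. f x * g x) x = lv v f x * g x + f x * lv v g x" by (simp add: chi_0)
  qed
qed

lemma lv_add: "lv (v + w) = lv v + lv w" and lv_scale: "lv (a *\<^sub>R v) = vf_scale a (lv v)"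
proof -
  have "lv (v + w) f x = lv v f x + lv w f x \<and> lv (a *\<^sub>R v) f x = a * lv v f x" for f x
  proof (cases "f \<in> smooth_functions \<A>")
    case True
    have "linear (\<lambda>v. lv v f x)" by (rule has_derivative_linear[OF lv_has_derivative[OF True]])
    from linear_add[OF this, of v w] linear_scale[OF this, of a v] show ?thesis by simp
  qed (simp add: lv_not_smooth)
  then show "lv (v + w) = lv v + lv w" "lv (a *\<^sub>R v) = vf_scale a (lv v)"
    by (auto simp: fun_eq_iff vf_scale_def)
qed

section \<open>Derivations at the identity are tangent vectors\<close>

definition coord :: "'m \<Rightarrow> 'g \<Rightarrow> real" where "coord b = loc (rad / 2) (\<lambda>y. y \<bullet> b)"

lemma smooth_coord: "coord b \<in> smooth_functions \<A>"
  unfolding coord_def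
  by (rule smooth_loc) (use rad(1) in \<open>auto intro!: smooth_on_bounded_linear bounded_linear_inner_left\<close>)

definition b0 :: real where "b0 = bump (rad / 2) (0::'m)"

lemma b0_pos: "b0 > 0" using rad(1) by (simp add: b0_def bump_pos_iff)

lemma bump_product_deriv_0:
  assumes "(g has_derivative g') (at 0)" "g 0 = 0"
  shows "((\<lambda>y. bump r y * g y) has_derivative (\<lambda>h. bump r (0::'m) * g' h)) (at (0::'m))"
proof -
  have "(bump r has_derivative blinfun_deriv (bump r) 0) (at (0::'m))"
    by (rule smooth_on_has_derivative[OF smooth_on_bump]) simp
  from has_derivative_mult[OF this assms(1)] show ?thesis using assms(2) by simp
qed

text \<open>The coordinate vanishes at the identity, so the bump contributes only its value there
  and not its derivative.\<close>

lemma lv_coord: "lv v (coord b) 0 = b0 * (v \<bullet> b)"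
proof -
  have "((\<lambda>y::'m. y \<bullet> b) has_derivative (\<lambda>h. h \<bullet> b)) (at 0)"
    by (rule bounded_linear_imp_has_derivative[OF bounded_linear_inner_left])
  from bump_product_deriv_0[OF this]
  have "((\<lambda>y. bump (rad / 2) y * (y \<bullet> b)) has_derivative (\<lambda>h. b0 * (h \<bullet> b))) (at 0)"
    by (simp add: b0_def)
  then have "((\<lambda>y. coord b (0 + \<xi> y)) has_derivative (\<lambda>h. b0 * (h \<bullet> b))) (at 0)"
    by (rule has_derivative_transform_within_open[OF _ open_dom zero_dom])
      (use rad(1) in \<open>simp add: coord_def loc_chi\<close>)
  then show ?thesis by (rule lv_unique[OF smooth_coord])
qed

lemma lv_inject_0:
  assumes "\<And>f. f \<in> smooth_functions \<A> \<Longrightarrow> lv v f 0 = lv w f 0"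
  shows "v = w"
proof (rule euclidean_eqI)
  fix b :: 'm assume "b \<in> Basis"
  show "v \<bullet> b = w \<bullet> b" using assms[OF smooth_coord, of b] b0_pos by (simp add: lv_coord)
qed

lemma lv_inject: "lv v = lv w \<longleftrightarrow> v = w"
  using lv_inject_0 by metis

lemma lie_algebraD:
  assumes "X \<in> lie_algebra \<A>"
  shows "f \<in> smooth_functions \<A> \<Longrightarrow> X f \<in> smooth_functions \<A>"
    and "f \<notin> smooth_functions \<A> \<Longrightarrow> X f = (\<lambda>x. 0)"
    and "f \<in> smooth_functions \<A> \<Longrightarrow> g \<in> smooth_functions \<A> \<Longrightarrow> X (\<lambda>x. a * f x + b * g x) = (\<lambda>x. a * X f x + b * X g x)"
    and "f \<in> smooth_functions \<A> \<Longrightarrow> g \<in> smooth_functions \<A> \<Longrightarrow> X (\<lambda>x. f x * g x) = (\<lambda>x. X f x * g x + f x * X g x)"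
    and "f \<in> smooth_functions \<A> \<Longrightarrow> X (\<lambda>x. f (y + x)) = (\<lambda>x. X f (y + x))"
  using assms unfolding lie_algebra_def by blast+

lemma vfield_const:
  assumes "X \<in> lie_algebra \<A>"
  shows "X (\<lambda>_. a) x = 0"
proof -
  have "X (\<lambda>_. 1) x = X (\<lambda>_. 1) x * 1 + 1 * X (\<lambda>_. 1) x"
    using fun_cong[OF lie_algebraD(4)[OF assms smooth_function_const[of 1] smooth_function_const[of 1]], of x] by simp
  then have "X (\<lambda>_. 1) x = 0" by linarith
  then show ?thesis
    using fun_cong[OF lie_algebraD(3)[OF assms smooth_function_const[of 1] smooth_function_const[of 1], of a 0], of x] by simp
qed

lemma vfield_sum:
  assumes X: "X \<in> lie_algebra \<A>" and "finite I" "\<And>i. i \<in> I \<Longrightarrow> f i \<in> smooth_functions \<A>"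
  shows "X (\<lambda>x. \<Sum>i\<in>I. f i x) y = (\<Sum>i\<in>I. X (f i) y)"
  using assms(2,3)
proof (induction I rule: finite_induct)
  case empty
  then show ?case by (simp add: vfield_const[OF X])
next
  case (insert i I)
  have "X (\<lambda>x. 1 * f i x + 1 * (\<Sum>i\<in>I. f i x)) = (\<lambda>x. 1 * X (f i) x + 1 * X (\<lambda>x. \<Sum>i\<in>I. f i x) x)"
    by (rule lie_algebraD(3)[OF X]) (use insert in \<open>auto intro: smooth_function_sum\<close>)
  from fun_cong[OF this, of y] show ?case using insert by simp
qed

text \<open>Hadamard's lemma made global by bumps writes B^2 (f - f(0)) as a sum of products of a
  coordinate and a smooth function. Since the coordinates vanish at the identity, the Leibniz rule
  gives X f there as a combination of partial derivatives of f; left invariance carries this to all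
  points.\<close>

lemma vfield_eq_lv:
  assumes X: "X \<in> lie_algebra \<A>"
  shows "\<exists>v. X = lv v"
proof -
  define v where "v = (\<Sum>b\<in>Basis. (X (coord b) 0 / b0) *\<^sub>R b)"
  let ?r = "rad / 2"
  have r: "0 < ?r" "?r < rad" using rad(1) by auto
  define B where "B = loc ?r (\<lambda>_. 1)"
  have B: "B \<in> smooth_functions \<A>" unfolding B_def by (rule smooth_loc[OF _ r]) auto
  have B0: "B 0 = b0" using loc_chi[OF zero_dom r(1)] by (simp add: B_def chi_0 b0_def)
  have at0: "X f 0 = lv v f 0" if f: "f \<in> smooth_functions \<A>" for f
  proof -
    have fs: "smooth_on (ball 0 rad) (\<lambda>y. f (\<xi> y))"
      using smooth_on_subset[OF smooth_shift[OF f, of 0] ball_rad] by simp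
    obtain g where g: "\<And>b. smooth_on (ball 0 rad) (g b)"
      "\<And>y. y \<in> ball 0 rad \<Longrightarrow> f (\<xi> y) = f (\<xi> 0) + (\<Sum>b\<in>Basis. (y \<bullet> b) * g b y)"
      "\<And>b. rad > 0 \<Longrightarrow> g b 0 = frechet_derivative (\<lambda>y. f (\<xi> y)) (at 0) b"
      by (rule Hadamard[OF fs]) blast
    have gb: "g b 0 = lv b f 0" for b
      using g(3)[OF rad(1), of b] f by (simp add: lv_def)
    define G where "G = (\<lambda>b. loc ?r (g b))"
    have G: "G b \<in> smooth_functions \<A>" for b unfolding G_def by (rule smooth_loc[OF g(1) r])
    have G0: "G b 0 = b0 * lv b f 0" for b
      using loc_chi[OF zero_dom r(1), of "g b"] by (simp add: G_def chi_0 b0_def gb)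
    have c0: "coord b 0 = 0" for b
      using loc_chi[OF zero_dom r(1), of "\<lambda>y. y \<bullet> b"] by (simp add: coord_def chi_0)
    \<comment> \<open>Two bumps on the left, because \<open>coord b\<close> and \<open>G b\<close>
      contain one each. The difference is written in the form of the linearity clause of
      \<open>lie_algebra\<close>.\<close>
    have eq: "B x * B x * (1 * f x + (- f 0) * 1) = (\<Sum>b\<in>Basis. coord b x * G b x)" for x
    proof (cases "x \<in> U \<and> norm (\<kappa> x) < ?r")
      case True
      then have k: "\<kappa> x \<in> ball 0 rad" "\<xi> (\<kappa> x) = x" using rad(1) chi_kappa by auto
      have "f x - f 0 = (\<Sum>b\<in>Basis. (\<kappa> x \<bullet> b) * g b (\<kappa> x))"
        using g(2)[OF k(1)] k(2) by (simp add: chi_0)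
      then show ?thesis using True
        by (simp add: B_def G_def coord_def loc_def sum_distrib_left mult_ac)
    next
      case False
      then have "coord b x = 0" for b unfolding coord_def loc_def by (simp only: if_False)
      moreover have "B x = 0" using False unfolding B_def loc_def by (simp only: if_False)
      ultimately show ?thesis by simp
    qed
    have sf: "(\<lambda>x. 1 * f x + (- f 0) * 1) \<in> smooth_functions \<A>"
      using f by (intro smooth_function_add smooth_function_mult smooth_function_const)
    have Xf: "X (\<lambda>x. 1 * f x + (- f 0) * 1) 0 = X f 0"
      using fun_cong[OF lie_algebraD(3)[OF X f smooth_function_const[of 1], of 1 "- f 0"], of 0] vfield_const[OF X, of 1] by simp
    have m1: "X (\<lambda>x. B x * B x * (1 * f x + (- f 0) * 1)) 0 = b0 * b0 * X f 0"
      using fun_cong[OF lie_algebraD(4)[OF X smooth_function_mult[OF B B] sf], of 0] Xf B0 by simp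
    have m2: "X (\<lambda>x. \<Sum>b\<in>Basis. coord b x * G b x) 0 = (\<Sum>b\<in>Basis. X (\<lambda>x. coord b x * G b x) 0)"
      by (rule vfield_sum[OF X]) (auto intro: smooth_function_mult smooth_coord G)
    have m3: "X (\<lambda>x. coord b x * G b x) 0 = X (coord b) 0 * (b0 * lv b f 0)" for b
      using fun_cong[OF lie_algebraD(4)[OF X smooth_coord[of b] G[of b]], where x = 0] by (simp add: c0 G0)
    have "b0 * (b0 * X f 0) = (\<Sum>b\<in>Basis. X (coord b) 0 * (b0 * lv b f 0))"
      using m1 unfolding eq m2 m3 by (simp only: mult.assoc)
    also have "\<dots> = b0 * (\<Sum>b\<in>Basis. X (coord b) 0 * lv b f 0)"
      by (simp add: sum_distrib_left mult_ac)
    finally have *: "b0 * X f 0 = (\<Sum>b\<in>Basis. X (coord b) 0 * lv b f 0)"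
      using b0_pos by simp
    have l: "linear (\<lambda>v. lv v f 0)" by (rule has_derivative_linear[OF lv_has_derivative[OF f]])
    have "lv v f 0 = (\<Sum>b\<in>Basis. (X (coord b) 0 / b0) * lv b f 0)"
      unfolding v_def by (simp add: linear_sum[OF l] linear_scale[OF l])
    also have "\<dots> = (\<Sum>b\<in>Basis. X (coord b) 0 * lv b f 0) / b0"
      by (simp add: sum_divide_distrib)
    also have "\<dots> = X f 0" using b0_pos by (simp add: *[symmetric])
    finally show ?thesis by simp
  qed
  have "X f x = lv v f x" for f x
  proof (cases "f \<in> smooth_functions \<A>")
    case True
    have "X f (x + 0) = X (\<lambda>y. f (x + y)) 0"
      by (rule fun_cong[OF lie_algebraD(5)[OF X True, where y = x], where x = 0, symmetric])
    also have "\<dots> = lv v (\<lambda>y. f (x + y)) 0" by (rule at0[OF smooth_function_translate[OF True]])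
    also have "\<dots> = lv v f (x + 0)" by (rule fun_cong[OF lv_translate[OF True], where x = 0])
    finally show ?thesis by simp
  next
    case False
    then show ?thesis using lie_algebraD(2)[OF X False] by (simp add: lv_not_smooth)
  qed
  then show ?thesis by (intro exI[of _ v]) auto
qed

lemma lie_algebra_eq: "lie_algebra \<A> = range lv"
  using vfield_eq_lv lv_in_lie_algebra by blast

end

section \<open>The exponential map and automorphisms\<close>

lemma additive_0: "(\<And>x y. F (x + y) = F x + F y) \<Longrightarrow> F (0::'a::group_add) = (0::'b::group_add)"
  by (metis add.right_neutral add_left_imp_eq)

lemma additive_eq:
  fixes F H :: "'g::topological_group_add \<Rightarrow> 'h::group_add"
  assumes "connected (UNIV :: 'g set)" "open W" "0 \<in> W" "\<And>u. u \<in> W \<Longrightarrow> F u = H u"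
    and F: "\<And>x y. F (x + y) = F x + F y" and H: "\<And>x y. H (x + y) = H x + H y"
  shows "F x = H x"
proof -
  have "{y. F y = H y} = UNIV"
    by (rule connected_group_generated[OF assms(1-3)]) (use assms(3,4) F H in auto)
  then show ?thesis by blast
qed

lemma additive_continuous:
  fixes F :: "'g::{topological_group_add,t2_space} \<Rightarrow> 'h::topological_group_add"
  assumes W: "open W" "0 \<in> W" "continuous_on W F" and F: "\<And>x y. F (x + y) = F x + F y"
  shows "continuous_on UNIV F"
proof -
  have "isCont F x" for x
  proof -
    have "open ((\<lambda>y. - x + y) -` W)" by (intro open_vimage W continuous_intros)
    moreover have "continuous_on ((\<lambda>y. - x + y) -` W) (\<lambda>y. F x + F (- x + y))"
      by (intro continuous_on_add continuous_on_const continuous_on_compose2[OF W(3)] continuous_intros) auto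
    moreover have "F x + F (- x + y) = F y" for y by (simp add: F[symmetric])
    ultimately show "isCont F x" using W(2) by (auto simp: continuous_on_eq_continuous_at)
  qed
  then show ?thesis by (simp add: continuous_at_imp_continuous_on)
qed

text \<open>The line as a local group, so that one-parameter subgroups come from the same theorem as
  automorphisms. Radii 1 and 2: the sum of two numbers of modulus below 1 has modulus below
  2.\<close>

lemma real_local_group: "local_group ((+) :: real \<Rightarrow> real \<Rightarrow> real) uminus 1 2"
proof
  show "smooth_on (ball 0 2 \<times> ball 0 2) (\<lambda>p. fst p + snd p :: real)"
    by (intro smooth_on_bounded_linear bounded_linear_add bounded_linear_fst bounded_linear_snd open_Times open_ball)
  show "smooth_on (ball 0 2) (uminus :: real \<Rightarrow> real)"
    by (intro smooth_on_bounded_linear bounded_linear_minus[OF bounded_linear_ident] open_ball)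
qed auto

lemma real_local_group_br: "local_group.br ((+) :: real \<Rightarrow> real \<Rightarrow> real) v w = 0"
proof -
  interpret local_group "(+) :: real \<Rightarrow> real \<Rightarrow> real" uminus 1 2 by (rule real_local_group)
  have d: "((\<lambda>p. fst p + snd p) has_derivative (\<lambda>h. fst h + snd h)) (at p)" for p :: "real \<times> real"
    by (intro has_derivative_add has_derivative_fst has_derivative_snd has_derivative_ident)
  have "J = (\<lambda>y. id_blinfun)"
    by (rule ext, rule blinfun_eqI) (simp add: J_def D2_def dm_def has_derivative_imp_blinfun_deriv[OF d])
  then have "(J has_derivative (\<lambda>h. 0)) (at 0)" by simp
  from has_derivative_imp_blinfun_deriv[OF this] show ?thesis by (simp add: br_def)
qed

context lie_chart
begin

section \<open>The group law in coordinates\<close>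

definition gm :: "'m \<Rightarrow> 'm \<Rightarrow> 'm" where "gm y z = \<kappa> (\<xi> y + \<xi> z)"
definition gi :: "'m \<Rightarrow> 'm" where "gi y = \<kappa> (- \<xi> y)"

lemma small_sums:
  fixes V :: "'g set"
  assumes "open V" "0 \<in> V"
  shows "\<exists>e>0. e \<le> rad \<and> (\<forall>x\<in>ball 0 e. \<forall>y\<in>ball 0 e. \<xi> x + \<xi> y \<in> V \<and> - \<xi> x \<in> V)"
proof -
  have c1: "continuous_on (\<Omega> \<times> \<Omega>) (\<lambda>p. \<xi> (fst p))"
    by (rule continuous_on_compose2[OF continuous_chi continuous_on_fst[OF continuous_on_id]]) auto
  have c2: "continuous_on (\<Omega> \<times> \<Omega>) (\<lambda>p. \<xi> (snd p))"
    by (rule continuous_on_compose2[OF continuous_chi continuous_on_snd[OF continuous_on_id]]) auto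
  have o: "open (\<Omega> \<times> \<Omega>)" by (intro open_Times open_dom)
  have o1: "open ((\<Omega> \<times> \<Omega>) \<inter> (\<lambda>p. \<xi> (fst p) + \<xi> (snd p)) -` V)"
    by (rule continuous_open_preimage[OF continuous_on_add[OF c1 c2] o assms(1)])
  have o2: "open ((\<Omega> \<times> \<Omega>) \<inter> (\<lambda>p. - \<xi> (fst p)) -` V)"
    by (rule continuous_open_preimage[OF continuous_on_minus[OF c1] o assms(1)])
  have z: "(0, 0) \<in> ((\<Omega> \<times> \<Omega>) \<inter> (\<lambda>p. \<xi> (fst p) + \<xi> (snd p)) -` V) \<inter> ((\<Omega> \<times> \<Omega>) \<inter> (\<lambda>p. - \<xi> (fst p)) -` V)"
    using zero_dom assms(2) by (simp add: chi_0)
  obtain A B where AB: "open A" "open B" "(0, 0) \<in> A \<times> B"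
    "A \<times> B \<subseteq> ((\<Omega> \<times> \<Omega>) \<inter> (\<lambda>p. \<xi> (fst p) + \<xi> (snd p)) -` V) \<inter> ((\<Omega> \<times> \<Omega>) \<inter> (\<lambda>p. - \<xi> (fst p)) -` V)"
    by (rule open_prod_elim[OF open_Int[OF o1 o2] z])
  obtain e where e: "e > 0" "ball 0 e \<subseteq> A \<inter> B"
    by (rule openE[of "A \<inter> B" 0]) (use AB in auto)
  have "\<xi> x + \<xi> y \<in> V \<and> - \<xi> x \<in> V" if "x \<in> ball 0 (min e rad)" "y \<in> ball 0 (min e rad)" for x y
  proof -
    have "x \<in> A" "y \<in> B" using that e(2) by auto
    then show ?thesis using AB(4) by auto
  qed
  then show ?thesis using e(1) rad(1) by (intro exI[of _ "min e rad"]) auto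
qed

text \<open>Continuity at the identity is used twice: \<open>\<sigma>\<close> keeps sums and
  inverses in the chart domain, \<open>\<rho>\<close> keeps them in the image of the ball of radius
  \<open>\<sigma>\<close>.\<close>

lemma local_group_exists:
  "\<exists>\<rho> \<sigma>. local_group gm gi \<rho> \<sigma> \<and> \<sigma> \<le> rad \<and> (\<forall>x\<in>ball 0 \<sigma>. \<forall>y\<in>ball 0 \<sigma>. \<xi> x + \<xi> y \<in> U \<and> - \<xi> x \<in> U)"
proof -
  obtain \<sigma> where \<sigma>: "\<sigma> > 0" "\<sigma> \<le> rad" "\<And>x y. x \<in> ball 0 \<sigma> \<Longrightarrow> y \<in> ball 0 \<sigma> \<Longrightarrow> \<xi> x + \<xi> y \<in> U \<and> - \<xi> x \<in> U"
    using small_sums[OF chartD(1)[OF U_chart] zero_U] by blast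
  have \<sigma>\<Omega>: "ball 0 \<sigma> \<subseteq> \<Omega>" using ball_rad \<sigma>(2) by auto
  have oV: "open (\<xi> ` ball 0 \<sigma>)" by (rule open_chi_image[OF open_ball \<sigma>\<Omega>])
  have zV: "0 \<in> \<xi> ` ball 0 \<sigma>" using \<sigma>(1) chi_0 by (intro image_eqI[of _ _ 0]) auto
  obtain \<rho> where \<rho>: "\<rho> > 0" "\<And>x y. x \<in> ball 0 \<rho> \<Longrightarrow> y \<in> ball 0 \<rho> \<Longrightarrow> \<xi> x + \<xi> y \<in> \<xi> ` ball 0 \<sigma> \<and> - \<xi> x \<in> \<xi> ` ball 0 \<sigma>"
    using small_sums[OF oV zV] by blast
  have k\<sigma>: "\<kappa> x \<in> ball 0 \<sigma>" if "x \<in> \<xi> ` ball 0 \<sigma>" for x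
    using that \<sigma>\<Omega> kappa_chi by force
  have osq: "open (ball (0::'m) \<sigma> \<times> ball (0::'m) \<sigma>)" by (intro open_Times open_ball)
  have si: "smooth_into (ball 0 \<sigma>) \<xi>"
    by (rule smooth_into_compose[OF smooth_chi open_ball smooth_on_ident[OF open_ball]]) (use \<sigma>\<Omega> in simp)
  have "local_group gm gi (min \<rho> \<sigma>) \<sigma>"
  proof
    show "0 < min \<rho> \<sigma>" "min \<rho> \<sigma> \<le> \<sigma>" using \<rho>(1) \<sigma>(1) by auto
    have 1: "smooth_into (ball 0 \<sigma> \<times> ball 0 \<sigma>) (\<lambda>p::'m \<times> 'm. \<xi> (fst p))"
      by (rule smooth_into_compose[OF si osq smooth_on_bounded_linear[OF bounded_linear_fst osq]]) auto
    have 2: "smooth_into (ball 0 \<sigma> \<times> ball 0 \<sigma>) (\<lambda>p::'m \<times> 'm. \<xi> (snd p))"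
      by (rule smooth_into_compose[OF si osq smooth_on_bounded_linear[OF bounded_linear_snd osq]]) auto
    show "smooth_on (ball 0 \<sigma> \<times> ball 0 \<sigma>) (\<lambda>p. gm (fst p) (snd p))"
      unfolding gm_def by (rule smooth_kappa[OF smooth_into_add[OF 1 2]]) (use \<sigma>(3) in auto)
    show "smooth_on (ball 0 \<sigma>) gi"
      unfolding gi_def by (rule smooth_kappa[OF smooth_into_uminus[OF si]]) (use \<sigma>(3) in blast)
    fix x :: 'm
    show "gm 0 x = x" "gm x 0 = x" if "x \<in> ball 0 \<sigma>"
      using that \<sigma>\<Omega> by (auto simp: gm_def chi_0 intro!: kappa_chi)
    show "gm (gi x) x = 0" if "x \<in> ball 0 (min \<rho> \<sigma>)"
    proof -
      have "- \<xi> x \<in> U" using that \<sigma>(3)[of x x] by simp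
      then show ?thesis by (simp add: gm_def gi_def chi_kappa kappa_0)
    qed
    show "gi x \<in> ball 0 \<sigma>" if "x \<in> ball 0 (min \<rho> \<sigma>)"
      unfolding gi_def by (rule k\<sigma>) (use \<rho>(2)[of x x] that in simp)
    fix y :: 'm
    show "gm x y \<in> ball 0 \<sigma>" if "x \<in> ball 0 (min \<rho> \<sigma>)" "y \<in> ball 0 (min \<rho> \<sigma>)"
      unfolding gm_def by (rule k\<sigma>) (use \<rho>(2)[of x y] that in simp)
    show "gm (gm x y) z = gm x (gm y z)" if "x \<in> ball 0 \<sigma>" "y \<in> ball 0 \<sigma>" "z \<in> ball 0 \<sigma>" for z
      using \<sigma>(3)[OF that(1,2)] \<sigma>(3)[OF that(2,3)] by (simp add: gm_def chi_kappa add.assoc)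
  qed
  then show ?thesis using \<sigma> by blast
qed

lemma locally_path_connected_0:
  fixes V :: "'g set"
  assumes "open V" "0 \<in> V"
  shows "\<exists>W. open W \<and> 0 \<in> W \<and> (\<forall>u\<in>W. \<exists>q. path q \<and> path_image q \<subseteq> V \<and> pathstart q = 0 \<and> pathfinish q = u)"
proof -
  have "open (\<Omega> \<inter> \<xi> -` V)" by (rule continuous_open_preimage[OF continuous_chi open_dom assms(1)])
  then obtain e where e: "e > 0" "ball 0 e \<subseteq> \<Omega> \<inter> \<xi> -` V"
    by (rule openE[of _ 0]) (use zero_dom assms(2) chi_0 in auto)
  have "open (\<xi> ` ball 0 e)" by (rule open_chi_image) (use e in auto)
  moreover have "0 \<in> \<xi> ` ball 0 e" using e(1) chi_0 by (intro image_eqI[of _ _ 0]) auto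
  moreover have "\<exists>q. path q \<and> path_image q \<subseteq> V \<and> pathstart q = 0 \<and> pathfinish q = u" if u: "u \<in> \<xi> ` ball 0 e" for u
  proof -
    obtain z where z: "u = \<xi> z" "z \<in> ball 0 e" using u by blast
    have tz: "t *\<^sub>R z \<in> ball 0 e" if "t \<in> {0..1}" for t :: real
      using that z(2) mult_left_le_one_le[of "norm z" t] by auto
    have "continuous_on {0..1} (\<lambda>t. \<xi> (t *\<^sub>R z))"
      by (rule continuous_on_compose2[OF continuous_chi]) (use tz e(2) in \<open>auto intro!: continuous_intros\<close>)
    moreover have "\<xi> (t *\<^sub>R z) \<in> V" if "t \<in> {0..1}" for t using tz[OF that] e(2) by blast
    ultimately show ?thesis
      by (intro exI[of _ "\<lambda>t. \<xi> (t *\<^sub>R z)"]) (auto simp: path_def path_image_def pathstart_def pathfinish_def chi_0 z(1))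
  qed
  ultimately show ?thesis by blast
qed

section \<open>One-parameter subgroups and the exponential map\<close>

definition one_parameter :: "'m \<Rightarrow> (real \<Rightarrow> 'g) \<Rightarrow> bool" where
  "one_parameter v \<gamma> \<longleftrightarrow> (\<forall>s t. \<gamma> (s + t) = \<gamma> s + \<gamma> t) \<and>
    (\<forall>f\<in>smooth_functions \<A>. ((\<lambda>t. f (\<gamma> t)) has_real_derivative lv v f 0) (at 0))"

lemma lie_exp_eq: "lie_exp \<A> (lv v) = (THE x. \<exists>\<gamma>. one_parameter v \<gamma> \<and> x = \<gamma> 1)"
  unfolding lie_exp_def one_parameter_def by (simp add: conj_assoc)

end

locale lie_exp_chart =
  lie_chart \<A> U c + G: exp_chart "lie_chart.gm U c" "lie_chart.gi U c" \<rho> \<sigma> r s R L E L'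
  for \<A> :: "('g::{topological_group_add,t2_space,second_countable_topology}, 'm::euclidean_space) atlas"
    and U c \<rho> \<sigma> r s R L E L' +
  assumes sigma_rad: "\<sigma> \<le> rad"
    and sigma_add: "x \<in> ball 0 \<sigma> \<Longrightarrow> y \<in> ball 0 \<sigma> \<Longrightarrow> \<xi> x + \<xi> y \<in> U"

lemma (in lie_chart) lie_exp_chart_exists: "\<exists>\<rho> \<sigma> r s R L E L'. lie_exp_chart \<A> U c \<rho> \<sigma> r s R L E L'"
proof -
  obtain \<rho> \<sigma> where lg: "local_group gm gi \<rho> \<sigma>" and \<sigma>: "\<sigma> \<le> rad" "\<And>x y. x \<in> ball 0 \<sigma> \<Longrightarrow> y \<in> ball 0 \<sigma> \<Longrightarrow> \<xi> x + \<xi> y \<in> U"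
    using local_group_exists by blast
  obtain r s R L E L' where "exp_chart gm gi \<rho> \<sigma> r s R L E L'"
    using local_group.exp_chart_exists[OF lg] by blast
  then have "lie_exp_chart \<A> U c \<rho> \<sigma> r s R L E L'"
    by (intro lie_exp_chart.intro lie_chart_axioms lie_exp_chart_axioms.intro \<sigma>)
  then show ?thesis by blast
qed

context lie_exp_chart
begin

lemma sigma_dom: "ball 0 \<sigma> \<subseteq> \<Omega>" using ball_rad sigma_rad by auto

lemma chi_gm: "x \<in> ball 0 \<sigma> \<Longrightarrow> y \<in> ball 0 \<sigma> \<Longrightarrow> \<xi> (gm x y) = \<xi> x + \<xi> y"
  unfolding gm_def by (rule chi_kappa[OF sigma_add])

lemma br_scale: "G.br (a *\<^sub>R v) (b *\<^sub>R v) = 0"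
  by (simp add: G.br_def blinfun.scaleR_left blinfun.scaleR_right)

text \<open>The map t -> t v is a Lie algebra homomorphism from the line, because the bracket
  vanishes on multiples of v; it integrates to a local homomorphism, which extends since the line is
  simply connected.\<close>

lemma one_parameter_exists: "\<exists>\<gamma>. one_parameter v \<gamma>"
proof -
  obtain r1 s1 R1 L1 E1 L1' where "exp_chart ((+) :: real \<Rightarrow> real \<Rightarrow> real) uminus 1 2 r1 s1 R1 L1 E1 L1'"
    using local_group.exp_chart_exists[OF real_local_group] by blast
  then interpret Z: exp_chart "(+) :: real \<Rightarrow> real \<Rightarrow> real" uminus 1 2 r1 s1 R1 L1 E1 L1' .
  interpret chart_hom "(+) :: real \<Rightarrow> real \<Rightarrow> real" uminus 1 2 r1 s1 R1 L1 E1 L1' gm gi \<rho> \<sigma> r s R L E L' "blinfun_scaleR_left v"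
    by unfold_locales (simp add: real_local_group_br br_scale)
  obtain t where t: "t > 0" "\<And>x. x \<in> ball 0 t \<Longrightarrow> D x \<in> ball 0 \<rho>" "D 0 = 0"
    "(D has_derivative (blinfun_scaleR_left v)) (at 0)"
    "\<And>x y. x \<in> ball 0 t \<Longrightarrow> y \<in> ball 0 t \<Longrightarrow> x + y \<in> ball 0 t \<Longrightarrow> D (x + y) = gm (D x) (D y)"
    using local_homomorphism by blast
  have Ds: "D x \<in> ball 0 \<sigma>" if "x \<in> ball 0 t" for x using G.rho_sigma[OF t(2)[OF that]] .
  interpret H: local_group_hom "ball (0::real) t" "\<lambda>x. \<xi> (D x)"
  proof
    fix x y :: real assume xy: "x \<in> ball 0 t" "y \<in> ball 0 t" "x + y \<in> ball 0 t"
    show "\<xi> (D (x + y)) = \<xi> (D x) + \<xi> (D y)"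
      unfolding t(5)[OF xy] by (rule chi_gm[OF Ds[OF xy(1)] Ds[OF xy(2)]])
  qed (use t(1) in auto)
  have lpc: "\<exists>W. open W \<and> 0 \<in> W \<and> (\<forall>u\<in>W. \<exists>q. path q \<and> path_image q \<subseteq> V \<and> pathstart q = 0 \<and> pathfinish q = u)"
    if V: "open V" "0 \<in> V" for V :: "real set"
  proof -
    obtain e where e: "e > 0" "ball 0 e \<subseteq> V" by (rule openE[OF V])
    have "path_image (linepath 0 u) \<subseteq> V" if "u \<in> ball 0 e" for u :: real
    proof -
      have "closed_segment 0 u \<subseteq> ball 0 e" by (rule closed_segment_subset) (use that e(1) in auto)
      then show ?thesis using e(2) by simp
    qed
    then have "\<forall>u\<in>ball 0 e. \<exists>q. path q \<and> path_image q \<subseteq> V \<and> pathstart q = 0 \<and> pathfinish q = u"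
      using path_linepath pathstart_linepath pathfinish_linepath by blast
    then show ?thesis using e(1) by (intro exI[of _ "ball 0 e"]) auto
  qed
  have "simply_connected (UNIV :: real set)" by (simp add: convex_imp_simply_connected)
  then obtain \<gamma> W where \<gamma>: "open W" "(0::real) \<in> W" "\<And>u. u \<in> W \<Longrightarrow> \<gamma> u = \<xi> (D u)" "\<And>x y. \<gamma> (x + y) = \<gamma> x + \<gamma> y"
    using H.extend_homomorphism[OF connected_UNIV _ lpc] by blast
  have "((\<lambda>t. f (\<gamma> t)) has_real_derivative lv v f 0) (at 0)" if f: "f \<in> smooth_functions \<A>" for f
  proof -
    have "((\<lambda>z. f (0 + \<xi> z)) has_derivative (\<lambda>v. lv v f 0)) (at (D 0))"
      unfolding t(3) by (rule lv_has_derivative[OF f])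
    from has_derivative_compose[OF t(4) this]
    have "((\<lambda>t. f (\<xi> (D t))) has_derivative (\<lambda>h. lv (h *\<^sub>R v) f 0)) (at 0)" by simp
    then have "((\<lambda>t. f (\<xi> (D t))) has_real_derivative lv v f 0) (at 0)"
      by (rule has_derivative_imp_has_field_derivative) (simp add: lv_scale vf_scale_def)
    then show ?thesis
      by (rule has_field_derivative_transform_within_open[OF _ \<gamma>(1,2)]) (simp add: \<gamma>(3))
  qed
  then show ?thesis unfolding one_parameter_def using \<gamma>(4) by blast
qed

text \<open>The logarithm of \<gamma> t minus t v equals twice its value at t/2 and has zero
  derivative at 0, so it vanishes by halving. The work lies in showing that \<gamma> is near the
  identity for small t and differentiable in coordinates.\<close>

lemma one_parameter_local:
  assumes \<gamma>: "one_parameter v \<gamma>"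
  shows "\<exists>\<tau>>0. \<forall>t. \<bar>t\<bar> < \<tau> \<longrightarrow> \<gamma> t = \<xi> (E (t *\<^sub>R v))"
proof -
  have add: "\<gamma> (a + b) = \<gamma> a + \<gamma> b" for a b using \<gamma> by (simp add: one_parameter_def)
  have \<gamma>0: "\<gamma> 0 = 0" by (rule additive_0[OF add])
  have der: "((\<lambda>t. f (\<gamma> t)) has_real_derivative lv v f 0) (at 0)" if "f \<in> smooth_functions \<A>" for f
    using \<gamma> that by (simp add: one_parameter_def)
  \<comment> \<open>Continuity of \<gamma> is not part of its definition. A bump composed with
    \<gamma> is differentiable at 0, so it stays positive for small t, and this keeps \<gamma> t in
    the chart.\<close>
  have near: "eventually (\<lambda>t. \<gamma> t \<in> U \<and> norm (\<kappa> (\<gamma> t)) < e) (nhds 0)" if e: "0 < e" "e < rad" for e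
  proof -
    have lf: "loc e (\<lambda>_. 1) \<in> smooth_functions \<A>" by (rule smooth_loc[OF _ e]) auto
    have "isCont (\<lambda>t. loc e (\<lambda>_. 1) (\<gamma> t)) 0" using DERIV_isCont[OF der[OF lf]] .
    then have "((\<lambda>t. loc e (\<lambda>_. 1) (\<gamma> t)) \<longlongrightarrow> loc e (\<lambda>_. 1) 0) (nhds 0)"
      using tendsto_at_iff_tendsto_nhds[of "\<lambda>t. loc e (\<lambda>_. 1) (\<gamma> t)" 0] by (simp add: isCont_def \<gamma>0)
    moreover have "loc e (\<lambda>_. 1) 0 > 0"
      using loc_chi[OF zero_dom e(1), of "\<lambda>_. 1"] e(1) by (simp add: chi_0 bump_pos_iff)
    ultimately have "eventually (\<lambda>t. loc e (\<lambda>_. 1) (\<gamma> t) > 0) (nhds 0)" by (rule order_tendstoD)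
    then show ?thesis by (rule eventually_mono) (simp add: loc_def split: if_splits)
  qed
  have hr: "0 < rad / 2" "rad / 2 < rad" using rad(1) by auto
  define k where "k = (\<lambda>t. \<kappa> (\<gamma> t))"
  have k0: "k 0 = 0" by (simp add: k_def \<gamma>0 kappa_0)
  define B where "B = loc (rad / 2) (\<lambda>_. 1)"
  have B: "B \<in> smooth_functions \<A>" unfolding B_def by (rule smooth_loc[OF _ hr]) auto
  have B0: "B 0 = b0" using loc_chi[OF zero_dom hr(1)] by (simp add: B_def chi_0 b0_def)
  have c0: "coord b 0 = 0" for b
    using loc_chi[OF zero_dom hr(1), of "\<lambda>y. y \<bullet> b"] by (simp add: coord_def chi_0)
  have kb: "((\<lambda>t. k t \<bullet> b) has_derivative (\<lambda>h. (h *\<^sub>R v) \<bullet> b)) (at 0)" for b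
  proof -
    \<comment> \<open>Dividing by \<open>B\<close> removes the bump from the coordinate
      function.\<close>
    have q: "((\<lambda>t. coord b (\<gamma> t) / B (\<gamma> t)) has_real_derivative v \<bullet> b) (at 0)"
      using DERIV_divide[OF der[OF smooth_coord] der[OF B], of b] b0_pos by (simp add: \<gamma>0 B0 c0 lv_coord)
    obtain W where W: "open W" "(0::real) \<in> W" "\<And>t. t \<in> W \<Longrightarrow> \<gamma> t \<in> U \<and> norm (\<kappa> (\<gamma> t)) < rad / 2"
      using near[OF hr] unfolding eventually_nhds by blast
    have "coord b (\<gamma> t) / B (\<gamma> t) = k t \<bullet> b" if "t \<in> W" for t
      using W(3)[OF that] bump_pos_iff[OF hr(1), of "\<kappa> (\<gamma> t)"] by (simp add: coord_def B_def loc_def k_def)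
    then have "((\<lambda>t. k t \<bullet> b) has_real_derivative v \<bullet> b) (at 0)"
      by (rule has_field_derivative_transform_within_open[OF q W(1,2)])
    moreover have "(\<lambda>h. (h *\<^sub>R v) \<bullet> b) = (*) (v \<bullet> b)" by (auto simp: mult.commute)
    ultimately show ?thesis by (simp only: has_field_derivative_def)
  qed
  have kd: "(k has_derivative (\<lambda>h. h *\<^sub>R v)) (at 0)"
    using kb by (subst has_derivative_componentwise_within) simp
  define q where "q = (\<lambda>t. L (k t) - t *\<^sub>R v)"
  have q0: "q 0 = 0" by (simp add: q_def k0 G.L_0)
  have "((\<lambda>t. L (k t)) has_derivative (\<lambda>h. h *\<^sub>R v)) (at 0)"
    by (rule has_derivative_compose[OF kd]) (simp add: k0 G.L_deriv_0)
  from has_derivative_diff[OF this has_derivative_scaleR_left[OF has_derivative_ident, of v]]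
  have qd: "(q has_derivative (\<lambda>_. 0)) (at 0)" by (simp add: q_def)
  have sr: "0 < min s rad / 2" "min s rad / 2 < rad" using rad(1) G.s_pos by auto
  obtain W where W: "open W" "(0::real) \<in> W" "\<And>t. t \<in> W \<Longrightarrow> \<gamma> t \<in> U \<and> norm (\<kappa> (\<gamma> t)) < min s rad / 2"
    using near[OF sr] unfolding eventually_nhds by blast
  obtain \<tau> where \<tau>: "\<tau> > 0" "ball 0 \<tau> \<subseteq> W" using W open_contains_ball by blast
  have in\<tau>: "\<gamma> t \<in> U" "k t \<in> ball 0 s" "k t \<in> ball 0 r" if "\<bar>t\<bar> < \<tau>" for t
    using W(3)[of t] \<tau>(2) that G.s_le G.s_pos by (auto simp: k_def)
  have "q t = 0" if t: "norm t < \<tau>" for t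
  proof (rule halving_vanish[where c = 0 and q = 2 and r = \<tau> and f = q, OF _ _ _ _ t])
    fix t :: real assume t: "norm t < \<tau>"
    then have t2: "\<bar>t /\<^sub>R 2\<bar> < \<tau>" by simp
    have "\<gamma> t = \<gamma> (t /\<^sub>R 2) + \<gamma> (t /\<^sub>R 2)" by (simp add: add[symmetric])
    then have "k t = gm (k (t /\<^sub>R 2)) (k (t /\<^sub>R 2))"
      using in\<tau>(1)[OF t2] by (simp add: gm_def k_def chi_kappa)
    then have "L (k t) = 2 *\<^sub>R L (k (t /\<^sub>R 2))"
      using G.L_square[OF in\<tau>(3)[OF t2]] in\<tau>(3)[of t] t by simp
    then have "q t = 2 *\<^sub>R q (t /\<^sub>R 2)" by (simp add: q_def scaleR_diff_right)
    then show "norm (q t) \<le> 2 * (1 + 0 * norm t) * norm (q (t /\<^sub>R 2))" by simp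
  next
    show "(\<lambda>k. 2 ^ k * norm (q (t /\<^sub>R 2 ^ k))) \<longlonglongrightarrow> 0"
      by (rule has_derivative_dyadic_tendsto_0[where f = q, OF qd q0])
  qed auto
  then have "\<gamma> t = \<xi> (E (t *\<^sub>R v))" if "\<bar>t\<bar> < \<tau>" for t
  proof -
    have "L (k t) = t *\<^sub>R v" using \<open>\<And>t. norm t < \<tau> \<Longrightarrow> q t = 0\<close>[of t] that by (simp add: q_def)
    then have "E (t *\<^sub>R v) = k t" using G.E_L[OF in\<tau>(2)[OF that]] by simp
    then show ?thesis using chi_kappa[OF in\<tau>(1)[OF that]] by (simp add: k_def)
  qed
  then show ?thesis using \<tau>(1) by blast
qed

lemma one_parameter_unique:
  assumes "one_parameter v \<gamma>" "one_parameter v \<gamma>'"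
  shows "\<gamma> t = \<gamma>' t"
proof -
  obtain a where a: "a > 0" "\<And>t. \<bar>t\<bar> < a \<Longrightarrow> \<gamma> t = \<xi> (E (t *\<^sub>R v))" using one_parameter_local[OF assms(1)] by blast
  obtain b where b: "b > 0" "\<And>t. \<bar>t\<bar> < b \<Longrightarrow> \<gamma>' t = \<xi> (E (t *\<^sub>R v))" using one_parameter_local[OF assms(2)] by blast
  show ?thesis
  proof (rule additive_eq[of "ball 0 (min a b)" \<gamma> \<gamma>'])
    show "\<gamma> u = \<gamma>' u" if "u \<in> ball 0 (min a b)" for u using a(2)[of u] b(2)[of u] that by simp
  qed (use a b assms in \<open>auto simp: one_parameter_def\<close>)
qed

lemma lie_exp_one_parameter: "one_parameter v \<gamma> \<Longrightarrow> lie_exp \<A> (lv v) = \<gamma> 1"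
  unfolding lie_exp_eq by (rule the_equality) (use one_parameter_unique in blast)+

text \<open>Near t = 0 the one-parameter subgroup is \<xi>(E(t w)); the doubling rule for
  \<open>E\<close> doubles the range of t in every step until it reaches 1.\<close>

lemma lie_exp_local:
  assumes w: "w \<in> ball 0 R"
  shows "lie_exp \<A> (lv w) = \<xi> (E w)"
proof -
  obtain \<gamma> where \<gamma>: "one_parameter w \<gamma>" using one_parameter_exists by blast
  obtain \<tau> where \<tau>: "\<tau> > 0" "\<And>t. \<bar>t\<bar> < \<tau> \<Longrightarrow> \<gamma> t = \<xi> (E (t *\<^sub>R w))" using one_parameter_local[OF \<gamma>] by blast
  have *: "\<gamma> t = \<xi> (E (t *\<^sub>R w))" if "\<bar>t\<bar> < 2 ^ k * \<tau>" "\<bar>t\<bar> \<le> 1" for k t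
    using that
  proof (induction k arbitrary: t)
    case (Suc k)
    have h: "\<gamma> (t / 2) = \<xi> (E ((t / 2) *\<^sub>R w))" using Suc.IH[of "t / 2"] Suc.prems by simp
    have tw: "t *\<^sub>R w \<in> ball 0 R"
      using w mult_left_le_one_le[of "norm w" "\<bar>t\<bar>"] Suc.prems(2) by (simp add: mult.commute)
    have th: "(t *\<^sub>R w) /\<^sub>R 2 = (t / 2) *\<^sub>R w" by simp
    have "\<gamma> (t / 2 + t / 2) = \<gamma> (t / 2) + \<gamma> (t / 2)" using \<gamma> unfolding one_parameter_def by blast
    then have "\<gamma> t = \<gamma> (t / 2) + \<gamma> (t / 2)" by simp
    also have "\<dots> = \<xi> (gm (E ((t / 2) *\<^sub>R w)) (E ((t / 2) *\<^sub>R w)))"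
      unfolding h using chi_gm[OF G.E_sigma G.E_sigma] G.half_in[OF tw] by (simp only: th)
    also have "\<dots> = \<xi> (E (t *\<^sub>R w))" using G.E_double[OF tw] by (simp only: th)
    finally show ?case .
  qed (use \<tau>(2) in simp)
  obtain k where "1 / \<tau> < 2 ^ k" using real_arch_pow[of 2 "1 / \<tau>"] by auto
  then have "1 < 2 ^ k * \<tau>" using \<tau>(1) by (simp add: field_simps)
  then have "\<gamma> 1 = \<xi> (E w)" using *[of 1 k] by simp
  then show ?thesis using lie_exp_one_parameter[OF \<gamma>] by simp
qed

text \<open>Provides a neighbourhood of the identity on which formulas for exponentials determine
  additive maps, and in which the spatial cutoff is supported.\<close>

lemma lie_exp_range: "\<exists>W. open W \<and> 0 \<in> W \<and> W \<subseteq> lie_exp \<A> ` lie_algebra \<A>"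
proof (intro exI[of _ "\<xi> ` ball 0 s"] conjI subsetI)
  have "s \<le> \<sigma>" using G.s_le G.r_le G.rho_le by linarith
  then show "open (\<xi> ` ball 0 s)"
    by (intro open_chi_image[OF open_ball] order_trans[OF subset_ball sigma_dom])
  show "0 \<in> \<xi> ` ball 0 s" using G.s_pos chi_0 by (intro image_eqI[of _ _ 0]) auto
  fix x assume "x \<in> \<xi> ` ball 0 s"
  then obtain z where z: "z \<in> ball 0 s" "x = \<xi> z" by blast
  then have "x = lie_exp \<A> (lv (L z))" using lie_exp_local[OF G.L_in[OF z(1)]] G.E_L[OF z(1)] by simp
  then show "x \<in> lie_exp \<A> ` lie_algebra \<A>" using lv_in_lie_algebra by blast
qed

text \<open>In coordinates \<open>lv u\<close> differentiates along the frame
  \<open>G.J y u\<close>. In the commutator the second derivatives of f cancel by symmetry, and the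
  antisymmetrized derivative of the frame at 0 is \<open>G.br\<close>.\<close>

lemma lie_bracket_lv_0:
  assumes f: "f \<in> smooth_functions \<A>"
  shows "lie_bracket (lv v) (lv w) f 0 = lv (G.br v w) f 0"
proof -
  define F where "F = (\<lambda>y. f (\<xi> y))"
  have F: "smooth_on (ball 0 \<sigma>) F"
    using smooth_on_subset[OF smooth_shift[OF f, of 0] sigma_dom] by (simp add: F_def)
  have lF: "lv u f 0 = blinfun_deriv F 0 u" for u
    using smooth_on_has_derivative[OF F G.zero_in(1)] by (intro lv_unique[OF f]) (simp add: F_def)
  have J0: "G.J 0 u = u" for u by (simp add: G.J_0)
  have lw: "lv u f (\<xi> y) = blinfun_deriv F y (G.J y u)" if y: "y \<in> ball 0 \<sigma>" for y u
  proof (rule lv_unique[OF f])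
    have m0: "gm y 0 = y" by (rule G.m_0_right[OF y])
    have d: "((\<lambda>z. F (gm y z)) has_derivative (\<lambda>h. blinfun_deriv F y (G.D2 y 0 h))) (at 0)"
      by (rule has_derivative_compose[OF G.m_right_has_derivative[OF y G.zero_in(1)]])
        (use smooth_on_has_derivative[OF F y] in \<open>simp add: m0\<close>)
    show "((\<lambda>z. f (\<xi> y + \<xi> z)) has_derivative (\<lambda>h. blinfun_deriv F y (G.J y h))) (at 0)"
      unfolding G.J_def
      by (rule has_derivative_transform_within_open[OF d open_ball G.zero_in(1)]) (simp add: F_def chi_gm[OF y])
  qed
  have second: "lv a (lv b f) 0 = blinfun_deriv F 0 (blinfun_deriv G.J 0 a b) + blinfun_deriv (\<lambda>x. blinfun_deriv F x b) 0 a" for a b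
  proof (rule lv_unique[OF lv_smooth[OF f]])
    have dF: "smooth_on (ball 0 \<sigma>) (blinfun_deriv F)" by (rule smooth_on_blinfun_deriv[OF open_ball F])
    have 1: "(blinfun_deriv F has_derivative blinfun_deriv (blinfun_deriv F) 0) (at 0)"
      by (rule smooth_on_has_derivative[OF dF G.zero_in(1)])
    have 2: "((\<lambda>y. G.J y b) has_derivative (\<lambda>h. blinfun_deriv G.J 0 h b)) (at 0)"
      by (rule bounded_linear.has_derivative[OF blinfun.bounded_linear_left smooth_on_has_derivative[OF G.smooth_J G.zero_in(1)]])
    have 3: "((\<lambda>x. blinfun_deriv F x b) has_derivative (\<lambda>h. blinfun_deriv (blinfun_deriv F) 0 h b)) (at 0)"
      by (rule bounded_linear.has_derivative[OF blinfun.bounded_linear_left 1])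
    have 4: "blinfun_deriv (blinfun_deriv F) 0 h b = blinfun_deriv (\<lambda>x. blinfun_deriv F x b) 0 h" for h
      using has_derivative_imp_blinfun_deriv[OF 3] by simp
    have "((\<lambda>y. blinfun_deriv F y (G.J y b)) has_derivative
        (\<lambda>h. blinfun_deriv F 0 (blinfun_deriv G.J 0 h b) + blinfun_deriv (\<lambda>x. blinfun_deriv F x b) 0 h)) (at 0)"
      using bounded_bilinear.FDERIV[OF bounded_bilinear_blinfun_apply 1 2] unfolding J0 4 .
    then show "((\<lambda>y. lv b f (0 + \<xi> y)) has_derivative
        (\<lambda>h. blinfun_deriv F 0 (blinfun_deriv G.J 0 h b) + blinfun_deriv (\<lambda>x. blinfun_deriv F x b) 0 h)) (at 0)"
      by (rule has_derivative_transform_within_open[OF _ open_ball G.zero_in(1)]) (simp add: lw)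
  qed
  show ?thesis
    unfolding lie_bracket_def second lF G.br_def
    using second_derivative_symmetric[OF open_ball F G.zero_in(1), of w v] by (simp add: blinfun.diff_right)
qed

lemma lie_bracket_lv: "lie_bracket (lv v) (lv w) = lv (G.br v w)"
proof (intro ext)
  fix f x
  show "lie_bracket (lv v) (lv w) f x = lv (G.br v w) f x"
  proof (cases "f \<in> smooth_functions \<A>")
    case True
    have t: "lv a (lv b f) (x + 0) = lv a (lv b (\<lambda>y. f (x + y))) 0" for a b
      unfolding lv_translate[OF True] lv_translate[OF lv_smooth[OF True]] ..
    have "lie_bracket (lv v) (lv w) f x = lie_bracket (lv v) (lv w) (\<lambda>y. f (x + y)) 0"
      unfolding lie_bracket_def using t[of v w] t[of w v] by simp
    also have "\<dots> = lv (G.br v w) (\<lambda>y. f (x + y)) 0"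
      by (rule lie_bracket_lv_0[OF smooth_function_translate[OF True]])
    finally show ?thesis unfolding lv_translate[OF True] by simp
  next
    case False
    have "lv a (\<lambda>x. 0) x = 0" for a by (rule vfield_const[OF lv_in_lie_algebra])
    then show ?thesis using False by (simp add: lie_bracket_def lv_not_smooth)
  qed
qed

text \<open>The local homomorphism with differential \<delta> is extended to the group, and F(x) =
  F(y) + F(-y + x) carries its smoothness from the identity to every point y.\<close>

lemma automorphism_exists:
  assumes conn: "connected (UNIV :: 'g set)" and sc: "simply_connected (UNIV :: 'g set)"
    and \<delta>: "linear \<delta>" "\<And>v w. \<delta> (G.br v w) = G.br (\<delta> v) (\<delta> w)"
  shows "\<exists>F. (\<forall>x y. F (x + y) = F x + F y) \<and> continuous_on UNIV F \<and>
    (\<forall>f\<in>smooth_functions \<A>. (\<lambda>x. f (F x)) \<in> smooth_functions \<A> \<and>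
       (\<forall>v x. lv v (\<lambda>x. f (F x)) x = lv (\<delta> v) f (F x)))"
proof -
  have bl: "bounded_linear \<delta>" using \<delta>(1) by (simp add: linear_conv_bounded_linear)
  interpret chart_hom gm gi \<rho> \<sigma> r s R L E L' gm gi \<rho> \<sigma> r s R L E L' "Blinfun \<delta>"
    by unfold_locales (simp add: bounded_linear_Blinfun_apply[OF bl] \<delta>(2))
  obtain t where t: "t > 0" "t \<le> \<rho>" "smooth_on (ball 0 t) D" "\<And>x. x \<in> ball 0 t \<Longrightarrow> D x \<in> ball 0 \<rho>" "D 0 = 0"
    "(D has_derivative \<delta>) (at 0)"
    "\<And>x y. x \<in> ball 0 t \<Longrightarrow> y \<in> ball 0 t \<Longrightarrow> gm x y \<in> ball 0 t \<Longrightarrow> D (gm x y) = gm (D x) (D y)"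
    using local_homomorphism unfolding bounded_linear_Blinfun_apply[OF bl] by blast
  have Ds: "D x \<in> ball 0 \<sigma>" if "x \<in> ball 0 t" for x using G.rho_sigma[OF t(4)[OF that]] .
  have tO: "ball 0 t \<subseteq> \<Omega>" using sigma_dom t(2) G.rho_le by auto
  have ts: "x \<in> ball 0 \<sigma>" if "x \<in> ball 0 t" for x using that t(2) G.rho_le by auto
  define V where "V = \<xi> ` ball 0 t"
  have kV: "\<kappa> x \<in> ball 0 t" "\<xi> (\<kappa> x) = x" if "x \<in> V" for x
    using that tO kappa_chi by (force simp: V_def)+
  have V0: "0 \<in> V" unfolding V_def using t(1) chi_0 by (intro image_eqI[of _ _ 0]) auto
  have oV: "open V" unfolding V_def by (rule open_chi_image[OF open_ball tO])
  interpret Hm: local_group_hom V "\<lambda>x. \<xi> (D (\<kappa> x))"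
  proof
    fix x y assume xy: "x \<in> V" "y \<in> V" "x + y \<in> V"
    have "gm (\<kappa> x) (\<kappa> y) = \<kappa> (x + y)" using xy by (simp add: gm_def kV)
    then have "D (\<kappa> (x + y)) = gm (D (\<kappa> x)) (D (\<kappa> y))"
      using t(7)[OF kV(1)[OF xy(1)] kV(1)[OF xy(2)]] kV(1)[OF xy(3)] by simp
    then show "\<xi> (D (\<kappa> (x + y))) = \<xi> (D (\<kappa> x)) + \<xi> (D (\<kappa> y))"
      using chi_gm[OF Ds Ds] kV(1) xy by simp
  qed (use oV V0 in auto)
  obtain F W where F: "open W" "0 \<in> W" "\<And>u. u \<in> W \<Longrightarrow> F u = \<xi> (D (\<kappa> u))" "\<And>x y. F (x + y) = F x + F y"
    using Hm.extend_homomorphism[OF conn sc locally_path_connected_0] by blast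
  have "open (\<Omega> \<inter> \<xi> -` W)" by (rule continuous_open_preimage[OF continuous_chi open_dom F(1)])
  then obtain e' where e': "e' > 0" "ball 0 e' \<subseteq> \<Omega> \<inter> \<xi> -` W"
    by (rule openE[of _ 0]) (use zero_dom F(2) chi_0 in auto)
  define e where "e = min e' t"
  have e: "e > 0" "ball 0 e \<subseteq> ball (0::'m) t" "ball 0 e \<subseteq> \<Omega>" using e' t(1) by (auto simp: e_def)
  have Fe: "F (\<xi> z) = \<xi> (D z)" if z: "z \<in> ball 0 e" for z
  proof -
    have "z \<in> ball 0 e'" using z by (simp add: e_def)
    then have "\<xi> z \<in> W" "z \<in> \<Omega>" using e'(2) by auto
    then show ?thesis using F(3)[of "\<xi> z"] kappa_chi[of z] by simp
  qed
  have smooth: "(\<lambda>x. f (F x)) \<in> smooth_functions \<A>" if f: "f \<in> smooth_functions \<A>" for f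
  proof (rule smooth_functionI)
    fix W d assume W: "(W, d) \<in> \<A>"
    let ?i = "inv_into W d"
    show "smooth_on (d ` W) (\<lambda>y. f (F (?i y)))"
    proof (rule smooth_on_local)
      fix y0 assume y0: "y0 \<in> d ` W"
      define T where "T = d ` W \<inter> (\<lambda>y. - ?i y0 + ?i y) -` (\<xi> ` ball 0 e)"
      have s: "smooth_into (d ` W) (\<lambda>y. - ?i y0 + ?i y)"
        by (rule smooth_into_add[OF smooth_into_const[OF chartD(2)[OF W]] smooth_into_chart[OF W]])
      have oT: "open T" unfolding T_def by (rule smooth_into_preimage[OF s open_chi_image[OF open_ball e(3)]])
      have sT: "smooth_into T (\<lambda>y. - ?i y0 + ?i y)"
        by (rule smooth_into_compose[OF s oT smooth_on_ident[OF oT]]) (auto simp: T_def)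
      have kT: "\<kappa> (- ?i y0 + ?i y) \<in> ball 0 e" "- ?i y0 + ?i y \<in> U" "\<xi> (\<kappa> (- ?i y0 + ?i y)) = - ?i y0 + ?i y" if "y \<in> T" for y
      proof -
        obtain z where z: "- ?i y0 + ?i y = \<xi> z" "z \<in> ball 0 e" using \<open>y \<in> T\<close> by (auto simp: T_def)
        then have "z \<in> \<Omega>" using e(3) by blast
        then show "\<kappa> (- ?i y0 + ?i y) \<in> ball 0 e" "- ?i y0 + ?i y \<in> U" "\<xi> (\<kappa> (- ?i y0 + ?i y)) = - ?i y0 + ?i y"
          using z kappa_chi chi_in by auto
      qed
      have k: "smooth_on T (\<lambda>y. \<kappa> (- ?i y0 + ?i y))"
        by (rule smooth_kappa[OF sT]) (use kT(2) in blast)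
      have "smooth_on T (\<lambda>y. D (\<kappa> (- ?i y0 + ?i y)))"
        by (rule smooth_on_compose[OF oT open_ball smooth_on_subset[OF t(3) e(2)] k]) (use kT(1) in blast)
      then have "smooth_on T (\<lambda>y. f (F (?i y0) + \<xi> (D (\<kappa> (- ?i y0 + ?i y)))))"
        by (rule smooth_on_compose[OF oT open_dom smooth_shift[OF f]]) (use kT(1) Ds sigma_dom e(2) in blast)
      then have "smooth_on T (\<lambda>y. f (F (?i y)))"
      proof (rule smooth_on_eq[OF oT])
        fix y assume y: "y \<in> T"
        have "F (?i y) = F (?i y0) + F (- ?i y0 + ?i y)" by (simp add: F(4)[symmetric])
        also have "F (- ?i y0 + ?i y) = \<xi> (D (\<kappa> (- ?i y0 + ?i y)))"
          using Fe[OF kT(1)[OF y]] kT(3)[OF y] by simp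
        finally show "f (F (?i y0) + \<xi> (D (\<kappa> (- ?i y0 + ?i y)))) = f (F (?i y))" by simp
      qed
      moreover have "y0 \<in> T" using y0 e(1) chi_0 by (auto simp: T_def intro!: image_eqI[of _ _ 0])
      ultimately show "\<exists>T. open T \<and> y0 \<in> T \<and> smooth_on T (\<lambda>y. f (F (?i y)))" using oT by blast
    qed
  qed
  have "lv v (\<lambda>x. f (F x)) x = lv (\<delta> v) f (F x)" if f: "f \<in> smooth_functions \<A>" for f v x
  proof (rule lv_unique[OF smooth[OF f]])
    have "((\<lambda>z. f (F x + \<xi> z)) has_derivative (\<lambda>v. lv v f (F x))) (at (D 0))"
      unfolding t(5) by (rule lv_has_derivative[OF f])
    from has_derivative_compose[OF t(6) this]
    have "((\<lambda>z. f (F x + \<xi> (D z))) has_derivative (\<lambda>v. lv (\<delta> v) f (F x))) (at 0)" .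
    then show "((\<lambda>z. f (F (x + \<xi> z))) has_derivative (\<lambda>v. lv (\<delta> v) f (F x))) (at 0)"
      by (rule has_derivative_transform_within_open[OF _ open_ball, of _ _ _ _ 0 e]) (use e(1) Fe F(4) in auto)
  qed
  moreover have "continuous_on UNIV F"
  proof (rule additive_continuous[OF open_chi_image[OF open_ball e(3)]])
    have kV': "\<kappa> x \<in> ball 0 e" "\<xi> (\<kappa> x) = x" "x \<in> U" if "x \<in> \<xi> ` ball 0 e" for x
      using that e(3) kappa_chi chi_in by force+
    have ck: "continuous_on (\<xi> ` ball 0 e) \<kappa>" using continuous_on_subset[OF continuous_kappa] kV'(3) by blast
    have "continuous_on (ball 0 e) D"
      using smooth_on_subset[OF t(3) e(2)] unfolding smooth_on_def by (metis Ck_on.simps(1))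
    from continuous_on_compose2[OF this ck]
    have "continuous_on (\<xi> ` ball 0 e) (\<lambda>x. D (\<kappa> x))" using kV'(1) by blast
    moreover have "D (\<kappa> x) \<in> \<Omega>" if "x \<in> \<xi> ` ball 0 e" for x
      using Ds[of "\<kappa> x"] sigma_dom e(2) kV'(1)[OF that] by blast
    ultimately have "continuous_on (\<xi> ` ball 0 e) (\<lambda>x. \<xi> (D (\<kappa> x)))"
      by (intro continuous_on_compose2[OF continuous_chi]) auto
    then show "continuous_on (\<xi> ` ball 0 e) F"
      by (rule continuous_on_eq) (use Fe kV' in metis)
    show "0 \<in> \<xi> ` ball 0 e" using e(1) chi_0 by (intro image_eqI[of _ _ 0]) auto
  qed (rule F(4))
  ultimately show ?thesis using F(4) smooth by blast
qed

end

section \<open>Dilations of graded groups\<close>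

locale graded_chart = lie_exp_chart \<A> U c \<rho> \<sigma> r s R L E L'
  for \<A> :: "('g::{topological_group_add,t2_space,second_countable_topology}, 'm::euclidean_space) atlas"
    and U c \<rho> \<sigma> r s R L E L' +
  fixes V :: "nat \<Rightarrow> 'g vfield set" and n :: nat and X :: "nat \<Rightarrow> 'g vfield" and \<nu> :: "nat \<Rightarrow> nat"
  assumes graded: "graded_lie_group \<A> V" and malcev: "strong_malcev_basis V n X \<nu>"
begin

lemma gradation: "gradation \<A> V"
  and conn: "connected (UNIV :: 'g set)" and sc: "simply_connected (UNIV :: 'g set)"
  using graded by (auto simp: graded_lie_group_def)

lemma V_sub: "vf.subspace (V i)" "V i \<subseteq> lie_algebra \<A>"
  and V_fin: "finite {i. V i \<noteq> {0}}"
  and V_dec: "Z \<in> lie_algebra \<A> \<Longrightarrow> \<exists>!Y. (\<forall>i. Y i \<in> V i) \<and> Z = (\<Sum>i | V i \<noteq> {0}. Y i)"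
  and V_bracket: "Y \<in> V i \<Longrightarrow> Z \<in> V j \<Longrightarrow> lie_bracket Y Z \<in> V (i + j)"
proof -
  note g = gradation[unfolded gradation_def]
  note g2 = conjunct2[OF g] note g3 = conjunct2[OF g2] note g4 = conjunct2[OF g3] note g5 = conjunct2[OF g4]
  show "vf.subspace (V i)" "V i \<subseteq> lie_algebra \<A>" using conjunct1[OF g] by blast+
  show "finite {i. V i \<noteq> {0}}" by (rule conjunct1[OF g3])
  show "Z \<in> lie_algebra \<A> \<Longrightarrow> \<exists>!Y. (\<forall>i. Y i \<in> V i) \<and> Z = (\<Sum>i | V i \<noteq> {0}. Y i)"
    by (rule bspec[OF conjunct1[OF g4]])
  show "Y \<in> V i \<Longrightarrow> Z \<in> V j \<Longrightarrow> lie_bracket Y Z \<in> V (i + j)" using g5 by simp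
qed

abbreviation B where "B \<equiv> X ` {1..n}"

lemma inj_X: "inj_on X {1..n}"
  and B_indep: "vf.independent (X ` {j\<in>{1..n}. \<nu> j = i})"
  and B_span: "vf.span (X ` {j\<in>{1..n}. \<nu> j = i}) = V i"
proof -
  note g = malcev[unfolded strong_malcev_basis_def Let_def]
  show "inj_on X {1..n}" by (rule conjunct1[OF g])
  note h = spec[OF conjunct2[OF conjunct2[OF g]], of i]
  show "vf.independent (X ` {j\<in>{1..n}. \<nu> j = i})" "vf.span (X ` {j\<in>{1..n}. \<nu> j = i}) = V i"
    by (rule conjunct1[OF h], rule conjunct2[OF h])
qed

lemma X_in_V: "j \<in> {1..n} \<Longrightarrow> X j \<in> V (\<nu> j)"
  unfolding B_span[of "\<nu> j", symmetric] by (rule vf.span_base) (rule imageI, simp)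

lemma X_in: "j \<in> {1..n} \<Longrightarrow> X j \<in> lie_algebra \<A>"
  using subsetD[OF V_sub(2) X_in_V] .

lemma X_nonzero: "j \<in> {1..n} \<Longrightarrow> X j \<noteq> 0"
proof
  assume j: "j \<in> {1..n}" and "X j = 0"
  have "X j \<in> X ` {i\<in>{1..n}. \<nu> i = \<nu> j}" by (rule imageI) (use j in simp)
  then have "vf.dependent (X ` {i\<in>{1..n}. \<nu> i = \<nu> j})" unfolding \<open>X j = 0\<close> by (rule vf.dependent_zero)
  then show False using B_indep by simp
qed

lemma weight_V: "j \<in> {1..n} \<Longrightarrow> V (\<nu> j) \<noteq> {0}"
  using X_in_V[of j] X_nonzero[of j] by auto

section \<open>Coordinates with respect to the graded basis\<close>

lemma lv_0: "lv 0 = 0" using lv_scale[of 0 0] by simp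

lemma lv_sum: "lv (\<Sum>i\<in>I. f i) = (\<Sum>i\<in>I. lv (f i))"
  by (induction I rule: infinite_finite_induct) (simp_all add: lv_0 lv_add)

text \<open>Grouping a linear relation by degree writes 0 as a sum over the \<open>V i\<close>;
  uniqueness of the decomposition makes every group vanish, and within one degree the basis is
  independent.\<close>

lemma B_independent: "vf.independent B"
  apply (rule vf.independent_if_scalars_zero)
   apply simp
  subgoal premises prems for f Z
  proof -
  note s = prems(1) and Z = prems(2)
  define Y where "Y i = (\<Sum>j | j \<in> {1..n} \<and> \<nu> j = i. vf_scale (f (X j)) (X j))" for i
  have Y: "Y i \<in> V i" for i
    unfolding Y_def by (rule vf.subspace_sum[OF V_sub(1)]) (auto intro!: vf.subspace_scale[OF V_sub(1)] X_in_V)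
  have "(\<Sum>i | V i \<noteq> {0}. Y i) = (\<Sum>j\<in>{1..n}. vf_scale (f (X j)) (X j))"
    unfolding Y_def by (rule sum.group[where g = \<nu>, simplified]) (use V_fin weight_V in auto)
  also have "\<dots> = (\<Sum>x\<in>B. vf_scale (f x) x)" using inj_X by (simp add: sum.reindex)
  finally have Y0: "(\<Sum>i | V i \<noteq> {0}. Y i) = 0" using s by simp
  have "0 \<in> lie_algebra \<A>" using lv_in_lie_algebra[of 0] lv_0 by simp
  note t = the1_equality[OF V_dec[OF this]]
  have "Y = (\<lambda>i. 0)"
    by (rule trans[OF t[of Y, symmetric] t[of "\<lambda>i. 0"]])
      (simp_all add: Y Y0 vf.subspace_0[OF V_sub(1)])
  obtain j where j: "Z = X j" "j \<in> {1..n}" using Z by (rule imageE)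
  let ?J = "{i \<in> {1..n}. \<nu> i = \<nu> j}"
  have "inj_on X ?J" using inj_X by (rule inj_on_subset) auto
  then have "(\<Sum>x\<in>X ` ?J. vf_scale (f x) x) = Y (\<nu> j)" by (simp add: sum.reindex Y_def)
  also have "\<dots> = 0" by (simp add: \<open>Y = _\<close>)
  finally have s0: "(\<Sum>x\<in>X ` ?J. vf_scale (f x) x) = 0" .
  have "j \<in> ?J" using j(2) by simp
  then have "X j \<in> X ` ?J" by (rule imageI[of j _ X])
  have "finite (X ` ?J)" by simp
  then show ?thesis
    unfolding j(1) by (rule vf.independentD[of "X ` ?J" "X ` ?J" f "X j", OF B_indep _ order.refl s0]) fact
  qed
  done

lemma lie_algebra_span: "lv v \<in> vf.span B"
proof -
  obtain Y where Y: "(\<forall>i. Y i \<in> V i) \<and> lv v = (\<Sum>i | V i \<noteq> {0}. Y i)"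
    using V_dec[OF lv_in_lie_algebra[of v]] by (rule ex1E)
  have "V i \<subseteq> vf.span B" for i unfolding B_span[symmetric] by (intro vf.span_mono image_mono) auto
  from subsetD[OF this] have "(\<Sum>i | V i \<noteq> {0}. Y i) \<in> vf.span B"
    by (rule vf.span_sum) (rule spec[OF conjunct1[OF Y]])
  then show ?thesis using Y by simp
qed

definition e :: "nat \<Rightarrow> 'm" where "e j = (SOME v. lv v = X j)"

lemma lv_e: "j \<in> {1..n} \<Longrightarrow> lv (e j) = X j"
proof -
  assume j: "j \<in> {1..n}"
  obtain v where "X j = lv v" using X_in[OF j, unfolded lie_algebra_eq] by (rule rangeE)
  then show ?thesis unfolding e_def by (intro someI[of "\<lambda>v. lv v = X j" v]) (rule sym)
qed

definition co :: "nat \<Rightarrow> 'm \<Rightarrow> real" where "co j v = vf.representation B (lv v) (X j)"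

lemma co_add: "co j (v + w) = co j v + co j w" and co_scale: "co j (a *\<^sub>R v) = a * co j v"
  unfolding co_def lv_add lv_scale vf.representation_add[OF B_independent lie_algebra_span lie_algebra_span]
    vf.representation_scale[OF B_independent lie_algebra_span] by (rule refl)+

lemma co_sum: "co j (\<Sum>i\<in>I. f i) = (\<Sum>i\<in>I. co j (f i))"
proof (induction I rule: infinite_finite_induct)
  case (insert x F)
  then show ?case by (simp add: co_add)
qed (simp_all add: co_def lv_0 vf.representation_zero)

lemma co_e: "j \<in> {1..n} \<Longrightarrow> i \<in> {1..n} \<Longrightarrow> co j (e i) = (if i = j then 1 else 0)"
proof -
  assume ij: "j \<in> {1..n}" "i \<in> {1..n}"
  show ?thesis
    unfolding co_def lv_e[OF ij(2)] vf.representation_basis[OF B_independent imageI[OF ij(2), of X]]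
    using inj_on_eq_iff[OF inj_X ij] by auto
qed

lemma expand: "v = (\<Sum>j = 1..n. co j v *\<^sub>R e j)"
proof -
  have "lv (\<Sum>j = 1..n. co j v *\<^sub>R e j) = (\<Sum>j = 1..n. vf_scale (co j v) (X j))"
    unfolding lv_sum lv_scale by (rule sum.cong[OF refl]) (simp only: lv_e)
  also have "\<dots> = (\<Sum>x\<in>B. vf_scale (vf.representation B (lv v) x) x)"
    unfolding sum.reindex[OF inj_X] o_def co_def by (rule refl)
  also have "\<dots> = lv v"
    by (rule vf.sum_representation_eq[OF B_independent lie_algebra_span]) auto
  finally show ?thesis by (simp add: lv_inject)
qed

section \<open>Dilations of the Lie algebra and of the group\<close>

definition \<delta> :: "real \<Rightarrow> 'm \<Rightarrow> 'm" where
  "\<delta> q v = (\<Sum>j = 1..n. (q ^ \<nu> j * co j v) *\<^sub>R e j)"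

lemma lv_delta: "lv (\<delta> q v) = dil_alg n X \<nu> q (lv v)"
  unfolding dil_alg_def \<delta>_def lv_sum lv_scale by (rule sum.cong[OF refl]) (simp only: lv_e co_def)

lemma linear_delta: "linear (\<delta> q)"
  by (rule linearI) (simp_all add: \<delta>_def co_add co_scale algebra_simps sum.distrib scaleR_sum_right)

lemma co_delta:
  assumes j: "j \<in> {1..n}"
  shows "co j (\<delta> q v) = q ^ \<nu> j * co j v"
proof -
  have "co j (\<delta> q v) = (\<Sum>i = 1..n. if i = j then q ^ \<nu> j * co j v else 0)"
    unfolding \<delta>_def co_sum by (rule sum.cong[OF refl]) (simp add: co_scale co_e[OF j])
  then show ?thesis using j by simp
qed

lemma delta_delta: "\<delta> q (\<delta> t v) = \<delta> (q * t) v"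
  unfolding \<delta>_def[of q] \<delta>_def[of "q * t"]
  by (rule sum.cong[OF refl]) (simp add: co_delta power_mult_distrib mult_ac)

lemma delta_1: "\<delta> 1 v = v"
  unfolding \<delta>_def power_one mult_1 by (rule expand[symmetric])

lemma delta_e: "j \<in> {1..n} \<Longrightarrow> \<delta> q (e j) = q ^ \<nu> j *\<^sub>R e j"
proof -
  assume j: "j \<in> {1..n}"
  have "\<delta> q (e j) = (\<Sum>i = 1..n. if i = j then q ^ \<nu> j *\<^sub>R e j else 0)"
    unfolding \<delta>_def by (rule sum.cong[OF refl]) (simp add: co_e[OF _ j])
  then show ?thesis using j by simp
qed

text \<open>The span lives among vector fields while \<delta> acts on coordinate vectors;
  quantifying over a preimage under the injective \<open>lv\<close> makes induction on the span
  possible.\<close>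

lemma delta_V:
  assumes "lv v \<in> V i"
  shows "\<delta> q v = q ^ i *\<^sub>R v"
proof -
  have "\<exists>w. lv w = lv v \<and> \<delta> q w = q ^ i *\<^sub>R w"
  proof (rule vf.span_induct_alt[where h = "\<lambda>Z. \<exists>w. lv w = Z \<and> \<delta> q w = q ^ i *\<^sub>R w"])
    show "lv v \<in> vf.span (X ` {j\<in>{1..n}. \<nu> j = i})" unfolding B_span by (rule assms)
    show "\<exists>w. lv w = 0 \<and> \<delta> q w = q ^ i *\<^sub>R w"
      by (rule exI[of _ 0]) (simp only: lv_0 linear_0[OF linear_delta] scaleR_zero_right simp_thms)
    fix a x y assume x: "x \<in> X ` {j\<in>{1..n}. \<nu> j = i}" and y: "\<exists>w. lv w = y \<and> \<delta> q w = q ^ i *\<^sub>R w"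
    obtain j where "x = X j" "j \<in> {j\<in>{1..n}. \<nu> j = i}" using x by (rule imageE)
    moreover obtain w where "lv w = y \<and> \<delta> q w = q ^ i *\<^sub>R w" using y by (rule exE)
    ultimately have "x = X j" "j \<in> {1..n}" "\<nu> j = i" "lv w = y" "\<delta> q w = q ^ i *\<^sub>R w" by simp_all
    then show "\<exists>w. lv w = vf_scale a x + y \<and> \<delta> q w = q ^ i *\<^sub>R w"
      by (intro exI[of _ "a *\<^sub>R e j + w"] conjI)
        (simp_all only: lv_add lv_scale lv_e linear_add[OF linear_delta] linear_scale[OF linear_delta] delta_e
          scaleR_add_right scaleR_left_commute)
  qed
  then show ?thesis by (auto simp: lv_inject)
qed

lemma bilinear_br: "bilinear G.br"
  unfolding bilinear_def G.br_def
  by (auto intro!: linearI simp: blinfun.add_left blinfun.add_right blinfun.scaleR_left blinfun.scaleR_right algebra_simps)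

text \<open>By bilinearity only basis vectors matter: there the bracket has degree \<nu> i + \<nu> j
  by the grading, so both sides carry the factor q^(\<nu> i + \<nu> j).\<close>

lemma delta_br: "\<delta> q (G.br v w) = G.br (\<delta> q v) (\<delta> q w)"
proof (rule bilinear_eq[where f = "\<lambda>v w. \<delta> q (G.br v w)" and g = "\<lambda>v w. G.br (\<delta> q v) (\<delta> q w)"
      and S = UNIV and T = UNIV and B = "e ` {1..n}" and C = "e ` {1..n}"])
  have b: "linear (\<lambda>y. G.br x y)" "linear (\<lambda>x. G.br x y)" for x y
    using bilinear_br[unfolded bilinear_def] by simp_all
  show "bilinear (\<lambda>v w. \<delta> q (G.br v w))"
    unfolding bilinear_def
    using linear_compose[OF b(1) linear_delta, unfolded o_def] linear_compose[OF b(2) linear_delta, unfolded o_def]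
    by (intro conjI allI)
  show "bilinear (\<lambda>v w. G.br (\<delta> q v) (\<delta> q w))"
    unfolding bilinear_def
    using linear_compose[OF linear_delta b(1), unfolded o_def] linear_compose[OF linear_delta b(2), unfolded o_def]
    by (intro conjI allI)
  have "v \<in> span (e ` {1..n})" for v
    by (subst expand, rule span_sum, rule span_scale, rule span_base, rule imageI)
  then show "UNIV \<subseteq> span (e ` {1..n})" "UNIV \<subseteq> span (e ` {1..n})" by blast+
  fix x y assume "x \<in> e ` {1..n}" "y \<in> e ` {1..n}"
  then obtain i j where ij: "x = e i" "i \<in> {1..n}" "y = e j" "j \<in> {1..n}" by (elim imageE)
  have "lv (G.br (e i) (e j)) \<in> V (\<nu> i + \<nu> j)"
    using V_bracket[OF X_in_V[OF ij(2)] X_in_V[OF ij(4)]] ij(2,4) by (simp add: lie_bracket_lv[symmetric] lv_e)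
  from delta_V[OF this] show "\<delta> q (G.br x y) = G.br (\<delta> q x) (\<delta> q y)"
    unfolding ij delta_e[OF ij(2)] delta_e[OF ij(4)] bilinear_lmul[OF bilinear_br] bilinear_rmul[OF bilinear_br]
    by (simp add: power_add)
qed auto

definition is_dilation :: "real \<Rightarrow> ('g \<Rightarrow> 'g) \<Rightarrow> bool" where
  "is_dilation q F \<longleftrightarrow> (\<forall>x y. F (x + y) = F x + F y) \<and> continuous_on UNIV F \<and>
    (\<forall>f\<in>smooth_functions \<A>. (\<lambda>x. f (F x)) \<in> smooth_functions \<A> \<and>
       (\<forall>v x. lv v (\<lambda>x. f (F x)) x = lv (\<delta> q v) f (F x)))"

lemma dilation_exists: "\<exists>F. is_dilation q F"
  unfolding is_dilation_def by (rule automorphism_exists[OF conn sc linear_delta delta_br])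

lemma dilation_one_parameter:
  assumes F: "is_dilation q F" and g: "one_parameter v g"
  shows "one_parameter (\<delta> q v) (\<lambda>t. F (g t))"
proof -
  have F0: "F 0 = 0" using F additive_0[of F] by (auto simp: is_dilation_def)
  have g0: "g 0 = 0" using g additive_0[of g] by (auto simp: one_parameter_def)
  show ?thesis
    unfolding one_parameter_def
  proof (intro conjI ballI allI)
    fix f assume f: "f \<in> smooth_functions \<A>"
    then have "(\<lambda>x. f (F x)) \<in> smooth_functions \<A>" using F by (simp add: is_dilation_def)
    then have "((\<lambda>t. f (F (g t))) has_real_derivative lv v (\<lambda>x. f (F x)) 0) (at 0)"
      using bspec[OF conjunct2[OF g[unfolded one_parameter_def]], of "\<lambda>x. f (F x)"] by simp
    moreover have "lv v (\<lambda>x. f (F x)) 0 = lv (\<delta> q v) f (F 0)" using F f by (simp add: is_dilation_def)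
    ultimately show "((\<lambda>t. f (F (g t))) has_real_derivative lv (\<delta> q v) f 0) (at 0)"
      unfolding F0 by simp
  qed (use F g in \<open>auto simp: is_dilation_def one_parameter_def\<close>)
qed

lemma dilation_lie_exp:
  assumes F: "is_dilation q F"
  shows "F (lie_exp \<A> (lv v)) = lie_exp \<A> (lv (\<delta> q v))"
proof -
  obtain g where g: "one_parameter v g" using one_parameter_exists by (rule exE)
  show ?thesis
    unfolding lie_exp_one_parameter[OF g] lie_exp_one_parameter[OF dilation_one_parameter[OF F g]] by (rule refl)
qed

text \<open>The composite is additive, and near the identity every point is an exponential, on which
  it acts through \<open>\<delta> (q * t) = \<delta> 1\<close>.\<close>

lemma dilation_inverse:
  assumes F: "is_dilation q F" and H: "is_dilation t H" and qs: "q * t = 1"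
  shows "F (H x) = x"
proof -
  obtain W where W: "open W" "0 \<in> W" "W \<subseteq> lie_exp \<A> ` lie_algebra \<A>" using lie_exp_range by blast
  show ?thesis
  proof (rule additive_eq[where F = "\<lambda>x. F (H x)" and H = "\<lambda>x. x", OF conn W(1,2)])
    fix u assume "u \<in> W"
    then obtain v where "u = lie_exp \<A> (lv v)" using W(3) unfolding lie_algebra_eq by auto
    then show "F (H u) = u"
      by (simp add: dilation_lie_exp[OF F] dilation_lie_exp[OF H] delta_delta qs delta_1)
  qed (use F H in \<open>simp_all add: is_dilation_def\<close>)
qed

text \<open>\<open>inv_into\<close> selects some preimage v of x; any preimage gives the same value,
  because F(exp v) = exp(\<delta> v) and the left-hand side depends on x only.\<close>

lemma dilation_dil:
  assumes F: "is_dilation q F" and x: "x \<in> lie_exp \<A> ` lie_algebra \<A>"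
  shows "(F ^^ k) x = dil \<A> n X \<nu> (q ^ k) x"
proof -
  obtain v where v: "inv_into (lie_algebra \<A>) (lie_exp \<A>) x = lv v"
    using inv_into_into[OF x] unfolding lie_algebra_eq by auto
  then have xv: "x = lie_exp \<A> (lv v)" using f_inv_into_f[OF x] by simp
  have "(F ^^ k) x = lie_exp \<A> (lv (\<delta> (q ^ k) v))"
    by (induction k) (simp_all add: xv delta_1 dilation_lie_exp[OF F] delta_delta)
  then show ?thesis unfolding dil_def o_def v lv_delta .
qed

lemma dilation_X:
  assumes F: "is_dilation q F" and f: "f \<in> smooth_functions \<A>" and j: "j \<in> {1..n}"
  shows "X j (\<lambda>x. f (F x)) x = q ^ \<nu> j * X j f (F x)"
  using F f j by (simp add: is_dilation_def lv_e[symmetric] delta_e lv_scale vf_scale_def)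

end

section \<open>Test functions\<close>

lemma real_has_deriv:
  assumes "smooth_on UNIV (f :: real \<Rightarrow> real)"
  shows "(f has_real_derivative deriv f t) (at t)"
  using smooth_on_differentiable[OF assms, of t]
  by (simp add: DERIV_deriv_iff_real_differentiable)

lemma smooth_on_deriv:
  assumes "smooth_on UNIV (f :: real \<Rightarrow> real)"
  shows "smooth_on UNIV (deriv f)"
proof -
  have "deriv f t = frechet_derivative f (at t) 1" for t
    using frechet_derivative_at[OF real_has_deriv[OF assms, of t, unfolded has_field_derivative_def]] by (metis mult_1_right)
  then have "deriv f = (\<lambda>t. frechet_derivative f (at t) 1)" by (rule ext)
  then show ?thesis using smooth_on_directional[OF assms, of 1] by simp
qed

lemma deriv_rescaled:
  assumes "smooth_on UNIV (f :: real \<Rightarrow> real)"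
  shows "deriv (\<lambda>s. f (s / T) * a) = (\<lambda>t. deriv f (t / T) * (a / T))"
proof
  fix t
  have "((\<lambda>s. f (s / T)) has_real_derivative deriv f (t / T) * (1 / T)) (at t)"
    by (rule DERIV_chain2[OF real_has_deriv[OF assms]]) (rule DERIV_cdivide[OF DERIV_ident])
  then have "((\<lambda>s. f (s / T) * a) has_real_derivative deriv f (t / T) * (1 / T) * a) (at t)"
    by (rule DERIV_cmult_right)
  then show "deriv (\<lambda>s. f (s / T) * a) t = deriv f (t / T) * (a / T)"
    by (simp add: DERIV_imp_deriv)
qed

lemma deriv2_rescaled:
  assumes "smooth_on UNIV (f :: real \<Rightarrow> real)"
  shows "(deriv ^^ 2) (\<lambda>s. f (s / T) * a) = (\<lambda>t. (deriv ^^ 2) f (t / T) * (a / T\<^sup>2))"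
  unfolding numeral_2_eq_2 funpow.simps o_def id_def deriv_rescaled[OF assms]
    deriv_rescaled[OF smooth_on_deriv[OF assms]] by (simp add: power2_eq_square)

text \<open>For the even time cutoff: it removes the term of the weak formulation that contains the
  time derivative at t = 0.\<close>

lemma deriv_even_0:
  assumes "smooth_on UNIV (f :: real \<Rightarrow> real)" "\<And>t. f (- t) = f t"
  shows "deriv f 0 = 0"
proof -
  have "deriv (\<lambda>s. f (s / - 1) * 1) = (\<lambda>t. deriv f (t / - 1) * (1 / - 1))" by (rule deriv_rescaled[OF assms(1)])
  from fun_cong[OF this, of 0] show ?thesis by (simp add: assms(2))
qed

lemma bounded_of_support:
  fixes g :: "'a::topological_space \<Rightarrow> real"
  assumes "continuous_on K g" "compact K"
  shows "\<exists>C\<ge>0. \<forall>x\<in>K. \<bar>g x\<bar> \<le> C"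
proof -
  have "bounded (g ` K)" by (intro compact_imp_bounded compact_continuous_image assms)
  then obtain C where "\<forall>y\<in>g ` K. norm y \<le> C" unfolding bounded_iff by blast
  then show ?thesis by (intro exI[of _ "\<bar>C\<bar>"]) force
qed

text \<open>Two derivatives lower the exponent by at most 2, and the remaining factors are
  continuous on [-1, 1], which contains the support. A bound by a power of the cutoff itself is what
  absorption needs.\<close>

lemma time_cutoff_bound:
  fixes \<eta> :: "real \<Rightarrow> real"
  assumes s: "smooth_on UNIV \<eta>" and 01: "\<And>t. 0 \<le> \<eta> t" "\<And>t. \<eta> t \<le> 1"
    and z: "\<And>t. \<bar>t\<bar> \<ge> 1 \<Longrightarrow> \<eta> t = 0" and M: "2 < M"
  shows "\<exists>C\<ge>0. \<forall>t. \<bar>deriv (\<lambda>t. \<eta> t ^ M) t\<bar> \<le> C * \<eta> t ^ (M - 2) \<and> \<bar>(deriv ^^ 2) (\<lambda>t. \<eta> t ^ M) t\<bar> \<le> C * \<eta> t ^ (M - 2)"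
proof -
  obtain k where k: "M = k + 2" "k > 0" using M by (metis add.commute less_imp_add_positive)
  define e1 e2 where "e1 = deriv \<eta>" and "e2 = deriv e1"
  have e1: "(\<eta> has_real_derivative e1 t) (at t)" for t unfolding e1_def by (rule real_has_deriv[OF s])
  have s1: "smooth_on UNIV e1" unfolding e1_def by (rule smooth_on_deriv[OF s])
  have e2: "(e1 has_real_derivative e2 t) (at t)" for t unfolding e2_def by (rule real_has_deriv[OF s1])
  have s2: "smooth_on UNIV e2" unfolding e2_def by (rule smooth_on_deriv[OF s1])
  have d1: "deriv (\<lambda>t. \<eta> t ^ M) = (\<lambda>t. real M * \<eta> t ^ (k + 1) * e1 t)"
    using DERIV_imp_deriv[OF DERIV_power[OF e1, of M]] by (auto simp: k(1) mult_ac)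
  have d2: "deriv (\<lambda>t. real M * \<eta> t ^ (k + 1) * e1 t) = (\<lambda>t. \<eta> t ^ k * (real M * (real (k + 1) * (e1 t)\<^sup>2 + \<eta> t * e2 t)))"
    using DERIV_imp_deriv[OF DERIV_mult[OF DERIV_cmult[OF DERIV_power[OF e1, of "k + 1"], of "real M"] e2]]
    by (auto simp: algebra_simps power2_eq_square)
  have c: "continuous_on {-1..1} \<eta>" "continuous_on {-1..1} e1" "continuous_on {-1..1} e2"
    by (rule continuous_on_subset[OF smooth_on_imp_continuous_on] s s1 s2 subset_UNIV)+
  have "continuous_on {-1..1} (\<lambda>t. real M * \<eta> t * e1 t)" by (intro continuous_intros c)
  from bounded_of_support[OF this compact_Icc] obtain C1 where
    C1: "0 \<le> C1 \<and> (\<forall>t\<in>{-1..1}. \<bar>real M * \<eta> t * e1 t\<bar> \<le> C1)" by (rule exE)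
  have "continuous_on {-1..1} (\<lambda>t. real M * (real (k + 1) * (e1 t)\<^sup>2 + \<eta> t * e2 t))" by (intro continuous_intros c)
  from bounded_of_support[OF this compact_Icc] obtain C2 where
    C2: "0 \<le> C2 \<and> (\<forall>t\<in>{-1..1}. \<bar>real M * (real (k + 1) * (e1 t)\<^sup>2 + \<eta> t * e2 t)\<bar> \<le> C2)" by (rule exE)
  have C: "C1 \<ge> 0" "\<And>t. t \<in> {-1..1} \<Longrightarrow> \<bar>real M * \<eta> t * e1 t\<bar> \<le> C1"
    "\<And>t. t \<in> {-1..1} \<Longrightarrow> \<bar>real M * (real (k + 1) * (e1 t)\<^sup>2 + \<eta> t * e2 t)\<bar> \<le> C2"
    using C1 C2 by blast+
  have b: "\<bar>\<eta> t ^ k * h t\<bar> \<le> max C1 C2 * \<eta> t ^ k" if h: "\<And>t. t \<in> {-1..1} \<Longrightarrow> \<bar>h t\<bar> \<le> max C1 C2"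
    for h :: "real \<Rightarrow> real" and t
  proof (cases "t \<in> {-1..1}")
    case True
    then show ?thesis using mult_left_mono[OF h[OF True], of "\<eta> t ^ k"] 01(1)[of t] by (simp add: abs_mult mult.commute)
  next
    case False
    then have "\<eta> t = 0" by (intro z) auto
    then show ?thesis by (simp only: zero_power[OF k(2)] mult_zero_left mult_zero_right abs_zero)
  qed
  show ?thesis
  proof (intro exI[of _ "max C1 C2"] conjI allI)
    show "0 \<le> max C1 C2" using C(1) by simp
    fix t
    have "\<bar>\<eta> t ^ k * (real M * \<eta> t * e1 t)\<bar> \<le> max C1 C2 * \<eta> t ^ k" by (rule b) (rule max.coboundedI1[OF C(2)])
    then show "\<bar>deriv (\<lambda>t. \<eta> t ^ M) t\<bar> \<le> max C1 C2 * \<eta> t ^ (M - 2)" unfolding d1 using k(1) by (simp add: mult_ac)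
    have "\<bar>\<eta> t ^ k * (real M * (real (k + 1) * (e1 t)\<^sup>2 + \<eta> t * e2 t))\<bar> \<le> max C1 C2 * \<eta> t ^ k"
      by (rule b) (rule max.coboundedI2[OF C(3)])
    then show "\<bar>(deriv ^^ 2) (\<lambda>t. \<eta> t ^ M) t\<bar> \<le> max C1 C2 * \<eta> t ^ (M - 2)"
      unfolding numeral_2_eq_2 funpow.simps o_def id_def d1 d2 using k(1) by simp
  qed
qed

context lie_chart
begin

section \<open>Powers of cutoffs under vector fields\<close>

lemma vfield_scale:
  assumes "Y \<in> lie_algebra \<A>" "f \<in> smooth_functions \<A>"
  shows "Y (\<lambda>x. b * f x) = (\<lambda>x. b * Y f x)"
proof -
  have "Y (\<lambda>x. b * f x + 0 * f x) = (\<lambda>x. b * Y f x + 0 * Y f x)" by (rule lie_algebraD(3)[OF assms(1,2,2)])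
  then show ?thesis by simp
qed

lemma vfield_power:
  assumes Y: "Y \<in> lie_algebra \<A>" and f: "f \<in> smooth_functions \<A>"
  shows "Y (\<lambda>x. f x ^ k) = (\<lambda>x. real k * f x ^ (k - 1) * Y f x)"
proof (induction k)
  case 0
  then show ?case using vfield_const[OF Y, of 1] by auto
next
  case (Suc k)
  have "Y (\<lambda>x. f x * f x ^ k) = (\<lambda>x. Y f x * f x ^ k + f x * (real k * f x ^ (k - 1) * Y f x))"
    using lie_algebraD(4)[OF Y f smooth_function_power[OF f, of k]] unfolding Suc .
  also have "\<dots> = (\<lambda>x. real (Suc k) * f x ^ k * Y f x)"
    by (cases k) (auto simp: algebra_simps)
  finally show ?case by simp
qed

lemma vfield_iter_smooth: "Y \<in> lie_algebra \<A> \<Longrightarrow> f \<in> smooth_functions \<A> \<Longrightarrow> (Y ^^ m) f \<in> smooth_functions \<A>"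
  by (induction m) (simp_all add: lie_algebraD(1))

text \<open>Each application of Y differentiates either one factor f or the cofactor g, so the
  exponent drops by at most one and a smooth cofactor is left.\<close>

lemma vfield_iter_power:
  assumes Y: "Y \<in> lie_algebra \<A>" and f: "f \<in> smooth_functions \<A>" and "m \<le> M"
  shows "\<exists>g\<in>smooth_functions \<A>. (Y ^^ m) (\<lambda>x. f x ^ M) = (\<lambda>x. f x ^ (M - m) * g x)"
  using \<open>m \<le> M\<close>
proof (induction m)
  case 0
  show ?case by (rule bexI[OF _ smooth_function_const[of 1]]) simp
next
  case (Suc m)
  obtain g where g: "g \<in> smooth_functions \<A>" "(Y ^^ m) (\<lambda>x. f x ^ M) = (\<lambda>x. f x ^ (M - m) * g x)"
    using Suc.IH Suc.prems by (auto simp del: funpow.simps)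
  define k where "k = M - Suc m"
  have k: "M - m = Suc k" using Suc.prems by (simp add: k_def)
  let ?g = "\<lambda>x. (\<lambda>x. real (Suc k) * (Y f x * g x)) x + (\<lambda>x. f x * Y g x) x"
  have "(Y ^^ Suc m) (\<lambda>x. f x ^ M) = Y (\<lambda>x. f x ^ Suc k * g x)" unfolding funpow.simps o_def g(2) k ..
  also have "\<dots> = (\<lambda>x. Y (\<lambda>x. f x ^ Suc k) x * g x + f x ^ Suc k * Y g x)"
    by (rule lie_algebraD(4)[OF Y smooth_function_power[OF f] g(1)])
  also have "\<dots> = (\<lambda>x. f x ^ k * ?g x)" unfolding vfield_power[OF Y f] by (simp add: algebra_simps)
  finally have "(Y ^^ Suc m) (\<lambda>x. f x ^ M) = (\<lambda>x. f x ^ (M - Suc m) * ?g x)" unfolding k_def .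
  moreover have "?g \<in> smooth_functions \<A>"
    by (intro smooth_function_add smooth_function_mult smooth_function_const f g lie_algebraD(1)[OF Y])
  ultimately show ?case by (rule bexI)
qed

text \<open>As f \<le> 1, lowering the exponent weakens the bound; thus one exponent M - k serves
  all orders m \<le> k that occur in the operator.\<close>

lemma vfield_iter_bound:
  assumes Y: "Y \<in> lie_algebra \<A>" and f: "f \<in> smooth_functions \<A>" and 01: "\<And>x. 0 \<le> f x" "\<And>x. f x \<le> 1"
    and K: "compact K" "\<And>x. x \<notin> K \<Longrightarrow> f x = 0" and m: "m \<le> k" "k < M"
  shows "\<exists>C\<ge>0. \<forall>x. \<bar>(Y ^^ m) (\<lambda>x. f x ^ M) x\<bar> \<le> C * f x ^ (M - k)"
proof -
  have "m \<le> M" using m by simp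
  from vfield_iter_power[OF Y f this] obtain g where
    g: "g \<in> smooth_functions \<A>" "(Y ^^ m) (\<lambda>x. f x ^ M) = (\<lambda>x. f x ^ (M - m) * g x)" by (rule bexE)
  obtain C where C: "C \<ge> 0" "\<And>x. x \<in> K \<Longrightarrow> \<bar>g x\<bar> \<le> C"
    using bounded_of_support[OF continuous_on_subset[OF smooth_function_continuous[OF g(1)] subset_UNIV] K(1)] by blast
  have "\<bar>f x ^ (M - m) * g x\<bar> \<le> C * f x ^ (M - k)" for x
  proof (cases "x \<in> K")
    case True
    have "f x ^ (M - m) \<le> f x ^ (M - k)" by (rule power_decreasing) (use m 01 in auto)
    then have "f x ^ (M - m) * \<bar>g x\<bar> \<le> f x ^ (M - k) * C"
      by (rule mult_mono) (use C(2)[OF True] 01 in auto)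
    then show ?thesis using 01(1)[of x] by (simp add: abs_mult mult.commute)
  next
    case False
    then have "f x = 0" by (rule K(2))
    \<comment> \<open>Positive exponents matter because \<open>0 ^ 0 = 1\<close>: outside
      \<open>K\<close> both sides have to vanish.\<close>
    moreover have "0 < M - m" "0 < M - k" using m by auto
    ultimately show ?thesis by (simp only: zero_power mult_zero_left mult_zero_right abs_zero)
  qed
  then show ?thesis unfolding g(2) using C(1) by blast
qed

end

context graded_chart
begin

lemma rockland_bound:
  assumes f: "f \<in> smooth_functions \<A>" and 01: "\<And>x. 0 \<le> f x" "\<And>x. f x \<le> 1"
    and K: "compact K" "\<And>x. x \<notin> K \<Longrightarrow> f x = 0" and M: "2 * \<nu>0 < M"
  shows "\<exists>C\<ge>0. \<forall>x. \<bar>rockland_operator n X \<nu> \<nu>0 a (\<lambda>x. f x ^ M) x\<bar> \<le> C * f x ^ (M - 2 * \<nu>0)"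
proof -
  have "\<exists>C\<ge>0. \<forall>x. \<bar>(X j ^^ (2 * (\<nu>0 div \<nu> j))) (\<lambda>x. f x ^ M) x\<bar> \<le> C * f x ^ (M - 2 * \<nu>0)"
    if "j \<in> {1..n}" for j
    by (rule vfield_iter_bound[OF X_in[OF that] f 01 K _ M]) simp_all
  then have "\<forall>j\<in>{1..n}. \<exists>C\<ge>0. \<forall>x. \<bar>(X j ^^ (2 * (\<nu>0 div \<nu> j))) (\<lambda>x. f x ^ M) x\<bar> \<le> C * f x ^ (M - 2 * \<nu>0)"
    by (rule ballI)
  from bchoice[OF this] obtain C where "\<forall>j\<in>{1..n}. C j \<ge> 0 \<and>
      (\<forall>x. \<bar>(X j ^^ (2 * (\<nu>0 div \<nu> j))) (\<lambda>x. f x ^ M) x\<bar> \<le> C j * f x ^ (M - 2 * \<nu>0))" by (rule exE)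
  then have C: "\<And>j. j \<in> {1..n} \<Longrightarrow> C j \<ge> 0"
    "\<And>j x. j \<in> {1..n} \<Longrightarrow> \<bar>(X j ^^ (2 * (\<nu>0 div \<nu> j))) (\<lambda>x. f x ^ M) x\<bar> \<le> C j * f x ^ (M - 2 * \<nu>0)"
    by simp_all
  show ?thesis
  proof (intro exI[of _ "\<Sum>j = 1..n. \<bar>a j\<bar> * C j"] conjI allI)
    show "0 \<le> (\<Sum>j = 1..n. \<bar>a j\<bar> * C j)" by (intro sum_nonneg mult_nonneg_nonneg C(1)) auto
    fix x
    show "\<bar>rockland_operator n X \<nu> \<nu>0 a (\<lambda>x. f x ^ M) x\<bar> \<le> (\<Sum>j = 1..n. \<bar>a j\<bar> * C j) * f x ^ (M - 2 * \<nu>0)"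
      unfolding rockland_operator_def sum_distrib_right
    proof (rule order.trans[OF sum_abs sum_mono])
      fix j assume j: "j \<in> {1..n}"
      show "\<bar>(- 1) ^ (\<nu>0 div \<nu> j) * a j * (X j ^^ (2 * (\<nu>0 div \<nu> j))) (\<lambda>x. f x ^ M) x\<bar> \<le> \<bar>a j\<bar> * C j * f x ^ (M - 2 * \<nu>0)"
        using mult_left_mono[OF C(2)[OF j, of x], of "\<bar>a j\<bar>"] by (simp add: abs_mult power_abs mult.assoc)
    qed
  qed
qed

lemma rockland_scale:
  assumes f: "f \<in> smooth_functions \<A>"
  shows "rockland_operator n X \<nu> \<nu>0 a (\<lambda>x. b * f x) x = b * rockland_operator n X \<nu> \<nu>0 a f x"
proof -
  have "(X j ^^ m) (\<lambda>x. b * f x) = (\<lambda>x. b * (X j ^^ m) f x)" if j: "j \<in> {1..n}" for j m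
    by (induction m) (simp_all add: vfield_scale[OF X_in[OF j] vfield_iter_smooth[OF X_in[OF j] f]])
  then show ?thesis unfolding rockland_operator_def by (simp add: sum_distrib_left mult_ac)
qed

text \<open>Each application of X_j contributes q^(\<nu> j), and there are 2 \<nu>0 / \<nu> j of
  them, an exact quotient by divisibility; so all summands scale by the same q^(2 \<nu>0).\<close>

lemma rockland_dilation:
  assumes F: "is_dilation q F" and f: "f \<in> smooth_functions \<A>" and dv: "\<And>j. j \<in> {1..n} \<Longrightarrow> \<nu> j dvd \<nu>0"
  shows "rockland_operator n X \<nu> \<nu>0 a (\<lambda>x. f (F x)) x = q ^ (2 * \<nu>0) * rockland_operator n X \<nu> \<nu>0 a f (F x)"
proof -
  have it: "(X j ^^ m) (\<lambda>x. f (F x)) = (\<lambda>x. q ^ (\<nu> j * m) * (X j ^^ m) f (F x))" if j: "j \<in> {1..n}" for j m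
  proof (induction m)
    case (Suc m)
    have s: "(X j ^^ m) f \<in> smooth_functions \<A>" by (rule vfield_iter_smooth[OF X_in[OF j] f])
    then have "(\<lambda>x. (X j ^^ m) f (F x)) \<in> smooth_functions \<A>" using F by (simp add: is_dilation_def)
    from vfield_scale[OF X_in[OF j] this, of "q ^ (\<nu> j * m)"] show ?case
      by (simp add: Suc dilation_X[OF F s j] power_add mult_ac)
  qed simp
  have e: "\<nu> j * (2 * (\<nu>0 div \<nu> j)) = 2 * \<nu>0" if j: "j \<in> {1..n}" for j
    using dv[OF j] by (simp add: mult.left_commute)
  show ?thesis
    unfolding rockland_operator_def sum_distrib_left
    by (rule sum.cong[OF refl]) (simp add: it e)
qed

text \<open>The support is placed in the range of the exponential map, where \<open>dil\<close>
  agrees with the automorphism, so that homogeneity of the norm is available on it.\<close>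

lemma space_cutoff:
  "\<exists>f K B0 b. f \<in> smooth_functions \<A> \<and> (\<forall>x. 0 \<le> f x \<and> f x \<le> 1) \<and> compact K \<and> (\<forall>x. x \<notin> K \<longrightarrow> f x = 0) \<and>
    K \<subseteq> lie_exp \<A> ` lie_algebra \<A> \<and> open B0 \<and> 0 \<in> B0 \<and> B0 \<subseteq> K \<and> 0 < b \<and> (\<forall>x\<in>B0. b \<le> f x)"
proof -
  obtain W where W: "open W" "0 \<in> W" "W \<subseteq> lie_exp \<A> ` lie_algebra \<A>" using lie_exp_range by blast
  have "open (\<Omega> \<inter> \<xi> -` W)" by (rule continuous_open_preimage[OF continuous_chi open_dom W(1)])
  then obtain d where d: "d > 0" "ball 0 d \<subseteq> \<Omega> \<inter> \<xi> -` W"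
    by (rule openE[of _ 0]) (use zero_dom W(2) chi_0 in auto)
  define q where "q = min d rad / 2"
  have q: "0 < q" "q < rad" "q < d" using d(1) rad(1) by (auto simp: q_def)
  define f where "f = loc q (\<lambda>_. 1)"
  have f: "f \<in> smooth_functions \<A>" unfolding f_def by (rule smooth_loc[OF _ q(1,2)]) auto
  have z: "x \<notin> \<xi> ` cball 0 q \<Longrightarrow> f x = 0" for x unfolding f_def by (rule loc_outside[OF q(1,2)])
  have f0: "f 0 > 0" using loc_chi[OF zero_dom q(1), of "\<lambda>_. 1"] bump_pos_iff[OF q(1), of "0::'m"] q(1)
    by (simp add: f_def chi_0)
  define B0 where "B0 = f -` {f 0 / 2<..}"
  have "open B0" unfolding B0_def by (rule open_vimage[OF open_greaterThan smooth_function_continuous[OF f]])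
  moreover have "\<xi> ` cball 0 q \<subseteq> lie_exp \<A> ` lie_algebra \<A>"
  proof -
    have "cball 0 q \<subseteq> ball (0::'m) d" using q(3) by auto
    then show ?thesis using d(2) W(3) by blast
  qed
  moreover have "B0 \<subseteq> \<xi> ` cball 0 q"
  proof
    fix x assume "x \<in> B0"
    then have "f x \<noteq> 0" using f0 by (auto simp: B0_def)
    then show "x \<in> \<xi> ` cball 0 q" using z by blast
  qed
  moreover have "compact (\<xi> ` cball 0 q)" by (rule compact_chi_cball) (use q(2) in simp)
  moreover have "0 \<in> B0" using f0 by (simp add: B0_def)
  moreover have "\<forall>x. 0 \<le> f x \<and> f x \<le> 1" by (simp add: f_def loc_def bump_nonneg bump_le_1)
  moreover have "\<forall>x\<in>B0. f 0 / 2 \<le> f x" by (simp add: B0_def)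
  ultimately show ?thesis using f z f0
    by (intro exI[of _ f] exI[of _ "\<xi> ` cball 0 q"] exI[of _ B0] exI[of _ "f 0 / 2"]) (intro conjI; simp)
qed

lemma dilated_test_function:
  assumes F: "is_dilation q F" and H: "\<And>x. H (F x) = x" and cH: "continuous_on UNIV H"
    and f: "f \<in> smooth_functions \<A>" and K: "compact K" "\<And>x. x \<notin> K \<Longrightarrow> f x = 0"
    and \<theta>: "smooth_on UNIV \<theta>" "\<And>t. \<bar>t\<bar> \<ge> 1 \<Longrightarrow> \<theta> t = (0::real)" and T: "T > 0"
  shows "(\<lambda>t x. \<theta> (t / T) * f (F x)) \<in> spacetime_test_functions \<A> \<infinity>"
  unfolding spacetime_test_functions_def
proof (intro CollectI conjI ballI)
  have fF: "(\<lambda>x. f (F x)) \<in> smooth_functions \<A>" using F f by (simp add: is_dilation_def)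
  fix A assume "A \<in> \<A>"
  obtain W d where A: "A = (W, d)" by (cases A)
  with \<open>A \<in> \<A>\<close> have W: "(W, d) \<in> \<A>" by simp
  have o: "open ((UNIV :: real set) \<times> d ` W)" by (intro open_Times open_UNIV chartD(2)[OF W])
  have 1: "smooth_on (UNIV \<times> d ` W) (\<lambda>z. \<theta> (fst z / T))"
    by (rule smooth_on_compose[OF o open_UNIV \<theta>(1)])
      (auto intro!: smooth_on_bounded_linear[OF _ o] bounded_linear_intros simp: divide_inverse)
  have "smooth_on (UNIV \<times> d ` W) (snd :: real \<times> 'm \<Rightarrow> 'm)"
    by (rule smooth_on_bounded_linear[OF bounded_linear_snd o])
  from smooth_on_compose[OF o chartD(2)[OF W] smooth_functionD[OF fF W] this]
  have 2: "smooth_on ((UNIV :: real set) \<times> d ` W) (\<lambda>z. f (F (inv_into W d (snd z))))" by auto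
  have "smooth_on (UNIV \<times> d ` W) (\<lambda>z. \<theta> (fst z / T) * f (F (inv_into W d (snd z))))"
    by (rule smooth_on_mult[OF o 1 2])
  then show "case A of (U, c) \<Rightarrow> smooth_on (UNIV \<times> c ` U) (\<lambda>(t, y). \<theta> (t / T) * f (F (inv_into U c y)))"
    by (simp add: A case_prod_unfold)
next
  show "\<exists>K. compact K \<and> K \<subseteq> {t. ereal t < \<infinity>} \<times> UNIV \<and> (\<forall>t x. (t, x) \<notin> K \<longrightarrow> \<theta> (t / T) * f (F x) = 0)"
  proof (intro exI[of _ "{- T..T} \<times> H ` K"] conjI allI impI)
    show "compact ({- T..T} \<times> H ` K)"
      by (intro compact_Times compact_Icc compact_continuous_image continuous_on_subset[OF cH] K(1)) simp
    fix t x assume tx: "(t, x) \<notin> {- T..T} \<times> H ` K"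
    show "\<theta> (t / T) * f (F x) = 0"
    proof (cases "F x \<in> K")
      case True
      then have "x \<in> H ` K" using H[of x] by (metis imageI)
      then have "t \<notin> {- T..T}" using tx unfolding mem_Times_iff fst_conv snd_conv by blast
      then have "\<bar>t\<bar> \<ge> T" by auto
      then have "\<bar>t / T\<bar> \<ge> 1" using T by (simp add: le_divide_eq)
      then show ?thesis using \<theta>(2) by simp
    qed (simp add: K(2))
  qed auto
qed

end

section \<open>Integral estimates and Haar measure\<close>

text \<open>Either y \<le> x^(p-1), and then x y \<le> x^p, or x \<le> y^(1/(p-1)), and then x y
  \<le> y^(p/(p-1)). The coefficient 1 of x^p lets the integral of |u|^p \<phi> cancel exactly later
  on.\<close>

lemma Young_crude:
  fixes x y p :: real
  assumes "x \<ge> 0" "y \<ge> 0" "p > 1"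
  shows "x * y \<le> x powr p + y powr (p / (p - 1))"
proof (cases "y \<le> x powr (p - 1)")
  case True
  then have "x * y \<le> x * x powr (p - 1)" using assms by (intro mult_left_mono)
  also have "\<dots> = x powr p" using assms by (cases "x = 0") (simp_all add: powr_mult_base)
  finally show ?thesis by (simp add: add_increasing2)
next
  case False
  then have y: "x powr (p - 1) < y" by simp
  have "x = (x powr (p - 1)) powr (1 / (p - 1))" using assms by (simp add: powr_powr)
  also have "\<dots> \<le> y powr (1 / (p - 1))" using y assms by (intro powr_mono2) auto
  finally have "x * y \<le> y powr (1 / (p - 1)) * y" using assms by (intro mult_right_mono)
  also have "\<dots> = y powr (1 + 1 / (p - 1))" using assms powr_mult_base[of y "1 / (p - 1)"] by (simp add: mult.commute)
  also have "1 + 1 / (p - 1) = p / (p - 1)" using assms by (simp add: field_simps)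
  finally show ?thesis using powr_ge_zero[of x p] by linarith
qed

lemma integrable_times_cutoff:
  fixes u \<phi> :: "'a \<Rightarrow> real"
  assumes u: "set_integrable M K u" and \<phi>: "\<phi> \<in> borel_measurable M"
    "\<And>x. 0 \<le> \<phi> x" "\<And>x. \<phi> x \<le> 1" "\<And>x. x \<notin> K \<Longrightarrow> \<phi> x = 0"
  shows "integrable M (\<lambda>x. u x * \<phi> x)"
proof -
  have e: "(\<lambda>x. u x * \<phi> x) = (\<lambda>x. (indicator K x *\<^sub>R u x) * \<phi> x)"
    by (rule ext) (auto simp: indicator_def \<phi>(4))
  show ?thesis
    unfolding e
  proof (rule Bochner_Integration.integrable_bound[OF u[unfolded set_integrable_def]])
    show "(\<lambda>x. (indicator K x *\<^sub>R u x) * \<phi> x) \<in> borel_measurable M"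
      by (rule borel_measurable_times[OF borel_measurable_integrable[OF u[unfolded set_integrable_def]] \<phi>(1)])
    show "AE x in M. norm ((indicator K x *\<^sub>R u x) * \<phi> x) \<le> norm (indicator K x *\<^sub>R u x)"
      using \<phi>(2,3) by (intro AE_I2) (auto simp: indicator_def abs_mult mult_left_le)
  qed
qed

text \<open>Young's inequality with x = |u| \<phi>^(1/p) and y = q bounds the integral of u l by I
  plus the right-hand side, where I is the integral of |u|^p \<phi>. By the equation the same
  integral is I + j, and I is finite since \<phi> lives on \<open>K\<close>.\<close>

lemma test_function_inequality:
  fixes u :: "'a \<Rightarrow> complex" and \<phi> l :: "'a \<Rightarrow> real" and p q j :: real
  assumes p: "p > 1" and u: "set_integrable M K (\<lambda>z. cmod (u z) powr p)"
    and K: "K \<in> sets M" "emeasure M K < \<infinity>" "K \<subseteq> S"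
    and \<phi>: "\<phi> \<in> borel_measurable M" "\<And>z. 0 \<le> \<phi> z" "\<And>z. \<phi> z \<le> 1" "\<And>z. z \<in> S \<Longrightarrow> z \<notin> K \<Longrightarrow> \<phi> z = 0"
    and l: "\<And>z. \<bar>l z\<bar> \<le> q * \<phi> z powr (1 / p)" "q \<ge> 0"
    and eq: "set_lebesgue_integral M S (\<lambda>z. u z * complex_of_real (l z)) - complex_of_real j
      = complex_of_real (set_lebesgue_integral M S (\<lambda>z. cmod (u z) powr p * \<phi> z))"
  shows "j \<le> q powr (p / (p - 1)) * measure M K"
proof -
  let ?g = "\<lambda>z. (indicator K z *\<^sub>R (cmod (u z) powr p)) * \<phi> z"
  let ?I = "\<integral>z. ?g z \<partial>M" and ?X = "set_lebesgue_integral M S (\<lambda>z. u z * complex_of_real (l z))"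
  have "integrable M (\<lambda>z. cmod (u z) powr p * (indicator K z * \<phi> z))"
    by (rule integrable_times_cutoff[OF u]) (use K(1) \<phi> in \<open>auto simp: indicator_def\<close>)
  then have g: "integrable M ?g" by (simp add: mult_ac)
  have iK: "integrable M (\<lambda>z. q powr (p / (p - 1)) * indicator K z)"
    by (intro integrable_mult_right integrable_real_indicator K)
  have I: "set_lebesgue_integral M S (\<lambda>z. cmod (u z) powr p * \<phi> z) = ?I"
    unfolding set_lebesgue_integral_def
    by (rule Bochner_Integration.integral_cong[OF refl]) (use K(3) \<phi>(4) in \<open>auto simp: indicator_def\<close>)
  have "norm ?X \<le> (\<integral>z. norm (indicator S z *\<^sub>R (u z * complex_of_real (l z))) \<partial>M)"
    unfolding set_lebesgue_integral_def by (rule integral_norm_bound)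
  also have "\<dots> \<le> (\<integral>z. ?g z + q powr (p / (p - 1)) * indicator K z \<partial>M)"
  proof (rule integral_mono')
    show "integrable M (\<lambda>z. ?g z + q powr (p / (p - 1)) * indicator K z)"
      by (rule Bochner_Integration.integrable_add[OF g iK])
    fix z
    show "0 \<le> ?g z + q powr (p / (p - 1)) * indicator K z" using \<phi>(2) by simp
    show "norm (indicator S z *\<^sub>R (u z * complex_of_real (l z))) \<le> ?g z + q powr (p / (p - 1)) * indicator K z"
    proof (cases "z \<in> K")
      case True
      have "cmod (u z) * \<bar>l z\<bar> \<le> cmod (u z) * (q * \<phi> z powr (1 / p))" by (rule mult_left_mono[OF l(1)]) simp
      also have "\<dots> = (cmod (u z) * \<phi> z powr (1 / p)) * q" by simp
      also have "\<dots> \<le> (cmod (u z) * \<phi> z powr (1 / p)) powr p + q powr (p / (p - 1))"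
        by (rule Young_crude) (use l(2) p in auto)
      also have "(cmod (u z) * \<phi> z powr (1 / p)) powr p = cmod (u z) powr p * \<phi> z"
        using p \<phi>(2)[of z] by (simp add: powr_mult powr_powr)
      finally show ?thesis using True K(3) by (auto simp: norm_mult)
    next
      case False
      show ?thesis
      proof (cases "z \<in> S")
        case True
        then have "l z = 0" using l(1)[of z] \<phi>(4)[OF True False] by simp
        then show ?thesis using False by simp
      qed (use False in simp)
    qed
  qed
  also have "\<dots> = ?I + q powr (p / (p - 1)) * measure M K"
    using Bochner_Integration.integral_add[OF g iK] K by (simp add: sets.Int_space_eq2)
  finally have X: "norm ?X \<le> ?I + q powr (p / (p - 1)) * measure M K" .
  have "?X = complex_of_real (?I + j)" using eq unfolding I by (simp add: algebra_simps)
  then have "norm ?X = \<bar>?I + j\<bar>" by (simp only: norm_of_real)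
  then have "?I + j \<le> norm ?X" by simp
  then show ?thesis using X by linarith
qed

text \<open>For 0 < y \<le> 1 the smaller exponent m/p gives the larger power; the condition on m
  decides how high a power of the cutoffs is taken.\<close>

lemma power_le_powr_root:
  fixes y p :: real
  assumes y: "0 \<le> y" "y \<le> 1" and p: "p > 1" and k: "k < m" "real m / p \<le> real (m - k)"
  shows "y ^ (m - k) \<le> (y ^ m) powr (1 / p)"
proof (cases "y = 0")
  case True
  then show ?thesis using k(1) by (simp add: zero_power)
next
  case False
  then have y0: "y > 0" using y by simp
  have "y ^ (m - k) = y powr real (m - k)" using y0 by (simp add: powr_realpow)
  also have "\<dots> \<le> y powr (real m / p)" by (rule powr_mono'[OF k(2)]) (use y in auto)
  also have "\<dots> = (y ^ m) powr (1 / p)" using y0 by (simp add: powr_realpow[symmetric] powr_powr)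
  finally show ?thesis .
qed

text \<open>Multiplied by x^\<beta>, the factor after \<open>a\<close> grows like x^(\<beta> -
  \<kappa>) / log x, which is unbounded.\<close>

lemma growth_contradiction:
  fixes A \<kappa> \<beta> a b :: real
  assumes A: "A > 0" and "\<kappa> < \<beta>" and a: "a > 0"
    and le: "\<And>x. x \<ge> 1 \<Longrightarrow> a * ((1 + A * x) powr (- \<kappa>) * inverse (ln (exp 1 + A * x))) \<le> b * x powr (- \<beta>)"
  shows False
proof -
  have "filterlim (\<lambda>x. (1 + A * x) powr (- \<kappa>) * inverse (ln (exp 1 + A * x)) * x powr \<beta>) at_top at_top"
    using A \<open>\<kappa> < \<beta>\<close> by real_asymp
  then have "eventually (\<lambda>x. (1 + A * x) powr (- \<kappa>) * inverse (ln (exp 1 + A * x)) * x powr \<beta> > b / a) at_top"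
    unfolding filterlim_at_top_dense by blast
  then have "eventually (\<lambda>x. (1 + A * x) powr (- \<kappa>) * inverse (ln (exp 1 + A * x)) * x powr \<beta> > b / a \<and> x \<ge> 1) at_top"
    by (intro eventually_conj eventually_ge_at_top)
  then obtain x where x: "(1 + A * x) powr (- \<kappa>) * inverse (ln (exp 1 + A * x)) * x powr \<beta> > b / a" "x \<ge> 1"
    using eventually_happens'[OF trivial_limit_at_top_linorder] by blast
  let ?y = "(1 + A * x) powr (- \<kappa>) * inverse (ln (exp 1 + A * x))"
  have "a * ?y * x powr \<beta> \<le> b * x powr (- \<beta>) * x powr \<beta>"
    by (rule mult_right_mono[OF le[OF x(2)]]) simp
  also have "\<dots> = b" using x(2) by (simp add: powr_minus)
  finally have "?y * x powr \<beta> \<le> b / a" using a by (simp add: field_simps)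
  then show False using x(1) by linarith
qed

section \<open>Haar measure, translations and automorphisms\<close>

lemma haar_measureD:
  assumes "haar_measure \<mu>"
  shows "sets \<mu> = sets borel" "space \<mu> = UNIV" "compact K \<Longrightarrow> emeasure \<mu> K < \<infinity>"
    "open U \<Longrightarrow> U \<noteq> {} \<Longrightarrow> emeasure \<mu> U > 0" "distr \<mu> borel (\<lambda>x. y + x) = \<mu>"
proof -
  show "sets \<mu> = sets borel" using assms by (simp add: haar_measure_def)
  then show "space \<mu> = UNIV" by (metis sets_eq_imp_space_eq space_borel)
qed (use assms in \<open>simp_all add: haar_measure_def\<close>)

lemma translate_eq_vimage: "(\<lambda>y. x + y) ` A = (\<lambda>y. - x + y) -` (A :: 'g::group_add set)"
proof
  show "(\<lambda>y. - x + y) -` A \<subseteq> (\<lambda>y. x + y) ` A"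
  proof
    fix y assume "y \<in> (\<lambda>y. - x + y) -` A"
    then show "y \<in> (\<lambda>y. x + y) ` A" by (intro image_eqI[of _ _ "- x + y"]) (simp_all add: add.assoc[symmetric])
  qed
qed (auto simp: add.assoc[symmetric])

lemma haar_translate:
  fixes \<mu> :: "'g::{topological_group_add,second_countable_topology} measure"
  assumes \<mu>: "haar_measure \<mu>" and A: "A \<in> sets borel"
  shows "emeasure \<mu> ((\<lambda>y. x + y) ` A) = emeasure \<mu> A"
proof -
  have "(\<lambda>y. - x + y) \<in> borel_measurable borel"
    by (intro borel_measurable_continuous_onI continuous_intros)
  then have m: "(\<lambda>y. - x + y) \<in> measurable \<mu> borel"
    by (simp add: measurable_cong_sets[OF haar_measureD(1)[OF \<mu>] refl])
  have "emeasure \<mu> A = emeasure (distr \<mu> borel (\<lambda>y. - x + y)) A" using haar_measureD(5)[OF \<mu>] by simp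
  also have "\<dots> = emeasure \<mu> ((\<lambda>y. - x + y) -` A)"
    using emeasure_distr[OF m A] by (simp add: haar_measureD(2)[OF \<mu>])
  finally show ?thesis by (simp add: translate_eq_vimage)
qed

lemma open_translate_image:
  fixes A :: "'g::topological_group_add set"
  shows "open A \<Longrightarrow> open ((\<lambda>y. x + y) ` A)"
  unfolding translate_eq_vimage by (intro open_vimage continuous_intros)

lemma in_translate: "0 \<in> A \<Longrightarrow> (x::'g::group_add) \<in> (\<lambda>y. x + y) ` A"
  by (rule image_eqI[of _ _ 0]) simp_all

text \<open>By second countability countably many translates of \<open>W\<close> cover the group,
  and each has finite measure because \<open>W\<close> lies in a compact set. The product measure on
  space-time relies on this.\<close>

lemma haar_sigma_finite:
  fixes \<mu> :: "'g::{topological_group_add,t2_space,second_countable_topology} measure"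
  assumes \<mu>: "haar_measure \<mu>" and K: "compact (K :: 'g set)" and W: "open W" "0 \<in> W" "W \<subseteq> K"
  shows "sigma_finite_measure \<mu>"
proof -
  define \<F> where "\<F> = range (\<lambda>x. (\<lambda>y. x + y) ` W)"
  have "S \<in> \<F> \<Longrightarrow> open S" for S using open_translate_image[OF W(1)] by (auto simp: \<F>_def)
  then obtain \<F>' where F: "\<F>' \<subseteq> \<F>" "countable \<F>'" "\<Union>\<F>' = \<Union>\<F>" using Lindelof by metis
  have "K \<in> sets \<mu>" using compact_imp_closed[OF K] by (simp add: haar_measureD(1)[OF \<mu>])
  then have W_fin: "emeasure \<mu> W < \<infinity>"
    using emeasure_mono[OF W(3)] haar_measureD(3)[OF \<mu> K] by (metis le_less_trans)
  have S: "emeasure \<mu> S \<noteq> \<infinity> \<and> S \<in> sets \<mu>" if S: "S \<in> \<F>" for S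
  proof -
    obtain x where x: "S = (\<lambda>y. x + y) ` W" using S by (auto simp: \<F>_def)
    have "open S" unfolding x by (rule open_translate_image[OF W(1)])
    then show ?thesis
      using haar_translate[OF \<mu>, of W x] W(1) W_fin unfolding x haar_measureD(1)[OF \<mu>] by auto
  qed
  have "x \<in> \<Union>\<F>" for x unfolding \<F>_def using in_translate[OF W(2), of x] by blast
  then have "\<Union>\<F> = UNIV" by blast
  then show ?thesis
    using F S by (intro sigma_finite_measure.intro exI[of _ \<F>']) (auto simp: haar_measureD(2)[OF \<mu>])
qed

text \<open>A covering of \<open>K\<close> by m translates of \<open>W\<close> is mapped by an
  automorphism F to a covering of F K by m translates of F W, so m is uniform in the dilation
  parameter.\<close>

lemma haar_doubling:
  fixes \<mu> :: "'g::{topological_group_add,t2_space,second_countable_topology} measure"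
  assumes \<mu>: "haar_measure \<mu>" and K: "compact (K :: 'g set)" and W: "open W" "0 \<in> W"
  shows "\<exists>m::nat. \<forall>F H. (\<forall>x y. F (x + y) = F x + F y) \<longrightarrow> continuous_on UNIV H \<longrightarrow>
    (\<forall>x. H (F x) = x) \<longrightarrow> (\<forall>x. F (H x) = x) \<longrightarrow> emeasure \<mu> (F ` K) \<le> of_nat m * emeasure \<mu> (F ` W)"
proof -
  have "K \<subseteq> (\<Union>x\<in>K. (\<lambda>y. x + y) ` W)" using in_translate[OF W(2)] by blast
  then obtain I where I: "I \<subseteq> K" "finite I" "K \<subseteq> (\<Union>x\<in>I. (\<lambda>y. x + y) ` W)"
    by (rule compactE_image[OF K open_translate_image[OF W(1)]])
  show ?thesis
  proof (intro exI[of _ "card I"] allI impI)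
    fix F H :: "'g \<Rightarrow> 'g"
    assume F: "\<forall>x y. F (x + y) = F x + F y" and H: "continuous_on UNIV H"
      and inv: "\<forall>x. H (F x) = x" "\<forall>x. F (H x) = x"
    have "F ` W = H -` W" using inv by (auto simp: image_iff) (metis inv(2))
    then have o: "open (F ` W)" using open_vimage[OF W(1) H] by simp
    then have t: "emeasure \<mu> ((\<lambda>y. x + y) ` F ` W) = emeasure \<mu> (F ` W)" for x
      by (intro haar_translate[OF \<mu>]) simp
    have ot: "(\<lambda>y. x + y) ` F ` W \<in> sets \<mu>" for x
      using open_translate_image[OF o] by (simp add: haar_measureD(1)[OF \<mu>])
    have "F ` K \<subseteq> (\<Union>x\<in>I. (\<lambda>y. F x + y) ` F ` W)"
    proof
      fix z assume "z \<in> F ` K"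
      then obtain x w where "x \<in> I" "w \<in> W" "z = F (x + w)" using I(3) by blast
      then show "z \<in> (\<Union>x\<in>I. (\<lambda>y. F x + y) ` F ` W)" using F by blast
    qed
    then have "emeasure \<mu> (F ` K) \<le> emeasure \<mu> (\<Union>x\<in>I. (\<lambda>y. F x + y) ` F ` W)"
      using ot I(2) by (intro emeasure_mono sets.finite_UN) auto
    also have "\<dots> \<le> (\<Sum>x\<in>I. emeasure \<mu> ((\<lambda>y. F x + y) ` F ` W))"
      using ot I(2) by (intro emeasure_subadditive_finite) auto
    also have "\<dots> = of_nat (card I) * emeasure \<mu> (F ` W)" by (simp add: t)
    finally show "emeasure \<mu> (F ` K) \<le> of_nat (card I) * emeasure \<mu> (F ` W)" .
  qed
qed

section \<open>Nonexistence of global solutions\<close>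

context graded_chart
begin

definition dl :: "real \<Rightarrow> 'g \<Rightarrow> 'g" where "dl q = (SOME F. is_dilation q F)"

lemma is_dilation_dl: "is_dilation q (dl q)"
  unfolding dl_def by (rule someI_ex[OF dilation_exists])

lemma dl_add: "dl q (x + y) = dl q x + dl q y" and continuous_dl: "continuous_on UNIV (dl q)"
  using is_dilation_dl[of q] by (simp_all add: is_dilation_def)

lemma dl_inverse: "q * t = 1 \<Longrightarrow> dl q (dl t x) = x"
  by (rule dilation_inverse[OF is_dilation_dl is_dilation_dl])

text \<open>With time scale T = q^(2 \<nu>0) and the dilation by 1/q in space, the operator and the
  first time derivative each give 1/T, and the second time derivative gives 1/T^2 \<le> 1/T since q
  \<ge> 1.\<close>

lemma damped_wave_operator_bound:
  assumes f: "f \<in> smooth_functions \<A>" and 01: "\<And>x. 0 \<le> f x" "\<And>x. f x \<le> 1"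
    and K: "compact K" "\<forall>x. x \<notin> K \<longrightarrow> f x = 0"
    and \<nu>0: "\<nu>0 > 0" "\<forall>j\<in>{1..n}. \<nu> j dvd \<nu>0" and p: "1 < p"
  shows "\<exists>M C. 0 < M \<and> 0 \<le> C \<and> (\<forall>q\<ge>1. \<forall>t x.
    \<bar>(deriv ^^ 2) (\<lambda>s. bump 1 (s / q ^ (2 * \<nu>0)) ^ M * f (dl (1 / q) x) ^ M) t +
      rockland_operator n X \<nu> \<nu>0 a (\<lambda>x. bump 1 (t / q ^ (2 * \<nu>0)) ^ M * f (dl (1 / q) x) ^ M) x -
      deriv (\<lambda>s. bump 1 (s / q ^ (2 * \<nu>0)) ^ M * f (dl (1 / q) x) ^ M) t\<bar>
    \<le> C / q ^ (2 * \<nu>0) * (bump 1 (t / q ^ (2 * \<nu>0)) ^ M * f (dl (1 / q) x) ^ M) powr (1 / p))"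
proof -
  \<comment> \<open>Chosen so that M - M/p \<ge> 2 \<nu>0, which turns the power M - 2 \<nu>0 of the
    cutoffs into the power M/p; the added 2 \<nu>0 + 1 keeps the exponents positive.\<close>
  obtain M0 :: nat where M0: "real (2 * \<nu>0) / (1 - 1 / p) \<le> real M0" using real_arch_simple by blast
  define M where "M = M0 + 2 * \<nu>0 + 1"
  define k where "k = 2 * \<nu>0"
  have M: "k < M" "2 < M" using \<nu>0(1) by (auto simp: M_def k_def)
  have "real k \<le> real M0 * (1 - 1 / p)" using M0 p by (simp add: pos_divide_le_eq k_def)
  also have "\<dots> \<le> real M * (1 - 1 / p)" using p by (intro mult_right_mono) (auto simp: M_def)
  finally have Mp: "real M / p \<le> real (M - k)" using M(1) by (simp add: of_nat_diff algebra_simps)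
  let ?\<eta> = "bump 1 :: real \<Rightarrow> real"
  define \<theta> where "\<theta> t = ?\<eta> t ^ M" for t
  have e01: "0 \<le> ?\<eta> t" "?\<eta> t \<le> 1" for t by (rule bump_nonneg, rule bump_le_1)
  obtain C1 where "C1 \<ge> 0 \<and> (\<forall>t. \<bar>deriv \<theta> t\<bar> \<le> C1 * ?\<eta> t ^ (M - 2) \<and> \<bar>(deriv ^^ 2) \<theta> t\<bar> \<le> C1 * ?\<eta> t ^ (M - 2))"
    using time_cutoff_bound[OF smooth_on_bump e01 _ M(2)] unfolding \<theta>_def by (metis bump_eq_0 real_norm_def zero_less_one)
  then have C1: "C1 \<ge> 0" "\<And>t. \<bar>deriv \<theta> t\<bar> \<le> C1 * ?\<eta> t ^ (M - 2)" "\<And>t. \<bar>(deriv ^^ 2) \<theta> t\<bar> \<le> C1 * ?\<eta> t ^ (M - 2)"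
    by auto
  define g where "g x = f x ^ M" for x
  have g: "g \<in> smooth_functions \<A>" unfolding g_def by (rule smooth_function_power[OF f])
  let ?R = "rockland_operator n X \<nu> \<nu>0 a"
  obtain C2 where "C2 \<ge> 0 \<and> (\<forall>x. \<bar>?R g x\<bar> \<le> C2 * f x ^ (M - k))"
    using rockland_bound[OF f 01 K(1) K(2)[rule_format] M(1)[unfolded k_def], of a] unfolding g_def k_def by (rule exE)
  then have C2: "C2 \<ge> 0" "\<And>x. \<bar>?R g x\<bar> \<le> C2 * f x ^ (M - k)" by auto
  have s\<theta>: "smooth_on UNIV \<theta>" unfolding \<theta>_def by (rule smooth_on_power[OF open_UNIV smooth_on_bump])
  have "\<bar>(deriv ^^ 2) (\<lambda>s. \<theta> (s / q ^ k) * g (dl (1 / q) x)) t + ?R (\<lambda>x. \<theta> (t / q ^ k) * g (dl (1 / q) x)) x -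
      deriv (\<lambda>s. \<theta> (s / q ^ k) * g (dl (1 / q) x)) t\<bar>
    \<le> (2 * C1 + C2) / q ^ k * (\<theta> (t / q ^ k) * g (dl (1 / q) x)) powr (1 / p)" if q: "q \<ge> 1" for q t x
  proof -
    define T where "T = q ^ k"
    have T: "T \<ge> 1" using q by (simp add: T_def one_le_power)
    define w y where "w = f (dl (1 / q) x)" and "y = ?\<eta> (t / T)"
    have w: "0 \<le> w" "w \<le> 1" and y: "0 \<le> y" "y \<le> 1" unfolding w_def y_def by (rule 01 e01)+
    have gF: "(\<lambda>x. g (dl (1 / q) x)) \<in> smooth_functions \<A>" using is_dilation_dl[of "1 / q"] g by (simp add: is_dilation_def)
    have d: "?R (\<lambda>x. g (dl (1 / q) x)) x = (1 / q) ^ (2 * \<nu>0) * ?R g (dl (1 / q) x)"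
      by (rule rockland_dilation[OF is_dilation_dl g bspec[OF \<nu>0(2)]])
    have r: "?R (\<lambda>x. \<theta> (t / T) * g (dl (1 / q) x)) x = y ^ M / T * ?R g (dl (1 / q) x)"
      unfolding rockland_scale[OF gF] d
      by (simp add: \<theta>_def y_def T_def k_def power_divide)
    have p1: "y ^ (M - 2) \<le> y ^ (M - k)" "w ^ M \<le> w ^ (M - k)" "y ^ M \<le> y ^ (M - k)"
      by (rule power_decreasing; use w y \<nu>0(1) in \<open>simp add: k_def\<close>)+
    have nn: "0 \<le> y ^ (M - k)" "0 \<le> w ^ (M - k)" "0 \<le> y ^ M" "0 \<le> w ^ M" using w y by auto
    let ?P = "y ^ (M - k) * w ^ (M - k)"
    have d1: "\<bar>deriv \<theta> (t / T)\<bar> \<le> C1 * y ^ (M - k)"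
      by (rule order.trans[OF C1(2)[of "t / T", folded y_def] mult_left_mono[OF p1(1) C1(1)]])
    have d2: "\<bar>(deriv ^^ 2) \<theta> (t / T)\<bar> \<le> C1 * y ^ (M - k)"
      by (rule order.trans[OF C1(3)[of "t / T", folded y_def] mult_left_mono[OF p1(1) C1(1)]])
    have b1: "\<bar>(deriv ^^ 2) \<theta> (t / T) * (w ^ M / T\<^sup>2)\<bar> \<le> C1 * ?P / T"
    proof -
      have "\<bar>(deriv ^^ 2) \<theta> (t / T)\<bar> * w ^ M \<le> (C1 * y ^ (M - k)) * w ^ (M - k)"
        by (intro mult_mono mult_nonneg_nonneg C1(1) nn p1(2) d2)
      then have "\<bar>(deriv ^^ 2) \<theta> (t / T)\<bar> * w ^ M / T\<^sup>2 \<le> (C1 * ?P) / T"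
        using T C1(1) nn self_le_power[of T 2] by (intro frac_le) auto
      then show ?thesis using nn T by (simp add: abs_mult)
    qed
    have b2: "\<bar>deriv \<theta> (t / T) * (w ^ M / T)\<bar> \<le> C1 * ?P / T"
    proof -
      have "\<bar>deriv \<theta> (t / T)\<bar> * w ^ M \<le> (C1 * y ^ (M - k)) * w ^ (M - k)"
        by (intro mult_mono mult_nonneg_nonneg C1(1) nn p1(2) d1)
      then have "\<bar>deriv \<theta> (t / T)\<bar> * w ^ M / T \<le> (C1 * ?P) / T"
        using T by (intro divide_right_mono) auto
      then show ?thesis using nn T by (simp add: abs_mult)
    qed
    have b3: "\<bar>y ^ M / T * ?R g (dl (1 / q) x)\<bar> \<le> C2 * ?P / T"
    proof -
      have "y ^ M * \<bar>?R g (dl (1 / q) x)\<bar> \<le> y ^ (M - k) * (C2 * w ^ (M - k))"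
        using p1(3) C2(2)[of "dl (1 / q) x"] nn by (intro mult_mono) (auto simp: w_def)
      then have "y ^ M * \<bar>?R g (dl (1 / q) x)\<bar> / T \<le> y ^ (M - k) * (C2 * w ^ (M - k)) / T"
        using T by (intro divide_right_mono) auto
      then show ?thesis using nn T by (simp add: abs_mult mult_ac)
    qed
    have tri: "\<bar>x1 + x2 - x3\<bar> \<le> y1 + y2 + y3" if "\<bar>x1\<bar> \<le> y1" "\<bar>x2\<bar> \<le> y2" "\<bar>x3\<bar> \<le> y3"
      for x1 x2 x3 y1 y2 y3 :: real using that by linarith
    have "(y * w) ^ (M - k) \<le> ((y * w) ^ M) powr (1 / p)"
      by (rule power_le_powr_root[OF _ _ p M(1) Mp]) (use w y in \<open>auto intro: mult_le_one\<close>)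
    then have P: "?P \<le> (y ^ M * w ^ M) powr (1 / p)" by (simp add: power_mult_distrib)
    have "\<bar>(deriv ^^ 2) \<theta> (t / T) * (w ^ M / T\<^sup>2) + y ^ M / T * ?R g (dl (1 / q) x) - deriv \<theta> (t / T) * (w ^ M / T)\<bar>
      \<le> C1 * ?P / T + C2 * ?P / T + C1 * ?P / T"
      by (rule tri[OF b1 b3 b2])
    also have "\<dots> = (2 * C1 + C2) / T * ?P" by (simp add: add_divide_distrib algebra_simps)
    also have "\<dots> \<le> (2 * C1 + C2) / T * (y ^ M * w ^ M) powr (1 / p)"
      by (rule mult_left_mono[OF P]) (use C1(1) C2(1) T in auto)
    finally show ?thesis
      unfolding T_def[symmetric] r deriv2_rescaled[OF s\<theta>] deriv_rescaled[OF s\<theta>]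
      unfolding g_def \<theta>_def[of "t / T"] w_def[symmetric] y_def[symmetric] .
  qed
  then show ?thesis
    using M(1) C1(1) C2(1) unfolding \<theta>_def g_def k_def
    by (intro exI[of _ M] exI[of _ "2 * C1 + C2"]) auto
qed

lemma homogeneous_norm_dl:
  assumes "homogeneous_norm \<A> n X \<nu> N" "q > 0" "x \<in> lie_exp \<A> ` lie_algebra \<A>"
  shows "N (dl q x) = q * N x"
  using dilation_dil[OF is_dilation_dl assms(3), where k = 1] assms(1,2) by (simp add: homogeneous_norm_def)

lemma weak_solution_data_bound:
  assumes f: "f \<in> smooth_functions \<A>" and f01: "\<And>x. 0 \<le> f x" "\<And>x. f x \<le> 1"
    and K: "compact K" "\<And>x. x \<notin> K \<Longrightarrow> f x = 0"
    and \<mu>: "haar_measure \<mu>" "sigma_finite_measure \<mu>" and p: "1 < p" and q: "q \<ge> 1" and M: "0 < M" and C: "0 \<le> C"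
    and bound: "\<And>t x. \<bar>(deriv ^^ 2) (\<lambda>s. bump 1 (s / T) ^ M * f (dl (1 / q) x) ^ M) t +
        RO (\<lambda>x. bump 1 (t / T) ^ M * f (dl (1 / q) x) ^ M) x - deriv (\<lambda>s. bump 1 (s / T) ^ M * f (dl (1 / q) x) ^ M) t\<bar>
      \<le> C / T * (bump 1 (t / T) ^ M * f (dl (1 / q) x) ^ M) powr (1 / p)"
    and T: "T > 0"
    and weak: "weak_solution \<A> \<mu> RO p \<epsilon> u0 u1 \<infinity> u"
  shows "\<epsilon> * (LINT x|\<mu>. (u0 x + u1 x) * (bump 1 (0::real) ^ M * f (dl (1 / q) x) ^ M))
    \<le> (C / T) powr (p / (p - 1)) * (T * measure \<mu> (dl q ` K))"
proof -
  interpret \<mu>: sigma_finite_measure \<mu> by (rule \<mu>(2))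
  let ?H = "dl q" and ?F = "dl (1 / q)"
  have HF: "?H (?F x) = x" "?F (?H x) = x" for x using q by (simp_all add: dl_inverse)
  define \<theta> where "\<theta> t = bump 1 (t :: real) ^ M" for t
  have s\<theta>: "smooth_on UNIV \<theta>" unfolding \<theta>_def by (rule smooth_on_power[OF open_UNIV smooth_on_bump])
  have \<theta>0: "\<theta> t = 0" if "\<bar>t\<bar> \<ge> 1" for t using that M by (simp add: \<theta>_def bump_eq_0 zero_power)
  have \<theta>01: "0 \<le> \<theta> t" "\<theta> t \<le> 1" for t by (auto simp: \<theta>_def bump_nonneg bump_le_1 power_le_one)
  define g where "g x = f x ^ M" for x
  have g: "g \<in> smooth_functions \<A>" unfolding g_def by (rule smooth_function_power[OF f])
  have g01: "0 \<le> g x" "g x \<le> 1" for x using f01 by (auto simp: g_def power_le_one)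
  have gK: "g x = 0" if "x \<notin> K" for x using K(2)[OF that] M by (simp add: g_def zero_power)
  define \<phi> where "\<phi> t x = \<theta> (t / T) * g (?F x)" for t x
  have test: "\<phi> \<in> spacetime_test_functions \<A> \<infinity>"
    unfolding \<phi>_def
    by (rule dilated_test_function[OF is_dilation_dl _ continuous_dl g K(1) gK s\<theta> \<theta>0 T]) (rule HF)
  let ?M = "lborel \<Otimes>\<^sub>M \<mu>" and ?S = "{t::real. 0 \<le> t \<and> ereal t < \<infinity>} \<times> (UNIV :: 'g set)"
  \<comment> \<open>Contains the part of the support with t \<ge> 0; negative times lie outside
    \<open>?S\<close>. Its measure T times that of the dilated \<open>K\<close> is the volume in the
    bound.\<close>
  define K' where "K' = {0..T} \<times> ?H ` K"
  have cHK: "compact (?H ` K)" by (intro compact_continuous_image continuous_on_subset[OF continuous_dl] K(1)) simp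
  have sHK: "?H ` K \<in> sets \<mu>" using compact_imp_closed[OF cHK] by (simp add: haar_measureD(1)[OF \<mu>(1)])
  have cK': "compact K'" "K' \<subseteq> ?S" unfolding K'_def using cHK by (auto intro: compact_Times)
  have sK': "K' \<in> sets ?M" unfolding K'_def using sHK by (intro pair_measureI) auto
  have eK': "emeasure ?M K' = ennreal T * emeasure \<mu> (?H ` K)"
    unfolding K'_def using T sHK by (subst \<mu>.emeasure_pair_measure_Times) auto
  have mK': "measure ?M K' = T * measure \<mu> (?H ` K)"
    using T by (simp add: measure_def eK' enn2real_mult)
  have fin: "emeasure ?M K' < \<infinity>"
    unfolding eK' using haar_measureD(3)[OF \<mu>(1) cHK] by (simp add: ennreal_mult_less_top)
  have mg: "(\<lambda>x. g (?F x)) \<in> borel_measurable \<mu>"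
    unfolding measurable_cong_sets[OF haar_measureD(1)[OF \<mu>(1)] refl]
    by (intro borel_measurable_continuous_onI continuous_on_compose2[OF smooth_function_continuous[OF g] continuous_dl]) simp
  have m\<theta>: "(\<lambda>t. \<theta> (t / T)) \<in> borel_measurable lborel"
  proof -
    have "continuous_on UNIV (\<lambda>t. \<theta> (t / T))"
      by (rule continuous_on_compose2[OF smooth_on_imp_continuous_on[OF s\<theta>]]) (use T in \<open>auto intro!: continuous_intros\<close>)
    then show ?thesis by (simp add: borel_measurable_continuous_onI)
  qed
  have m\<phi>: "(\<lambda>z. \<phi> (fst z) (snd z)) \<in> borel_measurable ?M"
    unfolding \<phi>_def
    by (rule borel_measurable_times[OF measurable_compose[OF measurable_fst m\<theta>] measurable_compose[OF measurable_snd mg]])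
  have \<phi>01: "0 \<le> \<phi> t x" "\<phi> t x \<le> 1" for t x using \<theta>01 g01 by (auto simp: \<phi>_def intro: mult_le_one)
  have \<phi>0: "\<phi> t x = 0" if "t \<ge> 0" "(t, x) \<notin> K'" for t x
  proof (cases "?F x \<in> K")
    case True
    then have "x \<in> ?H ` K" using HF(1)[of x] by (metis imageI)
    then have "t > T" using that by (auto simp: K'_def)
    then have "1 \<le> \<bar>t / T\<bar>" using T by (simp add: le_divide_eq)
    then show ?thesis using \<theta>0 by (simp add: \<phi>_def)
  qed (simp add: \<phi>_def gK)
  define l where "l t x = (deriv ^^ 2) (\<lambda>s. \<phi> s x) t + RO (\<phi> t) x - deriv (\<lambda>s. \<phi> s x) t" for t x
  have l: "\<bar>l t x\<bar> \<le> C / T * \<phi> t x powr (1 / p)" for t x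
    using bound[of x t] unfolding l_def \<phi>_def \<theta>_def g_def .
  \<comment> \<open>The time cutoff is even, so the data enter only through u0 + u1.\<close>
  have "deriv (\<lambda>s. \<phi> s x) 0 = 0" for x
    unfolding \<phi>_def deriv_rescaled[OF s\<theta>]
    using deriv_even_0[OF s\<theta>] by (simp add: \<theta>_def bump_def)
  then have z: "(LINT x|\<mu>. u0 x * deriv (\<lambda>s. \<phi> s x) 0) = 0" by simp
  have w: "set_integrable ?M K' (\<lambda>(t, x). cmod (u t x) powr p)"
    "set_lebesgue_integral ?M ?S (\<lambda>(t, x). u t x * complex_of_real (l t x))
         - complex_of_real (\<epsilon> * (LINT x|\<mu>. (u0 x + u1 x) * \<phi> 0 x))
       = complex_of_real (set_lebesgue_integral ?M ?S (\<lambda>(t, x). cmod (u t x) powr p * \<phi> t x))"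
    using weak cK' test z unfolding weak_solution_def Let_def l_def by auto
  have "\<epsilon> * (LINT x|\<mu>. (u0 x + u1 x) * \<phi> 0 x) \<le> (C / T) powr (p / (p - 1)) * measure ?M K'"
    by (rule test_function_inequality[where u = "\<lambda>z. u (fst z) (snd z)" and \<phi> = "\<lambda>z. \<phi> (fst z) (snd z)"
          and l = "\<lambda>z. l (fst z) (snd z)" and S = ?S, OF p w(1)[unfolded case_prod_unfold] sK' fin cK'(2) m\<phi>])
      (use w(2) \<phi>01 \<phi>0 l C T in \<open>auto simp: case_prod_unfold\<close>)
  then show ?thesis unfolding mK' \<phi>_def \<theta>_def g_def by simp
qed

theorem no_global_weak_solution:
  assumes \<mu>: "haar_measure \<mu>"
    and Q: "Q = real (\<Sum>j = 1..n. \<nu> j)"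
    and \<nu>0: "\<nu>0 > 0" "\<forall>j\<in>{1..n}. \<nu> j dvd \<nu>0"
    and \<gamma>: "0 < \<gamma>" "\<gamma> < Q / 2"
    and p: "1 < p" "p < 1 + 2 * (2 * real \<nu>0) / (Q + 2 * \<gamma>)"
    and N: "homogeneous_norm \<A> n X \<nu> N"
    and u0: "locally_integrable \<mu> u0" and u1: "locally_integrable \<mu> u1"
    and C1: "C1 > 0"
    and data: "AE x in \<mu>. u0 x + u1 x \<ge>
           C1 * sqrt (1 + (N x)\<^sup>2) powr (- Q * (1 / 2 + \<gamma> / Q)) * inverse (ln (exp 1 + N x))"
    and \<epsilon>: "\<epsilon> > 0"
  shows "\<not> weak_solution \<A> \<mu> (rockland_operator n X \<nu> \<nu>0 a) p \<epsilon> u0 u1 \<infinity> u"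
proof
  let ?R = "rockland_operator n X \<nu> \<nu>0 a"
  assume weak: "weak_solution \<A> \<mu> ?R p \<epsilon> u0 u1 \<infinity> u"
  obtain f K B0 b where f: "f \<in> smooth_functions \<A>" "\<forall>x. 0 \<le> f x \<and> f x \<le> 1" "compact K" "\<forall>x. x \<notin> K \<longrightarrow> f x = 0"
    "K \<subseteq> lie_exp \<A> ` lie_algebra \<A>" "open B0" "0 \<in> B0" "B0 \<subseteq> K" "0 < b" "\<forall>x\<in>B0. b \<le> f x"
    using space_cutoff by (elim exE conjE) rule
  have f01: "0 \<le> f x" "f x \<le> 1" and fK: "x \<notin> K \<Longrightarrow> f x = 0" for x using f(2,4) by auto
  obtain M C where MC: "0 < M" "0 \<le> C" and bound: "\<forall>q\<ge>1. \<forall>t x.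
    \<bar>(deriv ^^ 2) (\<lambda>s. bump 1 (s / q ^ (2 * \<nu>0)) ^ M * f (dl (1 / q) x) ^ M) t +
      ?R (\<lambda>x. bump 1 (t / q ^ (2 * \<nu>0)) ^ M * f (dl (1 / q) x) ^ M) x -
      deriv (\<lambda>s. bump 1 (s / q ^ (2 * \<nu>0)) ^ M * f (dl (1 / q) x) ^ M) t\<bar>
    \<le> C / q ^ (2 * \<nu>0) * (bump 1 (t / q ^ (2 * \<nu>0)) ^ M * f (dl (1 / q) x) ^ M) powr (1 / p)"
    using damped_wave_operator_bound[OF f(1) f01 f(3) f(4) \<nu>0(1) \<nu>0(2) p(1), of a] by (elim exE conjE) rule
  obtain m :: nat where m: "\<forall>F H. (\<forall>x y. F (x + y) = F x + F y) \<longrightarrow> continuous_on UNIV H \<longrightarrow>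
    (\<forall>x. H (F x) = x) \<longrightarrow> (\<forall>x. F (H x) = x) \<longrightarrow> emeasure \<mu> (F ` K) \<le> of_nat m * emeasure \<mu> (F ` B0)"
    using haar_doubling[OF \<mu> f(3,6,7)] by (rule exE)
  have sf: "sigma_finite_measure \<mu>" by (rule haar_sigma_finite[OF \<mu> f(3,6,7,8)])
  have "continuous_on K N" using N by (auto simp: homogeneous_norm_def intro: continuous_on_subset)
  from bounded_of_support[OF this f(3)] obtain A0 where A0: "0 \<le> A0 \<and> (\<forall>x\<in>K. \<bar>N x\<bar> \<le> A0)" by (rule exE)
  have N0: "0 \<le> N x" for x using N by (simp add: homogeneous_norm_def)
  \<comment> \<open>\<open>A\<close> bounds the norm on \<open>K\<close>, increased by 1 to be
    positive; \<open>\<kappa>\<close> is the decay exponent of the data and \<open>\<beta>\<close>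
    the rate produced by the test functions.\<close>
  define A \<kappa> \<beta> where "A = A0 + 1" and "\<kappa> = Q / 2 + \<gamma>" and "\<beta> = 2 * real \<nu>0 / (p - 1)"
  have A: "A > 0" using A0 by (simp add: A_def)
  have \<kappa>: "\<kappa> > 0" "- Q * (1 / 2 + \<gamma> / Q) = - \<kappa>" using \<gamma> by (auto simp: \<kappa>_def field_simps)
  \<comment> \<open>The upper bound assumed for p is exactly \<kappa> < \<beta>.\<close>
  have "p - 1 < 2 * real \<nu>0 / \<kappa>" using p(2) \<gamma> by (simp add: \<kappa>_def field_simps)
  then have \<kappa>\<beta>: "\<kappa> < \<beta>" using \<kappa>(1) p(1) by (simp add: \<beta>_def field_simps)
  \<comment> \<open>A lower bound, independent of q, for the test function at time 0 on the dilated
    copy of \<open>B0\<close>.\<close>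
  define c where "c = bump 1 (0::real) ^ M * b ^ M"
  have c: "c > 0" using bump_pos_iff[of 1 "0::real"] f(9) by (simp add: c_def)
  define h where "h q = (1 + A * q) powr (- \<kappa>) * inverse (ln (exp 1 + A * q))" for q
  have "\<epsilon> * C1 * c * h q \<le> C powr (p / (p - 1)) * real m * q powr (- \<beta>)" if q: "q \<ge> 1" for q
  proof -
    define T where "T = q ^ (2 * \<nu>0)"
    have T: "T > 0" using q by (simp add: T_def)
    let ?H = "dl q" and ?F = "dl (1 / q)"
    have HF: "?H (?F x) = x" "?F (?H x) = x" for x using q by (simp_all add: dl_inverse)
    define \<psi> where "\<psi> x = bump 1 (0::real) ^ M * f (?F x) ^ M" for x
    have up: "\<epsilon> * (LINT x|\<mu>. (u0 x + u1 x) * \<psi> x) \<le> (C / T) powr (p / (p - 1)) * (T * measure \<mu> (?H ` K))"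
      unfolding \<psi>_def
      by (rule weak_solution_data_bound[OF f(1) f01 f(3) fK \<mu> sf p(1) q MC _ T weak])
        (use bound q in \<open>auto simp: T_def\<close>)
    have cHK: "compact (?H ` K)" by (intro compact_continuous_image continuous_on_subset[OF continuous_dl] f(3)) simp
    have oHB: "open (?H ` B0)"
    proof -
      have "?H ` B0 = ?F -` B0" using HF by (auto simp: image_iff) (metis HF(1))
      then show ?thesis using open_vimage[OF f(6) continuous_dl] by simp
    qed
    have s: "?H ` B0 \<in> sets \<mu>" "?H ` K \<in> sets \<mu>"
      using oHB compact_imp_closed[OF cHK] by (simp_all add: haar_measureD(1)[OF \<mu>])
    have KB: "emeasure \<mu> (?H ` B0) \<le> emeasure \<mu> (?H ` K)" using f(8) s by (intro emeasure_mono image_mono)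
    have finB: "emeasure \<mu> (?H ` B0) < \<infinity>" using KB haar_measureD(3)[OF \<mu> cHK] by (rule le_less_trans)
    have posB: "emeasure \<mu> (?H ` B0) > 0" using f(7) by (intro haar_measureD(4)[OF \<mu> oHB]) auto
    \<comment> \<open>Finite and positive, so that it can be cancelled from both sides at the
      end.\<close>
    define mB where "mB = measure \<mu> (?H ` B0)"
    have mB: "mB > 0" using finB posB unfolding mB_def by (simp add: emeasure_eq_measure2 measure_def enn2real_positive_iff)
    have dbl: "measure \<mu> (?H ` K) \<le> real m * mB"
    proof -
      have "emeasure \<mu> (?H ` K) \<le> of_nat m * emeasure \<mu> (?H ` B0)"
        using m dl_add continuous_dl HF by blast
      also have "\<dots> = ennreal (real m * mB)"
        using finB unfolding mB_def by (simp add: emeasure_eq_ennreal_measure ennreal_mult ennreal_of_nat_eq_real_of_nat)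
      finally show ?thesis
        using mB by (simp add: measure_def enn2real_leI)
    qed
    have m\<psi>: "\<psi> \<in> borel_measurable \<mu>"
      unfolding measurable_cong_sets[OF haar_measureD(1)[OF \<mu>] refl] \<psi>_def
      by (intro borel_measurable_continuous_onI continuous_intros
          continuous_on_compose2[OF smooth_function_continuous[OF f(1)] continuous_dl]) simp
    have \<psi>01: "0 \<le> \<psi> x" "\<psi> x \<le> 1" for x
      unfolding \<psi>_def using f01 bump_nonneg[of 1 "0::real"] bump_le_1[of 1 "0::real"]
      by (auto intro!: mult_le_one power_le_one)
    have \<psi>0: "\<psi> x = 0" if "x \<notin> ?H ` K" for x
    proof -
      have "?F x \<notin> K" using that HF(1)[of x] by (metis imageI)
      then show ?thesis using fK MC(1) by (simp add: \<psi>_def zero_power)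
    qed
    have "set_integrable \<mu> (?H ` K) u0" "set_integrable \<mu> (?H ` K) u1"
      using u0 u1 cHK by (auto simp: locally_integrable_def)
    then have "integrable \<mu> (\<lambda>x. u0 x * \<psi> x)" "integrable \<mu> (\<lambda>x. u1 x * \<psi> x)"
      by (auto intro: integrable_times_cutoff m\<psi> \<psi>01 \<psi>0)
    then have int: "integrable \<mu> (\<lambda>x. (u0 x + u1 x) * \<psi> x)" by (simp add: distrib_right)
    have "ln (exp 1 + A * q) \<ge> 0"
      using mult_nonneg_nonneg[of A q] A q exp_gt_one[of "1 :: real"] by (intro ln_ge_zero) linarith
    then have hq: "h q \<ge> 0" by (simp add: h_def)
    have low: "C1 * c * h q * indicator (?H ` B0) x \<le> (u0 x + u1 x) * \<psi> x"
      if x: "u0 x + u1 x \<ge> C1 * sqrt (1 + (N x)\<^sup>2) powr (- Q * (1 / 2 + \<gamma> / Q)) * inverse (ln (exp 1 + N x))" for x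
    proof -
      have l0: "ln (exp 1 + N x) > 0" using N0[of x] by (intro ln_gt_zero) (use exp_gt_one[of 1] in linarith)
      show ?thesis
      proof (cases "x \<in> ?H ` B0")
        case True
        then obtain y where y: "x = ?H y" "y \<in> B0" by blast
        \<comment> \<open>Homogeneity applies because \<open>K\<close> lies in the range of the
          exponential map.\<close>
        have "N x = q * N y" unfolding y(1) using f(5,8) y(2) q by (intro homogeneous_norm_dl[OF N]) auto
        also have "\<dots> \<le> q * A" using q bspec[OF conjunct2[OF A0] subsetD[OF f(8) y(2)]] by (intro mult_left_mono) (auto simp: A_def)
        finally have Nx: "N x \<le> A * q" by (simp add: mult.commute)
        \<comment> \<open>From here on the data are compared with \<open>h q\<close>, which no
          longer depends on x: the norm is at most A q on the dilated set, and the lower bound for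
          the data decreases in the norm.\<close>
        have "sqrt (1 + (N x)\<^sup>2) \<le> 1 + N x" using N0[of x] by (intro real_le_lsqrt) (auto simp: power2_sum)
        then have "sqrt (1 + (N x)\<^sup>2) \<le> 1 + A * q" using Nx by linarith
        then have a1: "(1 + A * q) powr (- \<kappa>) \<le> sqrt (1 + (N x)\<^sup>2) powr (- \<kappa>)"
          using \<kappa>(1) by (intro powr_mono2') (auto intro: add_pos_nonneg)
        have "ln (exp 1 + N x) \<le> ln (exp 1 + A * q)" using Nx N0[of x] by (intro ln_mono) (auto intro: add_pos_nonneg)
        then have a2: "inverse (ln (exp 1 + A * q)) \<le> inverse (ln (exp 1 + N x))" using l0 by (intro le_imp_inverse_le)
        have i0: "0 \<le> inverse (ln (exp 1 + A * q))" using \<open>ln (exp 1 + N x) \<le> _\<close> l0 by simp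
        have "h q \<le> sqrt (1 + (N x)\<^sup>2) powr (- \<kappa>) * inverse (ln (exp 1 + N x))"
          unfolding h_def by (rule mult_mono[OF a1 a2]) (use i0 in auto)
        from mult_left_mono[OF this less_imp_le[OF C1]] have d1: "C1 * h q \<le> u0 x + u1 x"
          using x unfolding \<kappa>(2) by (simp add: mult.assoc)
        have "b \<le> f (?F x)" using f(10) y HF(2)[of y] by simp
        then have "b ^ M \<le> f (?F x) ^ M" by (rule power_mono) (use f(9) in simp)
        then have d2: "c \<le> \<psi> x" unfolding c_def \<psi>_def by (rule mult_left_mono) (simp add: bump_nonneg)
        have d0: "0 \<le> C1 * h q" using C1 hq by simp
        have "(C1 * h q) * c \<le> (u0 x + u1 x) * \<psi> x"
          by (rule mult_mono[OF d1 d2]) (use d0 d1 c in linarith)+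
        then show ?thesis using True by (simp add: mult_ac)
      next
        case False
        \<comment> \<open>The data bound has a nonnegative right-hand side, so off the dilated set
          the integrand is nonnegative too.\<close>
        have "0 \<le> u0 x + u1 x" by (rule order.trans[OF _ x]) (use C1 l0 in simp)
        then show ?thesis using False \<psi>01 by simp
      qed
    qed
    have "C1 * c * h q * mB = (LINT x|\<mu>. C1 * c * h q * indicator (?H ` B0) x)"
      using s(1) by (simp add: mB_def sets.Int_space_eq2)
    also have "\<dots> \<le> (LINT x|\<mu>. (u0 x + u1 x) * \<psi> x)"
    proof (rule integral_mono_AE[OF _ int])
      show "integrable \<mu> (\<lambda>x. C1 * c * h q * indicator (?H ` B0) x)"
        by (intro integrable_mult_right integrable_real_indicator s finB)
      show "AE x in \<mu>. C1 * c * h q * indicator (?H ` B0) x \<le> (u0 x + u1 x) * \<psi> x"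
        by (rule AE_mp[OF data]) (intro AE_I2 impI low)
    qed
    finally have "\<epsilon> * (C1 * c * h q * mB) \<le> \<epsilon> * (LINT x|\<mu>. (u0 x + u1 x) * \<psi> x)" using \<epsilon> by simp
    also note up
    also have "(C / T) powr (p / (p - 1)) * (T * measure \<mu> (?H ` K)) \<le> (C / T) powr (p / (p - 1)) * (T * (real m * mB))"
      using T dbl by (intro mult_left_mono) auto
    finally have "(\<epsilon> * C1 * c * h q) * mB \<le> ((C / T) powr (p / (p - 1)) * T * real m) * mB" by (simp add: mult_ac)
    then have "\<epsilon> * C1 * c * h q \<le> (C / T) powr (p / (p - 1)) * T * real m" using mB by simp
    \<comment> \<open>The exponent of T is 1 - p/(p-1) = -1/(p-1), and T = q^(2 \<nu>0).\<close>
    also have "(C / T) powr (p / (p - 1)) * T = C powr (p / (p - 1)) * q powr (- \<beta>)"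
    proof -
      have Tq: "T = q powr (2 * real \<nu>0)" using q by (simp add: T_def powr_realpow[symmetric])
      have "T powr (- (p / (p - 1))) * T = q powr (2 * real \<nu>0 * (- (p / (p - 1))) + 2 * real \<nu>0)"
        unfolding Tq powr_powr powr_add by (rule refl)
      also have "2 * real \<nu>0 * (- (p / (p - 1))) + 2 * real \<nu>0 = - \<beta>" using p(1) by (simp add: \<beta>_def field_simps)
      finally have "T powr (- (p / (p - 1))) * T = q powr (- \<beta>)" .
      moreover have "(C / T) powr (p / (p - 1)) = C powr (p / (p - 1)) * T powr (- (p / (p - 1)))"
        using powr_divide[of C T "p / (p - 1)"] T MC(2) by (simp add: powr_minus_divide)
      ultimately show ?thesis by (simp only: mult.assoc)
    qed
    finally show ?thesis by (simp add: mult_ac)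
  qed
  from growth_contradiction[OF A \<kappa>\<beta> _ this[unfolded h_def]] show False using \<epsilon> C1 c by simp
qed

end

theorem theorem1p3:
  fixes \<A> :: "('g::{topological_group_add,t2_space,second_countable_topology}, 'm::euclidean_space) atlas"
    and V :: "nat \<Rightarrow> 'g vfield set"
    and X :: "nat \<Rightarrow> 'g vfield"
    and n \<nu>0 :: nat and \<nu> :: "nat \<Rightarrow> nat" and a :: "nat \<Rightarrow> real"
    and \<mu> :: "'g measure" and N :: "'g \<Rightarrow> real"
    and Q \<gamma> p \<epsilon> C1 :: real and u0 u1 :: "'g \<Rightarrow> real"
    and R :: "('g \<Rightarrow> real) \<Rightarrow> ('g \<Rightarrow> real)"
  assumes "graded_lie_group \<A> V"
    and "strong_malcev_basis V n X \<nu>"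
    and "haar_measure \<mu>"
    and Q: "Q = real (\<Sum>j = 1..n. \<nu> j)"
    and "\<nu>0 > 0" and "\<And>j. j \<in> {1..n} \<Longrightarrow> \<nu> j dvd \<nu>0"
    and "\<And>j. j \<in> {1..n} \<Longrightarrow> a j > 0"
    and R: "R = rockland_operator n X \<nu> \<nu>0 a"
    and "0 < \<gamma>" and "\<gamma> < Q / 2"
    and "1 < p" and "p < 1 + 2 * (2 * real \<nu>0) / (Q + 2 * \<gamma>)"
    and "homogeneous_norm \<A> n X \<nu> N"
    and "locally_integrable \<mu> u0" and "locally_integrable \<mu> u1"
    and "AE x in \<mu>. u0 x \<ge> 0" and "AE x in \<mu>. u1 x \<ge> 0"
    and "homogeneous_sobolev_neg \<A> \<mu> R (2 * real \<nu>0) \<gamma> (distribution_of \<mu> u0)"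
    and "homogeneous_sobolev_neg \<A> \<mu> R (2 * real \<nu>0) \<gamma> (distribution_of \<mu> u1)"
    and "C1 > 0"
    and "AE x in \<mu>. u0 x + u1 x \<ge>
           C1 * sqrt (1 + (N x)\<^sup>2) powr (- Q * (1 / 2 + \<gamma> / Q)) * inverse (ln (exp 1 + N x))"
    and "\<epsilon> > 0"
  shows "\<not> (\<exists>u. weak_solution \<A> \<mu> R p \<epsilon> u0 u1 \<infinity> u)"
proof -
  interpret lie \<A> using assms(1) by unfold_locales (simp add: graded_lie_group_def)
  \<comment> \<open>The conclusion does not mention a chart, so any chart around the identity may be
    taken.\<close>
  obtain U c where U: "(U, c) \<in> \<A>" "0 \<in> U" using chart_at[of 0] by blast
  interpret lie_chart \<A> U c using U by unfold_locales
  obtain \<rho> \<sigma> r s R' L E L' where "lie_exp_chart \<A> U c \<rho> \<sigma> r s R' L E L'"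
    using lie_exp_chart_exists by blast
  then interpret graded_chart \<A> U c \<rho> \<sigma> r s R' L E L' V n X \<nu>
    by (intro graded_chart.intro graded_chart_axioms.intro assms(1,2))
  show ?thesis
    unfolding R
    using no_global_weak_solution[OF \<open>haar_measure \<mu>\<close> Q \<open>\<nu>0 > 0\<close> ballI[OF assms(6)] \<open>0 < \<gamma>\<close> \<open>\<gamma> < Q / 2\<close>
        \<open>1 < p\<close> \<open>p < 1 + 2 * (2 * real \<nu>0) / (Q + 2 * \<gamma>)\<close> \<open>homogeneous_norm \<A> n X \<nu> N\<close>
        \<open>locally_integrable \<mu> u0\<close> \<open>locally_integrable \<mu> u1\<close> \<open>C1 > 0\<close> assms(21) \<open>\<epsilon> > 0\<close>]
    by simp
qed

end
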